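(* Let $R$ be an irreducible reduced root system, $\omega$ a fixed weight, and $\{z^1,\dots,z^\ell\}$ a set of pencil generators associated with $(R,\omega)$, and suppose that the vector field $E=\sum_{r}\theta_r z^r\frac{\partial}{\partial z^r}$ is diagonalizable (i.e. $\mathcal L_E$ acts diagonalizably on the space $\mathcal K$ of flat functions of $\eta$). Then there exists a generalized Frobenius manifold structure of charge $d=1$ on $\mathcal M_D$ whose flat metric is given by $\eta$ (that is, $\langle X,Y\rangle=\eta(\eta^\flat X,\eta^\flat Y)$) and whose multiplication is $X\cdot Y=\eta^\sharp\bigl(\eta^\flat(X)\cdot\eta^\flat(Y)\bigr)$, where the product of one-forms on the right is $dt^\alpha\cdot dt^\beta=\frac{\kappa}{d_\beta}\Gamma^{\alpha\beta}_\gamma\,dt^\gamma$. Moreover, the unit vector field is $e=-\frac1\kappa\,\mathrm{grad}_\eta\sum_{r=1}^\ell m_r\log z^r$, the Euler vector field is $\tilde E=\frac1\kappa E=\sum_{\alpha}\frac{d_\alpha t^\alpha}{\kappa}\frac{\partial}{\partial t^\alpha}$, and the intersection form coincides with $g$, i.e. $g(dt^\alpha,dt^\beta)=i_{\tilde E}(dt^\alpha\cdot dt^\beta)$ for all $\alpha,\beta$.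
   Context: Root data. $R$ is an irreducible reduced root system in an $\ell$-dimensional Euclidean space $V$ with inner product $(\cdot,\cdot)$, normalized so that $(\alpha,\alpha)\in\mathbb Q$ for $\alpha\in R$; $\alpha_1,\dots,\alpha_\ell$ are simple roots, $\alpha_j^\vee=2\alpha_j/(\alpha_j,\alpha_j)$, and the fundamental weights $\omega_i$ satisfy $(\omega_i,\alpha_j^\vee)=\delta_{ij}$. $W=W(R)$ is the Weyl group and $W_a(R)$ the affine Weyl group, generated by $W$ and translations by the coroot lattice $\bigoplus\mathbb Z\alpha_j^\vee$. Fix a nonzero weight $\omega=\sum_j m_j\omega_j$, $m_j\in\mathbb Z_{\ge0}$. Put $\theta_j=(\omega_j,\omega)$ and $\kappa=\gcd\{(\omega,\alpha_r): r=1,\dots,\ell\}$ (the positive generator of the subgroup of $\mathbb Q$ generated by these numbers). Rings. Write $\mathbf x=c\omega+\hat{\mathbf x}$, $\hat{\mathbf x}=\sum_r x^r\alpha_r^\vee$, with $c$ a parameter, and $\lambda=e^{-2\pi i\kappa c}$. $\mathscr A=\mathbb C[\lambda]\otimes\mathbb C[e^{\pm2\pi i x^j}: 1\le j\le\ell]$, graded by $\deg e^{2\pi i x^j}=\theta_j$, $\deg\lambda=\kappa$; elements are polynomial in $\lambda$, so they can be evaluated at any $\lambda\in\mathbb C$, including $\lambda=0$. $W_a(R)$ acts on functions by $(\phi^*f)(\mathbf x;c)=f(\phi(\mathbf x);c)$, and $\mathscr A^W$ is the subring of elements of $\mathscr A$ invariant under $W_a(R)$. The basic generators are $y^j=e^{-2\pi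 i\theta_jc}\frac1{N_j}\sum_{\sigma\in W}e^{2\pi i(\omega_j,\sigma(\mathbf x))}\in\mathscr A^W$, $N_j=\#\{\sigma\in W:\sigma(\omega_j)=\omega_j\}$. Elements $z^1,\dots,z^\ell\in\mathscr A^W$ form a set of proper generators if $z^j$ is quasi-homogeneous of degree $\theta_j$ and $z^j|_{\lambda=0}=y^j|_{\lambda=0}$ for all $j$; then $\mathscr A^W=\mathbb C[z^1,\dots,z^\ell;\lambda]$. Metrics. $\mathcal M=\mathbb C^\ell$ with coordinates $z^1,\dots,z^\ell$. Let $(a^{ij})=((\alpha_i^\vee,\alpha_j^\vee))^{-1}$ and $g_\lambda^{ij}=\frac1{4\pi^2}\frac{\partial z^i}{\partial x^r}a^{rs}\frac{\partial z^j}{\partial x^s}$, a contravariant metric (summation over repeated indices); $\Gamma^{ij}_{g_\lambda,k}=-g_\lambda^{ir}\Gamma^j_{g_\lambda,rk}$ are its contravariant Christoffel symbols. Both $g_\lambda^{ij}$ and $\Gamma^{ij}_{g_\lambda,k}$ lie in $\mathbb C[z^1,\dots,z^\ell;\lambda]$. A set of proper generators is a set of pencil generators if $g_\lambda^{ij}$ and $\Gamma^{ij}_{g_\lambda,k}$ are at most linear in $\lambda$ and $(\partial_\lambda g_\lambda^{ij})$ is non-degenerate at generic points. Then $g_\lambda^{ij}=g^{ij}+\lambda\eta^{ij}$, and $\eta=(\eta^{ij})$ and $g=(g^{ij})$ form a flat pencil of metrics. Flat coordinates. $D_\eta=\{z\in\mathcal M:\det\eta(z)=0\}$; $\mathcal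 K$ is the $\ell$-dimensional space of solutions $t\in\mathscr O(\mathcal W)/\mathbb C$ of $\frac{\partial^2t}{\partial z^i\partial z^j}=\Gamma^k_{\eta,ij}\frac{\partial t}{\partial z^k}$, where $\mathcal W$ is the universal cover of $\mathcal M\setminus D_\eta$ and $\Gamma_{\eta,ij}^k$ are the Christoffel symbols of $\eta$. $\mathcal L_E$ preserves $\mathcal K$. When it is diagonalizable on $\mathcal K$, let $t^1,\dots,t^\ell$ be a basis of eigenvectors, $\mathcal L_Et^\alpha=d_\alpha t^\alpha$ (the $d_\alpha$ are nonzero and the additive constants are fixed by this equation). $\Gamma^{\alpha\beta}_\gamma$ are the contravariant Christoffel symbols of $g$ in the coordinates $t^\alpha$ (holomorphic where $\eta$ is non-degenerate). The space. $S=\{r:m_r>0\}$, $D_0=\{z\in\mathcal M:\exists\, i\in S,\ z^i=0\}$, $D=D_\eta\cup D_0$, $\mathcal M_D=\mathcal M\setminus D$. $\eta^\sharp:T^*\mathcal M_D\to T\mathcal M_D$, $\omega\mapsto\eta(\omega,\cdot)$, with inverse $\eta^\flat$. Generalized Frobenius manifold. A complex manifold $M$ with a Frobenius algebra structure $(\cdot,\langle\cdot,\cdot\rangle,e)$ (commutative, associative, unit $e$, symmetric non-degenerate bilinear form with $\langle u\cdot v,w\rangle=\langle u,v\cdot w\rangle$) on each tangent space, depending holomorphically on the point, such that: (FM1) $\langle\cdot,\cdot\rangle$ is a flat metric; (FM2) with $c(u,v,w)=\langle u\cdot v,w\rangle$ and $\nabla$ the Levi-Civita connection, the 4-tensor $(W,X,Y,Z)\mapsto(\nabla_Wc)(X,Y,Z)$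 is symmetric; (FM3) there is an Euler vector field $E_M$ with $\nabla\nabla E_M=0$, $\nabla E_M$ diagonalizable, $\mathcal L_{E_M}(X\cdot Y)=(\mathcal L_{E_M}X)\cdot Y+X\cdot(\mathcal L_{E_M}Y)+X\cdot Y$ and $\mathcal L_{E_M}\langle X,Y\rangle=\langle\mathcal L_{E_M}X,Y\rangle+\langle X,\mathcal L_{E_M}Y\rangle+(2-d)\langle X,Y\rangle$, where the constant $d$ is the charge. (Flatness of $e$ is not required.) The intersection form is the bilinear form $(\xi,\zeta)\mapsto i_{E_M}(\xi\cdot\zeta)$ on one-forms, with the product of one-forms obtained from that of vectors via the flat metric. *)

theory Defs
  imports
    "HOL-Analysis.Analysis"
    "HOL-Library.Poly_Mapping"
    "HOL-Computational_Algebra.Polynomial"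
begin

section \<open>Root data\<close>

definition reflect :: "'v::euclidean_space \<Rightarrow> 'v \<Rightarrow> 'v" where
  "reflect \<beta> v = v - (2 * (v \<bullet> \<beta>) / (\<beta> \<bullet> \<beta>)) *\<^sub>R \<beta>"

definition coroot :: "'v::euclidean_space \<Rightarrow> 'v" where
  "coroot \<beta> = (2 / (\<beta> \<bullet> \<beta>)) *\<^sub>R \<beta>"

definition root_system :: "'v::euclidean_space set \<Rightarrow> bool" where
  "root_system R \<longleftrightarrow> finite R \<and> 0 \<notin> R \<and> span R = UNIV \<and>
     (\<forall>\<beta>\<in>R. \<forall>\<gamma>\<in>R. reflect \<beta> \<gamma> \<in> R) \<and>
     (\<forall>\<beta>\<in>R. \<forall>\<gamma>\<in>R. \<gamma> \<bullet> coroot \<beta> \<in> \<int>)"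

definition reduced_roots :: "'v::euclidean_space set \<Rightarrow> bool" where
  "reduced_roots R \<longleftrightarrow> (\<forall>\<beta>\<in>R. \<forall>c. c *\<^sub>R \<beta> \<in> R \<longrightarrow> c = 1 \<or> c = -1)"

definition irreducible_roots :: "'v::euclidean_space set \<Rightarrow> bool" where
  "irreducible_roots R \<longleftrightarrow> R \<noteq> {} \<and>
     \<not> (\<exists>A B. A \<noteq> {} \<and> B \<noteq> {} \<and> A \<union> B = R \<and> A \<inter> B = {} \<and> (\<forall>\<beta>\<in>A. \<forall>\<gamma>\<in>B. \<beta> \<bullet> \<gamma> = 0))"

text \<open>Simple roots are indexed by a finite type, so that \<open>CARD('l)\<close> is the rank.\<close>

definition simple_roots :: "'v::euclidean_space set \<Rightarrow> ('l::finite \<Rightarrow> 'v) \<Rightarrow> bool" where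
  "simple_roots R \<alpha> \<longleftrightarrow> inj \<alpha> \<and> range \<alpha> \<subseteq> R \<and> independent (range \<alpha>) \<and>
     (\<forall>\<beta>\<in>R. \<exists>n :: 'l \<Rightarrow> int. \<beta> = (\<Sum>i\<in>UNIV. of_int (n i) *\<^sub>R \<alpha> i) \<and>
        ((\<forall>i. n i \<ge> 0) \<or> (\<forall>i. n i \<le> 0)))"

definition fund_weight :: "('l::finite \<Rightarrow> 'v::euclidean_space) \<Rightarrow> 'l \<Rightarrow> 'v" where
  "fund_weight \<alpha> i = (THE w. \<forall>j. w \<bullet> coroot (\<alpha> j) = (if i = j then 1 else 0))"

definition weight :: "('l::finite \<Rightarrow> 'v::euclidean_space) \<Rightarrow> ('l \<Rightarrow> nat) \<Rightarrow> 'v" where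
  "weight \<alpha> m = (\<Sum>j\<in>UNIV. real (m j) *\<^sub>R fund_weight \<alpha> j)"

definition theta :: "('l::finite \<Rightarrow> 'v::euclidean_space) \<Rightarrow> ('l \<Rightarrow> nat) \<Rightarrow> 'l \<Rightarrow> real" where
  "theta \<alpha> m j = fund_weight \<alpha> j \<bullet> weight \<alpha> m"

definition kappa :: "('l::finite \<Rightarrow> 'v::euclidean_space) \<Rightarrow> ('l \<Rightarrow> nat) \<Rightarrow> real" where
  "kappa \<alpha> m = (THE k. k > 0 \<and>
     (range (\<lambda>n :: 'l \<Rightarrow> int. \<Sum>r\<in>UNIV. of_int (n r) * (weight \<alpha> m \<bullet> \<alpha> r))
      = range (\<lambda>n :: int. of_int n * k)))"

inductive_set weyl_group :: "'v::euclidean_space set \<Rightarrow> ('v \<Rightarrow> 'v) set" for R where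
  weyl_id: "id \<in> weyl_group R"
| weyl_reflect: "\<lbrakk>\<sigma> \<in> weyl_group R; \<beta> \<in> R\<rbrakk> \<Longrightarrow> reflect \<beta> \<circ> \<sigma> \<in> weyl_group R"

definition coroot_lattice :: "('l::finite \<Rightarrow> 'v::euclidean_space) \<Rightarrow> 'v set" where
  "coroot_lattice \<alpha> = range (\<lambda>n :: 'l \<Rightarrow> int. \<Sum>j\<in>UNIV. of_int (n j) *\<^sub>R coroot (\<alpha> j))"

text \<open>
  The parameter \<open>c\<close> and the coordinates \<open>x^r\<close> are complex, so the groups act on the complexification
  of \<open>'v\<close>. A pair \<open>(u, v)\<close> stands for \<open>u + i v\<close>: Weyl group elements act on both parts,
  (real) translations on the real part. The generators below are closed under inverses.
\<close>

inductive_set affine_weyl_group ::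
    "'v::euclidean_space set \<Rightarrow> ('l::finite \<Rightarrow> 'v) \<Rightarrow> ('v \<times> 'v \<Rightarrow> 'v \<times> 'v) set" for R \<alpha> where
  affine_weyl: "\<sigma> \<in> weyl_group R \<Longrightarrow> map_prod \<sigma> \<sigma> \<in> affine_weyl_group R \<alpha>"
| affine_transl: "\<beta> \<in> coroot_lattice \<alpha> \<Longrightarrow> map_prod (\<lambda>u. u + \<beta>) id \<in> affine_weyl_group R \<alpha>"
| affine_comp: "\<lbrakk>\<phi> \<in> affine_weyl_group R \<alpha>; \<psi> \<in> affine_weyl_group R \<alpha>\<rbrakk>
     \<Longrightarrow> \<phi> \<circ> \<psi> \<in> affine_weyl_group R \<alpha>"

definition cpairing :: "'v::euclidean_space \<Rightarrow> 'v \<times> 'v \<Rightarrow> complex" where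
  "cpairing w x = Complex (w \<bullet> fst x) (w \<bullet> snd x)"

text \<open>The point \<open>c \<omega> + (\<Sum>r. x^r \<alpha>_r^\<or>)\<close>.\<close>

definition xpoint :: "('l::finite \<Rightarrow> 'v::euclidean_space) \<Rightarrow> ('l \<Rightarrow> nat) \<Rightarrow> complex \<Rightarrow> complex^'l \<Rightarrow> 'v \<times> 'v" where
  "xpoint \<alpha> m c x =
     (Re c *\<^sub>R weight \<alpha> m + (\<Sum>r\<in>UNIV. Re (x $ r) *\<^sub>R coroot (\<alpha> r)),
      Im c *\<^sub>R weight \<alpha> m + (\<Sum>r\<in>UNIV. Im (x $ r) *\<^sub>R coroot (\<alpha> r)))"


section \<open>The ring of exponential polynomials and its invariants\<close>

text \<open>
  \<open>'l exp_poly\<close> is the ring \<open>\<complex>[\<lambda>] \<otimes> \<complex>[exp(\<plusminus>2\<pi>i x^j)]\<close>: the exponent vector \<open>k\<close> stands for the monomial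
  \<open>exp(2\<pi>i \<Sum>j. k_j x^j)\<close>, and its coefficient is a polynomial in \<open>\<lambda>\<close>.
  \<open>'l zpoly\<close> is \<open>\<complex>[z^1, ..., z^\<ell>; \<lambda>]\<close>, encoded in the same way.
\<close>

type_synonym 'l exp_poly = "(int^'l) \<Rightarrow>\<^sub>0 complex poly"
type_synonym 'l zpoly = "(nat^'l) \<Rightarrow>\<^sub>0 complex poly"

definition eval_exp :: "'l::finite exp_poly \<Rightarrow> complex \<Rightarrow> complex^'l \<Rightarrow> complex" where
  "eval_exp f l x = (\<Sum>k\<in>Poly_Mapping.keys f. poly (Poly_Mapping.lookup f k) l *
     exp (2 * complex_of_real pi * \<i> * (\<Sum>j\<in>UNIV. of_int (k $ j) * x $ j)))"

definition eval_z :: "'l::finite zpoly \<Rightarrow> complex \<Rightarrow> complex^'l \<Rightarrow> complex" where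
  "eval_z P l v = (\<Sum>k\<in>Poly_Mapping.keys P. poly (Poly_Mapping.lookup P k) l *
     (\<Prod>j\<in>UNIV. (v $ j) ^ (k $ j)))"

definition linear_in_lambda :: "'l::finite zpoly \<Rightarrow> bool" where
  "linear_in_lambda P \<longleftrightarrow> (\<forall>k. degree (Poly_Mapping.lookup P k) \<le> 1)"

definition lam :: "('l::finite \<Rightarrow> 'v::euclidean_space) \<Rightarrow> ('l \<Rightarrow> nat) \<Rightarrow> complex \<Rightarrow> complex" where
  "lam \<alpha> m c = exp (- 2 * complex_of_real pi * \<i> * complex_of_real (kappa \<alpha> m) * c)"

definition invariant_ring ::
    "'v::euclidean_space set \<Rightarrow> ('l::finite \<Rightarrow> 'v) \<Rightarrow> ('l \<Rightarrow> nat) \<Rightarrow> 'l exp_poly set" where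
  "invariant_ring R \<alpha> m = {f. \<forall>\<phi>\<in>affine_weyl_group R \<alpha>. \<forall>c x x'.
     xpoint \<alpha> m c x' = \<phi> (xpoint \<alpha> m c x) \<longrightarrow>
       eval_exp f (lam \<alpha> m c) x' = eval_exp f (lam \<alpha> m c) x}"

definition quasi_homogeneous ::
    "('l::finite \<Rightarrow> 'v::euclidean_space) \<Rightarrow> ('l \<Rightarrow> nat) \<Rightarrow> real \<Rightarrow> 'l exp_poly \<Rightarrow> bool" where
  "quasi_homogeneous \<alpha> m \<delta> f \<longleftrightarrow>
     (\<forall>k n. coeff (Poly_Mapping.lookup f k) n \<noteq> 0 \<longrightarrow>
        (\<Sum>j\<in>UNIV. of_int (k $ j) * theta \<alpha> m j) + real n * kappa \<alpha> m = \<delta>)"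

definition basic_fun ::
    "'v::euclidean_space set \<Rightarrow> ('l::finite \<Rightarrow> 'v) \<Rightarrow> ('l \<Rightarrow> nat) \<Rightarrow> 'l \<Rightarrow> complex \<Rightarrow> complex^'l \<Rightarrow> complex" where
  "basic_fun R \<alpha> m j c x =
     exp (- 2 * complex_of_real pi * \<i> * complex_of_real (theta \<alpha> m j) * c) *
     (1 / of_nat (card {\<sigma>\<in>weyl_group R. \<sigma> (fund_weight \<alpha> j) = fund_weight \<alpha> j})) *
     (\<Sum>\<sigma>\<in>weyl_group R. exp (2 * complex_of_real pi * \<i> *
        cpairing (fund_weight \<alpha> j) (map_prod \<sigma> \<sigma> (xpoint \<alpha> m c x))))"

text \<open>
  As an element of the ring, \<open>y^j\<close> is determined by its values at \<open>\<lambda> = exp(-2\<pi>i\<kappa>c)\<close>, i.e. at all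
  nonzero \<open>\<lambda>\<close>; its value at \<open>\<lambda> = 0\<close> is that of this polynomial.
\<close>

definition basic_generator ::
    "'v::euclidean_space set \<Rightarrow> ('l::finite \<Rightarrow> 'v) \<Rightarrow> ('l \<Rightarrow> nat) \<Rightarrow> 'l \<Rightarrow> 'l exp_poly" where
  "basic_generator R \<alpha> m j =
     (THE f. \<forall>c x. eval_exp f (lam \<alpha> m c) x = basic_fun R \<alpha> m j c x)"

definition proper_generators ::
    "'v::euclidean_space set \<Rightarrow> ('l::finite \<Rightarrow> 'v) \<Rightarrow> ('l \<Rightarrow> nat) \<Rightarrow> ('l \<Rightarrow> 'l exp_poly) \<Rightarrow> bool" where
  "proper_generators R \<alpha> m z \<longleftrightarrow> (\<forall>j. z j \<in> invariant_ring R \<alpha> m \<and>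
     quasi_homogeneous \<alpha> m (theta \<alpha> m j) (z j) \<and>
     (\<forall>x. eval_exp (z j) 0 x = eval_exp (basic_generator R \<alpha> m j) 0 x))"


section \<open>Differential geometry on open subsets of \<open>\<complex>^n\<close>\<close>

text \<open>
  Vectors and one-forms at a point of \<open>\<complex>^n\<close> are given by their components with respect to the
  standard coordinates. Tensor fields are functions of the point.
\<close>

definition mholomorphic_on :: "(complex^'n::finite) set \<Rightarrow> (complex^'n \<Rightarrow> complex) \<Rightarrow> bool" where
  "mholomorphic_on V f \<longleftrightarrow> (\<forall>v\<in>V. \<exists>D. (f has_derivative D) (at v) \<and> (\<forall>c u. D (c *s u) = c * D u))"

definition vfield_on :: "(complex^'n::finite) set \<Rightarrow> (complex^'n \<Rightarrow> complex^'n) \<Rightarrow> bool" where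
  "vfield_on V X \<longleftrightarrow> (\<forall>k. mholomorphic_on V (\<lambda>v. X v $ k))"

definition pd :: "'n::finite \<Rightarrow> (complex^'n \<Rightarrow> complex) \<Rightarrow> complex^'n \<Rightarrow> complex" where
  "pd i f v = deriv (\<lambda>s. f (v + axis i s)) 0"

definition differential :: "(complex^'n::finite \<Rightarrow> complex) \<Rightarrow> complex^'n \<Rightarrow> complex^'n" where
  "differential f v = (\<chi> i. pd i f v)"

definition contract :: "complex^'n::finite \<Rightarrow> complex^'n \<Rightarrow> complex" where
  "contract X \<xi> = (\<Sum>i\<in>UNIV. X $ i * \<xi> $ i)"

definition dird :: "complex^'n::finite \<Rightarrow> (complex^'n \<Rightarrow> complex) \<Rightarrow> complex^'n \<Rightarrow> complex" where
  "dird X f v = contract X (differential f v)"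

text \<open>
  The vector \<open>\<partial>/\<partial>\<tau>^\<gamma>\<close> of local coordinates \<open>\<tau>\<close>, and the derivative along it.
\<close>

definition jacobian :: "(complex^'n::finite \<Rightarrow> complex^'n) \<Rightarrow> complex^'n \<Rightarrow> complex^'n^'n" where
  "jacobian \<tau> v = (\<chi> a i. pd i (\<lambda>u. \<tau> u $ a) v)"

definition coord_vec :: "(complex^'n::finite \<Rightarrow> complex^'n) \<Rightarrow> 'n \<Rightarrow> complex^'n \<Rightarrow> complex^'n" where
  "coord_vec \<tau> \<gamma> v = (\<chi> i. matrix_inv (jacobian \<tau> v) $ i $ \<gamma>)"

definition coord_pd :: "(complex^'n::finite \<Rightarrow> complex^'n) \<Rightarrow> 'n \<Rightarrow> (complex^'n \<Rightarrow> complex) \<Rightarrow> complex^'n \<Rightarrow> complex" where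
  "coord_pd \<tau> \<gamma> f v = dird (coord_vec \<tau> \<gamma> v) f v"

text \<open>
  \<open>christoffel D h k i j\<close> is \<open>\<Gamma>^k_ij\<close> for the covariant metric with Gram matrix \<open>h\<close>, where \<open>D i\<close> is the
  derivative along the \<open>i\<close>-th coordinate: \<open>pd\<close> for the standard coordinates, \<open>coord_pd \<tau>\<close> for the
  coordinates \<open>\<tau>\<close> (in which case \<open>h\<close> must be expressed in these coordinates too).
  \<open>contra_christoffel D G i j k\<close> is \<open>\<Gamma>^ij_k\<close> for the contravariant metric with matrix \<open>G\<close>.
\<close>

definition christoffel ::
    "('n::finite \<Rightarrow> (complex^'n \<Rightarrow> complex) \<Rightarrow> complex^'n \<Rightarrow> complex) \<Rightarrow>
     (complex^'n \<Rightarrow> complex^'n^'n) \<Rightarrow> 'n \<Rightarrow> 'n \<Rightarrow> 'n \<Rightarrow> complex^'n \<Rightarrow> complex" where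
  "christoffel D h k i j v = (1/2) * (\<Sum>l\<in>UNIV. matrix_inv (h v) $ k $ l *
     (D i (\<lambda>u. h u $ l $ j) v + D j (\<lambda>u. h u $ i $ l) v - D l (\<lambda>u. h u $ i $ j) v))"

definition contra_christoffel ::
    "('n::finite \<Rightarrow> (complex^'n \<Rightarrow> complex) \<Rightarrow> complex^'n \<Rightarrow> complex) \<Rightarrow>
     (complex^'n \<Rightarrow> complex^'n^'n) \<Rightarrow> 'n \<Rightarrow> 'n \<Rightarrow> 'n \<Rightarrow> complex^'n \<Rightarrow> complex" where
  "contra_christoffel D G i j k v =
     - (\<Sum>r\<in>UNIV. G v $ i $ r * christoffel D (\<lambda>u. matrix_inv (G u)) j r k v)"

definition coord_metric ::
    "(complex^'n::finite \<Rightarrow> complex^'n) \<Rightarrow> (complex^'n \<Rightarrow> complex^'n^'n) \<Rightarrow> complex^'n \<Rightarrow> complex^'n^'n" where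
  "coord_metric \<tau> G v = jacobian \<tau> v ** G v ** transpose (jacobian \<tau> v)"

definition bil :: "complex^'n^'n \<Rightarrow> complex^'n::finite \<Rightarrow> complex^'n \<Rightarrow> complex" where
  "bil A \<xi> \<zeta> = (\<Sum>i\<in>UNIV. \<Sum>j\<in>UNIV. \<xi> $ i * A $ i $ j * \<zeta> $ j)"

definition sharp :: "(complex^'n::finite \<Rightarrow> complex^'n^'n) \<Rightarrow> complex^'n \<Rightarrow> complex^'n \<Rightarrow> complex^'n" where
  "sharp \<eta> v \<xi> = \<xi> v* \<eta> v"

definition flat :: "(complex^'n::finite \<Rightarrow> complex^'n^'n) \<Rightarrow> complex^'n \<Rightarrow> complex^'n \<Rightarrow> complex^'n" where
  "flat \<eta> v X = X v* matrix_inv (\<eta> v)"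

definition grad :: "(complex^'n::finite \<Rightarrow> complex^'n^'n) \<Rightarrow> (complex^'n \<Rightarrow> complex) \<Rightarrow> complex^'n \<Rightarrow> complex^'n" where
  "grad \<eta> f v = sharp \<eta> v (differential f v)"

definition covariant_form ::
    "(complex^'n::finite \<Rightarrow> complex^'n^'n) \<Rightarrow> complex^'n \<Rightarrow> complex^'n \<Rightarrow> complex^'n \<Rightarrow> complex" where
  "covariant_form \<eta> v X Y = bil (\<eta> v) (flat \<eta> v X) (flat \<eta> v Y)"


section \<open>Generalized Frobenius manifolds\<close>

text \<open>A metric \<open>b\<close> is a field of bilinear forms on tangent vectors.\<close>

definition gram ::
    "(complex^'n::finite \<Rightarrow> complex^'n \<Rightarrow> complex^'n \<Rightarrow> complex) \<Rightarrow> complex^'n \<Rightarrow> complex^'n^'n" where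
  "gram b v = (\<chi> i j. b v (axis i 1) (axis j 1))"

definition cov_deriv ::
    "(complex^'n::finite \<Rightarrow> complex^'n \<Rightarrow> complex^'n \<Rightarrow> complex) \<Rightarrow>
     (complex^'n \<Rightarrow> complex^'n) \<Rightarrow> (complex^'n \<Rightarrow> complex^'n) \<Rightarrow> complex^'n \<Rightarrow> complex^'n" where
  "cov_deriv b X Y v = (\<chi> k. dird (X v) (\<lambda>u. Y u $ k) v +
     (\<Sum>i\<in>UNIV. \<Sum>j\<in>UNIV. christoffel pd (gram b) k i j v * X v $ i * Y v $ j))"

definition lie_bracket ::
    "(complex^'n::finite \<Rightarrow> complex^'n) \<Rightarrow> (complex^'n \<Rightarrow> complex^'n) \<Rightarrow> complex^'n \<Rightarrow> complex^'n" where
  "lie_bracket X Y v = (\<chi> k. dird (X v) (\<lambda>u. Y u $ k) v - dird (Y v) (\<lambda>u. X u $ k) v)"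

definition flat_metric_on ::
    "(complex^'n::finite) set \<Rightarrow> (complex^'n \<Rightarrow> complex^'n \<Rightarrow> complex^'n \<Rightarrow> complex) \<Rightarrow> bool" where
  "flat_metric_on U b \<longleftrightarrow>
     (\<forall>v\<in>U. (\<forall>X. Vector_Spaces.linear (*s) (*) (b v X)) \<and> (\<forall>X Y. b v X Y = b v Y X) \<and>
        (\<forall>X. (\<forall>Y. b v X Y = 0) \<longrightarrow> X = 0)) \<and>
     (\<forall>X Y. mholomorphic_on U (\<lambda>v. b v X Y)) \<and>
     (\<forall>V X Y Z. open V \<and> V \<subseteq> U \<and> vfield_on V X \<and> vfield_on V Y \<and> vfield_on V Z \<longrightarrow>
        (\<forall>v\<in>V. cov_deriv b X (cov_deriv b Y Z) v - cov_deriv b Y (cov_deriv b X Z) v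
               - cov_deriv b (lie_bracket X Y) Z v = 0))"

definition frobenius_algebra ::
    "(complex^'n::finite \<Rightarrow> complex^'n \<Rightarrow> complex^'n) \<Rightarrow>
     (complex^'n \<Rightarrow> complex^'n \<Rightarrow> complex) \<Rightarrow> complex^'n \<Rightarrow> bool" where
  "frobenius_algebra mul b e \<longleftrightarrow>
     (\<forall>X. Vector_Spaces.linear (*s) (*s) (mul X)) \<and>
     (\<forall>X Y. mul X Y = mul Y X) \<and>
     (\<forall>X Y Z. mul (mul X Y) Z = mul X (mul Y Z)) \<and>
     (\<forall>X. mul e X = X) \<and>
     (\<forall>X. Vector_Spaces.linear (*s) (*) (b X)) \<and>
     (\<forall>X Y. b X Y = b Y X) \<and>
     (\<forall>X. (\<forall>Y. b X Y = 0) \<longrightarrow> X = 0) \<and>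
     (\<forall>X Y Z. b (mul X Y) Z = b X (mul Y Z))"

text \<open>\<open>nabla_c b mul W X Y Z\<close> is \<open>(\<nabla>_W c)(X, Y, Z)\<close> for \<open>c(X, Y, Z) = b(X \<cdot> Y, Z)\<close>.\<close>

definition nabla_c ::
    "(complex^'n::finite \<Rightarrow> complex^'n \<Rightarrow> complex^'n \<Rightarrow> complex) \<Rightarrow>
     (complex^'n \<Rightarrow> complex^'n \<Rightarrow> complex^'n \<Rightarrow> complex^'n) \<Rightarrow>
     (complex^'n \<Rightarrow> complex^'n) \<Rightarrow> (complex^'n \<Rightarrow> complex^'n) \<Rightarrow>
     (complex^'n \<Rightarrow> complex^'n) \<Rightarrow> (complex^'n \<Rightarrow> complex^'n) \<Rightarrow> complex^'n \<Rightarrow> complex" where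
  "nabla_c b mul W X Y Z v =
     dird (W v) (\<lambda>u. b u (mul u (X u) (Y u)) (Z u)) v
     - b v (mul v (cov_deriv b W X v) (Y v)) (Z v)
     - b v (mul v (X v) (cov_deriv b W Y v)) (Z v)
     - b v (mul v (X v) (Y v)) (cov_deriv b W Z v)"

definition diagonalizable_matrix :: "complex^'n::finite^'n \<Rightarrow> bool" where
  "diagonalizable_matrix A \<longleftrightarrow> (\<exists>(P :: complex^'n^'n) (D :: complex^'n^'n). invertible P \<and> (\<forall>i j. i \<noteq> j \<longrightarrow> D $ i $ j = 0) \<and>
     A = P ** D ** matrix_inv P)"

definition euler_vector_field ::
    "(complex^'n::finite) set \<Rightarrow> (complex^'n \<Rightarrow> complex^'n \<Rightarrow> complex^'n \<Rightarrow> complex) \<Rightarrow>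
     (complex^'n \<Rightarrow> complex^'n \<Rightarrow> complex^'n \<Rightarrow> complex^'n) \<Rightarrow>
     (complex^'n \<Rightarrow> complex^'n) \<Rightarrow> complex \<Rightarrow> bool" where
  "euler_vector_field U b mul E d \<longleftrightarrow>
     vfield_on U E \<and>
     (\<forall>v\<in>U. diagonalizable_matrix (\<chi> k j. cov_deriv b (\<lambda>_. axis j 1) E v $ k)) \<and>
     (\<forall>V X Y. open V \<and> V \<subseteq> U \<and> vfield_on V X \<and> vfield_on V Y \<longrightarrow> (\<forall>v\<in>V.
        cov_deriv b X (cov_deriv b Y E) v - cov_deriv b (cov_deriv b X Y) E v = 0 \<and>
        lie_bracket E (\<lambda>u. mul u (X u) (Y u)) v =
          mul v (lie_bracket E X v) (Y v) + mul v (X v) (lie_bracket E Y v) + mul v (X v) (Y v) \<and>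
        dird (E v) (\<lambda>u. b u (X u) (Y u)) v =
          b v (lie_bracket E X v) (Y v) + b v (X v) (lie_bracket E Y v)
          + (2 - d) * b v (X v) (Y v)))"

definition generalized_frobenius_manifold ::
    "(complex^'n::finite) set \<Rightarrow> (complex^'n \<Rightarrow> complex^'n \<Rightarrow> complex^'n \<Rightarrow> complex) \<Rightarrow>
     (complex^'n \<Rightarrow> complex^'n \<Rightarrow> complex^'n \<Rightarrow> complex^'n) \<Rightarrow>
     (complex^'n \<Rightarrow> complex^'n) \<Rightarrow> (complex^'n \<Rightarrow> complex^'n) \<Rightarrow> complex \<Rightarrow> bool" where
  "generalized_frobenius_manifold U b mul e E d \<longleftrightarrow>
     open U \<and>
     (\<forall>v\<in>U. frobenius_algebra (mul v) (b v) (e v)) \<and>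
     (\<forall>X Y. vfield_on U (\<lambda>v. mul v X Y)) \<and> vfield_on U e \<and>
     flat_metric_on U b \<and>
     (\<forall>V W X Y Z. open V \<and> V \<subseteq> U \<and> vfield_on V W \<and> vfield_on V X \<and> vfield_on V Y \<and> vfield_on V Z \<longrightarrow>
        (\<forall>v\<in>V. nabla_c b mul W X Y Z v = nabla_c b mul X W Y Z v \<and>
               nabla_c b mul W X Y Z v = nabla_c b mul W Y X Z v \<and>
               nabla_c b mul W X Y Z v = nabla_c b mul W X Z Y v)) \<and>
     euler_vector_field U b mul E d"

text \<open>
  The product of one-forms is transported from that of vectors by the isomorphism \<open>X \<mapsto> b(X, \<cdot>)\<close>.
\<close>

definition intersection_form ::
    "(complex^'n::finite \<Rightarrow> complex^'n \<Rightarrow> complex^'n \<Rightarrow> complex) \<Rightarrow>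
     (complex^'n \<Rightarrow> complex^'n \<Rightarrow> complex^'n \<Rightarrow> complex^'n) \<Rightarrow>
     (complex^'n \<Rightarrow> complex^'n) \<Rightarrow> complex^'n \<Rightarrow> complex^'n \<Rightarrow> complex^'n \<Rightarrow> complex" where
  "intersection_form b mul E v \<xi> \<zeta> =
     contract (E v) (gram b v *v mul v (matrix_inv (gram b v) *v \<xi>) (matrix_inv (gram b v) *v \<zeta>))"


section \<open>Pencil generators\<close>

definition zmap :: "('l::finite \<Rightarrow> 'l exp_poly) \<Rightarrow> complex \<Rightarrow> complex^'l \<Rightarrow> complex^'l" where
  "zmap z l x = (\<chi> j. eval_exp (z j) l x)"

definition coroot_gram_inv :: "('l::finite \<Rightarrow> 'v::euclidean_space) \<Rightarrow> real^'l^'l" where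
  "coroot_gram_inv \<alpha> = matrix_inv (\<chi> i j. coroot (\<alpha> i) \<bullet> coroot (\<alpha> j))"

text \<open>\<open>P\<close> expresses \<open>g_\<lambda>^ij\<close> as a polynomial in \<open>z^1, ..., z^\<ell>, \<lambda>\<close>. For proper generators there is exactly one such \<open>P\<close>.\<close>

definition expresses_metric ::
    "('l::finite \<Rightarrow> 'v::euclidean_space) \<Rightarrow> ('l \<Rightarrow> 'l exp_poly) \<Rightarrow> 'l \<Rightarrow> 'l \<Rightarrow> 'l zpoly \<Rightarrow> bool" where
  "expresses_metric \<alpha> z i j P \<longleftrightarrow> (\<forall>l x. eval_z P l (zmap z l x) =
     1 / (4 * (complex_of_real pi)\<^sup>2) * (\<Sum>r\<in>UNIV. \<Sum>s\<in>UNIV.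
       pd r (\<lambda>u. zmap z l u $ i) x * complex_of_real (coroot_gram_inv \<alpha> $ r $ s) *
       pd s (\<lambda>u. zmap z l u $ j) x))"

definition metric_poly ::
    "('l::finite \<Rightarrow> 'v::euclidean_space) \<Rightarrow> ('l \<Rightarrow> 'l exp_poly) \<Rightarrow> 'l \<Rightarrow> 'l \<Rightarrow> 'l zpoly" where
  "metric_poly \<alpha> z i j = (THE P. expresses_metric \<alpha> z i j P)"

definition g_pencil ::
    "('l::finite \<Rightarrow> 'v::euclidean_space) \<Rightarrow> ('l \<Rightarrow> 'l exp_poly) \<Rightarrow> complex \<Rightarrow> complex^'l \<Rightarrow> complex^'l^'l" where
  "g_pencil \<alpha> z l v = (\<chi> i j. eval_z (metric_poly \<alpha> z i j) l v)"

definition g_metric ::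
    "('l::finite \<Rightarrow> 'v::euclidean_space) \<Rightarrow> ('l \<Rightarrow> 'l exp_poly) \<Rightarrow> complex^'l \<Rightarrow> complex^'l^'l" where
  "g_metric \<alpha> z = g_pencil \<alpha> z 0"

text \<open>\<open>\<eta> = \<partial>g_\<lambda>/\<partial>\<lambda>\<close>, which does not depend on \<open>\<lambda>\<close> for pencil generators.\<close>

definition eta_metric ::
    "('l::finite \<Rightarrow> 'v::euclidean_space) \<Rightarrow> ('l \<Rightarrow> 'l exp_poly) \<Rightarrow> complex^'l \<Rightarrow> complex^'l^'l" where
  "eta_metric \<alpha> z v = (\<chi> i j. deriv (\<lambda>l. g_pencil \<alpha> z l v $ i $ j) 0)"

text \<open>
  Being at most linear in \<open>\<lambda>\<close> refers to the expressions of \<open>g_\<lambda>^ij\<close> and \<open>\<Gamma>^ij_k\<close> as elements of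
  \<open>\<complex>[z^1, ..., z^\<ell>; \<lambda>]\<close>. The defining formula of \<open>\<Gamma>^ij_k\<close> makes sense only where \<open>g_\<lambda>\<close> is invertible,
  which is a dense set. "Generic points" are the points of a dense (and automatically open) set.
\<close>

definition pencil_generators ::
    "'v::euclidean_space set \<Rightarrow> ('l::finite \<Rightarrow> 'v) \<Rightarrow> ('l \<Rightarrow> nat) \<Rightarrow> ('l \<Rightarrow> 'l exp_poly) \<Rightarrow> bool" where
  "pencil_generators R \<alpha> m z \<longleftrightarrow> proper_generators R \<alpha> m z \<and>
     (\<forall>i j. \<exists>P. expresses_metric \<alpha> z i j P \<and> linear_in_lambda P) \<and>
     (\<forall>i j k. \<exists>Q. linear_in_lambda Q \<and> (\<forall>l v. det (g_pencil \<alpha> z l v) \<noteq> 0 \<longrightarrow>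
        contra_christoffel pd (g_pencil \<alpha> z l) i j k v = eval_z Q l v)) \<and>
     closure {v. det (eta_metric \<alpha> z v) \<noteq> 0} = UNIV"

definition D_eta :: "('l::finite \<Rightarrow> 'v::euclidean_space) \<Rightarrow> ('l \<Rightarrow> 'l exp_poly) \<Rightarrow> (complex^'l) set" where
  "D_eta \<alpha> z = {v. det (eta_metric \<alpha> z v) = 0}"

definition M_D ::
    "('l::finite \<Rightarrow> 'v::euclidean_space) \<Rightarrow> ('l \<Rightarrow> nat) \<Rightarrow> ('l \<Rightarrow> 'l exp_poly) \<Rightarrow> (complex^'l) set" where
  "M_D \<alpha> m z = UNIV - (D_eta \<alpha> z \<union> {v. \<exists>i. m i > 0 \<and> v $ i = 0})"

definition E_field ::
    "('l::finite \<Rightarrow> 'v::euclidean_space) \<Rightarrow> ('l \<Rightarrow> nat) \<Rightarrow> complex^'l \<Rightarrow> complex^'l" where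
  "E_field \<alpha> m v = (\<chi> r. complex_of_real (theta \<alpha> m r) * v $ r)"


section \<open>Flat functions on the universal cover\<close>

text \<open>
  Functions on a covering space \<open>C\<close> of an open set, with projection \<open>p\<close>, are studied through their
  branches \<open>f \<circ> s\<close> along local sections \<open>s\<close> of \<open>p\<close>: the complex structure of \<open>C\<close> is the one for
  which \<open>p\<close> is locally biholomorphic, and vector fields on the base are lifted along \<open>p\<close>.
\<close>

definition local_section ::
    "'w::topological_space set \<Rightarrow> ('w \<Rightarrow> complex^'l::finite) \<Rightarrow> (complex^'l) set \<Rightarrow> (complex^'l \<Rightarrow> 'w) \<Rightarrow> bool" where
  "local_section C p V s \<longleftrightarrow> open V \<and> continuous_on V s \<and> s ` V \<subseteq> C \<and> (\<forall>v\<in>V. p (s v) = v)"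

definition flat_functions ::
    "'w::topological_space set \<Rightarrow> ('w \<Rightarrow> complex^'l::finite) \<Rightarrow> (complex^'l \<Rightarrow> complex^'l^'l) \<Rightarrow> ('w \<Rightarrow> complex) set" where
  "flat_functions C p \<eta> = {f. \<forall>V s. local_section C p V s \<longrightarrow> mholomorphic_on V (f \<circ> s) \<and>
     (\<forall>v\<in>V. \<forall>i j. pd i (pd j (f \<circ> s)) v =
        (\<Sum>k\<in>UNIV. christoffel pd (\<lambda>u. matrix_inv (\<eta> u)) k i j v * pd k (f \<circ> s) v))}"

text \<open>
  The classes of the \<open>t a\<close> form a basis of the space of flat functions modulo constants, consisting
  of eigenvectors of the Lie derivative along \<open>E\<close> with eigenvalues \<open>d a\<close>. So such a family exists
  iff the Lie derivative is diagonalizable. As the operator acts on classes modulo constants, its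
  eigenvalue equation holds up to a constant \<open>K\<close>; the additive constant of \<open>t a\<close> is chosen such
  that \<open>K = 0\<close>, which is possible if \<open>d a \<noteq> 0\<close>.
\<close>

definition flat_eigenbasis ::
    "'w::topological_space set \<Rightarrow> ('w \<Rightarrow> complex^'l::finite) \<Rightarrow> (complex^'l \<Rightarrow> complex^'l^'l) \<Rightarrow>
     (complex^'l \<Rightarrow> complex^'l) \<Rightarrow> ('l \<Rightarrow> 'w \<Rightarrow> complex) \<Rightarrow> ('l \<Rightarrow> complex) \<Rightarrow> bool" where
  "flat_eigenbasis C p \<eta> E t d \<longleftrightarrow>
     (\<forall>a. t a \<in> flat_functions C p \<eta>) \<and>
     (\<forall>c K. (\<forall>w\<in>C. (\<Sum>a\<in>UNIV. c a * t a w) = K) \<longrightarrow> (\<forall>a. c a = 0)) \<and>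
     (\<forall>f\<in>flat_functions C p \<eta>. \<exists>c K. \<forall>w\<in>C. f w = (\<Sum>a\<in>UNIV. c a * t a w) + K) \<and>
     (\<forall>a. \<exists>K. (d a \<noteq> 0 \<longrightarrow> K = 0) \<and>
        (\<forall>V s. local_section C p V s \<longrightarrow>
           (\<forall>v\<in>V. dird (E v) (t a \<circ> s) v = d a * t a (s v) + K)))"

text \<open>
  The contravariant Christoffel symbols of \<open>G\<close> in the coordinates \<open>\<tau>\<close>, as holomorphic functions on
  the whole of \<open>V\<close>, including the points where \<open>G\<close> degenerates.
\<close>

definition contra_christoffel_on ::
    "(complex^'n::finite) set \<Rightarrow> (complex^'n \<Rightarrow> complex^'n) \<Rightarrow> (complex^'n \<Rightarrow> complex^'n^'n) \<Rightarrow>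
     ('n \<Rightarrow> 'n \<Rightarrow> 'n \<Rightarrow> complex^'n \<Rightarrow> complex) \<Rightarrow> bool" where
  "contra_christoffel_on V \<tau> G \<Gamma> \<longleftrightarrow> (\<forall>a b c. mholomorphic_on V (\<Gamma> a b c) \<and>
     (\<forall>v\<in>V. det (G v) \<noteq> 0 \<longrightarrow>
        \<Gamma> a b c v = contra_christoffel (coord_pd \<tau>) (coord_metric \<tau> G) a b c v))"

end

theory Submission
  imports Defs "HOL-Complex_Analysis.Conformal_Mappings"
begin

text \<open>
  For a function \<open>t\<close> that is flat for \<open>\<eta>\<close>, let \<open>R t\<close> be its Hessian with respect to \<open>g + \<lambda> \<eta>\<close>, with one index raised; it does not
  depend on \<open>\<lambda>\<close>. Flatness of the whole pencil amounts to two facts: the endomorphisms \<open>R t\<close> commute, and the one-form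
  \<open>ds R t\<close> is closed. The product of one-forms is \<open>u \<cdot> dt^\<beta> = (\<kappa> / d_\<beta>) u R t^\<beta>\<close>. The logarithmic form \<open>- \<Sum>r. m_r dlog z^r\<close> is
  mapped by \<open>g\<close> to \<open>E\<close>, since at \<open>\<lambda> = 0\<close> the \<open>z^r\<close> with \<open>m_r > 0\<close> are pure exponentials; it has vanishing Hessian for \<open>g\<close>,
  and \<open>dlog R t^\<beta> = d_\<beta> dt^\<beta>\<close>. This yields the unit, the commutativity of the product and the intersection form.

  That no \<open>d_\<beta>\<close> vanishes is seen upstairs, in the coordinates \<open>x\<close> at \<open>\<lambda> = 1\<close>: if \<open>d_\<beta> = 0\<close>, then \<open>R t^\<beta>\<close> squares to zero, so the
  derivatives of \<open>t^\<beta>\<close> satisfy an eikonal equation. Near a reflection wall on which \<open>\<eta>\<close> does not degenerate, the derivative of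
  \<open>t^\<beta>\<close> across the wall is odd, so it vanishes identically. Analytic continuation and reflections spread this to all
  directions.
\<close>

section \<open>Holomorphic functions of several variables\<close>

text \<open>Flat coordinates are local and multivalued, while the product must be one tensor on all
  of \<open>M_D\<close>. It is therefore written without them: \<open>Rmat\<close> recovers the
  Hessian of a flat function from its differential alone, and the inverse of \<open>Bmat\<close>,
  the covariant derivative of \<open>E\<close>, supplies the factors 1/d_\<beta>. Coordinates only
  serve to verify identities. The symbols of the pencil are prescribed only where the metric is
  invertible, so tensor identities are checked at images of regular points of x \<mapsto> z, where
  the metric upstairs is constant, and extended by the identity theorem. Two obstacles shape the
  proof that degrees are nonzero. A wall off the zeros of det \<eta> is found by a degree count: at
  \<lambda> = 1 the exponents of det \<eta> have degree at most 2 \<Sum>\<theta>_j - l \<kappa>,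
  with l the rank, but vanishing on all walls would force one of degree at least 2 \<Sum>\<theta>_j.
  And t^\<beta> does not continue across det \<eta> = 0; what is continued is an entire vector,
  obtained from a column of the Jacobian by a polynomial in \<open>Bmat\<close> with cleared
  denominators.\<close>

definition cdiff :: "(complex^'n::finite \<Rightarrow> complex) \<Rightarrow> complex^'n \<Rightarrow> bool" where
  "cdiff f v \<longleftrightarrow> (f has_derivative (\<lambda>u. contract u (differential f v))) (at v)"

lemma bounded_linear_axis: "bounded_linear (axis i :: complex \<Rightarrow> complex^'n::finite)"
proof -
  have "linear (axis i :: complex \<Rightarrow> complex^'n)"
    by (rule linearI) (auto simp: vec_eq_iff axis_def)
  then show ?thesis by (rule linear_conv_bounded_linear[THEN iffD1])
qed

lemma axis_scale: "axis i (c::complex) = c *s axis i 1"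
  by (auto simp: vec_eq_iff axis_def)

lemma vec_eq_sum_axis: "(u::complex^'n::finite) = (\<Sum>i\<in>UNIV. (u $ i) *s axis i 1)"
  by (rule basis_expansion[symmetric])

lemma contract_axis [simp]: "contract (axis i c) \<xi> = c * \<xi> $ i"
  by (simp add: contract_def axis_def if_distrib[of "\<lambda>x. x * _"] cong: if_cong)

lemma contract_axis' [simp]: "contract u (axis i c) = c * u $ i"
  by (simp add: contract_def axis_def if_distrib[of "\<lambda>x. _ * x"] mult.commute cong: if_cong)

lemma contract_add: "contract (X + Y) \<xi> = contract X \<xi> + contract Y \<xi>"
  by (simp add: contract_def algebra_simps sum.distrib)

lemma contract_diff: "contract (X - Y) \<xi> = contract X \<xi> - contract Y \<xi>"
  by (simp add: contract_def algebra_simps sum_subtractf)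

lemma contract_scale: "contract (c *s X) \<xi> = c * contract X \<xi>"
  by (simp add: contract_def algebra_simps sum_distrib_left)

lemma complex_linear_contract:
  assumes "bounded_linear D" and "\<And>c u. D (c *s u) = c * D u"
  shows "D (u::complex^'n::finite) = contract u (\<chi> i. D (axis i 1))"
proof -
  interpret bounded_linear D by fact
  have "D u = D (\<Sum>i\<in>UNIV. (u $ i) *s axis i 1)" by (simp flip: vec_eq_sum_axis)
  also have "\<dots> = (\<Sum>i\<in>UNIV. u $ i * D (axis i 1))" by (simp add: sum assms(2))
  finally show ?thesis by (simp add: contract_def)
qed

lemma has_derivative_imp_pd:
  fixes f :: "complex^'n::finite \<Rightarrow> complex"
  assumes "(f has_derivative D) (at v)" and "\<And>c u. D (c *s u) = c * D u"
  shows "((\<lambda>s. f (v + axis i s)) has_field_derivative D (axis i 1)) (at 0)"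
proof -
  have 1: "((\<lambda>s. v + axis i s) has_derivative axis i) (at 0)"
    by (rule has_derivative_add[OF has_derivative_const bounded_linear.has_derivative[OF bounded_linear_axis has_derivative_ident], simplified])
  have 2: "(f has_derivative D) (at (v + axis i 0))"
    using assms(1) by (simp add: axis_def zero_vec_def[symmetric])
  have "((\<lambda>s. f (v + axis i s)) has_derivative (\<lambda>s. D (axis i s))) (at 0)"
    using has_derivative_compose[OF 1 2] by simp
  moreover have "(\<lambda>s. D (axis i s)) = (*) (D (axis i 1))"
    by (rule ext) (metis axis_scale assms(2) mult.commute)
  ultimately show ?thesis by (simp add: has_field_derivative_def)
qed

lemma cdiff_pdI:
  assumes "(f has_derivative (\<lambda>u. contract u a)) (at v)"
  shows "cdiff f v" and "pd i f v = a $ i" and "differential f v = a"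
proof -
  have *: "pd i f v = a $ i" for i
    using has_derivative_imp_pd[OF assms, of i]
    by (simp add: pd_def DERIV_imp_deriv contract_scale)
  then show "pd i f v = a $ i" .
  show d: "differential f v = a" by (simp add: differential_def * vec_eq_iff)
  show "cdiff f v" using assms d by (simp add: cdiff_def)
qed

lemma mholomorphic_on_iff_cdiff: "mholomorphic_on V f \<longleftrightarrow> (\<forall>v\<in>V. cdiff f v)"
proof
  assume *: "mholomorphic_on V f"
  show "\<forall>v\<in>V. cdiff f v"
  proof
    fix v assume "v \<in> V"
    then obtain D where D: "(f has_derivative D) (at v)" "\<And>c u. D (c *s u) = c * D u"
      using * unfolding mholomorphic_on_def by blast
    have "D = (\<lambda>u. contract u (\<chi> i. D (axis i 1)))"
      using complex_linear_contract[OF has_derivative_bounded_linear[OF D(1)] D(2)] by blast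
    then show "cdiff f v" using cdiff_pdI(1) D(1) by metis
  qed
next
  assume "\<forall>v\<in>V. cdiff f v"
  then show "mholomorphic_on V f"
    unfolding mholomorphic_on_def cdiff_def using contract_scale by blast
qed

lemma cdiff_has_derivative:
  "cdiff f v \<Longrightarrow> (f has_derivative (\<lambda>u. contract u (differential f v))) (at v)"
  by (simp add: cdiff_def)

lemma differential_nth [simp]: "differential f v $ i = pd i f v"
  by (simp add: differential_def)

lemma dird_axis [simp]: "dird (axis i c) f v = c * pd i f v"
  by (simp add: dird_def)

lemma dird_expand: "dird X f v = (\<Sum>i\<in>UNIV. X $ i * pd i f v)"
  by (simp add: dird_def contract_def)

lemma cdiff_const: "cdiff (\<lambda>_. c) v" and pd_const: "pd i (\<lambda>_. c) v = 0"
  using cdiff_pdI(1,2)[of "\<lambda>_. c" 0 v] by (auto simp: contract_def)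

lemma cdiff_coord: "cdiff (\<lambda>v. v $ k) v" and pd_coord: "pd i (\<lambda>v. v $ k) v = (if i = k then 1 else 0)"
proof -
  have "((\<lambda>v. v $ k) has_derivative (\<lambda>u. contract u (axis k 1))) (at v)"
    by (simp add: bounded_linear.has_derivative[OF bounded_linear_vec_nth] )
  from cdiff_pdI[OF this] show "cdiff (\<lambda>v. v $ k) v" "pd i (\<lambda>v. v $ k) v = (if i = k then 1 else 0)"
    by (auto simp: axis_def)
qed

lemma contract_add_right: "contract X (\<xi> + \<zeta>) = contract X \<xi> + contract X \<zeta>"
  by (simp add: contract_def algebra_simps sum.distrib)
lemma contract_scale_right: "contract X (c *s \<xi>) = c * contract X \<xi>"
  by (simp add: contract_def algebra_simps sum_distrib_left)
lemma contract_sum_right: "contract X (\<Sum>i\<in>A. \<xi> i) = (\<Sum>i\<in>A. contract X (\<xi> i))"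
  by (induction A rule: infinite_finite_induct) (auto simp: contract_add_right, auto simp: contract_def)

lemma cdiff_add: "cdiff f v \<Longrightarrow> cdiff g v \<Longrightarrow> cdiff (\<lambda>v. f v + g v) v"
  and pd_add: "cdiff f v \<Longrightarrow> cdiff g v \<Longrightarrow> pd i (\<lambda>v. f v + g v) v = pd i f v + pd i g v"
proof -
  assume "cdiff f v" "cdiff g v"
  then have "((\<lambda>v. f v + g v) has_derivative (\<lambda>u. contract u (differential f v + differential g v))) (at v)"
    unfolding contract_add_right by (intro derivative_intros cdiff_has_derivative)
  from cdiff_pdI[OF this] show "cdiff (\<lambda>v. f v + g v) v" "pd i (\<lambda>v. f v + g v) v = pd i f v + pd i g v"
    by auto
qed

lemma cdiff_mult: "cdiff f v \<Longrightarrow> cdiff g v \<Longrightarrow> cdiff (\<lambda>v. f v * g v) v"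
  and pd_mult: "cdiff f v \<Longrightarrow> cdiff g v \<Longrightarrow> pd i (\<lambda>v. f v * g v) v = pd i f v * g v + f v * pd i g v"
proof -
  assume "cdiff f v" "cdiff g v"
  then have "((\<lambda>v. f v * g v) has_derivative (\<lambda>u. contract u (g v *s differential f v + f v *s differential g v))) (at v)"
    unfolding contract_add_right contract_scale_right
    by (auto intro!: derivative_eq_intros cdiff_has_derivative simp: algebra_simps)
  from cdiff_pdI[OF this] show "cdiff (\<lambda>v. f v * g v) v"
    "pd i (\<lambda>v. f v * g v) v = pd i f v * g v + f v * pd i g v"
    by (auto simp: algebra_simps)
qed

lemma cdiff_compose_field:
  assumes "(h has_field_derivative h') (at (f v))" "cdiff f v"
  shows "cdiff (\<lambda>v. h (f v)) v" and "pd i (\<lambda>v. h (f v)) v = h' * pd i f v"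
proof -
  have "((\<lambda>v. h (f v)) has_derivative (\<lambda>u. contract u (h' *s differential f v))) (at v)"
    unfolding contract_scale_right
    using has_derivative_compose[OF cdiff_has_derivative[OF assms(2)] assms(1)[unfolded has_field_derivative_def]] .
  from cdiff_pdI[OF this] show "cdiff (\<lambda>v. h (f v)) v" "pd i (\<lambda>v. h (f v)) v = h' * pd i f v"
    by auto
qed

lemma cdiff_minus: "cdiff f v \<Longrightarrow> cdiff (\<lambda>v. - f v) v"
  and pd_minus: "cdiff f v \<Longrightarrow> pd i (\<lambda>v. - f v) v = - pd i f v"
  using cdiff_mult[OF cdiff_const[of "-1"], of f v] pd_mult[OF cdiff_const[of "-1"], of f v i]
  by (auto simp: pd_const)

lemma cdiff_diff: "cdiff f v \<Longrightarrow> cdiff g v \<Longrightarrow> cdiff (\<lambda>v. f v - g v) v"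
  and pd_diff: "cdiff f v \<Longrightarrow> cdiff g v \<Longrightarrow> pd i (\<lambda>v. f v - g v) v = pd i f v - pd i g v"
  using cdiff_add[OF _ cdiff_minus, of f v g] pd_add[OF _ cdiff_minus, of f v g i]
  by (auto simp: pd_minus)

lemma cdiff_sum: "(\<And>j. j \<in> A \<Longrightarrow> cdiff (f j) v) \<Longrightarrow> cdiff (\<lambda>v. \<Sum>j\<in>A. f j v) v"
  and pd_sum: "(\<And>j. j \<in> A \<Longrightarrow> cdiff (f j) v) \<Longrightarrow> pd i (\<lambda>v. \<Sum>j\<in>A. f j v) v = (\<Sum>j\<in>A. pd i (f j) v)"
proof -
  have "(\<forall>j\<in>A. cdiff (f j) v) \<longrightarrow> cdiff (\<lambda>v. \<Sum>j\<in>A. f j v) v \<and>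
     pd i (\<lambda>v. \<Sum>j\<in>A. f j v) v = (\<Sum>j\<in>A. pd i (f j) v)"
    by (induction A rule: infinite_finite_induct) (auto simp: cdiff_const pd_const cdiff_add pd_add)
  then show "(\<And>j. j \<in> A \<Longrightarrow> cdiff (f j) v) \<Longrightarrow> cdiff (\<lambda>v. \<Sum>j\<in>A. f j v) v"
    "(\<And>j. j \<in> A \<Longrightarrow> cdiff (f j) v) \<Longrightarrow> pd i (\<lambda>v. \<Sum>j\<in>A. f j v) v = (\<Sum>j\<in>A. pd i (f j) v)"
    by auto
qed

lemma cdiff_prod: "(\<And>j. j \<in> A \<Longrightarrow> cdiff (f j) v) \<Longrightarrow> cdiff (\<lambda>v. \<Prod>j\<in>A. f j v) v"
  by (induction A rule: infinite_finite_induct) (auto simp: cdiff_const cdiff_mult)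

lemma cdiff_power: "cdiff f v \<Longrightarrow> cdiff (\<lambda>v. f v ^ k) v"
  by (induction k) (auto simp: cdiff_const cdiff_mult)

lemma cdiff_exp: "cdiff f v \<Longrightarrow> cdiff (\<lambda>v. exp (f v)) v"
  and pd_exp: "cdiff f v \<Longrightarrow> pd i (\<lambda>v. exp (f v)) v = exp (f v) * pd i f v"
  using cdiff_compose_field[of exp "exp (f v)" f v] DERIV_exp by blast+

lemma cdiff_divide: "cdiff f v \<Longrightarrow> cdiff g v \<Longrightarrow> g v \<noteq> 0 \<Longrightarrow> cdiff (\<lambda>v. f v / g v) v"
proof -
  assume *: "cdiff f v" "cdiff g v" "g v \<noteq> 0"
  have "cdiff (\<lambda>v. inverse (g v)) v"
    using cdiff_compose_field(1)[OF DERIV_inverse, of g v] * by blast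
  then show ?thesis using cdiff_mult[OF *(1)] by (simp add: divide_inverse)
qed

lemmas cdiff_intros = cdiff_const cdiff_coord cdiff_add cdiff_mult cdiff_minus cdiff_diff cdiff_sum
  cdiff_prod cdiff_power cdiff_exp cdiff_divide

lemma cdiff_det:
  fixes A :: "complex^'n::finite \<Rightarrow> complex^'m::finite^'m"
  assumes "\<And>i j. cdiff (\<lambda>v. A v $ i $ j) v"
  shows "cdiff (\<lambda>v. det (A v)) v"
  unfolding det_def by (intro cdiff_intros assms)

lemma eventually_cong_pd:
  assumes "eventually (\<lambda>u. f u = g u) (nhds v)"
  shows "pd i f v = pd i g v" and "cdiff f v \<longleftrightarrow> cdiff g v" and "differential f v = differential g v"
    and "dird X f v = dird X g v"
proof -
  have p: "pd i f v = pd i g v" for i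
  proof -
    have "filterlim (\<lambda>s. v + axis i s) (nhds v) (nhds 0)"
      using tendsto_add[OF tendsto_const bounded_linear.tendsto[OF bounded_linear_axis filterlim_ident], of v i 0]
      by (simp add: axis_def[of i 0] zero_vec_def[symmetric])
    from eventually_compose_filterlim[OF assms this]
    show ?thesis unfolding pd_def by (rule deriv_cong_ev) simp
  qed
  then show "pd i f v = pd i g v" and d: "differential f v = differential g v"
    by (auto simp: differential_def)
  then show "dird X f v = dird X g v" by (simp add: dird_def)
  have ev: "eventually (\<lambda>u. f u = g u) (at v)" using assms by (simp add: eventually_nhds_conv_at)
  have fv: "f v = g v" using assms by (rule eventually_nhds_x_imp_x)
  show "cdiff f v \<longleftrightarrow> cdiff g v"
    unfolding cdiff_def d
    using has_derivative_transform_eventually[OF _ ev fv] 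
      has_derivative_transform_eventually[of g _ v UNIV f] ev fv by (auto simp: eq_commute)
qed

lemma open_cong_pd:
  assumes "open V" "v \<in> V" "\<And>u. u \<in> V \<Longrightarrow> f u = g u"
  shows "pd i f v = pd i g v" and "cdiff f v \<longleftrightarrow> cdiff g v" and "differential f v = differential g v"
    and "dird X f v = dird X g v"
proof -
  have "eventually (\<lambda>u. f u = g u) (nhds v)" using assms eventually_nhds by blast
  note * = eventually_cong_pd[OF this]
  show "pd i f v = pd i g v" by (rule *)
  show "cdiff f v \<longleftrightarrow> cdiff g v" by (rule *)
  show "differential f v = differential g v" by (rule *)
  show "dird X f v = dird X g v" by (rule *)
qed

lemma has_derivative_vec:
  fixes F :: "'a::real_normed_vector \<Rightarrow> complex^'m::finite"
  assumes "\<And>k. ((\<lambda>v. F v $ k) has_derivative (\<lambda>u. D u $ k)) (at v)"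
  shows "(F has_derivative D) (at v)"
proof -
  have *: "(x::complex^'m) = (\<Sum>k\<in>UNIV. axis k (x $ k))" for x
    using vec_eq_sum_axis[of x] by (subst axis_scale) 
  have "((\<lambda>v. \<Sum>k\<in>UNIV. axis k (F v $ k)) has_derivative (\<lambda>u. \<Sum>k\<in>UNIV. axis k (D u $ k))) (at v)"
    by (intro has_derivative_sum bounded_linear.has_derivative[OF bounded_linear_axis] assms)
  moreover have "(\<lambda>v. \<Sum>k\<in>UNIV. axis k (F v $ k)) = F" "(\<lambda>u. \<Sum>k\<in>UNIV. axis k (D u $ k)) = D"
    by (intro ext *[symmetric])+
  ultimately show ?thesis by argo
qed

lemma has_derivative_jacobian:
  assumes "\<And>k. cdiff (\<lambda>v. F v $ k) v"
  shows "(F has_derivative (\<lambda>u. jacobian F v *v u)) (at v)"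
proof (rule has_derivative_vec)
  fix k
  have "(\<lambda>u. (jacobian F v *v u) $ k) = (\<lambda>u. contract u (differential (\<lambda>v. F v $ k) v))"
    by (simp add: jacobian_def matrix_vector_mult_def contract_def mult.commute)
  then show "((\<lambda>v. F v $ k) has_derivative (\<lambda>u. (jacobian F v *v u) $ k)) (at v)"
    using cdiff_has_derivative[OF assms] by simp
qed

lemma pd_chain:
  fixes F :: "complex^'n::finite \<Rightarrow> complex^'n"
  assumes "cdiff f (F v)" "\<And>k. cdiff (\<lambda>v. F v $ k) v"
  shows "cdiff (\<lambda>v. f (F v)) v"
    and "pd i (\<lambda>v. f (F v)) v = (\<Sum>k\<in>UNIV. pd k f (F v) * pd i (\<lambda>v. F v $ k) v)"
proof -
  let ?a = "\<chi> i. \<Sum>k\<in>UNIV. pd k f (F v) * pd i (\<lambda>v. F v $ k) v"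
  have "((\<lambda>v. f (F v)) has_derivative (\<lambda>u. contract (jacobian F v *v u) (differential f (F v)))) (at v)"
    using has_derivative_compose[OF has_derivative_jacobian cdiff_has_derivative] assms by blast
  moreover have "contract (jacobian F v *v u) (differential f (F v)) = contract u ?a" for u
    by (simp add: contract_def jacobian_def matrix_vector_mult_def sum_distrib_left sum_distrib_right)
      (subst sum.swap, simp add: mult_ac)
  ultimately have "((\<lambda>v. f (F v)) has_derivative (\<lambda>u. contract u ?a)) (at v)" by simp
  from cdiff_pdI[OF this] show "cdiff (\<lambda>v. f (F v)) v"
    "pd i (\<lambda>v. f (F v)) v = (\<Sum>k\<in>UNIV. pd k f (F v) * pd i (\<lambda>v. F v $ k) v)" by auto
qed

lemma bounded_linear_scale: "bounded_linear (\<lambda>s. s *s (u::complex^'n::finite))"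
proof -
  have "linear (\<lambda>s. s *s u)"
    by (rule linearI) (auto simp: vec_eq_iff algebra_simps)
  then show ?thesis by (rule linear_conv_bounded_linear[THEN iffD1])
qed

lemma has_field_derivative_line:
  assumes "cdiff f (v + s *s u)"
  shows "((\<lambda>s. f (v + s *s u)) has_field_derivative dird u f (v + s *s u)) (at s)"
proof -
  have 1: "((\<lambda>s. v + s *s u) has_derivative (\<lambda>h. h *s u)) (at s)"
    by (rule has_derivative_add[OF has_derivative_const
        bounded_linear.has_derivative[OF bounded_linear_scale has_derivative_ident], simplified])
  have "((\<lambda>s. f (v + s *s u)) has_derivative (\<lambda>h. contract (h *s u) (differential f (v + s *s u)))) (at s)"
    using has_derivative_compose[OF 1 cdiff_has_derivative[OF assms]] .
  moreover have "(\<lambda>h. contract (h *s u) (differential f (v + s *s u))) = (*) (dird u f (v + s *s u))"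
    by (rule ext) (simp add: contract_scale dird_def)
  ultimately show ?thesis by (simp add: has_field_derivative_def)
qed

section \<open>Cauchy's formula and iterated partial derivatives\<close>

lemma continuous_on_mholomorphic: "mholomorphic_on V f \<Longrightarrow> continuous_on V f"
  by (meson cdiff_has_derivative continuous_at_imp_continuous_on has_derivative_continuous mholomorphic_on_iff_cdiff)

text \<open>Cauchy's formula in the i-th variable alone. Writing a partial derivative as an integral
  of values of \<open>f\<close> turns questions about the regularity of \<open>pd i f\<close> into
  questions about an integral with parameter \<open>v\<close>.\<close>

lemma pd_circle_integral:
  fixes f :: "complex^'n::finite \<Rightarrow> complex" and r :: real
  assumes "0 < r" and "\<And>w. norm w \<le> r \<Longrightarrow> cdiff f (v + axis i w)"
  shows "pd i f v = integral {0..1} (\<lambda>t. f (v + axis i (r * exp (2 * of_real pi * \<i> * of_real t)))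
           / (r * exp (2 * of_real pi * \<i> * of_real t)))"
proof -
  define F where "F = (\<lambda>w::complex. f (v + axis i w))"
  have D: "(F has_field_derivative pd i f (v + axis i w)) (at w)" if "norm w \<le> r" for w :: complex
  proof -
    have "cdiff f (v + w *s axis i 1)" using assms(2)[OF that] by (subst axis_scale[symmetric])
    note has_field_derivative_line[OF this]
    moreover have "(\<lambda>s. f (v + s *s axis i 1)) = F"
      unfolding F_def by (rule ext) (simp only: axis_scale[symmetric])
    moreover have "dird (axis i 1) f (v + w *s axis i 1) = pd i f (v + axis i w)"
      using axis_scale[of i w] by simp
    ultimately show ?thesis by argo
  qed
  have hol: "F holomorphic_on ball 0 r"
    unfolding holomorphic_on_open[OF open_ball]
  proof
    fix w :: complex assume "w \<in> ball 0 (r::real)"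
    then have "norm w \<le> r" by simp
    from D[OF this] show "\<exists>f'. (F has_field_derivative f') (at w)" by blast
  qed
  have cont: "continuous_on (cball 0 r) F"
  proof (rule continuous_at_imp_continuous_on, rule ballI)
    fix w :: complex assume "w \<in> cball 0 (r::real)"
    then have "norm w \<le> r" by simp
    from DERIV_isCont[OF D[OF this]] show "isCont F w" .
  qed
  let ?\<phi> = "\<lambda>t. r * exp (2 * of_real pi * \<i> * of_real t)"
  have "pd i f v = deriv F 0" by (simp add: pd_def F_def)
  also have "\<dots> = 1 / (2 * of_real pi * \<i>) * contour_integral (circlepath 0 r) (\<lambda>u. F u / (u - 0)\<^sup>2)"
    by (rule DERIV_imp_deriv, rule Cauchy_derivative_integral_circlepath(2)[OF cont hol]) (use assms in auto)
  \<comment> \<open>On the circle the velocity is 2 pi \<i> times the point itself, which cancels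
    one of the two factors in the denominator.\<close>
  also have "contour_integral (circlepath 0 r) (\<lambda>u. F u / (u - 0)\<^sup>2) =
      integral {0..1} (\<lambda>t. (2 * of_real pi * \<i>) * (F (?\<phi> t) / ?\<phi> t))"
    unfolding contour_integral_integral vector_derivative_circlepath
    by (rule integral_cong) (use assms in \<open>simp add: circlepath power2_eq_square field_simps\<close>)
  also have "\<dots> = (2 * of_real pi * \<i>) * integral {0..1} (\<lambda>t. F (?\<phi> t) / ?\<phi> t)"
    by (rule integral_mult_right)
  finally show ?thesis by (simp add: F_def)
qed

lemma norm_axis: "norm (axis i w :: complex^'n::finite) = norm w"
proof -
  have "(\<Sum>k\<in>UNIV. (norm (axis i w $ k :: complex))\<^sup>2) = (\<Sum>k\<in>UNIV. if k = i then (norm w)\<^sup>2 else 0)"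
    by (rule sum.cong) (auto simp: axis_def)
  then show ?thesis by (simp add: norm_vec_def L2_set_def)
qed

text \<open>\<open>mholomorphic_on\<close> asserts differentiability point by point and says nothing
  about continuity of the derivative. Continuity comes from the Cauchy integral, whose integrand is
  jointly continuous; the ball of radius 2r leaves room for a circle of radius r about every point
  of the smaller ball.\<close>

lemma mholomorphic_pd_aux:
  fixes f :: "complex^'n::finite \<Rightarrow> complex"
  assumes "open V" "mholomorphic_on V f" "v \<in> V"
  shows "\<exists>r>0. cball v (2 * r) \<subseteq> V \<and> (\<forall>i. continuous_on (ball v r) (pd i f))"
proof -
  obtain r' where r': "r' > 0" "cball v r' \<subseteq> V" using open_contains_cball assms by blast
  define r where "r = r' / 2"
  have r: "r > 0" "cball v (2 * r) \<subseteq> V" using r' by (auto simp: r_def)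
  let ?\<phi> = "\<lambda>t::real. of_real r * exp (2 * of_real pi * \<i> * of_real t) :: complex"
  have mem: "u + axis i w \<in> V" if "u \<in> ball v r" "norm w \<le> r" for u i w
  proof -
    have "dist v (u + axis i w) \<le> dist v u + norm (axis i w :: complex^'n)"
      by (metis add_diff_cancel_left' dist_norm dist_triangle dist_commute)
    also have "\<dots> \<le> 2 * r" using that by (simp add: norm_axis)
    finally show ?thesis using r by auto
  qed
  have "continuous_on (ball v r) (pd i f)" for i
  proof -
    have "continuous_on (ball v r \<times> cbox 0 1) (\<lambda>(u, t). f (u + axis i (?\<phi> t)) / ?\<phi> t)"
      unfolding split_beta
      by (intro continuous_intros continuous_on_compose2[OF continuous_on_mholomorphic[OF assms(2)]]
          bounded_linear.continuous_on[OF bounded_linear_axis])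
        (use r mem in \<open>auto simp: norm_mult norm_exp_eq_Re\<close>)
    then have "continuous_on (ball v r) (\<lambda>u. integral (cbox 0 1) (\<lambda>t. f (u + axis i (?\<phi> t)) / ?\<phi> t))"
      by (rule integral_continuous_on_param)
    moreover have "pd i f u = integral (cbox 0 1) (\<lambda>t. f (u + axis i (?\<phi> t)) / ?\<phi> t)" if "u \<in> ball v r" for u
      unfolding box_real
      by (rule pd_circle_integral[OF r(1)]) (use mem[OF that] assms(2) in \<open>auto simp: mholomorphic_on_iff_cdiff\<close>)
    ultimately show ?thesis by (metis (no_types, lifting) continuous_on_cong)
  qed
  then show ?thesis using r by blast
qed

lemma continuous_on_pd:
  assumes "open V" "mholomorphic_on V f"
  shows "continuous_on V (pd i f)"
proof (rule continuous_at_imp_continuous_on, rule ballI)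
  fix v assume "v \<in> V"
  then obtain r where "r > 0" "continuous_on (ball v r) (pd i f)"
    using mholomorphic_pd_aux[OF assms] by blast
  then show "isCont (pd i f) v" by (simp add: continuous_on_eq_continuous_at)
qed

text \<open>Differentiation under the integral sign in Cauchy's formula, licensed by the continuity
  of the partial derivatives. The derivative is recorded explicitly: its j-th component is the
  Cauchy integral of \<open>pd j f\<close>, from which the symmetry of second derivatives can be
  read off.\<close>

lemma mholomorphic_pd_has_derivative:
  fixes f :: "complex^'n::finite \<Rightarrow> complex"
  assumes "open V" "mholomorphic_on V f" "v \<in> V"
  obtains r where "r > 0" "cball v r \<subseteq> V" "\<And>w u. norm w \<le> r \<Longrightarrow> v + axis i w \<in> V"
    "(pd i f has_derivative (\<lambda>u. contract u (\<chi> j. integral {0..1}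
       (\<lambda>t. pd j f (v + axis i (of_real r * exp (2 * of_real pi * \<i> * of_real t)))
           / (of_real r * exp (2 * of_real pi * \<i> * of_real t)))))) (at v)"
proof -
  obtain r' where r': "r' > 0" "cball v r' \<subseteq> V" using open_contains_cball assms by blast
  define r where "r = r' / 2"
  have r: "r > 0" "cball v (2 * r) \<subseteq> V" using r' by (auto simp: r_def)
  let ?\<phi> = "\<lambda>t::real. of_real r * exp (2 * of_real pi * \<i> * of_real t) :: complex"
  have \<phi>: "?\<phi> t \<noteq> 0" "norm (?\<phi> t) = r" for t using r by (auto simp: norm_mult norm_exp_eq_Re)
  have mem: "u + axis i w \<in> V" if "u \<in> ball v r" "norm w \<le> r" for u w
  proof -
    have "dist v (u + axis i w) \<le> dist v u + norm (axis i w :: complex^'n)"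
      by (metis add_diff_cancel_left' dist_norm dist_triangle dist_commute)
    also have "\<dots> \<le> 2 * r" using that by (simp add: norm_axis)
    finally show ?thesis using r by auto
  qed
  have mem': "u + axis i (?\<phi> t) \<in> V" if "u \<in> ball v r" for u t using mem[OF that] \<phi>(2) by auto
  define L where "L = (\<lambda>u t. Blinfun (\<lambda>h. contract h (differential f (u + axis i (?\<phi> t))) / ?\<phi> t))"
  have cd: "cdiff f u" if "u \<in> V" for u using that assms(2) mholomorphic_on_iff_cdiff by blast
  have L: "blinfun_apply (L u t) = (\<lambda>h. contract h (differential f (u + axis i (?\<phi> t))) / ?\<phi> t)"
    if "u \<in> ball v r" for u t
    unfolding L_def
  proof (rule bounded_linear_Blinfun_apply)
    have "bounded_linear (\<lambda>h. contract h (differential f (u + axis i (?\<phi> t))))"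
      by (rule has_derivative_bounded_linear[OF cdiff_has_derivative[OF cd[OF mem'[OF that]]]])
    from bounded_linear_compose[OF bounded_linear_mult_left this, of "inverse (?\<phi> t)"]
    show "bounded_linear (\<lambda>h. contract h (differential f (u + axis i (?\<phi> t))) / ?\<phi> t)"
      by (simp add: divide_inverse)
  qed
  have contpd: "continuous_on (ball v r \<times> cbox 0 1) (\<lambda>p. pd j f (fst p + axis i (?\<phi> (snd p))))" for j
    by (rule continuous_on_compose2[OF continuous_on_pd[OF assms(1,2)]])
      (use mem' in \<open>auto intro!: continuous_intros bounded_linear.continuous_on[OF bounded_linear_axis]\<close>)
  have "((\<lambda>u. integral (cbox 0 1) (\<lambda>t. f (u + axis i (?\<phi> t)) / ?\<phi> t)) has_derivative
        blinfun_apply (integral (cbox 0 1) (L v))) (at v within ball v r)"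
  proof (rule leibniz_rule)
    fix u t assume u: "u \<in> ball v r" and t: "t \<in> cbox (0::real) 1"
    have "((\<lambda>u. f (u + axis i (?\<phi> t)) / ?\<phi> t) has_derivative
        (\<lambda>h. contract h (differential f (u + axis i (?\<phi> t))) / ?\<phi> t)) (at u)"
    proof -
      have "((\<lambda>u. u + axis i (?\<phi> t)) has_derivative (\<lambda>h. h)) (at u)"
        using has_derivative_add[OF has_derivative_ident has_derivative_const] by force
      from has_derivative_compose[OF this cdiff_has_derivative[OF cd[OF mem'[OF u]]]]
      have "((\<lambda>u. f (u + axis i (?\<phi> t))) has_derivative (\<lambda>h. contract h (differential f (u + axis i (?\<phi> t))))) (at u)" .
      from has_derivative_mult_left[OF this, of "inverse (?\<phi> t)"]
      show ?thesis by (simp add: divide_inverse)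
    qed
    then show "((\<lambda>x. f (x + axis i (?\<phi> t)) / ?\<phi> t) has_derivative blinfun_apply (L u t)) (at u within ball v r)"
      unfolding L[OF u] by (rule has_derivative_at_withinI)
  next
    fix u assume u: "u \<in> ball v r"
    show "(\<lambda>t. f (u + axis i (?\<phi> t)) / ?\<phi> t) integrable_on cbox 0 1"
      by (rule integrable_continuous, intro continuous_intros continuous_on_compose2[OF continuous_on_mholomorphic[OF assms(2)]]
          bounded_linear.continuous_on[OF bounded_linear_axis]) (use \<phi> mem'[OF u] in auto)
  next
    show "continuous_on (ball v r \<times> cbox 0 1) (\<lambda>(u, t). L u t)"
    proof (rule continuous_on_blinfun_componentwise)
      fix b :: "complex^'n"
      have "continuous_on (ball v r \<times> cbox 0 1) (\<lambda>p. (\<Sum>j\<in>UNIV. b $ j * pd j f (fst p + axis i (?\<phi> (snd p)))) / ?\<phi> (snd p))"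
        by (intro continuous_intros contpd) (use \<phi> in auto)
      moreover have "(\<Sum>j\<in>UNIV. b $ j * pd j f (fst p + axis i (?\<phi> (snd p)))) / ?\<phi> (snd p) = (case p of (u, t) \<Rightarrow> L u t) b"
        if "p \<in> ball v r \<times> cbox 0 1" for p using that by (auto simp: L contract_def split: prod.splits)
      ultimately show "continuous_on (ball v r \<times> cbox 0 1) (\<lambda>p. (case p of (u, t) \<Rightarrow> L u t) b)"
        by (metis (no_types, lifting) continuous_on_cong)
    qed
  qed (use r in auto)
  then have D: "((\<lambda>u. integral (cbox 0 1) (\<lambda>t. f (u + axis i (?\<phi> t)) / ?\<phi> t)) has_derivative
        blinfun_apply (integral (cbox 0 1) (L v))) (at v)"
    using r by (simp add: at_within_open[OF _ open_ball])
  have eq: "pd i f u = integral (cbox 0 1) (\<lambda>t. f (u + axis i (?\<phi> t)) / ?\<phi> t)" if "u \<in> ball v r" for u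
    using pd_circle_integral[of r f u i] r mem[OF that] cd by auto
  have D2: "(pd i f has_derivative blinfun_apply (integral (cbox 0 1) (L v))) (at v)"
    by (rule has_derivative_transform_within_open[OF D, of "ball v r"]) (use r eq in auto)
  have Lint: "L v integrable_on cbox 0 1"
  proof (rule integrable_continuous, rule continuous_on_blinfun_componentwise)
    fix b :: "complex^'n"
    have "continuous_on (cbox 0 1) (\<lambda>t. (\<Sum>j\<in>UNIV. b $ j * pd j f (v + axis i (?\<phi> t))) / ?\<phi> t)"
      by (intro continuous_intros continuous_on_compose2[OF contpd, where f = "\<lambda>t. (v, t)", simplified]) (use \<phi> r in auto)
    then show "continuous_on (cbox 0 1) (\<lambda>t. L v t b)"
      using r by (simp add: L contract_def)
  qed
  have "blinfun_apply (integral (cbox 0 1) (L v)) h = contract h (\<chi> j. integral {0..1} (\<lambda>t. pd j f (v + axis i (?\<phi> t)) / ?\<phi> t))" for h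
  proof -
    have i1: "(\<lambda>t. pd j f (v + axis i (?\<phi> t)) / ?\<phi> t) integrable_on {0..1}" for j
      unfolding box_real[symmetric]
      by (rule integrable_continuous, intro continuous_intros continuous_on_compose2[OF contpd, where f = "\<lambda>t. (v, t)", simplified]) (use \<phi> r in auto)
    have "blinfun_apply (integral (cbox 0 1) (L v)) h = integral (cbox 0 1) (\<lambda>t. L v t h)"
      by (rule blinfun_apply_integral[OF Lint])
    also have "\<dots> = integral {0..1} (\<lambda>t. \<Sum>j\<in>UNIV. h $ j * (pd j f (v + axis i (?\<phi> t)) / ?\<phi> t))"
      using r by (simp add: L contract_def sum_divide_distrib)
    also have "\<dots> = (\<Sum>j\<in>UNIV. integral {0..1} (\<lambda>t. h $ j * (pd j f (v + axis i (?\<phi> t)) / ?\<phi> t)))"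
      by (rule integral_sum, rule finite, rule integrable_on_mult_right, rule i1)
    finally show ?thesis by (simp only: contract_def integral_mult_right vec_lambda_beta)
  qed
  then have "(pd i f has_derivative (\<lambda>h. contract h (\<chi> j. integral {0..1} (\<lambda>t. pd j f (v + axis i (?\<phi> t)) / ?\<phi> t)))) (at v)"
    using D2 by presburger
  moreover have "v + axis i w \<in> V" if "norm w \<le> r" for w using mem[of v w] that r by simp
  moreover have "cball v r \<subseteq> V" using r subset_cball[of r "2 * r" v] by force
  ultimately show thesis using that r by blast
qed

lemma mholomorphic_on_pd:
  assumes "open V" "mholomorphic_on V f"
  shows "mholomorphic_on V (pd i f)"
  unfolding mholomorphic_on_iff_cdiff
proof
  fix v assume "v \<in> V"
  with assms show "cdiff (pd i f) v"
    by (rule_tac mholomorphic_pd_has_derivative[OF assms \<open>v \<in> V\<close>]) (rule cdiff_pdI(1))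
qed

text \<open>The i-th component of the derivative of \<open>pd j f\<close> is the Cauchy integral of
  \<open>pd i f\<close> along the j-th axis, and Cauchy's formula evaluates that integral.\<close>

lemma pd_commute:
  assumes "open V" "mholomorphic_on V f" "v \<in> V"
  shows "pd i (pd j f) v = pd j (pd i f) v"
proof -
  obtain r where r: "r > 0" "\<And>w. norm w \<le> r \<Longrightarrow> v + axis j w \<in> V"
    "(pd j f has_derivative (\<lambda>u. contract u (\<chi> i. integral {0..1}
       (\<lambda>t. pd i f (v + axis j (of_real r * exp (2 * of_real pi * \<i> * of_real t)))
           / (of_real r * exp (2 * of_real pi * \<i> * of_real t)))))) (at v)"
    by (rule mholomorphic_pd_has_derivative[OF assms, of j]) (rule that)
  have "pd i (pd j f) v = integral {0..1}
       (\<lambda>t. pd i f (v + axis j (of_real r * exp (2 * of_real pi * \<i> * of_real t)))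
           / (of_real r * exp (2 * of_real pi * \<i> * of_real t)))"
    using cdiff_pdI(2)[OF r(3)] by simp
  also have "\<dots> = pd j (pd i f) v"
    by (rule pd_circle_integral[symmetric])
      (use r mholomorphic_on_pd[OF assms(1,2)] mholomorphic_on_iff_cdiff in blast)+
  finally show ?thesis .
qed

section \<open>Identity theorems\<close>

abbreviation "entire f \<equiv> mholomorphic_on UNIV f"

lemma mholomorphic_on_cdiff: "mholomorphic_on V f \<Longrightarrow> v \<in> V \<Longrightarrow> cdiff f v"
  by (simp add: mholomorphic_on_iff_cdiff)

lemma entire_cdiff: "entire f \<Longrightarrow> cdiff f v"
  by (simp add: mholomorphic_on_iff_cdiff)

lemma entireI: "(\<And>v. cdiff f v) \<Longrightarrow> entire f"
  by (simp add: mholomorphic_on_iff_cdiff)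

text \<open>Restriction to the complex line through \<open>v\<close> and \<open>w\<close> reduces
  the claim to one variable. Convexity of \<open>V\<close> makes the part of the line inside
  \<open>V\<close> connected.\<close>

lemma mholomorphic_eq_0:
  fixes f :: "complex^'n::finite \<Rightarrow> complex"
  assumes "open V" "convex V" "mholomorphic_on V f"
    and "v \<in> V" "eventually (\<lambda>u. f u = 0) (nhds v)" "w \<in> V"
  shows "f w = 0"
proof -
  define \<gamma> where "\<gamma> = (\<lambda>s. v + s *s (w - v))"
  have cont: "continuous_on UNIV \<gamma>"
    unfolding \<gamma>_def by (intro continuous_intros bounded_linear.continuous_on[OF bounded_linear_scale])
  have S: "open (\<gamma> -` V)" using cont assms(1) by (simp add: continuous_on_open_vimage)
  have "convex (\<gamma> -` V)"
  proof (rule convexI)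
    fix a b and x y :: real assume *: "a \<in> \<gamma> -` V" "b \<in> \<gamma> -` V" "0 \<le> x" "0 \<le> y" "x + y = 1"
    have "\<gamma> (x *\<^sub>R a + y *\<^sub>R b) = x *\<^sub>R \<gamma> a + y *\<^sub>R \<gamma> b"
    proof -
      have "v = x *\<^sub>R v + y *\<^sub>R v" using *(5) by (metis scaleR_add_left scaleR_one)
      moreover have "(x *\<^sub>R a + y *\<^sub>R b) *s (w - v) = x *\<^sub>R (a *s (w - v)) + y *\<^sub>R (b *s (w - v))"
        by (simp add: vec_eq_iff algebra_simps)
      ultimately show ?thesis unfolding \<gamma>_def by (simp add: scaleR_add_right)
    qed
    then show "x *\<^sub>R a + y *\<^sub>R b \<in> \<gamma> -` V" using * convexD[OF assms(2)] by simp
  qed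
  then have conn: "connected (\<gamma> -` V)" by (rule convex_connected)
  have hol: "(\<lambda>s. f (\<gamma> s)) holomorphic_on \<gamma> -` V"
    unfolding holomorphic_on_open[OF S]
  proof
    fix s assume "s \<in> \<gamma> -` V"
    then have "cdiff f (v + s *s (w - v))" using assms(3) by (simp add: \<gamma>_def mholomorphic_on_iff_cdiff)
    from has_field_derivative_line[OF this]
    show "\<exists>D. ((\<lambda>s. f (\<gamma> s)) has_field_derivative D) (at s)" unfolding \<gamma>_def by blast
  qed
  have "filterlim \<gamma> (nhds v) (nhds 0)"
  proof -
    have "isCont \<gamma> 0" using cont by (simp add: continuous_on_eq_continuous_at)
    then show ?thesis unfolding continuous_at tendsto_at_iff_tendsto_nhds by (simp add: \<gamma>_def)
  qed
  then have "eventually (\<lambda>s. f (\<gamma> s) = 0) (nhds 0)"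
    using assms(5) by (rule eventually_compose_filterlim[rotated])
  then obtain U where U: "open U" "0 \<in> U" "\<And>s. s \<in> U \<Longrightarrow> f (\<gamma> s) = 0"
    unfolding eventually_nhds by blast
  have "f (\<gamma> 1) = 0"
  proof (rule analytic_continuation[OF hol S conn])
    show "U \<inter> \<gamma> -` V \<subseteq> \<gamma> -` V" by simp
    show "0 islimpt U \<inter> \<gamma> -` V" 
      by (rule interior_limit_point) (use U S assms(4) in \<open>auto simp: interior_open \<gamma>_def\<close>)
  qed (use U assms in \<open>auto simp: \<gamma>_def\<close>)
  then show ?thesis by (simp add: \<gamma>_def)
qed

lemma entire_eq_0:
  fixes f :: "complex^'n::finite \<Rightarrow> complex"
  assumes "entire f" "v \<in> interior {u. f u = 0}"
  shows "f w = 0"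
proof (rule mholomorphic_eq_0[OF open_UNIV convex_UNIV assms(1) UNIV_I _ UNIV_I])
  show "eventually (\<lambda>u. f u = 0) (nhds v)"
    unfolding eventually_nhds
    by (rule exI[of _ "interior {u. f u = 0}"]) (use assms(2) interior_subset in auto)
qed

lemma entire_continuous: "entire f \<Longrightarrow> continuous_on A f"
  by (meson continuous_on_mholomorphic continuous_on_subset top_greatest)

lemma entire_open_nonzero: "entire f \<Longrightarrow> open {u. f u \<noteq> 0}"
  by (intro open_Collect_neq entire_continuous continuous_intros)

lemma entire_dense_nonzero:
  assumes "entire f" "f v \<noteq> 0" "open V" "u \<in> V"
  obtains w where "w \<in> V" "f w \<noteq> 0"
proof -
  have "\<exists>w\<in>V. f w \<noteq> 0"
  proof (rule ccontr)
    assume "\<not> (\<exists>w\<in>V. f w \<noteq> 0)"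
    then have "u \<in> interior {u. f u = 0}"
      using assms(3,4) by (intro interiorI[of V]) auto
    from entire_eq_0[OF assms(1) this, of v] show False using assms(2) by simp
  qed
  then show thesis using that by blast
qed

text \<open>The zero set of a nonzero entire function has empty interior, so identities obtained by
  inverting \<open>f\<close> extend by continuity. In the applications \<open>f\<close> is a
  determinant or a product of coordinates.\<close>

lemma continuous_eq_0_dense:
  fixes g :: "complex^'n::finite \<Rightarrow> complex"
  assumes "entire f" "f v0 \<noteq> 0" "open V" "continuous_on V g" "\<And>u. u \<in> V \<Longrightarrow> f u \<noteq> 0 \<Longrightarrow> g u = 0" "v \<in> V"
  shows "g v = 0"
proof (rule ccontr)
  assume "g v \<noteq> 0"
  have "open {u \<in> V. g u \<noteq> 0}"
  proof -
    have "V \<inter> g -` (- {0}) = {u \<in> V. g u \<noteq> 0}" by auto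
    then show ?thesis using continuous_open_preimage[OF assms(4,3), of "- {0}"] by (simp add: open_Compl)
  qed
  then obtain w where "w \<in> {u \<in> V. g u \<noteq> 0}" "f w \<noteq> 0"
    using entire_dense_nonzero[OF assms(1,2), of "{u \<in> V. g u \<noteq> 0}" v] \<open>g v \<noteq> 0\<close> assms(6) by blast
  then show False using assms(5) by blast
qed

lemma matrix_inv_det:
  fixes A :: "'a::field^'n::finite^'n"
  assumes "det A \<noteq> 0"
  shows "A ** matrix_inv A = mat 1" "matrix_inv A ** A = mat 1"
proof -
  have "\<exists>A'. A ** A' = mat 1 \<and> A' ** A = mat 1" using assms by (simp add: invertible_det_nz[symmetric] invertible_def)
  then have "A ** matrix_inv A = mat 1 \<and> matrix_inv A ** A = mat 1"
    unfolding matrix_inv_def by (rule someI_ex)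
  then show "A ** matrix_inv A = mat 1" "matrix_inv A ** A = mat 1" by auto
qed

lemma image_interior_jacobian:
  fixes F :: "complex^'n::finite \<Rightarrow> complex^'n"
  assumes "open S" "\<And>k. mholomorphic_on S (\<lambda>x. F x $ k)" "x \<in> S" "det (jacobian F x) \<noteq> 0"
  shows "F x \<in> interior (F ` S)"
proof (rule sussmann_open_mapping[OF assms(1) _ assms(3)])
  have d: "(F has_derivative (\<lambda>u. jacobian F y *v u)) (at y)" if "y \<in> S" for y
    using has_derivative_jacobian assms(2) that mholomorphic_on_cdiff by blast
  show "continuous_on S F"
    by (rule continuous_at_imp_continuous_on) (use d has_derivative_continuous in blast)
  show "(F has_derivative (\<lambda>u. jacobian F x *v u)) (at x)" using d assms(3) .
  show "(\<lambda>u. jacobian F x *v u) \<circ> (\<lambda>u. matrix_inv (jacobian F x) *v u) = id"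
    by (auto simp: o_def matrix_vector_mul_assoc matrix_inv_det[OF assms(4)])
  show "bounded_linear (\<lambda>u. matrix_inv (jacobian F x) *v u)"
  proof (rule linear_conv_bounded_linear[THEN iffD1], rule linearI)
    fix a b and r :: real
    show "matrix_inv (jacobian F x) *v (a + b) = matrix_inv (jacobian F x) *v a + matrix_inv (jacobian F x) *v b"
      by (rule matrix_vector_right_distrib)
    show "matrix_inv (jacobian F x) *v (r *\<^sub>R a) = r *\<^sub>R (matrix_inv (jacobian F x) *v a)"
      by (simp add: vec_eq_iff matrix_vector_mult_def scaleR_sum_right)
  qed
qed (use assms(1,3) in \<open>auto simp: interior_open\<close>)

text \<open>The principle by which identities for the metrics are transported from the flat
  coordinates. \<open>F\<close> may be ramified; by the open mapping theorem the image of its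
  regular points has interior, and the identity theorem does the rest.\<close>

lemma entire_eq_0_image:
  fixes F :: "complex^'n::finite \<Rightarrow> complex^'n"
  assumes f: "entire f" and F: "\<And>k. entire (\<lambda>x. F x $ k)" and x0: "det (jacobian F x0) \<noteq> 0"
    and eq: "\<And>x. det (jacobian F x) \<noteq> 0 \<Longrightarrow> f (F x) = 0"
  shows "f w = 0"
proof -
  have "entire (\<lambda>x. det (jacobian F x))"
    by (intro entireI cdiff_det) (simp add: jacobian_def entire_cdiff mholomorphic_on_pd F)
  then have op: "open {x. det (jacobian F x) \<noteq> 0}" (is "open ?S") by (rule entire_open_nonzero)
  have "F x0 \<in> interior (F ` ?S)"
    by (rule image_interior_jacobian[OF op]) (use x0 F in \<open>auto simp: mholomorphic_on_iff_cdiff\<close>)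
  moreover have "F ` ?S \<subseteq> {u. f u = 0}" using eq by auto
  ultimately have "F x0 \<in> interior {u. f u = 0}" by (meson interior_mono subsetD)
  then show ?thesis by (rule entire_eq_0[OF f])
qed

lemma norm_contract_le: "norm (contract u \<xi>) \<le> norm u * (\<Sum>i\<in>UNIV. norm (\<xi> $ i))"
proof -
  have "norm (contract u \<xi>) \<le> (\<Sum>i\<in>UNIV. norm (u $ i) * norm (\<xi> $ i))"
    unfolding contract_def by (rule order_trans[OF norm_sum]) (simp add: norm_mult)
  also have "\<dots> \<le> (\<Sum>i\<in>UNIV. norm u * norm (\<xi> $ i))"
    by (intro sum_mono mult_right_mono) (auto simp: component_le_norm_cart Finite_Cartesian_Product.norm_nth_le)
  finally show ?thesis by (simp add: sum_distrib_left)
qed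

text \<open>Uniqueness for the linear system \<open>df = A f\<close>: near a zero \<open>v\<close> of \<open>f\<close> the mean value theorem
  bounds the supremum of \<open>f\<close> on a small ball by half of itself.\<close>

lemma linear_system_zero:
  fixes f :: "'m::finite \<Rightarrow> complex^'n::finite \<Rightarrow> complex"
  assumes V: "open V" "convex V" and f: "\<And>j. mholomorphic_on V (f j)"
    and A: "\<And>i j k. continuous_on V (A i j k)"
    and eq: "\<And>i j u. u \<in> V \<Longrightarrow> pd i (f j) u = (\<Sum>k\<in>UNIV. A i j k u * f k u)"
    and v: "v \<in> V" "\<And>j. f j v = 0" and w: "w \<in> V"
  shows "f j w = 0"
proof -
  define n where "n = real CARD('m)"
  have n: "n > 0" by (simp add: n_def)
  obtain \<rho> where \<rho>: "\<rho> > 0" "cball v \<rho> \<subseteq> V" using open_contains_cball V v by blast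
  define C where "C = (\<lambda>u. \<Sum>i\<in>UNIV. \<Sum>j\<in>UNIV. \<Sum>k\<in>UNIV. norm (A i j k u))"
  have "continuous_on (cball v \<rho>) C"
    unfolding C_def by (intro continuous_intros continuous_on_subset[OF A] \<rho>)
  then have "bounded (C ` cball v \<rho>)" by (intro compact_imp_bounded compact_continuous_image compact_cball)
  then obtain M where M: "M > 0" "\<And>u. u \<in> cball v \<rho> \<Longrightarrow> C u \<le> M"
    unfolding bounded_pos by (metis abs_le_D1 image_eqI real_norm_def)
  \<comment> \<open>With \<open>n\<close> components, each bounded by \<open>r * M\<close> times the
    supremum, this radius makes their total at most half of the supremum.\<close>
  define r where "r = min \<rho> (1 / (2 * n * M))"
  have r: "r > 0" "r \<le> \<rho>" "n * (r * M) \<le> 1 / 2"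
    using \<rho> n M by (auto simp: r_def min_def field_simps)
  have sub: "cball v r \<subseteq> V" using r \<rho> by auto
  define N where "N = (\<lambda>u. \<Sum>j\<in>UNIV. norm (f j u))"
  have contN: "continuous_on (cball v r) N"
    unfolding N_def by (intro continuous_intros continuous_on_subset[OF continuous_on_mholomorphic[OF f]] sub)
  have "\<exists>u0\<in>cball v r. \<forall>u\<in>cball v r. N u \<le> N u0"
    by (rule continuous_attains_sup[OF compact_cball _ contN]) (use r in auto)
  then obtain u0 where u0: "u0 \<in> cball v r" "\<And>u. u \<in> cball v r \<Longrightarrow> N u \<le> N u0" by blast
  define \<mu> where "\<mu> = N u0"
  have \<mu>: "\<mu> \<ge> 0" by (simp add: \<mu>_def N_def sum_nonneg)
  have fk: "norm (f k u) \<le> \<mu>" if "u \<in> cball v r" for k u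
  proof -
    have "norm (f k u) \<le> N u" unfolding N_def by (rule member_le_sum) auto
    then show ?thesis using u0(2)[OF that] by (simp add: \<mu>_def)
  qed
  have "norm (f j u0) \<le> r * M * \<mu>" for j
  proof -
    have "norm (f j u0 - f j v) \<le> M * \<mu> * norm (u0 - v)"
    proof (rule differentiable_bound[OF convex_cball[of v r]])
      fix u assume u: "u \<in> cball v r"
      then have uV: "u \<in> V" using sub by blast
      show "(f j has_derivative (\<lambda>h. contract h (differential (f j) u))) (at u within cball v r)"
        by (rule has_derivative_at_withinI[OF cdiff_has_derivative[OF mholomorphic_on_cdiff[OF f uV]]])
      show "onorm (\<lambda>h. contract h (differential (f j) u)) \<le> M * \<mu>"
      proof (rule onorm_le)
        fix h
        have "(\<Sum>i\<in>UNIV. norm (pd i (f j) u)) \<le> (\<Sum>i\<in>UNIV. \<Sum>k\<in>UNIV. norm (A i j k u) * \<mu>)"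
          unfolding eq[OF uV]
          by (intro sum_mono order_trans[OF norm_sum]) (auto simp: norm_mult intro!: sum_mono mult_left_mono fk u)
        also have "\<dots> = (\<Sum>i\<in>UNIV. \<Sum>k\<in>UNIV. norm (A i j k u)) * \<mu>"
          by (simp add: sum_distrib_right)
        also have "(\<Sum>i\<in>UNIV. \<Sum>k\<in>UNIV. norm (A i j k u)) \<le> C u"
          unfolding C_def 
          by (intro sum_mono member_le_sum[where f = "\<lambda>j. \<Sum>k\<in>UNIV. norm (A _ j k u)"]) (auto intro: sum_nonneg)
        also have "C u \<le> M" using M u r by auto
        finally have "(\<Sum>i\<in>UNIV. norm (differential (f j) u $ i)) \<le> M * \<mu>" using \<mu> by (simp add: mult_right_mono)
        then show "norm (contract h (differential (f j) u)) \<le> M * \<mu> * norm h"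
        proof -
          assume "(\<Sum>i\<in>UNIV. norm (differential (f j) u $ i)) \<le> M * \<mu>"
          from order_trans[OF norm_contract_le mult_left_mono[OF this norm_ge_zero[of h]]]
          show ?thesis by (simp only: mult.commute[of "M * \<mu>"])
        qed
      qed
    qed (use u0 r in auto)
    also have "\<dots> \<le> M * \<mu> * r" using u0 M \<mu> by (intro mult_left_mono) (auto simp: dist_norm norm_minus_commute)
    finally show ?thesis using v(2) by (simp add: mult_ac)
  qed
  then have "\<mu> \<le> (\<Sum>j\<in>(UNIV::'m set). r * M * \<mu>)" unfolding \<mu>_def N_def by (intro sum_mono)
  also have "\<dots> = n * (r * M) * \<mu>" by (simp add: n_def)
  also have "\<dots> \<le> 1 / 2 * \<mu>" using r(3) \<mu> by (rule mult_right_mono)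
  finally have "\<mu> = 0" using \<mu> by simp
  then have "f j u = 0" if "u \<in> cball v r" for u using fk[OF that, of j] by simp
  then have "eventually (\<lambda>u. f j u = 0) (nhds v)"
    unfolding eventually_nhds using r by (intro exI[of _ "ball v r"]) auto
  then show ?thesis using mholomorphic_eq_0[OF V f v(1) _ w] by blast
qed

lemma mholomorphic_const_on_convex:
  fixes f :: "complex^'n::finite \<Rightarrow> complex"
  assumes "open V" "convex V" "mholomorphic_on V f" "\<And>i u. u \<in> V \<Longrightarrow> pd i f u = 0" "v \<in> V" "w \<in> V"
  shows "f w = f v"
proof -
  have "(f has_derivative (\<lambda>h. 0)) (at u within V)" if "u \<in> V" for u
  proof -
    have "differential f u = 0" using assms(4)[OF that] by (simp add: vec_eq_iff)
    then show ?thesis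
      using cdiff_has_derivative[OF mholomorphic_on_cdiff[OF assms(3) that]]
      by (simp add: contract_def has_derivative_at_withinI)
  qed
  from has_derivative_zero_unique[OF assms(2) this assms(6,5)] show ?thesis .
qed

section \<open>Inverse matrices\<close>

text \<open>Cramer's rule expresses the entries by determinants, hence polynomially in
  \<open>A\<close>. This gives a substitute for the inverse that stays holomorphic where
  \<open>A\<close> degenerates; \<open>hB\<close> is built from it.\<close>

definition adjugate :: "'a::comm_ring_1^'n::finite^'n \<Rightarrow> 'a^'n^'n" where
  "adjugate A = (\<chi> k l. det (\<chi> i j. if j = k then axis l 1 $ i else A $ i $ j))"

lemma matrix_inv_unique':
  fixes A :: "'a::field^'n::finite^'n"
  assumes "A ** B = mat 1"
  shows "matrix_inv A = B" "det A \<noteq> 0"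
proof -
  have "invertible A" using assms invertible_right_inverse by blast
  then show "det A \<noteq> 0" by (simp add: invertible_det_nz)
  then show "matrix_inv A = B"
    by (metis assms matrix_inv_det(2) matrix_mul_assoc matrix_mul_lid matrix_mul_rid)
qed

lemma matrix_inv_adjugate:
  fixes A :: "'a::field^'n::finite^'n"
  assumes "det A \<noteq> 0"
  shows "matrix_inv A $ k $ l = adjugate A $ k $ l / det A"
proof -
  let ?x = "column l (matrix_inv A)"
  have "A *v ?x = axis l 1"
  proof -
    have "A *v ?x = column l (A ** matrix_inv A)"
      by (simp add: vec_eq_iff column_def matrix_vector_mult_def matrix_matrix_mult_def)
    then show ?thesis by (simp add: matrix_inv_det[OF assms] column_def mat_def axis_def vec_eq_iff)
  qed
  then have "?x = (\<chi> k. det (\<chi> i j. if j = k then axis l 1 $ i else A $ i $ j) / det A)"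
    using cramer[OF assms] by blast
  then have "?x $ k = det (\<chi> i j. if j = k then axis l 1 $ i else A $ i $ j) / det A" by simp
  then show ?thesis by (simp add: adjugate_def column_def)
qed

lemma cdiff_adjugate:
  fixes A :: "complex^'n::finite \<Rightarrow> complex^'m::finite^'m"
  assumes "\<And>i j. cdiff (\<lambda>v. A v $ i $ j) v"
  shows "cdiff (\<lambda>v. adjugate (A v) $ i $ j) v"
  unfolding adjugate_def vec_lambda_beta
proof (rule cdiff_det)
  fix k l
  show "cdiff (\<lambda>v. (\<chi> a b. if b = i then axis j 1 $ a else A v $ a $ b) $ k $ l) v"
    by (cases "l = i") (auto intro: assms cdiff_const)
qed

lemma eventually_det_nonzero:
  fixes A :: "complex^'n::finite \<Rightarrow> complex^'m::finite^'m"
  assumes "\<And>i j. cdiff (\<lambda>v. A v $ i $ j) v" "det (A v) \<noteq> 0"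
  shows "eventually (\<lambda>v. det (A v) \<noteq> 0) (nhds v)"
proof -
  have "isCont (\<lambda>v. det (A v)) v" 
    using cdiff_has_derivative[OF cdiff_det] has_derivative_continuous assms(1) by blast
  then show ?thesis using assms(2) by (simp add: isCont_def tendsto_imp_eventually_ne eventually_nhds_conv_at)
qed

lemma cdiff_matrix_inv:
  fixes A :: "complex^'n::finite \<Rightarrow> complex^'m::finite^'m"
  assumes "\<And>i j. cdiff (\<lambda>v. A v $ i $ j) v" "det (A v) \<noteq> 0"
  shows "cdiff (\<lambda>v. matrix_inv (A v) $ i $ j) v"
proof -
  have "cdiff (\<lambda>v. adjugate (A v) $ i $ j / det (A v)) v"
    by (intro cdiff_divide cdiff_adjugate cdiff_det assms)
  moreover have "eventually (\<lambda>u. adjugate (A u) $ i $ j / det (A u) = matrix_inv (A u) $ i $ j) (nhds v)"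
    using eventually_det_nonzero[OF assms] by eventually_elim (simp add: matrix_inv_adjugate)
  ultimately show ?thesis by (simp add: eventually_cong_pd(2))
qed

lemma transpose_matrix_inv:
  fixes A :: "'a::field^'n::finite^'n"
  assumes "det A \<noteq> 0"
  shows "transpose (matrix_inv A) = matrix_inv (transpose A)"
  by (rule matrix_inv_unique'(1)[symmetric])
    (metis assms matrix_inv_det(2) matrix_transpose_mul transpose_mat)

section \<open>Contravariant Levi-Civita connections\<close>

lemma dird_const: "dird X (\<lambda>_. c) v = 0"
  by (simp add: dird_expand pd_const)

lemma dird_add: "cdiff f v \<Longrightarrow> cdiff g v \<Longrightarrow> dird X (\<lambda>v. f v + g v) v = dird X f v + dird X g v"
  by (simp add: dird_expand pd_add algebra_simps sum.distrib)

lemma dird_mult: "cdiff f v \<Longrightarrow> cdiff g v \<Longrightarrow> dird X (\<lambda>v. f v * g v) v = dird X f v * g v + f v * dird X g v"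
  by (simp add: dird_expand pd_mult algebra_simps sum.distrib sum_distrib_left)

lemma dird_sum: "(\<And>j. j \<in> A \<Longrightarrow> cdiff (f j) v) \<Longrightarrow> dird X (\<lambda>v. \<Sum>j\<in>A. f j v) v = (\<Sum>j\<in>A. dird X (f j) v)"
  by (simp add: dird_expand pd_sum sum_distrib_left) (rule sum.swap)

lemma symmetric_nth:
  assumes "transpose A = A"
  shows "A $ i $ j = A $ j $ i"
proof -
  have "transpose A $ i $ j = A $ j $ i" by (simp add: transpose_def)
  then show ?thesis using assms by simp
qed

lemma matrix_sub_ldistrib: "A ** (B - C) = A ** B - A ** (C :: complex^'m^'n::finite)"
  by (simp add: matrix_matrix_mult_def vec_eq_iff right_diff_distrib sum_subtractf)

lemma matrix_sub_rdistrib: "(A - B) ** C = A ** C - B ** (C :: complex^'m^'n::finite)"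
  by (simp add: matrix_matrix_mult_def vec_eq_iff left_diff_distrib sum_subtractf)

lemma matrix_add_rdistrib: "(A + B) ** C = A ** C + B ** (C :: complex^'m^'n::finite)"
  by (simp add: matrix_matrix_mult_def vec_eq_iff distrib_right sum.distrib)

lemma sum_matrix_inv_right:
  fixes A :: "complex^'n::finite^'n"
  assumes "det A \<noteq> 0"
  shows "(\<Sum>l\<in>UNIV. A $ i $ l * matrix_inv A $ l $ k) = (if i = k then 1 else 0)"
    and "(\<Sum>l\<in>UNIV. matrix_inv A $ i $ l * A $ l $ k) = (if i = k then 1 else 0)"
  using matrix_inv_det[OF assms] by (auto simp: matrix_matrix_mult_def vec_eq_iff mat_def)

text \<open>Differentiating the product of \<open>G\<close> with its inverse expresses the
  derivatives of the inverse by \<open>\<Gamma>\<close>; substituted in the Koszul formula, all but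
  one term cancel. The derivations \<open>D i\<close> are tied to vectors at \<open>v\<close> only,
  so the lemma covers both the standard and the flat coordinates.\<close>

lemma contra_christoffel_unique:
  fixes G :: "complex^'n::finite \<Rightarrow> complex^'n^'n"
  assumes D: "\<And>i f. D i f v = dird (Y i) f v"
    and G: "\<And>i j. cdiff (\<lambda>v. G v $ i $ j) v" "det (G v) \<noteq> 0"
    and sym: "transpose (G v) = G v"
    and a: "\<And>i j k. (\<Sum>s\<in>UNIV. G v $ i $ s * \<Gamma> j k s) = (\<Sum>s\<in>UNIV. G v $ j $ s * \<Gamma> i k s)"
    and b: "\<And>i j k. D k (\<lambda>v. G v $ i $ j) v = \<Gamma> i j k + \<Gamma> j i k"
  shows "contra_christoffel D G i j k v = \<Gamma> i j k"
proof -
  let ?h = "\<lambda>v. matrix_inv (G v)"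
  have symG: "G v $ i $ j = G v $ j $ i" for i j
    by (rule symmetric_nth[OF sym])
  have h: "cdiff (\<lambda>v. ?h v $ i $ j) v" for i j using cdiff_matrix_inv[OF G] .
  have symh: "?h v $ i $ j = ?h v $ j $ i" for i j
    by (rule symmetric_nth) (use transpose_matrix_inv[OF G(2)] sym in simp)
  have hh: "matrix_inv (?h v) = G v" using matrix_inv_unique'(1) matrix_inv_det(2)[OF G(2)] by blast
  have Dh: "(\<Sum>l\<in>UNIV. G v $ j $ l * D r (\<lambda>v. ?h v $ l $ k) v) = - (\<Sum>m\<in>UNIV. (\<Gamma> j m r + \<Gamma> m j r) * ?h v $ m $ k)" for j r k
  proof -
    have "eventually (\<lambda>u. (\<Sum>l\<in>UNIV. G u $ j $ l * ?h u $ l $ k) = (if j = k then 1 else 0)) (nhds v)"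
      using eventually_det_nonzero[OF G] by eventually_elim (rule sum_matrix_inv_right(1))
    then have "dird (Y r) (\<lambda>u. \<Sum>l\<in>UNIV. G u $ j $ l * ?h u $ l $ k) v = dird (Y r) (\<lambda>u. if j = k then 1 else 0) v"
      by (rule eventually_cong_pd(4))
    then have "(\<Sum>l\<in>UNIV. D r (\<lambda>u. G u $ j $ l) v * ?h v $ l $ k + G v $ j $ l * D r (\<lambda>u. ?h u $ l $ k) v) = 0"
      by (simp add: dird_sum dird_mult cdiff_intros G h D dird_const)
    then show ?thesis by (simp add: b sum.distrib eq_neg_iff_add_eq_0 add.commute)
  qed
  \<comment> \<open>\<open>\<Gamma>\<close> with its lower index raised. Torsion-freeness is the
    symmetry of \<open>A\<close> in the first two arguments, and this symmetry makes the surplus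
    terms of the Koszul formula cancel.\<close>
  define A where "A = (\<lambda>i j m. \<Sum>r\<in>UNIV. G v $ i $ r * \<Gamma> j m r)"
  have Asym: "A i j m = A j i m" for i j m unfolding A_def by (rule a)
  have hA: "(\<Sum>m\<in>UNIV. ?h v $ m $ k * A m i j) = \<Gamma> i j k" for i j
  proof -
    have "(\<Sum>m\<in>UNIV. ?h v $ m $ k * A m i j) = (\<Sum>r\<in>UNIV. (\<Sum>m\<in>UNIV. ?h v $ k $ m * G v $ m $ r) * \<Gamma> i j r)"
      unfolding A_def sum_distrib_left sum_distrib_right by (subst sum.swap) (simp add: symh[of _ k] mult_ac)
    then show ?thesis by (simp add: sum_matrix_inv_right(2)[OF G(2)] if_distrib[of "\<lambda>x. x * _"] cong: if_cong)
  qed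
  have T1: "(\<Sum>r\<in>UNIV. G v $ i $ r * (\<Sum>l\<in>UNIV. G v $ j $ l * D r (\<lambda>u. ?h u $ l $ k) v))
      = - (\<Sum>m\<in>UNIV. ?h v $ m $ k * (A i j m + A i m j))" for i j
    unfolding Dh A_def
    by (simp add: sum_distrib_left sum_distrib_right sum_negf flip: sum.distrib)
      (subst sum.swap, simp add: algebra_simps)
  have T2: "(\<Sum>r\<in>UNIV. G v $ i $ r * (\<Sum>l\<in>UNIV. G v $ j $ l * D k (\<lambda>u. ?h u $ r $ l) v)) = - (\<Gamma> i j k + \<Gamma> j i k)"
  proof -
    have "(\<Sum>l\<in>UNIV. \<Sum>r\<in>UNIV. G v $ j $ l * (G v $ i $ r * D k (\<lambda>u. ?h u $ r $ l) v))
        = (\<Sum>l\<in>UNIV. G v $ j $ l * - (\<Sum>m\<in>UNIV. (\<Gamma> i m k + \<Gamma> m i k) * ?h v $ m $ l))"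
      by (simp only: sum_distrib_left[symmetric] Dh)
    also have "\<dots> = - (\<Sum>m\<in>UNIV. (\<Gamma> i m k + \<Gamma> m i k) * (\<Sum>l\<in>UNIV. ?h v $ m $ l * G v $ l $ j))"
      by (simp add: sum_distrib_left sum_negf) (subst sum.swap, simp add: mult_ac symG[of _ j])
    also have "\<dots> = - (\<Gamma> i j k + \<Gamma> j i k)"
      by (simp add: sum_matrix_inv_right(2)[OF G(2)] if_distrib[of "\<lambda>x. _ * x"] cong: if_cong)
    finally show ?thesis
      by (simp add: sum_distrib_left) (subst sum.swap, simp add: mult_ac)
  qed
  have T3: "(\<Sum>r\<in>UNIV. G v $ i $ r * (\<Sum>l\<in>UNIV. G v $ j $ l * D l (\<lambda>u. ?h u $ r $ k) v))
      = - (\<Sum>m\<in>UNIV. ?h v $ m $ k * (A j i m + A j m i))"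
    using T1[of j i] by (simp add: sum_distrib_left) (subst sum.swap, simp add: mult_ac)
  have "contra_christoffel D G i j k v = - (1/2) * (
      (\<Sum>r\<in>UNIV. G v $ i $ r * (\<Sum>l\<in>UNIV. G v $ j $ l * D r (\<lambda>u. ?h u $ l $ k) v))
    + (\<Sum>r\<in>UNIV. G v $ i $ r * (\<Sum>l\<in>UNIV. G v $ j $ l * D k (\<lambda>u. ?h u $ r $ l) v))
    - (\<Sum>r\<in>UNIV. G v $ i $ r * (\<Sum>l\<in>UNIV. G v $ j $ l * D l (\<lambda>u. ?h u $ r $ k) v)))"
    unfolding contra_christoffel_def christoffel_def hh
    by (simp add: sum_distrib_left algebra_simps sum.distrib sum_subtractf sum_negf)
  also have "\<dots> = \<Gamma> i j k"
    unfolding T1 T2 T3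
    by (simp add: Asym[of i j] distrib_left sum.distrib Asym[of i _ j] Asym[of j _ i] hA)
  finally show ?thesis .
qed

lemma contra_christoffel_pd_unique:
  fixes G :: "complex^'n::finite \<Rightarrow> complex^'n^'n"
  assumes "\<And>i j. cdiff (\<lambda>v. G v $ i $ j) v" "det (G v) \<noteq> 0" "transpose (G v) = G v"
    and "\<And>i j k. (\<Sum>s\<in>UNIV. G v $ i $ s * \<Gamma> j k s) = (\<Sum>s\<in>UNIV. G v $ j $ s * \<Gamma> i k s)"
    and "\<And>i j k. pd k (\<lambda>v. G v $ i $ j) v = \<Gamma> i j k + \<Gamma> j i k"
  shows "contra_christoffel pd G i j k v = \<Gamma> i j k"
  by (rule contra_christoffel_unique[where Y = "\<lambda>i. axis i 1"]) (use assms in auto)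

section \<open>Flat contravariant metrics and the pullback of a constant metric\<close>

definition Gam :: "('n \<Rightarrow> 'n \<Rightarrow> 'n \<Rightarrow> complex^'n::finite \<Rightarrow> complex) \<Rightarrow> complex^'n \<Rightarrow> complex^'n \<Rightarrow> complex^'n^'n" where
  "Gam \<Gamma> v w = (\<chi> i k. \<Sum>j\<in>UNIV. \<Gamma> i j k v * w $ j)"

definition curl :: "(complex^'n::finite \<Rightarrow> complex^'n) \<Rightarrow> complex^'n \<Rightarrow> complex^'n^'n" where
  "curl \<omega> v = (\<chi> m l. pd m (\<lambda>u. \<omega> u $ l) v - pd l (\<lambda>u. \<omega> u $ m) v)"

text \<open>The axioms invert nothing, so they make sense also where \<open>G\<close> degenerates.
  \<open>flat\<close> is the vanishing of the curvature with one index raised, tested on constant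
  one-forms \<open>u\<close> and \<open>w\<close>.\<close>

locale flat_pair =
  fixes G :: "complex^'n::finite \<Rightarrow> complex^'n^'n"
    and \<Gamma> :: "'n \<Rightarrow> 'n \<Rightarrow> 'n \<Rightarrow> complex^'n \<Rightarrow> complex"
  assumes entire_G: "entire (\<lambda>v. G v $ i $ j)" and entire_\<Gamma>: "entire (\<Gamma> i j k)"
    and G_sym: "transpose (G v) = G v"
    and torsion_free: "G v ** transpose (Gam \<Gamma> v w) = Gam \<Gamma> v w ** G v"
    and metric: "pd k (\<lambda>v. G v $ i $ j) v = \<Gamma> i j k v + \<Gamma> j i k v"
    and flat: "G v ** curl (\<lambda>v. u v* Gam \<Gamma> v w) v = Gam \<Gamma> v u ** Gam \<Gamma> v w - Gam \<Gamma> v w ** Gam \<Gamma> v u"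

text \<open>The coordinates \<open>x\<close> are flat: along \<open>F\<close>, the metric
  \<open>G\<close> is the image of the constant metric \<open>a\<close>. The point \<open>x0\<close>
  guarantees regular points, from which identities can spread.\<close>

locale pullback =
  fixes F :: "complex^'n::finite \<Rightarrow> complex^'n" and a :: "complex^'n^'n"
    and G :: "complex^'n \<Rightarrow> complex^'n^'n"
    and \<Gamma> :: "'n \<Rightarrow> 'n \<Rightarrow> 'n \<Rightarrow> complex^'n \<Rightarrow> complex" and x0 :: "complex^'n"
  assumes entire_F: "entire (\<lambda>x. F x $ k)" and a_sym: "transpose a = a" and det_a: "det a \<noteq> 0"
    and entire_G: "entire (\<lambda>v. G v $ i $ j)"
    and G_F: "G (F x) = jacobian F x ** a ** transpose (jacobian F x)"
    and entire_\<Gamma>: "entire (\<Gamma> i j k)"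
    and \<Gamma>: "det (G v) \<noteq> 0 \<Longrightarrow> contra_christoffel pd G i j k v = \<Gamma> i j k v"
    and x0: "det (jacobian F x0) \<noteq> 0"
begin

abbreviation "Z \<equiv> jacobian F"

definition hess :: "complex^'n \<Rightarrow> complex^'n \<Rightarrow> complex^'n^'n" where
  "hess w x = (\<chi> q s. \<Sum>j\<in>UNIV. w $ j * pd s (pd q (\<lambda>x. F x $ j)) x)"

lemma entire_pd_F: "entire (pd q (\<lambda>x. F x $ j))" 
  by (rule mholomorphic_on_pd[OF open_UNIV entire_F])
lemma entire_pd2_F: "entire (pd s (pd q (\<lambda>x. F x $ j)))" 
  by (rule mholomorphic_on_pd[OF open_UNIV entire_pd_F])

lemmas cd = entire_cdiff[OF entire_F] entire_cdiff[OF entire_pd_F] entire_cdiff[OF entire_pd2_F]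
  entire_cdiff[OF entire_G] entire_cdiff[OF entire_\<Gamma>]

lemma Z_nth: "Z x $ i $ r = pd r (\<lambda>x. F x $ i) x"
  by (simp add: jacobian_def)

lemma a_nth_sym: "a $ r $ q = a $ q $ r"
  by (rule symmetric_nth[OF a_sym])

lemma hess_sym: "transpose (hess w x) = hess w x"
  by (simp add: hess_def transpose_def pd_commute[OF open_UNIV entire_F])

lemma G_F_sym: "transpose (G (F x)) = G (F x)"
  by (simp add: G_F matrix_transpose_mul a_sym matrix_mul_assoc)

lemma det_G_F: "det (Z x) \<noteq> 0 \<Longrightarrow> det (G (F x)) \<noteq> 0"
  by (simp add: G_F det_mul det_a)

lemma G_nth: "G (F x) $ i $ j = (\<Sum>r\<in>UNIV. \<Sum>q\<in>UNIV. Z x $ i $ r * a $ r $ q * Z x $ j $ q)"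
  by (simp add: G_F matrix_matrix_mult_def transpose_def sum_distrib_right) (rule sum.swap)

lemma pd_G_F: "(\<Sum>k\<in>UNIV. pd k (\<lambda>v. G v $ i $ j) (F x) * Z x $ k $ s) =
   (Z x ** a ** hess (axis j 1) x) $ i $ s + (Z x ** a ** hess (axis i 1) x) $ j $ s"
proof -
  have "(\<Sum>k\<in>UNIV. pd k (\<lambda>v. G v $ i $ j) (F x) * Z x $ k $ s) = pd s (\<lambda>x. G (F x) $ i $ j) x"
    by (subst pd_chain(2)) (auto simp: cd Z_nth)
  also have "\<dots> = (\<Sum>r\<in>UNIV. \<Sum>q\<in>UNIV. pd s (pd r (\<lambda>x. F x $ i)) x * a $ r $ q * Z x $ j $ q
       + Z x $ i $ r * a $ r $ q * pd s (pd q (\<lambda>x. F x $ j)) x)"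
    unfolding G_nth by (simp add: pd_sum pd_mult cdiff_intros cd Z_nth pd_const)
  also have "\<dots> = (\<Sum>r\<in>UNIV. \<Sum>q\<in>UNIV. pd s (pd r (\<lambda>x. F x $ i)) x * a $ r $ q * Z x $ j $ q)
       + (\<Sum>r\<in>UNIV. \<Sum>q\<in>UNIV. Z x $ i $ r * a $ r $ q * pd s (pd q (\<lambda>x. F x $ j)) x)"
    by (simp add: sum.distrib)
  also have "(\<Sum>r\<in>UNIV. \<Sum>q\<in>UNIV. Z x $ i $ r * a $ r $ q * pd s (pd q (\<lambda>x. F x $ j)) x)
      = (Z x ** a ** hess (axis j 1) x) $ i $ s"
    by (simp add: matrix_matrix_mult_def hess_def axis_def sum_distrib_right if_distrib[of "\<lambda>x. x * _"] cong: if_cong)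
      (rule sum.swap)
  also have "(\<Sum>r\<in>UNIV. \<Sum>q\<in>UNIV. pd s (pd r (\<lambda>x. F x $ i)) x * a $ r $ q * Z x $ j $ q)
      = (Z x ** a ** hess (axis i 1) x) $ j $ s"
    by (simp add: matrix_matrix_mult_def hess_def axis_def sum_distrib_right if_distrib[of "\<lambda>x. x * _"] cong: if_cong)
      (simp add: mult_ac a_nth_sym)
  finally show ?thesis by simp
qed

lemma hess_expand: "hess w x = (\<chi> q s. \<Sum>j\<in>UNIV. w $ j * hess (axis j 1) x $ q $ s)"
  by (simp add: hess_def axis_def if_distrib[of "\<lambda>x. x * _"] cong: if_cong)

text \<open>In the coordinates \<open>x\<close> the connection has no symbols, so the transformation
  law leaves only second derivatives of \<open>F\<close>. The resulting candidate \<open>P\<close>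
  is checked against the two properties that characterize the symbols.\<close>

lemma Gam_F:
  assumes "det (Z x) \<noteq> 0"
  shows "Gam \<Gamma> (F x) w ** Z x = Z x ** a ** hess w x"
proof -
  let ?Zi = "matrix_inv (Z x)"
  define P where "P = (\<lambda>j. Z x ** a ** hess (axis j 1) x ** ?Zi)"
  have "contra_christoffel pd G i j k (F x) = P j $ i $ k" for i j k
  proof (rule contra_christoffel_pd_unique[OF cd(4) det_G_F[OF assms] G_F_sym])
    fix i j k
    have "G (F x) ** transpose (P k) = Z x ** a ** transpose (Z x) ** transpose ?Zi ** hess (axis k 1) x ** a ** transpose (Z x)"
      by (simp add: P_def matrix_transpose_mul G_F hess_sym a_sym matrix_mul_assoc)
    also have "transpose (Z x) ** transpose ?Zi = mat 1"
      by (metis assms matrix_inv_det(2) matrix_transpose_mul transpose_mat)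
    then have "Z x ** a ** transpose (Z x) ** transpose ?Zi = Z x ** a"
      by (metis matrix_mul_assoc matrix_mul_rid)
    also have "Z x ** a ** hess (axis k 1) x ** a ** transpose (Z x) = P k ** G (F x)"
    proof -
      have "P k ** G (F x) = Z x ** a ** hess (axis k 1) x ** (?Zi ** Z x) ** a ** transpose (Z x)"
        by (simp add: P_def G_F matrix_mul_assoc)
      then show ?thesis by (simp add: matrix_inv_det[OF assms])
    qed
    finally have eq: "G (F x) ** transpose (P k) = P k ** G (F x)" .
    have "(\<Sum>s\<in>UNIV. G (F x) $ i $ s * P k $ j $ s) = (G (F x) ** transpose (P k)) $ i $ j"
      by (simp add: matrix_matrix_mult_def transpose_def)
    also have "\<dots> = (P k ** G (F x)) $ i $ j" by (simp only: eq)
    also have "\<dots> = (\<Sum>s\<in>UNIV. P k $ i $ s * G (F x) $ s $ j)"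
      by (simp add: matrix_matrix_mult_def)
    also have "\<dots> = (\<Sum>s\<in>UNIV. G (F x) $ j $ s * P k $ i $ s)"
      by (simp add: symmetric_nth[OF G_F_sym, of x _ j] mult.commute)
    finally show "(\<Sum>s\<in>UNIV. G (F x) $ i $ s * P k $ j $ s) = (\<Sum>s\<in>UNIV. G (F x) $ j $ s * P k $ i $ s)" .
    have "pd k (\<lambda>v. G v $ i $ j) (F x) = (\<Sum>m\<in>UNIV. pd m (\<lambda>v. G v $ i $ j) (F x) * (\<Sum>s\<in>UNIV. Z x $ m $ s * ?Zi $ s $ k))"
      by (simp add: sum_matrix_inv_right[OF assms] if_distrib[of "\<lambda>x. _ * x"] cong: if_cong)
    also have "\<dots> = (\<Sum>s\<in>UNIV. (\<Sum>m\<in>UNIV. pd m (\<lambda>v. G v $ i $ j) (F x) * Z x $ m $ s) * ?Zi $ s $ k)"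
      by (simp add: sum_distrib_left sum_distrib_right mult_ac) (rule sum.swap)
    also have "\<dots> = P j $ i $ k + P i $ j $ k"
      unfolding pd_G_F P_def matrix_matrix_mult_def[of _ ?Zi] by (simp add: distrib_right sum.distrib)
    finally show "pd k (\<lambda>v. G v $ i $ j) (F x) = P j $ i $ k + P i $ j $ k" .
  qed
  then have GP: "\<Gamma> i j k (F x) = P j $ i $ k" for i j k using \<Gamma>[OF det_G_F[OF assms]] by metis
  have "(\<Sum>j\<in>UNIV. P j $ i $ k * w $ j) = (Z x ** a ** hess w x ** ?Zi) $ i $ k" for i k
    unfolding hess_expand[of w] P_def
    by (simp add: matrix_matrix_mult_def sum_distrib_left sum_distrib_right mult_ac)
      (subst sum.swap, rule sum.cong[OF refl], subst sum.swap, rule refl)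
  then have "Gam \<Gamma> (F x) w = Z x ** a ** hess w x ** ?Zi"
    by (simp add: Gam_def GP vec_eq_iff)
  then show ?thesis by (metis assms matrix_inv_det(2) matrix_mul_assoc matrix_mul_rid)
qed

lemma eq_0_F: "entire f \<Longrightarrow> (\<And>x. det (Z x) \<noteq> 0 \<Longrightarrow> f (F x) = 0) \<Longrightarrow> f v = 0"
  using entire_eq_0_image[OF _ entire_F x0] by blast

lemma Z_cancel: "det (Z x) \<noteq> 0 \<Longrightarrow> A ** Z x = B ** Z x \<Longrightarrow> A = B"
  by (metis matrix_inv_det(1) matrix_mul_assoc matrix_mul_rid)

text \<open>The one-form \<open>u v* Gam \<Gamma> v w\<close> pulls back to first derivatives of the
  combination of \<open>F\<close> by \<open>u\<close> times second derivatives of the combination by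
  \<open>w\<close>. In the exterior derivative the third derivatives cancel by symmetry and the
  commutator of the two Hessians survives.\<close>

lemma curl_F:
  assumes "det (Z x) \<noteq> 0"
  shows "transpose (Z x) ** curl (\<lambda>v. u v* Gam \<Gamma> v w) (F x) ** Z x = hess u x ** a ** hess w x - hess w x ** a ** hess u x"
proof -
  define \<omega> where "\<omega> = (\<lambda>l v. (u v* Gam \<Gamma> v w) $ l)"
  have \<omega>: "entire (\<omega> l)" for l
    by (rule entireI) (simp add: \<omega>_def vector_matrix_mult_def Gam_def cdiff_intros cd)
  note cd\<omega> = entire_cdiff[OF \<omega>]
  define M where "M = (\<lambda>t s. \<Sum>r\<in>UNIV. \<Sum>q\<in>UNIV. (\<Sum>i\<in>UNIV. u $ i * pd t (pd r (\<lambda>x. F x $ i)) x) * a $ r $ q * (\<Sum>j\<in>UNIV. w $ j * pd s (pd q (\<lambda>x. F x $ j)) x))"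
  \<comment> \<open>The part symmetric in \<open>s\<close> and \<open>t\<close>: third derivatives
    of \<open>F\<close>, and the correction from differentiating the Jacobian in the
    pullback.\<close>
  define N where "N = (\<lambda>t s. (\<Sum>r\<in>UNIV. \<Sum>q\<in>UNIV. (\<Sum>i\<in>UNIV. u $ i * Z x $ i $ r) * a $ r $ q * (\<Sum>j\<in>UNIV. w $ j * pd t (pd s (pd q (\<lambda>x. F x $ j))) x))
      - (\<Sum>l\<in>UNIV. \<omega> l (F x) * pd t (pd s (\<lambda>x. F x $ l)) x))"
  have N: "N t s = N s t" for s t
    unfolding N_def pd_commute[OF open_UNIV entire_F UNIV_I, of t s] pd_commute[OF open_UNIV entire_pd_F UNIV_I, of t s] ..
  have 1: "(\<Sum>l\<in>UNIV. \<omega> l (F y) * Z y $ l $ s) = (\<Sum>r\<in>UNIV. \<Sum>q\<in>UNIV. (\<Sum>i\<in>UNIV. u $ i * Z y $ i $ r) * a $ r $ q * (\<Sum>j\<in>UNIV. w $ j * pd s (pd q (\<lambda>x. F x $ j)) y))" 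
    if "det (Z y) \<noteq> 0" for s y
  proof -
    have "(\<Sum>l\<in>UNIV. \<omega> l (F y) * Z y $ l $ s) = (u v* (Gam \<Gamma> (F y) w ** Z y)) $ s"
      unfolding \<omega>_def by (subst vector_matrix_mul_assoc[symmetric]) (simp add: vector_matrix_mult_def mult.commute)
    also have "\<dots> = (u v* Z y v* a v* hess w y) $ s"
      unfolding Gam_F[OF that] by (simp add: vector_matrix_mul_assoc)
    finally show ?thesis
      by (simp add: vector_matrix_mult_def hess_def sum_distrib_right sum_distrib_left mult_ac)
        (subst sum.swap, rule refl)
  qed
  have deriv: "(\<Sum>l\<in>UNIV. \<Sum>m\<in>UNIV. pd m (\<omega> l) (F x) * Z x $ m $ t * Z x $ l $ s) = M t s + N t s" for t s
  proof -
    have "open {y. det (Z y) \<noteq> 0}"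
      by (intro entire_open_nonzero entireI cdiff_det) (simp add: Z_nth cd)
    then have "pd t (\<lambda>y. \<Sum>l\<in>UNIV. \<omega> l (F y) * Z y $ l $ s) x = pd t (\<lambda>y. \<Sum>r\<in>UNIV. \<Sum>q\<in>UNIV. (\<Sum>i\<in>UNIV. u $ i * Z y $ i $ r) * a $ r $ q * (\<Sum>j\<in>UNIV. w $ j * pd s (pd q (\<lambda>x. F x $ j)) y)) x"
      by (rule open_cong_pd(1)) (use assms 1 in auto)
    moreover have "pd t (\<lambda>y. \<Sum>l\<in>UNIV. \<omega> l (F y) * Z y $ l $ s) x = (\<Sum>l\<in>UNIV. (\<Sum>m\<in>UNIV. pd m (\<omega> l) (F x) * Z x $ m $ t) * Z x $ l $ s + \<omega> l (F x) * pd t (pd s (\<lambda>x. F x $ l)) x)"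
      by (simp add: Z_nth pd_sum pd_mult cdiff_intros cd pd_chain[OF cd\<omega> cd(1)])
    moreover have "pd t (\<lambda>y. \<Sum>r\<in>UNIV. \<Sum>q\<in>UNIV. (\<Sum>i\<in>UNIV. u $ i * Z y $ i $ r) * a $ r $ q * (\<Sum>j\<in>UNIV. w $ j * pd s (pd q (\<lambda>x. F x $ j)) y)) x
       = M t s + (\<Sum>r\<in>UNIV. \<Sum>q\<in>UNIV. (\<Sum>i\<in>UNIV. u $ i * Z x $ i $ r) * a $ r $ q * (\<Sum>j\<in>UNIV. w $ j * pd t (pd s (pd q (\<lambda>x. F x $ j))) x))"
      by (simp add: Z_nth pd_sum pd_mult cdiff_intros cd M_def pd_const sum.distrib)
    ultimately have "(\<Sum>l\<in>UNIV. (\<Sum>m\<in>UNIV. pd m (\<omega> l) (F x) * Z x $ m $ t) * Z x $ l $ s)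
        + (\<Sum>l\<in>UNIV. \<omega> l (F x) * pd t (pd s (\<lambda>x. F x $ l)) x)
       = M t s + (\<Sum>r\<in>UNIV. \<Sum>q\<in>UNIV. (\<Sum>i\<in>UNIV. u $ i * Z x $ i $ r) * a $ r $ q * (\<Sum>j\<in>UNIV. w $ j * pd t (pd s (pd q (\<lambda>x. F x $ j))) x))"
      by (simp only: sum.distrib)
    then show ?thesis unfolding N_def add_diff_eq eq_diff_eq by (simp only: sum_distrib_right)
  qed
  have M: "M t s = (hess u x ** a ** hess w x) $ t $ s" for t s
    unfolding M_def by (subst hess_sym[symmetric], simp add: matrix_matrix_mult_def hess_def transpose_def sum_distrib_right) (rule sum.swap)
  have M': "M s t = (hess w x ** a ** hess u x) $ t $ s" for t s
  proof -
    have "hess w x ** a ** hess u x = transpose (hess u x ** a ** hess w x)"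
      by (simp add: matrix_transpose_mul hess_sym a_sym matrix_mul_assoc)
    then show ?thesis by (simp add: M transpose_def)
  qed
  have "(transpose (Z x) ** curl (\<lambda>v. u v* Gam \<Gamma> v w) (F x) ** Z x) $ t $ s = M t s - M s t" for t s
  proof -
    have "(transpose (Z x) ** curl (\<lambda>v. u v* Gam \<Gamma> v w) (F x) ** Z x) $ t $ s
      = (\<Sum>l\<in>UNIV. \<Sum>m\<in>UNIV. (pd m (\<omega> l) (F x) - pd l (\<omega> m) (F x)) * Z x $ m $ t * Z x $ l $ s)"
      by (simp add: matrix_matrix_mult_def transpose_def curl_def \<omega>_def sum_distrib_right sum_distrib_left mult_ac)
    also have "\<dots> = (M t s + N t s) - (M s t + N s t)"
      unfolding deriv[symmetric] left_diff_distrib sum_subtractf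
      by (subst (4) sum.swap) (simp add: mult_ac)
    finally show ?thesis by (simp add: N)
  qed
  then show ?thesis by (simp add: vec_eq_iff M M'[unfolded M])
qed

text \<open>Every axiom is an identity between entire functions of \<open>v\<close>. At images of
  regular points it follows from the formulas in \<open>x\<close>, the Jacobian being cancellable
  there.\<close>

sublocale flat_pair G \<Gamma>
proof
  show "entire (\<lambda>v. G v $ i $ j)" for i j by (rule entire_G)
  show "entire (\<Gamma> i j k)" for i j k by (rule entire_\<Gamma>)
  have "G v $ j $ i - G v $ i $ j = 0" for v i j
  proof (rule eq_0_F[where f = "\<lambda>v. G v $ j $ i - G v $ i $ j" and v = v])
    show "entire (\<lambda>v. G v $ j $ i - G v $ i $ j)" by (intro entireI cdiff_intros cd)
    show "G (F x) $ j $ i - G (F x) $ i $ j = 0" for x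
      using symmetric_nth[OF G_F_sym, of x i j] by simp
  qed
  then show "transpose (G v) = G v" for v by (simp add: vec_eq_iff transpose_def)
  have "(G v ** transpose (Gam \<Gamma> v w)) $ i $ j - (Gam \<Gamma> v w ** G v) $ i $ j = 0" for v w i j
  proof (rule eq_0_F[where f = "\<lambda>v. (G v ** transpose (Gam \<Gamma> v w)) $ i $ j - (Gam \<Gamma> v w ** G v) $ i $ j" and v = v])
    show "entire (\<lambda>v. (G v ** transpose (Gam \<Gamma> v w)) $ i $ j - (Gam \<Gamma> v w ** G v) $ i $ j)"
      unfolding matrix_matrix_mult_def transpose_def Gam_def vec_lambda_beta by (intro entireI cdiff_intros cd)
    fix x assume x: "det (Z x) \<noteq> 0"
    have "Gam \<Gamma> (F x) w ** G (F x) = Z x ** a ** hess w x ** a ** transpose (Z x)"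
      by (simp add: G_F matrix_mul_assoc Gam_F[OF x])
    moreover have "G (F x) ** transpose (Gam \<Gamma> (F x) w) = transpose (Gam \<Gamma> (F x) w ** G (F x))"
      by (simp add: matrix_transpose_mul G_F_sym)
    ultimately have "G (F x) ** transpose (Gam \<Gamma> (F x) w) = Gam \<Gamma> (F x) w ** G (F x)"
      by (simp add: matrix_transpose_mul hess_sym a_sym matrix_mul_assoc)
    then show "(G (F x) ** transpose (Gam \<Gamma> (F x) w)) $ i $ j - (Gam \<Gamma> (F x) w ** G (F x)) $ i $ j = 0" by simp
  qed
  then show "G v ** transpose (Gam \<Gamma> v w) = Gam \<Gamma> v w ** G v" for v w by (simp add: vec_eq_iff)
  have "pd k (\<lambda>v. G v $ i $ j) v - (\<Gamma> i j k v + \<Gamma> j i k v) = 0" for k i j v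
  proof (rule eq_0_F[where f = "\<lambda>v. pd k (\<lambda>v. G v $ i $ j) v - (\<Gamma> i j k v + \<Gamma> j i k v)" and v = v])
    show "entire (\<lambda>v. pd k (\<lambda>v. G v $ i $ j) v - (\<Gamma> i j k v + \<Gamma> j i k v))"
      by (intro entireI cdiff_intros cd entire_cdiff[OF mholomorphic_on_pd[OF open_UNIV entire_G]])
    fix x assume x: "det (Z x) \<noteq> 0"
    have G1: "(Gam \<Gamma> v (axis j 1)) $ i $ k = \<Gamma> i j k v" for i j k v
      by (simp add: Gam_def axis_def if_distrib[of "\<lambda>x. _ * x"] cong: if_cong)
    have "(\<chi> i k. pd k (\<lambda>v. G v $ i $ j) (F x)) ** Z x = (\<chi> i k. \<Gamma> i j k (F x) + \<Gamma> j i k (F x)) ** Z x" for j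
    proof -
      have "pd_G i s = (\<Sum>k\<in>UNIV. (\<Gamma> i j k (F x) + \<Gamma> j i k (F x)) * Z x $ k $ s)"
        if "pd_G = (\<lambda>i s. \<Sum>k\<in>UNIV. pd k (\<lambda>v. G v $ i $ j) (F x) * Z x $ k $ s)" for i s pd_G
        unfolding that pd_G_F Gam_F[OF x, symmetric]
        by (simp add: matrix_matrix_mult_def G1 distrib_right sum.distrib)
      then show ?thesis by (simp add: vec_eq_iff matrix_matrix_mult_def)
    qed
    from Z_cancel[OF x this, of j] show "pd k (\<lambda>v. G v $ i $ j) (F x) - (\<Gamma> i j k (F x) + \<Gamma> j i k (F x)) = 0"
      by (simp add: vec_eq_iff)
  qed
  then show "pd k (\<lambda>v. G v $ i $ j) v = \<Gamma> i j k v + \<Gamma> j i k v" for k i j v by simp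
  have "(G v ** curl (\<lambda>v. u v* Gam \<Gamma> v w) v) $ i $ j - (Gam \<Gamma> v u ** Gam \<Gamma> v w - Gam \<Gamma> v w ** Gam \<Gamma> v u) $ i $ j = 0" for v u w i j
  proof (rule eq_0_F[where f = "\<lambda>v. (G v ** curl (\<lambda>v. u v* Gam \<Gamma> v w) v) $ i $ j - (Gam \<Gamma> v u ** Gam \<Gamma> v w - Gam \<Gamma> v w ** Gam \<Gamma> v u) $ i $ j" and v = v])
    have e: "entire (\<lambda>v. \<Sum>i\<in>UNIV. (\<Sum>j\<in>UNIV. \<Gamma> i j k v * w $ j) * u $ i)" for k
      by (intro entireI cdiff_intros cd)
    show "entire (\<lambda>v. (G v ** curl (\<lambda>v. u v* Gam \<Gamma> v w) v) $ i $ j - (Gam \<Gamma> v u ** Gam \<Gamma> v w - Gam \<Gamma> v w ** Gam \<Gamma> v u) $ i $ j)"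
      unfolding matrix_matrix_mult_def curl_def transpose_def Gam_def vec_lambda_beta vector_matrix_mult_def vector_minus_component
      by (intro entireI cdiff_intros cd entire_cdiff[OF mholomorphic_on_pd[OF open_UNIV]])
    fix x assume x: "det (Z x) \<noteq> 0"
    have "(G (F x) ** curl (\<lambda>v. u v* Gam \<Gamma> v w) (F x)) ** Z x = Z x ** a ** (transpose (Z x) ** curl (\<lambda>v. u v* Gam \<Gamma> v w) (F x) ** Z x)"
      by (simp add: G_F matrix_mul_assoc)
    also have "\<dots> = Z x ** a ** hess u x ** a ** hess w x - Z x ** a ** hess w x ** a ** hess u x"
      unfolding curl_F[OF x] by (simp add: matrix_mul_assoc matrix_sub_ldistrib)
    also have "\<dots> = (Gam \<Gamma> (F x) u ** Gam \<Gamma> (F x) w - Gam \<Gamma> (F x) w ** Gam \<Gamma> (F x) u) ** Z x"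
      by (simp add: matrix_sub_rdistrib matrix_mul_assoc[symmetric] Gam_F[OF x])
        (simp add: matrix_mul_assoc Gam_F[OF x])
    finally have "G (F x) ** curl (\<lambda>v. u v* Gam \<Gamma> v w) (F x) = Gam \<Gamma> (F x) u ** Gam \<Gamma> (F x) w - Gam \<Gamma> (F x) w ** Gam \<Gamma> (F x) u"
      by (rule Z_cancel[OF x])
    then show "(G (F x) ** curl (\<lambda>v. u v* Gam \<Gamma> v w) (F x)) $ i $ j - (Gam \<Gamma> (F x) u ** Gam \<Gamma> (F x) w - Gam \<Gamma> (F x) w ** Gam \<Gamma> (F x) u) $ i $ j = 0"
      by simp
  qed
  then show "G v ** curl (\<lambda>v. u v* Gam \<Gamma> v w) v = Gam \<Gamma> v u ** Gam \<Gamma> v w - Gam \<Gamma> v w ** Gam \<Gamma> v u" for v u w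
    by (simp add: vec_eq_iff)
qed

end

section \<open>Hessians of functions with respect to a flat metric\<close>

definition Hess :: "(complex^'n::finite \<Rightarrow> complex) \<Rightarrow> complex^'n \<Rightarrow> complex^'n^'n" where
  "Hess f v = (\<chi> i j. pd i (pd j f) v)"

lemma Gam_nth: "Gam \<Gamma> v w $ i $ k = (\<Sum>j\<in>UNIV. \<Gamma> i j k v * w $ j)"
  by (simp add: Gam_def)

lemma transpose_nth: "transpose A $ i $ j = A $ j $ i"
  by (simp add: transpose_def)

lemma matrix_mult_nth: "(A ** B) $ i $ j = (\<Sum>k\<in>UNIV. A $ i $ k * B $ k $ j)"
  by (simp add: matrix_matrix_mult_def)

lemma vector_matrix_nth: "((u :: complex^'m::finite) v* A) $ j = (\<Sum>i\<in>UNIV. A $ i $ j * u $ i)"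
  by (simp add: vector_matrix_mult_def mult.commute)

lemma transpose_add: "transpose (A + B) = transpose A + transpose (B :: 'a::plus^'n^'m)"
  by (simp add: transpose_def vec_eq_iff)
lemma transpose_diff: "transpose (A - B) = transpose A - transpose (B :: 'a::minus^'n^'m)"
  by (simp add: transpose_def vec_eq_iff)

context flat_pair
begin

text \<open>The covariant Hessian with one index raised. The connection enters with a plus sign
  because contravariant symbols carry a minus sign by definition; the inverse of \<open>G\<close>
  does not occur.\<close>

definition rhess :: "(complex^'n \<Rightarrow> complex) \<Rightarrow> complex^'n \<Rightarrow> complex^'n^'n" where
  "rhess f v = G v ** Hess f v + Gam \<Gamma> v (differential f v)"

lemma Hess_sym:
  assumes "open V" "mholomorphic_on V f" "v \<in> V"
  shows "transpose (Hess f v) = Hess f v"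
  by (simp add: vec_eq_iff transpose_nth Hess_def pd_commute[OF assms])

lemma rhess_sym:
  assumes "open V" "mholomorphic_on V f" "v \<in> V"
  shows "transpose (rhess f v ** G v) = rhess f v ** G v"
proof -
  have "transpose (rhess f v ** G v) = G v ** (Hess f v ** G v) + G v ** transpose (Gam \<Gamma> v (differential f v))"
    by (simp add: rhess_def matrix_transpose_mul transpose_add G_sym Hess_sym[OF assms] matrix_add_ldistrib)
  then show ?thesis by (simp add: torsion_free rhess_def matrix_add_rdistrib matrix_mul_assoc)
qed

lemma mholomorphic_rhess:
  assumes "open V" "mholomorphic_on V f"
  shows "mholomorphic_on V (\<lambda>v. rhess f v $ i $ k)"
  unfolding mholomorphic_on_iff_cdiff
proof
  fix v assume v: "v \<in> V"
  have 1: "cdiff (pd j f) v" "cdiff (pd i (pd j f)) v" for i j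
    using mholomorphic_on_pd[OF assms(1)] assms(2) v mholomorphic_on_cdiff by metis+
  show "cdiff (\<lambda>v. rhess f v $ i $ k) v"
    unfolding rhess_def vector_add_component matrix_mult_nth Gam_nth Hess_def vec_lambda_beta differential_nth
    by (intro cdiff_intros 1 entire_cdiff[OF entire_G] entire_cdiff[OF entire_\<Gamma>])
qed

text \<open>The source of both associativity and the closedness of the structure forms. The terms
  with third derivatives of \<open>t\<close> are symmetric (\<open>X\<close>) and drop out.
  Multiplication by \<open>G\<close> completes each Hessian to \<open>rhess\<close> minus a
  connection term, and the leftover products of connection terms cancel against the flatness
  axiom.\<close>

lemma curl_rhess:
  assumes V: "open V" and s: "mholomorphic_on V s" and t: "mholomorphic_on V t" and v: "v \<in> V"
  shows "G v ** curl (\<lambda>v. differential s v v* rhess t v) v = rhess s v ** rhess t v - rhess t v ** rhess s v"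
proof -
  have h: "mholomorphic_on V (pd j f)" "mholomorphic_on V (pd i (pd j f))" if "mholomorphic_on V f" for i j f
    using mholomorphic_on_pd[OF V] that by blast+
  note c = mholomorphic_on_cdiff[OF h(1)[OF s] v] mholomorphic_on_cdiff[OF h(2)[OF s] v]
    mholomorphic_on_cdiff[OF h(1)[OF t] v] mholomorphic_on_cdiff[OF h(2)[OF t] v]
    entire_cdiff[OF entire_G] entire_cdiff[OF entire_\<Gamma>] mholomorphic_on_cdiff[OF mholomorphic_rhess[OF V t] v]
  let ?R = "rhess t v" and ?S = "Hess s v" and ?T = "Hess t v"
    and ?\<Gamma>s = "Gam \<Gamma> v (differential s v)" and ?\<Gamma>t = "Gam \<Gamma> v (differential t v)"
  let ?c = "\<lambda>u. differential s v v* Gam \<Gamma> u (differential t v)"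
  define X where "X = (\<lambda>m l. \<Sum>i\<in>UNIV. pd i s v * (\<Sum>j\<in>UNIV. \<Gamma> i j m v * pd j (pd l t) v
     + G v $ i $ j * pd m (pd j (pd l t)) v + \<Gamma> i j l v * pd m (pd j t) v))"
  have pd3: "pd a (pd b (pd c t)) v = pd c (pd b (pd a t)) v" for a b c
  proof -
    have "pd a (pd b (pd c t)) v = pd a (pd c (pd b t)) v"
      by (rule open_cong_pd(1)[OF V v pd_commute[OF V t]])
    also have "\<dots> = pd c (pd a (pd b t)) v" by (rule pd_commute[OF V h(1)[OF t] v])
    also have "\<dots> = pd c (pd b (pd a t)) v"
      by (rule open_cong_pd(1)[OF V v pd_commute[OF V t]])
    finally show ?thesis .
  qed
  have X: "X k l = X l k" for k l
  proof -
    have "\<Gamma> i j k v * pd j (pd l t) v + G v $ i $ j * pd k (pd j (pd l t)) v + \<Gamma> i j l v * pd k (pd j t) v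
      = \<Gamma> i j l v * pd j (pd k t) v + G v $ i $ j * pd l (pd j (pd k t)) v + \<Gamma> i j k v * pd l (pd j t) v" for i j
      unfolding pd3[of k j l] pd_commute[OF V t v, of k j] pd_commute[OF V t v, of l j] by simp
    then show ?thesis by (simp add: X_def)
  qed
  have pdc: "pd m (\<lambda>u. ?c u $ l) v = (\<Sum>i\<in>UNIV. pd i s v * (\<Sum>j\<in>UNIV. pd m (\<Gamma> i j l) v * pd j t v))" for m l
    by (simp add: vector_matrix_nth Gam_nth pd_sum pd_mult cdiff_intros c pd_const mult.commute)
  have R: "pd m (\<lambda>u. rhess t u $ i $ l) v = (\<Sum>j\<in>UNIV. (\<Gamma> i j m v + \<Gamma> j i m v) * pd j (pd l t) v
       + G v $ i $ j * pd m (pd j (pd l t)) v) + (\<Sum>j\<in>UNIV. pd m (\<Gamma> i j l) v * pd j t v + \<Gamma> i j l v * pd m (pd j t) v)" for m i l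
    unfolding rhess_def vector_add_component matrix_mult_nth Gam_nth Hess_def vec_lambda_beta differential_nth
    by (simp add: pd_sum pd_mult pd_add cdiff_intros c metric)
  have "pd m (\<lambda>u. (differential s u v* rhess t u) $ l) v =
      (?S ** ?R) $ m $ l + (transpose ?\<Gamma>s ** ?T) $ m $ l + pd m (\<lambda>u. ?c u $ l) v + X m l" for m l
  proof -
    have "pd m (\<lambda>u. (differential s u v* rhess t u) $ l) v
        = (\<Sum>i\<in>UNIV. pd m (pd i s) v * ?R $ i $ l + pd i s v * pd m (\<lambda>u. rhess t u $ i $ l) v)"
      unfolding vector_matrix_nth differential_nth by (simp add: pd_sum pd_mult cdiff_intros c add.commute mult.commute)
    also have "\<dots> = (?S ** ?R) $ m $ l + (\<Sum>i\<in>UNIV. pd i s v * pd m (\<lambda>u. rhess t u $ i $ l) v)"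
      by (simp add: sum.distrib matrix_mult_nth Hess_def)
    also have "(\<Sum>i\<in>UNIV. pd i s v * pd m (\<lambda>u. rhess t u $ i $ l) v) =
        (\<Sum>i\<in>UNIV. pd i s v * (\<Sum>j\<in>UNIV. \<Gamma> j i m v * pd j (pd l t) v)) + pd m (\<lambda>u. ?c u $ l) v + X m l"
      unfolding R pdc X_def by (simp add: sum.distrib algebra_simps)
    also have "(\<Sum>i\<in>UNIV. pd i s v * (\<Sum>j\<in>UNIV. \<Gamma> j i m v * pd j (pd l t) v)) = (transpose ?\<Gamma>s ** ?T) $ m $ l"
      by (simp add: matrix_mult_nth transpose_nth Gam_nth Hess_def sum_distrib_left sum_distrib_right mult_ac)
        (rule sum.swap)
    finally show ?thesis by (simp add: add_ac)
  qed
  then have "curl (\<lambda>v. differential s v v* rhess t v) v = (?S ** ?R - transpose (?S ** ?R))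
      + (transpose ?\<Gamma>s ** ?T - transpose (transpose ?\<Gamma>s ** ?T)) + curl ?c v"
    by (simp add: curl_def vec_eq_iff transpose_nth X[of _ _])
  also have "\<dots> = (?S ** ?R - transpose ?R ** ?S) + (transpose ?\<Gamma>s ** ?T - ?T ** ?\<Gamma>s) + curl ?c v"
    by (simp add: matrix_transpose_mul Hess_sym[OF V s v] Hess_sym[OF V t v])
  finally have "G v ** curl (\<lambda>v. differential s v v* rhess t v) v =
      (G v ** ?S ** ?R - G v ** transpose ?R ** ?S) + (G v ** transpose ?\<Gamma>s ** ?T - G v ** ?T ** ?\<Gamma>s) + G v ** curl ?c v"
    by (simp add: matrix_add_ldistrib matrix_sub_ldistrib matrix_mul_assoc)
  also have "G v ** transpose ?R = ?R ** G v"
    using rhess_sym[OF V t v] by (simp add: matrix_transpose_mul G_sym)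
  also have "?R ** G v ** ?S = ?R ** (rhess s v - ?\<Gamma>s)"
    by (simp add: rhess_def matrix_mul_assoc)
  also have "G v ** ?S = rhess s v - ?\<Gamma>s" by (simp add: rhess_def)
  also have "G v ** ?T = ?R - ?\<Gamma>t" by (simp add: rhess_def)
  also have "G v ** transpose ?\<Gamma>s = ?\<Gamma>s ** G v" by (rule torsion_free)
  also have "?\<Gamma>s ** G v ** ?T = ?\<Gamma>s ** (?R - ?\<Gamma>t)"
    by (simp add: rhess_def matrix_mul_assoc)
  also have "G v ** curl ?c v = ?\<Gamma>s ** ?\<Gamma>t - ?\<Gamma>t ** ?\<Gamma>s" by (rule flat)
  finally show ?thesis
    by (simp add: matrix_sub_ldistrib matrix_sub_rdistrib)
qed

end

section \<open>Flat pencils of quasi-homogeneous metrics\<close>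

text \<open>\<open>v0\<close> and \<open>v1\<close> witness that the two determinants do not vanish
  identically. Homogeneity of \<open>\<Gamma>0\<close> is enough for the degrees of Hessians, since
  the Hessian of a flat function is the same for all members of the pencil and can be computed from
  \<open>g\<close>. \<open>g_dlog\<close> is what the root system contributes.\<close>

locale flat_pencil =
  fixes g \<eta> :: "complex^'n::finite \<Rightarrow> complex^'n^'n"
    and \<Gamma>0 \<Gamma>1 :: "'n \<Rightarrow> 'n \<Rightarrow> 'n \<Rightarrow> complex^'n \<Rightarrow> complex"
    and \<theta> :: "'n \<Rightarrow> complex" and \<kappa> :: complex and m :: "'n \<Rightarrow> nat" and v0 v1 :: "complex^'n"
  assumes pencil: "flat_pair (\<lambda>v. \<chi> i j. g v $ i $ j + l * \<eta> v $ i $ j) (\<lambda>i j k v. \<Gamma>0 i j k v + l * \<Gamma>1 i j k v)"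
    and E_g: "dird (\<chi> r. \<theta> r * v $ r) (\<lambda>v. g v $ i $ j) v = (\<theta> i + \<theta> j) * g v $ i $ j"
    and E_\<eta>: "dird (\<chi> r. \<theta> r * v $ r) (\<lambda>v. \<eta> v $ i $ j) v = (\<theta> i + \<theta> j - \<kappa>) * \<eta> v $ i $ j"
    and E_\<Gamma>0: "dird (\<chi> r. \<theta> r * v $ r) (\<Gamma>0 i j k) v = (\<theta> i + \<theta> j - \<theta> k) * \<Gamma>0 i j k v"
    and \<kappa>: "\<kappa> \<noteq> 0"
    and g_dlog: "(\<And>i. m i > 0 \<Longrightarrow> v $ i \<noteq> 0) \<Longrightarrow>
       g v *v (\<chi> i. - of_nat (m i) / v $ i) = (\<chi> r. \<theta> r * v $ r)"
    and det_g: "det (g v0) \<noteq> 0" and det_\<eta>: "det (\<eta> v1) \<noteq> 0"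
begin

abbreviation "E v \<equiv> \<chi> r. \<theta> r * v $ r"
abbreviation "Gl l \<equiv> \<lambda>v. \<chi> i j. g v $ i $ j + l * \<eta> v $ i $ j"
abbreviation "\<Gamma>l l \<equiv> \<lambda>i j k v. \<Gamma>0 i j k v + l * \<Gamma>1 i j k v"

sublocale P: flat_pair g \<Gamma>0
  using pencil[of 0] by simp

lemma entire_\<eta>: "entire (\<lambda>v. \<eta> v $ i $ j)"
proof -
  interpret Q: flat_pair "Gl 1" "\<Gamma>l 1" by (rule pencil)
  have "cdiff (\<lambda>v. (g v $ i $ j + 1 * \<eta> v $ i $ j) - g v $ i $ j) v" for v
    using cdiff_diff[OF entire_cdiff[OF Q.entire_G[of i j]] entire_cdiff[OF P.entire_G[of i j]]] by simp
  then show ?thesis by (intro entireI) simp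
qed

lemma entire_\<Gamma>1: "entire (\<Gamma>1 i j k)"
proof -
  interpret Q: flat_pair "Gl 1" "\<Gamma>l 1" by (rule pencil)
  have "cdiff (\<lambda>v. (\<Gamma>0 i j k v + 1 * \<Gamma>1 i j k v) - \<Gamma>0 i j k v) v" for v
    using cdiff_diff[OF entire_cdiff[OF Q.entire_\<Gamma>[of i j k]] entire_cdiff[OF P.entire_\<Gamma>[of i j k]]] by simp
  then show ?thesis by (intro entireI) simp
qed

lemmas cd = entire_cdiff[OF P.entire_G] entire_cdiff[OF entire_\<eta>] entire_cdiff[OF P.entire_\<Gamma>] entire_cdiff[OF entire_\<Gamma>1]

lemma \<eta>_sym: "transpose (\<eta> v) = \<eta> v"
proof -
  interpret Q: flat_pair "Gl 1" "\<Gamma>l 1" by (rule pencil)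
  have "\<eta> v $ i $ j = \<eta> v $ j $ i" for i j
    using symmetric_nth[OF Q.G_sym, of v i j] symmetric_nth[OF P.G_sym, of v i j] by simp
  then show ?thesis by (simp add: vec_eq_iff transpose_nth)
qed

lemma torsion_free_nth: "flat_pair G \<Gamma> \<Longrightarrow> (\<Sum>s\<in>UNIV. G v $ i $ s * \<Gamma> j k s v) = (\<Sum>s\<in>UNIV. G v $ j $ s * \<Gamma> i k s v)"
proof -
  assume "flat_pair G \<Gamma>"
  then interpret flat_pair G \<Gamma> .
  have G1: "(Gam \<Gamma> v (axis j 1)) $ i $ k = \<Gamma> i j k v" for i j k v
    by (simp add: Gam_def axis_def if_distrib[of "\<lambda>x. _ * x"] cong: if_cong)
  have "(G v ** transpose (Gam \<Gamma> v (axis k 1))) $ i $ j = (Gam \<Gamma> v (axis k 1) ** G v) $ i $ j"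
    by (simp only: torsion_free)
  then show ?thesis
    by (simp add: matrix_mult_nth transpose_nth G1 symmetric_nth[OF G_sym, of v _ j] mult.commute)
qed

lemma metric_\<eta>: "pd k (\<lambda>v. \<eta> v $ i $ j) v = \<Gamma>1 i j k v + \<Gamma>1 j i k v"
proof -
  interpret Q: flat_pair "Gl 1" "\<Gamma>l 1" by (rule pencil)
  show ?thesis using Q.metric[of k i j v] P.metric[of k i j v] by (simp add: pd_add cd)
qed

text \<open>The torsion condition for the pencil is quadratic in \<open>l\<close>; its values at 0,
  1 and -1 isolate the coefficient of the square.\<close>

lemma torsion_free_\<eta>: "(\<Sum>s\<in>UNIV. \<eta> v $ i $ s * \<Gamma>1 j k s v) = (\<Sum>s\<in>UNIV. \<eta> v $ j $ s * \<Gamma>1 i k s v)"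
proof -
  define A B C where "A i j = (\<Sum>s\<in>UNIV. g v $ i $ s * \<Gamma>0 j k s v)"
    and "B i j = (\<Sum>s\<in>UNIV. g v $ i $ s * \<Gamma>1 j k s v + \<eta> v $ i $ s * \<Gamma>0 j k s v)"
    and "C i j = (\<Sum>s\<in>UNIV. \<eta> v $ i $ s * \<Gamma>1 j k s v)" for i j
  have eq: "(\<Sum>s\<in>UNIV. Gl l v $ i $ s * \<Gamma>l l j k s v) = A i j + l * B i j + l * l * C i j" for l i j
    unfolding A_def B_def C_def by (simp add: sum_distrib_left sum.distrib algebra_simps)
  have "A i j + l * B i j + l * l * C i j = A j i + l * B j i + l * l * C j i" for l
    using torsion_free_nth[OF pencil[of l], of v i j k] unfolding eq .
  from this[of 0] this[of 1] this[of "-1"] have "2 * C i j = 2 * C j i" by algebra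
  then show ?thesis by (simp add: C_def)
qed

lemma christoffel_\<eta>:
  assumes "det (\<eta> v) \<noteq> 0"
  shows "(\<Sum>r\<in>UNIV. \<eta> v $ i $ r * christoffel pd (\<lambda>u. matrix_inv (\<eta> u)) j r k v) = - \<Gamma>1 i j k v"
  using contra_christoffel_pd_unique[OF cd(2) assms \<eta>_sym, of "\<lambda>i j k. \<Gamma>1 i j k v" i j k] torsion_free_\<eta> metric_\<eta>
  by (simp add: contra_christoffel_def minus_equation_iff)

lemma christoffel_\<eta>':
  assumes "det (\<eta> v) \<noteq> 0"
  shows "christoffel pd (\<lambda>u. matrix_inv (\<eta> u)) j r k v = - (\<Sum>i\<in>UNIV. matrix_inv (\<eta> v) $ r $ i * \<Gamma>1 i j k v)"
proof -
  have "(\<Sum>i\<in>UNIV. matrix_inv (\<eta> v) $ r $ i * - \<Gamma>1 i j k v) =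
     (\<Sum>s\<in>UNIV. (\<Sum>i\<in>UNIV. matrix_inv (\<eta> v) $ r $ i * \<eta> v $ i $ s) * christoffel pd (\<lambda>u. matrix_inv (\<eta> u)) j s k v)"
    unfolding christoffel_\<eta>[OF assms, symmetric]
    by (simp add: sum_distrib_left sum_distrib_right mult_ac) (rule sum.swap)
  then show ?thesis
    by (simp add: sum_matrix_inv_right(2)[OF assms] sum_negf if_distrib[of "\<lambda>x. x * _"] cong: if_cong)
qed

end

context flat_pencil
begin

definition flat_fun :: "(complex^'n) set \<Rightarrow> (complex^'n \<Rightarrow> complex) \<Rightarrow> bool" where
  "flat_fun V f \<longleftrightarrow> mholomorphic_on V f \<and> (\<forall>v\<in>V. \<forall>i j. pd i (pd j f) v =
     (\<Sum>k\<in>UNIV. christoffel pd (\<lambda>u. matrix_inv (\<eta> u)) k i j v * pd k f v))"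

text \<open>By \<open>christoffel_\<eta>\<close> the part \<open>\<Gamma>1\<close> is the connection
  of \<open>\<eta>\<close>, so the equation for flat functions says that their Hessian for
  \<open>\<eta>\<close> vanishes, here with an index raised.\<close>

lemma flat_fun_Hess:
  assumes "flat_fun V f" "v \<in> V" "det (\<eta> v) \<noteq> 0"
  shows "\<eta> v ** Hess f v = - Gam \<Gamma>1 v (differential f v)"
proof -
  have "(\<eta> v ** Hess f v) $ i $ k = (- Gam \<Gamma>1 v (differential f v)) $ i $ k" for i k
  proof -
    have "(\<eta> v ** Hess f v) $ i $ k = (\<Sum>r\<in>UNIV. \<Sum>j\<in>UNIV. \<eta> v $ i $ r * (christoffel pd (\<lambda>u. matrix_inv (\<eta> u)) j r k v * pd j f v))"
      using assms by (simp add: matrix_mult_nth Hess_def flat_fun_def sum_distrib_left)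
    also have "\<dots> = (\<Sum>j\<in>UNIV. (\<Sum>r\<in>UNIV. \<eta> v $ i $ r * christoffel pd (\<lambda>u. matrix_inv (\<eta> u)) j r k v) * pd j f v)"
      by (subst sum.swap) (simp add: sum_distrib_left sum_distrib_right mult_ac)
    finally show ?thesis by (simp add: christoffel_\<eta>[OF assms(3)] Gam_nth sum_negf)
  qed
  then show ?thesis by (simp add: vec_eq_iff)
qed

text \<open>Flatness replaces the second derivatives in \<open>rhess\<close> by first ones. The
  result is linear in an arbitrary one-form \<open>w\<close>, which permits a pointwise definition
  of the product of one-forms.\<close>

definition Rmat :: "complex^'n \<Rightarrow> complex^'n \<Rightarrow> complex^'n^'n" where
  "Rmat v w = Gam \<Gamma>0 v w - g v ** matrix_inv (\<eta> v) ** Gam \<Gamma>1 v w"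

abbreviation "R \<equiv> P.rhess"

lemma R_Rmat:
  assumes "flat_fun V f" "v \<in> V" "det (\<eta> v) \<noteq> 0"
  shows "R f v = Rmat v (differential f v)"
proof -
  have "matrix_inv (\<eta> v) ** (\<eta> v ** Hess f v) = Hess f v"
    by (simp add: matrix_mul_assoc matrix_inv_det[OF assms(3)])
  then have "Hess f v = matrix_inv (\<eta> v) ** (- Gam \<Gamma>1 v (differential f v))"
    by (simp add: flat_fun_Hess[OF assms])
  moreover have "A ** (- X) = - (A ** X)" for A X :: "complex^'n^'n"
    by (simp add: vec_eq_iff matrix_mult_nth sum_negf)
  ultimately show ?thesis by (simp add: P.rhess_def Rmat_def matrix_mul_assoc)
qed

text \<open>The coefficient of \<open>l\<close> is the Hessian with respect to
  \<open>\<eta>\<close>, which is zero.\<close>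

lemma rhess_pencil:
  assumes "flat_fun V f" "v \<in> V" "det (\<eta> v) \<noteq> 0"
  shows "flat_pair.rhess (Gl l) (\<Gamma>l l) f v = R f v"
proof -
  interpret Q: flat_pair "Gl l" "\<Gamma>l l" by (rule pencil)
  have "Q.rhess f v $ i $ k = R f v $ i $ k + l * (\<eta> v ** Hess f v + Gam \<Gamma>1 v (differential f v)) $ i $ k" for i k
    by (simp add: Q.rhess_def P.rhess_def matrix_mult_nth Gam_nth distrib_right sum.distrib sum_distrib_left algebra_simps)
  then show ?thesis by (simp add: flat_fun_Hess[OF assms] vec_eq_iff)
qed

lemma Gl_diff: "Gl 1 v ** X - g v ** X = \<eta> v ** X"
  by (simp add: vec_eq_iff matrix_mult_nth distrib_right sum.distrib)

text \<open>The corresponding symmetry holds for two members of the pencil with the same Hessian,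
  hence for their difference.\<close>

lemma R_\<eta>_sym:
  assumes "open V" "flat_fun V f" "v \<in> V" "det (\<eta> v) \<noteq> 0"
  shows "transpose (R f v ** \<eta> v) = R f v ** \<eta> v"
proof -
  have f: "mholomorphic_on V f" using assms(2) by (simp add: flat_fun_def)
  interpret Q: flat_pair "Gl 1" "\<Gamma>l 1" by (rule pencil)
  have "R f v ** \<eta> v = R f v ** Gl 1 v - R f v ** g v"
    by (simp add: vec_eq_iff matrix_mult_nth distrib_left sum.distrib)
  moreover have "transpose (R f v ** Gl 1 v) = R f v ** Gl 1 v"
    using Q.rhess_sym[OF assms(1) f assms(3)] unfolding rhess_pencil[OF assms(2-4)] .
  ultimately show ?thesis by (simp add: transpose_diff P.rhess_sym[OF assms(1) f assms(3)])
qed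

lemma curl_cong:
  assumes "open V" "v \<in> V" "\<And>u. u \<in> V \<Longrightarrow> \<omega> u = \<omega>' u"
  shows "curl \<omega> v = curl \<omega>' v"
  unfolding curl_def vec_eq_iff using open_cong_pd(1)[OF assms(1,2), of "\<lambda>u. \<omega> u $ _" "\<lambda>u. \<omega>' u $ _"] assms(3) by simp

text \<open>In \<open>curl_rhess\<close> neither the curl nor the commutator depends on
  \<open>l\<close>. Comparing \<open>l = 0\<close> with \<open>l = 1\<close> shows that
  \<open>\<eta>\<close> times the curl is zero; \<open>\<eta>\<close> is invertible, so the curl
  vanishes and with it the commutator.\<close>

lemma curl_R_and_commute:
  assumes V: "open V" "\<And>u. u \<in> V \<Longrightarrow> det (\<eta> u) \<noteq> 0" and s: "flat_fun V s" and t: "flat_fun V t" and v: "v \<in> V"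
  shows "curl (\<lambda>v. differential s v v* R t v) v = 0" and "R s v ** R t v = R t v ** R s v"
proof -
  interpret Q: flat_pair "Gl 1" "\<Gamma>l 1" by (rule pencil)
  let ?C = "curl (\<lambda>v. differential s v v* R t v) v"
  have h: "mholomorphic_on V s" "mholomorphic_on V t" using s t by (auto simp: flat_fun_def)
  have c: "curl (\<lambda>v. differential s v v* Q.rhess t v) v = ?C"
    by (rule curl_cong[OF V(1) v]) (simp only: rhess_pencil[OF t _ V(2)])
  have "Gl 1 v ** ?C = R s v ** R t v - R t v ** R s v"
    using Q.curl_rhess[OF V(1) h v]
    unfolding c rhess_pencil[OF t v V(2)[OF v]] rhess_pencil[OF s v V(2)[OF v]] .
  then have "Gl 1 v ** ?C = g v ** ?C"
    by (simp only: P.curl_rhess[OF V(1) h v])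
  then have "\<eta> v ** ?C = 0" using Gl_diff[of v ?C] by simp
  then have "matrix_inv (\<eta> v) ** \<eta> v ** ?C = 0" 
    by (simp add: matrix_mul_assoc[symmetric])
  then show "?C = 0" by (simp add: matrix_inv_det[OF V(2)[OF v]])
  then show "R s v ** R t v = R t v ** R s v"
    using P.curl_rhess[OF V(1) h v] by (simp add: vec_eq_iff matrix_mult_nth)
qed

section \<open>The logarithmic one-form\<close>

definition dlog :: "complex^'n \<Rightarrow> complex^'n" where
  "dlog v = (\<chi> i. - of_nat (m i) / v $ i)"

text \<open>The formula of \<open>rhess\<close> for the function - \<Sum> m_i log z^i. As logarithms
  are multivalued, their gradient and diagonal Hessian are inserted directly.\<close>

definition R_dlog :: "complex^'n \<Rightarrow> complex^'n^'n" where
  "R_dlog v = g v ** (\<chi> i k. if i = k then of_nat (m i) / (v $ i)\<^sup>2 else 0) + Gam \<Gamma>0 v (dlog v)"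

lemma open_nonzero_coords: "open {v :: complex^'n. \<forall>i. m i > 0 \<longrightarrow> v $ i \<noteq> 0}"
proof -
  have "{v :: complex^'n. \<forall>i. m i > 0 \<longrightarrow> v $ i \<noteq> 0} = (\<Inter>i\<in>{i. m i > 0}. {v. v $ i \<noteq> 0})" by auto
  then show ?thesis by (auto intro!: open_INT open_Collect_neq continuous_intros)
qed

lemma dlog_pd:
  assumes "\<And>i. m i > 0 \<Longrightarrow> v $ i \<noteq> 0"
  shows "cdiff (\<lambda>v. dlog v $ i) v" and "pd k (\<lambda>v. dlog v $ i) v = (if i = k then of_nat (m i) / (v $ i)\<^sup>2 else 0)"
proof -
  have "cdiff (\<lambda>v. dlog v $ i) v \<and> pd k (\<lambda>v. dlog v $ i) v = (if i = k then of_nat (m i) / (v $ i)\<^sup>2 else 0)"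
  proof (cases "m i > 0")
    case True
    then have "v $ i \<noteq> 0" using assms by blast
    then have "((\<lambda>z. - of_nat (m i) / z) has_field_derivative of_nat (m i) / (v $ i)\<^sup>2) (at (v $ i))"
      by (auto intro!: derivative_eq_intros simp: power2_eq_square)
    from cdiff_compose_field[where f = "\<lambda>v. v $ i", OF this cdiff_coord] show ?thesis
      by (simp add: dlog_def pd_coord)
  qed (auto simp add: dlog_def cdiff_const pd_const)
  then show "cdiff (\<lambda>v. dlog v $ i) v" "pd k (\<lambda>v. dlog v $ i) v = (if i = k then of_nat (m i) / (v $ i)\<^sup>2 else 0)"
    by auto
qed

text \<open>Differentiation of the relation that \<open>g\<close> maps \<open>dlog\<close> to
  \<open>E\<close>. Metric compatibility splits the derivative of \<open>g\<close> into two
  connection terms, one of which completes \<open>R_dlog\<close>.\<close>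

lemma R_dlog_nth:
  assumes v: "\<And>i. m i > 0 \<Longrightarrow> v $ i \<noteq> 0"
  shows "R_dlog v $ i $ k + (\<Sum>p\<in>UNIV. \<Gamma>0 p i k v * dlog v $ p) = (if i = k then \<theta> i else 0)"
proof -
  have "pd k (\<lambda>u. \<Sum>p\<in>UNIV. g u $ i $ p * dlog u $ p) v = pd k (\<lambda>u. \<theta> i * u $ i) v"
  proof (rule open_cong_pd(1)[OF open_nonzero_coords])
    fix u :: "complex^'n" assume "u \<in> {v. \<forall>i. m i > 0 \<longrightarrow> v $ i \<noteq> 0}"
    then have "(g u *v dlog u) $ i = E u $ i" unfolding dlog_def using g_dlog[of u] by simp
    then show "(\<Sum>p\<in>UNIV. g u $ i $ p * dlog u $ p) = \<theta> i * u $ i" by (simp add: matrix_vector_mult_def)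
  qed (use v in auto)
  moreover have "pd k (\<lambda>u. \<theta> i * u $ i) v = (if i = k then \<theta> i else 0)"
    by (simp add: pd_mult cdiff_intros pd_const pd_coord)
  moreover have "pd k (\<lambda>u. \<Sum>p\<in>UNIV. g u $ i $ p * dlog u $ p) v =
      (\<Sum>p\<in>UNIV. (\<Gamma>0 i p k v + \<Gamma>0 p i k v) * dlog v $ p + g v $ i $ p * (if p = k then of_nat (m p) / (v $ p)\<^sup>2 else 0))"
    by (simp add: pd_sum pd_mult cdiff_intros cd dlog_pd[OF v] P.metric)
  ultimately show ?thesis
    by (simp add: R_dlog_def Gam_nth matrix_mult_nth sum.distrib distrib_right add_ac)
qed

text \<open>The product is symmetric because the connection has no torsion. It is also
  antisymmetric: by \<open>R_dlog_nth\<close> its symmetric part compares (\<theta>_i + \<theta>_j)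
  g^ij with the derivative of g^ij along \<open>E\<close>, and the two agree by homogeneity.\<close>

lemma R_dlog_g:
  assumes v: "\<And>i. m i > 0 \<Longrightarrow> v $ i \<noteq> 0"
  shows "R_dlog v ** g v = 0"
proof -
  let ?T = "\<chi> i k. if i = k then of_nat (m i) / (v $ i)\<^sup>2 else 0 :: complex^'n^'n"
  have "transpose ?T = ?T" by (auto simp: vec_eq_iff transpose_nth)
  then have "transpose (R_dlog v ** g v) = g v ** (?T ** g v) + g v ** transpose (Gam \<Gamma>0 v (dlog v))"
    by (simp add: R_dlog_def matrix_transpose_mul transpose_add P.G_sym matrix_add_ldistrib)
  then have sym: "transpose (R_dlog v ** g v) = R_dlog v ** g v"
    by (simp add: P.torsion_free R_dlog_def matrix_add_rdistrib matrix_mul_assoc)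
  have F: "flat_pair g \<Gamma>0" by unfold_locales
  have E: "E v $ k = (\<Sum>p\<in>UNIV. dlog v $ p * g v $ p $ k)" for k
  proof -
    have "(g v *v dlog v) $ k = E v $ k" unfolding dlog_def using g_dlog[OF v] by simp
    then show ?thesis by (simp add: matrix_vector_mult_def symmetric_nth[OF P.G_sym, of v k] mult.commute)
  qed
  have RG: "(R_dlog v ** g v) $ i $ j = \<theta> i * g v $ i $ j - (\<Sum>k\<in>UNIV. E v $ k * \<Gamma>0 j i k v)" for i j
  proof -
    have "R_dlog v $ i $ k = (if i = k then \<theta> i else 0) - (\<Sum>p\<in>UNIV. \<Gamma>0 p i k v * dlog v $ p)" for k
      using R_dlog_nth[OF v, of i k] by (simp add: eq_diff_eq)
    then have "(R_dlog v ** g v) $ i $ j = (\<Sum>k\<in>UNIV. (if i = k then \<theta> i else 0) * g v $ k $ j) - (\<Sum>k\<in>UNIV. (\<Sum>p\<in>UNIV. \<Gamma>0 p i k v * dlog v $ p) * g v $ k $ j)"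
      by (simp add: matrix_mult_nth left_diff_distrib sum_subtractf)
    also have "(\<Sum>k\<in>UNIV. (if i = k then \<theta> i else 0) * g v $ k $ j) = \<theta> i * g v $ i $ j"
      by (simp add: if_distrib[of "\<lambda>x. x * _"] cong: if_cong)
    also have "(\<Sum>k\<in>UNIV. (\<Sum>p\<in>UNIV. \<Gamma>0 p i k v * dlog v $ p) * g v $ k $ j) = (\<Sum>p\<in>UNIV. dlog v $ p * (\<Sum>k\<in>UNIV. g v $ j $ k * \<Gamma>0 p i k v))"
      by (simp add: sum_distrib_left sum_distrib_right) (subst sum.swap, simp add: symmetric_nth[OF P.G_sym, of v _ j] mult_ac)
    also have "\<dots> = (\<Sum>p\<in>UNIV. dlog v $ p * (\<Sum>k\<in>UNIV. g v $ p $ k * \<Gamma>0 j i k v))"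
      using torsion_free_nth[OF F, of v j] by simp
    also have "\<dots> = (\<Sum>k\<in>UNIV. E v $ k * \<Gamma>0 j i k v)"
      unfolding E sum_distrib_left sum_distrib_right by (subst sum.swap) (simp add: mult_ac)
    finally show ?thesis .
  qed
  have "(R_dlog v ** g v) $ i $ j + (R_dlog v ** g v) $ j $ i = 0" for i j
  proof -
    have "(\<theta> i + \<theta> j) * g v $ i $ j = (\<Sum>k\<in>UNIV. E v $ k * (\<Gamma>0 i j k v + \<Gamma>0 j i k v))"
      unfolding E_g[symmetric] dird_expand P.metric ..
    then show ?thesis
      unfolding RG by (simp add: symmetric_nth[OF P.G_sym, of v j i] algebra_simps sum.distrib)
  qed
  then have "(R_dlog v ** g v) $ i $ j + (R_dlog v ** g v) $ i $ j = 0" for i j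
    using symmetric_nth[OF sym, of i j] by metis
  then have "(R_dlog v ** g v) $ i $ j = 0" for i j by (simp flip: mult_2)
  then show ?thesis by (simp add: vec_eq_iff)
qed

text \<open>\<open>g\<close> can be cancelled on a dense set, and \<open>R_dlog\<close> is
  continuous off the coordinate hyperplanes in question.\<close>

lemma R_dlog_eq_0:
  assumes "\<And>i. m i > 0 \<Longrightarrow> v $ i \<noteq> 0"
  shows "R_dlog v = 0"
proof -
  let ?V = "{v :: complex^'n. \<forall>i. m i > 0 \<longrightarrow> v $ i \<noteq> 0}"
  have "R_dlog v $ i $ k = 0" for i k
  proof (rule continuous_eq_0_dense[where f = "\<lambda>v. det (g v)" and V = ?V and ?v0.0 = v0 and g = "\<lambda>v. R_dlog v $ i $ k"])
    show "entire (\<lambda>v. det (g v))" by (intro entireI cdiff_det cd)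
    show "continuous_on ?V (\<lambda>v. R_dlog v $ i $ k)"
    proof -
      have c1: "continuous_on ?V (\<lambda>v. if i = k then of_nat (m i) / (v $ i)\<^sup>2 else 0 :: complex)" for i k
        by (cases "m i > 0"; cases "k = i") (auto intro!: continuous_intros)
      have c2: "continuous_on ?V (\<lambda>v. dlog v $ i)" for i
        unfolding dlog_def by (cases "m i > 0") (auto intro!: continuous_intros)
      show ?thesis
        unfolding R_dlog_def vector_add_component matrix_mult_nth Gam_nth vec_lambda_beta
        by (intro continuous_on_add continuous_on_sum continuous_on_mult c1 c2 entire_continuous P.entire_G P.entire_\<Gamma>)
    qed
    fix u assume u: "u \<in> ?V" "det (g u) \<noteq> 0"
    have "R_dlog u ** g u ** matrix_inv (g u) = 0"
      using R_dlog_g[of u] u(1) by (simp add: vec_eq_iff matrix_mult_nth)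
    then show "R_dlog u $ i $ k = 0"
      by (simp add: matrix_mul_assoc[symmetric] matrix_inv_det[OF u(2)])
  qed (use assms open_nonzero_coords det_g in auto)
  then show ?thesis by (simp add: vec_eq_iff)
qed

section \<open>Homogeneity of flat eigenfunctions and of their Hessians\<close>

lemma E_pd:
  assumes V: "open V" "mholomorphic_on V f" "\<And>v. v \<in> V \<Longrightarrow> dird (E v) f v = d * f v + K" and v: "v \<in> V"
  shows "dird (E v) (pd j f) v = (d - \<theta> j) * pd j f v"
proof -
  note c = mholomorphic_on_cdiff[OF V(2) v] mholomorphic_on_cdiff[OF mholomorphic_on_pd[OF V(1,2)] v]
  have "pd j (\<lambda>v. \<Sum>i\<in>UNIV. \<theta> i * v $ i * pd i f v) v = pd j (\<lambda>v. d * f v + K) v"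
    by (rule open_cong_pd(1)[OF V(1) v]) (use V(3) in \<open>simp add: dird_expand\<close>)
  then have "(\<Sum>i\<in>UNIV. \<theta> i * (if j = i then 1 else 0) * pd i f v + \<theta> i * v $ i * pd j (pd i f) v) = d * pd j f v"
    by (simp add: pd_sum pd_mult pd_add cdiff_intros c pd_const pd_coord)
  moreover have "(\<Sum>i\<in>UNIV. \<theta> i * v $ i * pd j (pd i f) v) = dird (E v) (pd j f) v"
    by (simp add: dird_expand pd_commute[OF V(1,2) v, of j])
  ultimately show ?thesis
    by (simp add: sum.distrib if_distrib[of "\<lambda>x. x * _"] if_distrib[of "\<lambda>x. _ * x"] algebra_simps cong: if_cong)
qed

text \<open>Pairing with \<open>dlog\<close> turns \<open>g\<close> into \<open>E\<close>, so the
  second derivatives become the derivative along \<open>E\<close> of a partial derivative, which has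
  degree d - \<theta>_k. The vanishing of \<open>R_dlog\<close> evaluates the connection term as
  \<theta>_k times that partial derivative, which restores \<open>d\<close>.\<close>

lemma dlog_R:
  assumes V: "open V" "mholomorphic_on V f" "\<And>v. v \<in> V \<Longrightarrow> dird (E v) f v = d * f v + K" and v: "v \<in> V"
    and nz: "\<And>i. m i > 0 \<Longrightarrow> v $ i \<noteq> 0"
  shows "dlog v v* R f v = d *s differential f v"
proof -
  have E: "E v $ j = (\<Sum>i\<in>UNIV. dlog v $ i * g v $ i $ j)" for j
  proof -
    have "(g v *v dlog v) $ j = E v $ j" unfolding dlog_def using g_dlog[OF nz] by simp
    then show ?thesis by (simp add: matrix_vector_mult_def symmetric_nth[OF P.G_sym, of v j] mult.commute)
  qed
  have "(dlog v v* R f v) $ k = d * pd k f v" for k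
  proof -
    have "(dlog v v* R f v) $ k = (\<Sum>i\<in>UNIV. (\<Sum>j\<in>UNIV. g v $ i $ j * pd j (pd k f) v) * dlog v $ i) + (\<Sum>i\<in>UNIV. (\<Sum>j\<in>UNIV. \<Gamma>0 i j k v * pd j f v) * dlog v $ i)"
      by (simp add: vector_matrix_nth P.rhess_def matrix_mult_nth Gam_nth Hess_def distrib_right sum.distrib)
    also have "(\<Sum>i\<in>UNIV. (\<Sum>j\<in>UNIV. g v $ i $ j * pd j (pd k f) v) * dlog v $ i) = dird (E v) (pd k f) v"
      unfolding dird_expand E sum_distrib_right by (subst sum.swap) (simp add: mult_ac)
    also have "\<dots> = (d - \<theta> k) * pd k f v" by (rule E_pd[OF V v])
    also have "(\<Sum>i\<in>UNIV. (\<Sum>j\<in>UNIV. \<Gamma>0 i j k v * pd j f v) * dlog v $ i) = (\<Sum>j\<in>UNIV. (\<Sum>i\<in>UNIV. \<Gamma>0 i j k v * dlog v $ i) * pd j f v)"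
      unfolding sum_distrib_right by (subst sum.swap) (simp add: mult_ac)
    also have "\<dots> = (\<Sum>j\<in>UNIV. (if j = k then \<theta> j else 0) * pd j f v)"
      using R_dlog_nth[OF nz, of _ k] R_dlog_eq_0[OF nz] by simp
    finally show ?thesis by (simp add: algebra_simps if_distrib[of "\<lambda>x. x * _"] if_distrib[of "\<lambda>x. _ * x"] cong: if_cong)
  qed
  then show ?thesis by (simp add: vec_eq_iff)
qed

lemma E_Hess:
  assumes V: "open V" "mholomorphic_on V f" "\<And>v. v \<in> V \<Longrightarrow> dird (E v) f v = d * f v + K" and v: "v \<in> V"
  shows "dird (E v) (pd i (pd j f)) v = (d - \<theta> i - \<theta> j) * pd i (pd j f) v"
proof -
  have "dird (E u) (pd j f) u = (d - \<theta> j) * pd j f u + 0" if "u \<in> V" for u using E_pd[OF V that] by simp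
  from E_pd[OF V(1) mholomorphic_on_pd[OF V(1,2)] this v] show ?thesis by (simp add: algebra_simps)
qed

lemma E_R:
  assumes V: "open V" "mholomorphic_on V f" "\<And>v. v \<in> V \<Longrightarrow> dird (E v) f v = d * f v + K" and v: "v \<in> V"
  shows "dird (E v) (\<lambda>v. R f v $ i $ k) v = (d + \<theta> i - \<theta> k) * R f v $ i $ k"
proof -
  note c = mholomorphic_on_cdiff[OF V(2) v] mholomorphic_on_cdiff[OF mholomorphic_on_pd[OF V(1,2)] v]
    mholomorphic_on_cdiff[OF mholomorphic_on_pd[OF V(1) mholomorphic_on_pd[OF V(1,2)]] v]
  have "dird (E v) (\<lambda>v. R f v $ i $ k) v = (\<Sum>j\<in>UNIV. ((\<theta> i + \<theta> j) + (d - \<theta> j - \<theta> k)) * (g v $ i $ j * pd j (pd k f) v))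
     + (\<Sum>j\<in>UNIV. ((\<theta> i + \<theta> j - \<theta> k) + (d - \<theta> j)) * (\<Gamma>0 i j k v * pd j f v))"
    unfolding P.rhess_def vector_add_component matrix_mult_nth Gam_nth Hess_def vec_lambda_beta differential_nth
    by (simp add: dird_sum dird_mult dird_add cdiff_intros c cd E_g E_\<Gamma>0 E_Hess[OF V v] E_pd[OF V v] algebra_simps)
  also have "\<dots> = (d + \<theta> i - \<theta> k) * R f v $ i $ k"
    unfolding P.rhess_def vector_add_component matrix_mult_nth Gam_nth Hess_def vec_lambda_beta differential_nth
    by (simp add: sum_distrib_left distrib_left) (simp add: algebra_simps)
  finally show ?thesis .
qed

end

section \<open>Frames of flat coordinates\<close>

lemma row_mult: "(A ** B) $ i = (A $ i) v* (B :: complex^'n::finite^'n)"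
  by (simp add: vec_eq_iff matrix_mult_nth vector_matrix_nth mult.commute)

lemma vector_scale_matrix: "(c *s u) v* A = c *s (u v* (A :: complex^'n::finite^'n))"
  by (simp add: vec_eq_iff vector_matrix_nth sum_distrib_left mult_ac)

lemma vector_matrix_scale: "u v* (\<chi> i j. c * A $ i $ j) = c *s (u v* (A :: complex^'n::finite^'n))"
  by (simp add: vec_eq_iff vector_matrix_nth sum_distrib_left mult_ac)

definition diagm :: "('n \<Rightarrow> complex) \<Rightarrow> complex^'n::finite^'n" where
  "diagm d = (\<chi> a b. if a = b then d a else 0)"

lemma diagm_mult: "(diagm d ** A) $ a $ b = d a * A $ a $ b"
  by (simp add: diagm_def matrix_mult_nth if_distrib[of "\<lambda>x. x * _"] cong: if_cong)

lemma mult_diagm: "(A ** diagm d) $ a $ b = A $ a $ b * d b"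
  by (simp add: diagm_def matrix_mult_nth if_distrib[of "\<lambda>x. _ * x"] cong: if_cong)

lemma det_diagm: "(\<And>a. d a \<noteq> 0) \<Longrightarrow> det (diagm d) \<noteq> 0"
  by (rule matrix_inv_unique'(2)[of _ "diagm (\<lambda>a. 1 / d a)"]) (simp add: vec_eq_iff diagm_mult, simp add: diagm_def mat_def)

context flat_pencil
begin

text \<open>The covariant derivative of \<open>E\<close> for \<open>\<eta>\<close>. Differentials of
  flat coordinates are left eigenvectors for their degrees (\<open>J_B\<close>), so the inverse
  furnishes the factors 1/d_\<beta> without reference to coordinates.\<close>

definition Bmat :: "complex^'n \<Rightarrow> complex^'n^'n" where
  "Bmat v = (\<chi> k j. (if k = j then \<theta> j else 0) +
     (\<Sum>i\<in>UNIV. E v $ i * christoffel pd (\<lambda>u. matrix_inv (\<eta> u)) k i j v))"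

text \<open>Multiplication by the one-form \<open>\<zeta>\<close>, acting on row vectors from the
  right. On differentials of flat coordinates it is the prescribed (\<kappa>/d_\<beta>) R t^\<beta>,
  see \<open>Mmat_J\<close>.\<close>

definition Mmat :: "complex^'n \<Rightarrow> complex^'n \<Rightarrow> complex^'n^'n" where
  "Mmat v \<zeta> = (\<chi> i j. \<kappa> * Rmat v (\<zeta> v* matrix_inv (Bmat v)) $ i $ j)"

definition formprod :: "complex^'n \<Rightarrow> complex^'n \<Rightarrow> complex^'n \<Rightarrow> complex^'n" where
  "formprod v \<xi> \<zeta> = \<xi> v* Mmat v \<zeta>"

lemma Gam_add: "Gam \<Gamma> v (w + w') = Gam \<Gamma> v w + Gam \<Gamma> v w'"
  by (simp add: vec_eq_iff Gam_nth distrib_left sum.distrib)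
lemma Gam_scale: "Gam \<Gamma> v (c *s w) = (\<chi> i j. c * Gam \<Gamma> v w $ i $ j)"
  by (simp add: vec_eq_iff Gam_nth sum_distrib_left mult_ac)

lemma Rmat_add: "Rmat v (w + w') = Rmat v w + Rmat v w'"
  by (simp add: Rmat_def Gam_add matrix_add_ldistrib)
lemma Rmat_scale: "Rmat v (c *s w) = (\<chi> i j. c * Rmat v w $ i $ j)"
  by (simp add: vec_eq_iff Rmat_def Gam_scale matrix_mult_nth sum_distrib_left right_diff_distrib mult_ac)

lemma Mmat_add: "Mmat v (\<zeta> + \<zeta>') = Mmat v \<zeta> + Mmat v \<zeta>'"
  by (simp add: vec_eq_iff Mmat_def vector_matrix_left_distrib Rmat_add distrib_left)
lemma Mmat_scale: "Mmat v (c *s \<zeta>) = (\<chi> i j. c * Mmat v \<zeta> $ i $ j)"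
  by (simp add: vec_eq_iff Mmat_def vector_scale_matrix Rmat_scale)

lemma formprod_add: "formprod v (\<xi> + \<xi>') \<zeta> = formprod v \<xi> \<zeta> + formprod v \<xi>' \<zeta>"
  "formprod v \<xi> (\<zeta> + \<zeta>') = formprod v \<xi> \<zeta> + formprod v \<xi> \<zeta>'"
  by (simp_all add: formprod_def vector_matrix_left_distrib Mmat_add)
    (simp add: vec_eq_iff vector_matrix_nth distrib_right sum.distrib)

lemma formprod_scale: "formprod v (c *s \<xi>) \<zeta> = c *s formprod v \<xi> \<zeta>"
  "formprod v \<xi> (c *s \<zeta>) = c *s formprod v \<xi> \<zeta>"
  by (simp_all add: formprod_def vector_scale_matrix Mmat_scale vector_matrix_scale)

lemma formprod_sum: "formprod v (\<Sum>a\<in>S. \<xi>' a) \<zeta> = (\<Sum>a\<in>S. formprod v (\<xi>' a) \<zeta>)"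
  "formprod v \<xi> (\<Sum>a\<in>S. \<zeta>' a) = (\<Sum>a\<in>S. formprod v \<xi> (\<zeta>' a))"
proof -
  have z: "formprod v 0 \<zeta> = 0" "formprod v \<xi> 0 = 0"
    using formprod_scale(1)[of v 0 0 \<zeta>] formprod_scale(2)[of v \<xi> 0 0] by simp_all
  show "formprod v (\<Sum>a\<in>S. \<xi>' a) \<zeta> = (\<Sum>a\<in>S. formprod v (\<xi>' a) \<zeta>)"
    by (induction S rule: infinite_finite_induct) (auto simp: z formprod_add)
  show "formprod v \<xi> (\<Sum>a\<in>S. \<zeta>' a) = (\<Sum>a\<in>S. formprod v \<xi> (\<zeta>' a))"
    by (induction S rule: infinite_finite_induct) (auto simp: z formprod_add)
qed

end

text \<open>Local flat coordinates with degrees that may be zero: this version also serves the proof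
  that degree zero is impossible. Hence the constants \<open>K\<close>, which in degree zero cannot
  be normalized away.\<close>

locale flat_frame = flat_pencil g \<eta> \<Gamma>0 \<Gamma>1 \<theta> \<kappa> m v0 v1
  for g \<eta> :: "complex^'n::finite \<Rightarrow> complex^'n^'n" and \<Gamma>0 \<Gamma>1 \<theta> \<kappa> m v0 v1 +
  fixes V :: "(complex^'n) set" and f :: "'n \<Rightarrow> complex^'n \<Rightarrow> complex" and d K :: "'n \<Rightarrow> complex"
  assumes open_V: "open V" and V_\<eta>: "v \<in> V \<Longrightarrow> det (\<eta> v) \<noteq> 0" and flat_f: "flat_fun V (f a)"
    and eig: "v \<in> V \<Longrightarrow> dird (E v) (f a) v = d a * f a v + K a"
    and det_J': "v \<in> V \<Longrightarrow> det (\<chi> a i. pd i (f a) v) \<noteq> 0"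
begin

definition "J v = (\<chi> a i. pd i (f a) v)"

lemma det_J: "v \<in> V \<Longrightarrow> det (J v) \<noteq> 0" using det_J' by (simp add: J_def)

lemma J_nth [simp]: "J v $ a $ i = pd i (f a) v" by (simp add: J_def)
lemma J_row: "J v $ a = differential (f a) v" by (simp add: vec_eq_iff)

lemma hol_f: "mholomorphic_on V (f a)" using flat_f by (simp add: flat_fun_def)
lemma hol_pd: "mholomorphic_on V (pd i (f a))" by (rule mholomorphic_on_pd[OF open_V hol_f])
lemma hol_pd2: "mholomorphic_on V (pd j (pd i (f a)))" by (rule mholomorphic_on_pd[OF open_V hol_pd])
lemma hol_R: "mholomorphic_on V (\<lambda>v. R (f a) v $ i $ k)" by (rule P.mholomorphic_rhess[OF open_V hol_f])
lemmas cdV = mholomorphic_on_cdiff[OF hol_f] mholomorphic_on_cdiff[OF hol_pd] mholomorphic_on_cdiff[OF hol_pd2] 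
  mholomorphic_on_cdiff[OF hol_R]

definition H :: "complex^'n \<Rightarrow> complex^'n^'n" where
  "H v = J v ** \<eta> v ** transpose (J v)"

lemma H_nth: "H v $ a $ b = (\<Sum>i\<in>UNIV. \<Sum>j\<in>UNIV. pd i (f a) v * \<eta> v $ i $ j * pd j (f b) v)"
  by (simp add: H_def matrix_mult_nth transpose_nth sum_distrib_right) (rule sum.swap)

lemma H_sym: "transpose (H v) = H v"
  by (simp add: H_def matrix_transpose_mul \<eta>_sym matrix_mul_assoc)

lemma det_H: "v \<in> V \<Longrightarrow> det (H v) \<noteq> 0"
  using det_J V_\<eta> by (simp add: H_def det_mul)

lemma H_cdiff: "v \<in> V \<Longrightarrow> cdiff (\<lambda>v. H v $ a $ b) v"
  unfolding H_nth by (intro cdiff_intros cdV cd)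

lemma Hess_\<eta>:
  assumes v: "v \<in> V"
  shows "(\<Sum>j\<in>UNIV. \<eta> v $ i $ j * pd k (pd j (f b)) v) = - (\<Sum>j\<in>UNIV. \<Gamma>1 i j k v * pd j (f b) v)"
proof -
  have "(\<eta> v ** Hess (f b) v) $ i $ k = (- Gam \<Gamma>1 v (differential (f b) v)) $ i $ k"
    by (simp only: flat_fun_Hess[OF flat_f v V_\<eta>[OF v]])
  then show ?thesis by (simp add: matrix_mult_nth Hess_def Gam_nth pd_commute[OF open_V hol_f v, of k])
qed

text \<open>Compatibility of \<open>\<eta>\<close> with its connection gives two connection terms,
  and flatness of each of the two coordinates cancels one of them.\<close>

lemma pd_H:
  assumes v: "v \<in> V"
  shows "pd k (\<lambda>v. H v $ a $ b) v = 0"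
proof -
  have "pd k (\<lambda>v. H v $ a $ b) v = (\<Sum>i\<in>UNIV. \<Sum>j\<in>UNIV. pd k (pd i (f a)) v * \<eta> v $ i $ j * pd j (f b) v)
      + (\<Sum>i\<in>UNIV. \<Sum>j\<in>UNIV. pd i (f a) v * \<Gamma>1 j i k v * pd j (f b) v)
      + ((\<Sum>i\<in>UNIV. \<Sum>j\<in>UNIV. pd i (f a) v * \<Gamma>1 i j k v * pd j (f b) v)
      + (\<Sum>i\<in>UNIV. \<Sum>j\<in>UNIV. pd i (f a) v * \<eta> v $ i $ j * pd k (pd j (f b)) v))"
    unfolding H_nth by (simp add: pd_sum pd_mult cdiff_intros cdV[OF v] cd metric_\<eta> sum.distrib[symmetric] algebra_simps)
  also have "(\<Sum>i\<in>UNIV. \<Sum>j\<in>UNIV. pd i (f a) v * \<eta> v $ i $ j * pd k (pd j (f b)) v)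
      = (\<Sum>i\<in>UNIV. pd i (f a) v * (\<Sum>j\<in>UNIV. \<eta> v $ i $ j * pd k (pd j (f b)) v))"
    by (simp add: sum_distrib_left mult_ac)
  also have "\<dots> = - (\<Sum>i\<in>UNIV. \<Sum>j\<in>UNIV. pd i (f a) v * \<Gamma>1 i j k v * pd j (f b) v)"
    unfolding Hess_\<eta>[OF v] by (simp add: sum_distrib_left sum_negf mult_ac)
  also have "(\<Sum>i\<in>UNIV. \<Sum>j\<in>UNIV. pd k (pd i (f a)) v * \<eta> v $ i $ j * pd j (f b) v)
      = (\<Sum>j\<in>UNIV. pd j (f b) v * (\<Sum>i\<in>UNIV. \<eta> v $ j $ i * pd k (pd i (f a)) v))"
    by (subst sum.swap) (simp add: sum_distrib_left mult_ac symmetric_nth[OF \<eta>_sym, of v])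
  also have "\<dots> = - (\<Sum>j\<in>UNIV. \<Sum>i\<in>UNIV. pd i (f a) v * \<Gamma>1 j i k v * pd j (f b) v)"
    unfolding Hess_\<eta>[OF v] by (simp add: sum_distrib_left sum_negf mult_ac)
  also have "\<dots> = - (\<Sum>i\<in>UNIV. \<Sum>j\<in>UNIV. pd i (f a) v * \<Gamma>1 j i k v * pd j (f b) v)"
    by (subst sum.swap) simp
  finally show ?thesis by simp
qed

lemma dird_H: "v \<in> V \<Longrightarrow> dird X (\<lambda>v. H v $ a $ b) v = 0"
  by (simp add: dird_expand pd_H)

lemma E_J: "v \<in> V \<Longrightarrow> dird (E v) (pd i (f a)) v = (d a - \<theta> i) * pd i (f a) v"
  by (rule E_pd[OF open_V hol_f eig])

text \<open>\<open>H\<close> is constant and at the same time homogeneous of degree d_a + d_b -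
  \<kappa>, so \<open>\<eta>\<close> pairs only degrees that add up to \<kappa>.\<close>

lemma H_deg:
  assumes v: "v \<in> V"
  shows "(d a + d b - \<kappa>) * H v $ a $ b = 0"
proof -
  have "0 = dird (E v) (\<lambda>v. H v $ a $ b) v" by (simp add: dird_H[OF v])
  also have "\<dots> = (\<Sum>i\<in>UNIV. \<Sum>j\<in>UNIV. (d a + d b - \<kappa>) * (pd i (f a) v * \<eta> v $ i $ j * pd j (f b) v))"
    unfolding H_nth by (simp add: dird_sum dird_mult cdiff_intros cdV[OF v] cd E_J[OF v] E_\<eta> algebra_simps)
  also have "\<dots> = (d a + d b - \<kappa>) * H v $ a $ b"
    by (simp add: H_nth sum_distrib_left)
  finally show ?thesis by simp
qed

text \<open>For a flat function, the connection part of \<open>Bmat\<close> contracted with its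
  differential is the derivative of the partial derivatives along \<open>E\<close>, whose degree is
  known.\<close>

lemma J_B:
  assumes v: "v \<in> V"
  shows "J v ** Bmat v = diagm d ** J v"
proof -
  have "(J v ** Bmat v) $ a $ j = d a * pd j (f a) v" for a j
  proof -
    have "(J v ** Bmat v) $ a $ j = \<theta> j * pd j (f a) v + (\<Sum>k\<in>UNIV. pd k (f a) v * (\<Sum>i\<in>UNIV. E v $ i * christoffel pd (\<lambda>u. matrix_inv (\<eta> u)) k i j v))"
      by (simp add: matrix_mult_nth Bmat_def distrib_left sum.distrib if_distrib[of "\<lambda>x. _ * x"] mult.commute cong: if_cong)
    also have "(\<Sum>k\<in>UNIV. pd k (f a) v * (\<Sum>i\<in>UNIV. E v $ i * christoffel pd (\<lambda>u. matrix_inv (\<eta> u)) k i j v))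
       = (\<Sum>i\<in>UNIV. E v $ i * (\<Sum>k\<in>UNIV. christoffel pd (\<lambda>u. matrix_inv (\<eta> u)) k i j v * pd k (f a) v))"
      by (simp add: sum_distrib_left mult_ac, (rule sum.swap)?)
    also have "\<dots> = dird (E v) (pd j (f a)) v"
      using flat_f[of a] v by (simp add: flat_fun_def dird_expand)
    finally show ?thesis by (simp add: E_J[OF v] algebra_simps)
  qed
  then show ?thesis by (simp add: vec_eq_iff diagm_mult)
qed

lemma R_commute: "v \<in> V \<Longrightarrow> R (f a) v ** R (f b) v = R (f b) v ** R (f a) v"
  by (rule curl_R_and_commute(2)[OF open_V V_\<eta> flat_f flat_f])

text \<open>Both sides are \<open>dlog\<close> times a product of the two Hessians, and these
  commute. Without division by degrees the identity remains available in degree zero.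
  \<open>dlog\<close> needs nonzero coordinates, so the identity is extended to all of
  \<open>V\<close> by density.\<close>

lemma JR_symmetric:
  assumes v: "v \<in> V"
  shows "d a *s (J v $ a v* R (f b) v) = d b *s (J v $ b v* R (f a) v)"
proof -
  have "d a * (J v $ a v* R (f b) v) $ k - d b * (J v $ b v* R (f a) v) $ k = 0" for k
  proof (rule continuous_eq_0_dense[where f = "\<lambda>v. \<Prod>i\<in>UNIV. v $ i" and V = V and ?v0.0 = "\<chi> i. 1"
        and g = "\<lambda>v. d a * (J v $ a v* R (f b) v) $ k - d b * (J v $ b v* R (f a) v) $ k"])
    show "entire (\<lambda>v::complex^'n. \<Prod>i\<in>UNIV. v $ i)" by (intro entireI cdiff_intros)
    show "continuous_on V (\<lambda>v. d a * (J v $ a v* R (f b) v) $ k - d b * (J v $ b v* R (f a) v) $ k)"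
      by (rule continuous_on_mholomorphic, unfold mholomorphic_on_iff_cdiff vector_matrix_nth J_nth, intro ballI cdiff_intros cdV)
    fix u assume u: "u \<in> V" "(\<Prod>i\<in>UNIV. u $ i) \<noteq> 0"
    then have nz: "\<And>i. m i > 0 \<Longrightarrow> u $ i \<noteq> 0" by auto
    have *: "d a *s (J u $ a) v* R (f b) u = dlog u v* (R (f a) u ** R (f b) u)" for a b
    proof -
      have "dlog u v* R (f a) u = d a *s differential (f a) u"
        by (rule dlog_R[OF open_V hol_f eig u(1) nz])
      then show ?thesis by (simp only: J_row vector_matrix_mul_assoc[symmetric])
    qed
    have "d a *s (J u $ a v* R (f b) u) = d b *s (J u $ b v* R (f a) u)"
      using *[of a b] *[of b a] R_commute[OF u(1), of a b] by (simp add: vector_scale_matrix)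
    then show "d a * (J u $ a v* R (f b) u) $ k - d b * (J u $ b v* R (f a) u) $ k = 0"
      by (simp add: vec_eq_iff)
  qed (use open_V v in auto)
  then show ?thesis by (simp add: vec_eq_iff)
qed

lemma expand_J:
  assumes "v \<in> V"
  shows "\<xi> = (\<Sum>a\<in>UNIV. (\<xi> v* matrix_inv (J v)) $ a *s J v $ a)"
proof -
  have "\<xi> = (\<xi> v* matrix_inv (J v)) v* J v"
    by (simp add: vector_matrix_mul_assoc matrix_inv_det[OF det_J[OF assms]])
  also have "\<dots> = (\<Sum>a\<in>UNIV. (\<xi> v* matrix_inv (J v)) $ a *s J v $ a)"
    by (simp add: vec_eq_iff vector_matrix_nth mult.commute)
  finally show ?thesis .
qed

lemma J_row_eqI:
  assumes "v \<in> V" "(\<Sum>a\<in>UNIV. x a *s J v $ a) = (\<Sum>a\<in>UNIV. y a *s J v $ a)"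
  shows "x a = y a"
proof -
  have "(\<chi> a. x a) v* J v = (\<chi> a. y a) v* J v"
    using assms(2) by (simp add: vec_eq_iff vector_matrix_nth mult.commute)
  then have "((\<chi> a. x a) v* J v) v* matrix_inv (J v) = ((\<chi> a. y a) v* J v) v* matrix_inv (J v)" by simp
  then have "(\<chi> a. x a) = (\<chi> a. y a)"
    by (simp only: vector_matrix_mul_assoc matrix_inv_det[OF det_J[OF assms(1)]] vector_matrix_mul_rid)
  then show ?thesis by (simp add: vec_eq_iff)
qed

end

locale eigen_frame = flat_frame +
  assumes d: "d a \<noteq> 0"
begin

lemma det_B:
  assumes v: "v \<in> V"
  shows "det (Bmat v) \<noteq> 0"
proof -
  have "det (J v) * det (Bmat v) = det (diagm d) * det (J v)"
    using J_B[OF v] by (simp flip: det_mul)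
  then show ?thesis using det_J[OF v] det_diagm[of d] d by (auto simp: mult.commute)
qed

lemma Mmat_J:
  assumes v: "v \<in> V"
  shows "Mmat v (J v $ b) = (\<chi> i j. \<kappa> / d b * R (f b) v $ i $ j)"
proof -
  have "diagm (\<lambda>a. 1 / d a) ** (J v ** Bmat v) = J v"
    unfolding J_B[OF v] by (simp add: vec_eq_iff diagm_mult d)
  then have "J v ** matrix_inv (Bmat v) = diagm (\<lambda>a. 1 / d a) ** J v ** (Bmat v ** matrix_inv (Bmat v))"
    by (metis matrix_mul_assoc)
  then have "J v ** matrix_inv (Bmat v) = diagm (\<lambda>a. 1 / d a) ** J v"
    by (simp add: matrix_inv_det[OF det_B[OF v]])
  then have "J v $ b v* matrix_inv (Bmat v) = (1 / d b) *s J v $ b"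
    unfolding row_mult[symmetric] by (simp add: vec_eq_iff diagm_mult)
  then show ?thesis
    unfolding Mmat_def by (simp only: Rmat_scale) (simp add: J_row R_Rmat[OF flat_f v V_\<eta>[OF v]] vec_eq_iff)
qed

lemma formprod_J:
  assumes v: "v \<in> V"
  shows "formprod v (J v $ a) (J v $ b) = (\<kappa> / d b) *s (J v $ a v* R (f b) v)"
  by (simp only: formprod_def Mmat_J[OF v] vector_matrix_scale)

lemma formprod_J_commute:
  assumes v: "v \<in> V"
  shows "formprod v (J v $ a) (J v $ b) = formprod v (J v $ b) (J v $ a)"
proof -
  have "(\<kappa> / d b) *s (J v $ a v* R (f b) v) = (\<kappa> / (d a * d b)) *s (d a *s (J v $ a v* R (f b) v))"
    using d by (simp add: vec_eq_iff)
  also have "\<dots> = (\<kappa> / d a) *s (J v $ b v* R (f a) v)"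
    by (subst JR_symmetric[OF v, of a b]) (use d in \<open>simp add: vec_eq_iff\<close>)
  finally show ?thesis by (simp add: formprod_J[OF v])
qed

lemma formprod_commute:
  assumes v: "v \<in> V"
  shows "formprod v \<xi> \<zeta> = formprod v \<zeta> \<xi>"
proof -
  define x y where "x = \<xi> v* matrix_inv (J v)" and "y = \<zeta> v* matrix_inv (J v)"
  have *: "formprod v (\<Sum>a\<in>UNIV. x $ a *s J v $ a) (\<Sum>b\<in>UNIV. y $ b *s J v $ b)
      = (\<Sum>a\<in>UNIV. \<Sum>b\<in>UNIV. (x $ a * y $ b) *s formprod v (J v $ a) (J v $ b))" for x y
    by (simp only: formprod_sum(1) formprod_scale(1))
      (simp only: formprod_sum(2) formprod_scale(2), simp add: vec_eq_iff sum_distrib_left mult_ac)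
  have "formprod v (\<Sum>a\<in>UNIV. x $ a *s J v $ a) (\<Sum>b\<in>UNIV. y $ b *s J v $ b)
      = (\<Sum>a\<in>UNIV. \<Sum>b\<in>UNIV. (y $ b * x $ a) *s formprod v (J v $ b) (J v $ a))"
    unfolding * by (simp only: formprod_J_commute[OF v, of _ _] mult.commute)
  also have "\<dots> = formprod v (\<Sum>b\<in>UNIV. y $ b *s J v $ b) (\<Sum>a\<in>UNIV. x $ a *s J v $ a)"
    unfolding * by (rule sum.swap)
  finally have "formprod v (\<Sum>a\<in>UNIV. x $ a *s J v $ a) (\<Sum>b\<in>UNIV. y $ b *s J v $ b)
      = formprod v (\<Sum>b\<in>UNIV. y $ b *s J v $ b) (\<Sum>a\<in>UNIV. x $ a *s J v $ a)" .
  then show ?thesis unfolding x_def y_def by (simp only: expand_J[OF v, symmetric])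
qed

lemma Mmat_expand:
  assumes v: "v \<in> V"
  shows "Mmat v \<zeta> = (\<chi> i j. \<Sum>b\<in>UNIV. (\<zeta> v* matrix_inv (J v)) $ b * Mmat v (J v $ b) $ i $ j)"
proof -
  have z: "Mmat v 0 = 0" using Mmat_scale[of v 0 0] by (simp add: vec_eq_iff)
  have "Mmat v (\<Sum>b\<in>S. y b *s J v $ b) = (\<chi> i j. \<Sum>b\<in>S. y b * Mmat v (J v $ b) $ i $ j)" for S y
    by (induction S rule: infinite_finite_induct) (simp_all add: z Mmat_add Mmat_scale vec_eq_iff)
  then show ?thesis by (subst expand_J[OF v, of \<zeta>]) simp
qed

lemma Mmat_commute:
  assumes v: "v \<in> V"
  shows "Mmat v \<xi> ** Mmat v \<zeta> = Mmat v \<zeta> ** Mmat v \<xi>"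
proof -
  have J: "Mmat v (J v $ a) ** Mmat v (J v $ b) = Mmat v (J v $ b) ** Mmat v (J v $ a)" for a b
  proof -
    have "(\<Sum>k\<in>UNIV. R (f a) v $ i $ k * R (f b) v $ k $ j) = (\<Sum>k\<in>UNIV. R (f b) v $ i $ k * R (f a) v $ k $ j)" for i j
      using R_commute[OF v, of a b] by (simp add: vec_eq_iff matrix_mult_nth)
    then have "(\<Sum>k\<in>UNIV. c * R (f a) v $ i $ k * (e * R (f b) v $ k $ j)) = (\<Sum>k\<in>UNIV. e * R (f b) v $ i $ k * (c * R (f a) v $ k $ j))" for i j c e
      by (simp add: sum_distrib_left[symmetric] mult_ac)
    then show ?thesis unfolding Mmat_J[OF v] vec_eq_iff matrix_mult_nth vec_lambda_beta by blast
  qed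
  have J1: "Mmat v (J v $ a) ** Mmat v \<zeta> = Mmat v \<zeta> ** Mmat v (J v $ a)" for a \<zeta>
  proof -
    have "(Mmat v (J v $ a) ** Mmat v \<zeta>) $ i $ j = (\<Sum>b\<in>UNIV. (\<zeta> v* matrix_inv (J v)) $ b * (Mmat v (J v $ a) ** Mmat v (J v $ b)) $ i $ j)" for i j
      unfolding Mmat_expand[OF v, of \<zeta>] by (simp add: matrix_mult_nth sum_distrib_left mult_ac, (rule sum.swap)?)
    also have "(\<Sum>b\<in>UNIV. (\<zeta> v* matrix_inv (J v)) $ b * (Mmat v (J v $ a) ** Mmat v (J v $ b)) $ i $ j) = (Mmat v \<zeta> ** Mmat v (J v $ a)) $ i $ j" for i j
      unfolding J Mmat_expand[OF v, of \<zeta>] by (simp add: matrix_mult_nth sum_distrib_left sum_distrib_right mult_ac, (rule sum.swap)?)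
    finally show ?thesis by (simp add: vec_eq_iff)
  qed
  have "(Mmat v \<xi> ** Mmat v \<zeta>) $ i $ j = (\<Sum>b\<in>UNIV. (\<xi> v* matrix_inv (J v)) $ b * (Mmat v (J v $ b) ** Mmat v \<zeta>) $ i $ j)" for i j
    by (subst Mmat_expand[OF v, of \<xi>], simp add: matrix_mult_nth sum_distrib_left sum_distrib_right mult_ac, (rule sum.swap)?)
  also have "(\<Sum>b\<in>UNIV. (\<xi> v* matrix_inv (J v)) $ b * (Mmat v (J v $ b) ** Mmat v \<zeta>) $ i $ j) = (Mmat v \<zeta> ** Mmat v \<xi>) $ i $ j" for i j
    unfolding J1 by (subst Mmat_expand[OF v, of \<xi>], simp add: matrix_mult_nth sum_distrib_left sum_distrib_right mult_ac, (rule sum.swap)?)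
  finally show ?thesis by (simp add: vec_eq_iff)
qed

text \<open>Commutativity reduces associativity to the statement that multiplications by two
  one-forms commute as matrices.\<close>

lemma formprod_assoc:
  assumes v: "v \<in> V"
  shows "formprod v (formprod v \<xi> \<zeta>) \<xi>' = formprod v \<xi> (formprod v \<zeta> \<xi>')"
proof -
  have "formprod v \<xi> (formprod v \<zeta> \<xi>') = \<zeta> v* (Mmat v \<xi>' ** Mmat v \<xi>)"
    by (subst formprod_commute[OF v]) (simp add: formprod_def vector_matrix_mul_assoc)
  also have "\<dots> = formprod v (formprod v \<zeta> \<xi>) \<xi>'"
    by (simp add: Mmat_commute[OF v, of \<xi>'] formprod_def vector_matrix_mul_assoc)
  finally show ?thesis by (simp add: formprod_commute[OF v, of \<zeta>])
qed

text \<open>The symmetry for \<open>\<eta>\<close> is the invariance of the bilinear form; the one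
  for \<open>g\<close> identifies the intersection form.\<close>

lemma Mmat_sym:
  assumes v: "v \<in> V"
  shows "transpose (Mmat v \<zeta> ** \<eta> v) = Mmat v \<zeta> ** \<eta> v" and "transpose (Mmat v \<zeta> ** g v) = Mmat v \<zeta> ** g v"
proof -
  have *: "transpose (Mmat v \<zeta> ** A) = Mmat v \<zeta> ** A" if "\<And>b. transpose (R (f b) v ** A) = R (f b) v ** A" for A
  proof -
    have "(Mmat v \<zeta> ** A) $ i $ j = (\<Sum>b\<in>UNIV. (\<zeta> v* matrix_inv (J v)) $ b * (\<kappa> / d b) * (R (f b) v ** A) $ i $ j)" for i j
      by (subst Mmat_expand[OF v], simp add: matrix_mult_nth sum_distrib_left sum_distrib_right mult_ac Mmat_J[OF v]) (rule sum.swap)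
    then show ?thesis using symmetric_nth[OF that] by (simp add: vec_eq_iff transpose_nth)
  qed
  show "transpose (Mmat v \<zeta> ** \<eta> v) = Mmat v \<zeta> ** \<eta> v"
    by (rule *) (rule R_\<eta>_sym[OF open_V flat_f v V_\<eta>[OF v]])
  show "transpose (Mmat v \<zeta> ** g v) = Mmat v \<zeta> ** g v"
    by (rule *) (rule P.rhess_sym[OF open_V hol_f v])
qed

text \<open>The factors \<kappa>/d_b and the eigenvalues d_b from \<open>dlog_R\<close> cancel. Thus
  \<open>dlog\<close> divided by \<kappa> is the unit among one-forms.\<close>

lemma dlog_Mmat:
  assumes v: "v \<in> V" and nz: "\<And>i. m i > 0 \<Longrightarrow> v $ i \<noteq> 0"
  shows "dlog v v* Mmat v \<zeta> = \<kappa> *s \<zeta>"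
proof -
  define y c where "y = (\<lambda>b. (\<zeta> v* matrix_inv (J v)) $ b)" and "c = (\<lambda>b. \<kappa> / d b)"
  have M: "Mmat v \<zeta> = (\<chi> i j. \<Sum>b\<in>UNIV. y b * (c b * R (f b) v $ i $ j))"
    by (subst Mmat_expand[OF v]) (simp add: y_def c_def Mmat_J[OF v])
  have "dlog v v* Mmat v \<zeta> = (\<Sum>b\<in>UNIV. y b *s (c b *s (dlog v v* R (f b) v)))"
    unfolding M
    by (simp add: vec_eq_iff vector_matrix_nth sum_distrib_left sum_distrib_right mult_ac)
      (rule allI, rule sum.swap)
  also have "\<dots> = (\<Sum>b\<in>UNIV. y b *s (\<kappa> *s J v $ b))"
  proof -
    have "dlog v v* R (f b) v = d b *s J v $ b" for b
      unfolding J_row by (rule dlog_R[OF open_V hol_f eig v nz])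
    then show ?thesis using d by (simp add: c_def vec_eq_iff mult.assoc)
  qed
  finally have "dlog v v* Mmat v \<zeta> = (\<Sum>b\<in>UNIV. (\<zeta> v* matrix_inv (J v)) $ b *s (\<kappa> *s J v $ b))"
    unfolding y_def .
  also have "\<dots> = \<kappa> *s (\<Sum>b\<in>UNIV. (\<zeta> v* matrix_inv (J v)) $ b *s J v $ b)"
    by (simp add: vec_eq_iff sum_distrib_left mult_ac)
  also have "\<dots> = \<kappa> *s \<zeta>" by (simp only: expand_J[OF v, symmetric])
  finally show ?thesis .
qed

end

section \<open>Covariant derivatives in a flat frame\<close>

lemma bil_contract: "bil A \<xi> \<zeta> = contract (\<xi> v* A) \<zeta>"
  by (simp add: bil_def contract_def vector_matrix_nth sum_distrib_right sum_distrib_left mult_ac) (rule sum.swap)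

lemma axis_vector_matrix: "(axis j 1 v* (A :: complex^'n::finite^'n)) $ i = A $ j $ i"
  by (simp add: vector_matrix_nth axis_def if_distrib[of "\<lambda>x. _ * x"] cong: if_cong)

lemma sum_swap3: "(\<Sum>a\<in>A. \<Sum>b\<in>B. \<Sum>c\<in>C. F a b c) = (\<Sum>c\<in>C. \<Sum>b\<in>B. \<Sum>a\<in>A. F a b c)"
proof -
  have "(\<Sum>a\<in>A. \<Sum>b\<in>B. \<Sum>c\<in>C. F a b c) = (\<Sum>a\<in>A. \<Sum>c\<in>C. \<Sum>b\<in>B. F a b c)"
    by (rule sum.cong[OF refl], rule sum.swap)
  also have "\<dots> = (\<Sum>c\<in>C. \<Sum>a\<in>A. \<Sum>b\<in>B. F a b c)" by (rule sum.swap)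
  also have "\<dots> = (\<Sum>c\<in>C. \<Sum>b\<in>B. \<Sum>a\<in>A. F a b c)"
    by (rule sum.cong[OF refl], rule sum.swap)
  finally show ?thesis .
qed

lemma linear_vec_iff: "Vector_Spaces.linear (*s) (*s) (T :: complex^'n::finite \<Rightarrow> complex^'n) \<longleftrightarrow>
    (\<forall>x y. T (x + y) = T x + T y) \<and> (\<forall>c x. T (c *s x) = c *s T x)"
  by (auto simp: Vector_Spaces.linear_def module_hom_def module_hom_axioms_def vec.vector_space_axioms vec.module_axioms)

lemma linear_scalar_iff: "Vector_Spaces.linear (*s) (*) (T :: complex^'n::finite \<Rightarrow> complex) \<longleftrightarrow>
    (\<forall>x y. T (x + y) = T x + T y) \<and> (\<forall>c x. T (c *s x) = c * T x)"
proof -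
  have "vector_space ((*) :: complex \<Rightarrow> complex \<Rightarrow> complex)" by unfold_locales (auto simp: algebra_simps)
  then show ?thesis
    by (auto simp: Vector_Spaces.linear_def module_hom_def module_hom_axioms_def vec.vector_space_axioms vec.module_axioms
      module_iff_vector_space)
qed

lemma vfield_cdiff: "vfield_on V X \<Longrightarrow> v \<in> V \<Longrightarrow> cdiff (\<lambda>v. X v $ k) v"
  by (simp add: vfield_on_def mholomorphic_on_iff_cdiff)

lemma cdiff_dird:
  assumes "open V" "mholomorphic_on V \<phi>" "v \<in> V" "\<And>k. cdiff (\<lambda>u. Y u $ k) v"
  shows "cdiff (\<lambda>u. dird (Y u) \<phi> u) v"
  unfolding dird_expand using mholomorphic_on_cdiff[OF mholomorphic_on_pd[OF assms(1,2)] assms(3)]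
  by (intro cdiff_intros assms(4))

lemma dird_dird:
  assumes "open V" "mholomorphic_on V \<phi>" "v \<in> V" "\<And>k. cdiff (\<lambda>u. Y u $ k) v"
  shows "dird X (\<lambda>u. dird (Y u) \<phi> u) v = (\<Sum>k\<in>UNIV. dird X (\<lambda>u. Y u $ k) v * pd k \<phi> v + Y v $ k * dird X (pd k \<phi>) v)"
  unfolding dird_expand[of "Y _"] using mholomorphic_on_cdiff[OF mholomorphic_on_pd[OF assms(1,2)] assms(3)]
  by (simp add: dird_sum dird_mult cdiff_intros assms(4))

lemma dird_lie_bracket:
  assumes "open V" "mholomorphic_on V \<phi>" "v \<in> V" "\<And>k. cdiff (\<lambda>u. X u $ k) v" "\<And>k. cdiff (\<lambda>u. Y u $ k) v"
  shows "dird (lie_bracket X Y v) \<phi> v = dird (X v) (\<lambda>u. dird (Y u) \<phi> u) v - dird (Y v) (\<lambda>u. dird (X u) \<phi> u) v"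
proof -
  have "(\<Sum>k\<in>UNIV. Y v $ k * dird (X v) (pd k \<phi>) v) = (\<Sum>k\<in>UNIV. X v $ k * dird (Y v) (pd k \<phi>) v)"
    by (simp add: dird_expand sum_distrib_left mult_ac) (subst sum.swap, simp add: pd_commute[OF assms(1-3)] mult_ac)
  then show ?thesis
    unfolding dird_expand[of "lie_bracket X Y v"]
    by (simp add: dird_dird[OF assms(1-3)] assms(4,5) sum.distrib lie_bracket_def left_diff_distrib sum_subtractf)
qed

context flat_pencil
begin

abbreviation "b \<equiv> covariant_form \<eta>"

lemma flat_sharp: "det (\<eta> v) \<noteq> 0 \<Longrightarrow> flat \<eta> v (sharp \<eta> v \<xi>) = \<xi>"
  by (simp add: flat_def sharp_def vector_matrix_mul_assoc matrix_inv_det)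

lemma sharp_flat: "det (\<eta> v) \<noteq> 0 \<Longrightarrow> sharp \<eta> v (flat \<eta> v X) = X"
  by (simp add: flat_def sharp_def vector_matrix_mul_assoc matrix_inv_det)

lemma flat_add: "flat \<eta> v (X + Y) = flat \<eta> v X + flat \<eta> v Y"
  by (simp add: flat_def vector_matrix_left_distrib)
lemma flat_scale: "flat \<eta> v (c *s X) = c *s flat \<eta> v X"
  by (simp add: flat_def vector_scale_matrix)
lemma sharp_add: "sharp \<eta> v (X + Y) = sharp \<eta> v X + sharp \<eta> v Y"
  by (simp add: sharp_def vector_matrix_left_distrib)
lemma sharp_scale: "sharp \<eta> v (c *s X) = c *s sharp \<eta> v X"
  by (simp add: sharp_def vector_scale_matrix)

lemma \<eta>_inv_sym: "det (\<eta> v) \<noteq> 0 \<Longrightarrow> transpose (matrix_inv (\<eta> v)) = matrix_inv (\<eta> v)"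
  using transpose_matrix_inv[of "\<eta> v"] by (simp add: \<eta>_sym)

lemma b_eq: "det (\<eta> v) \<noteq> 0 \<Longrightarrow> b v X Y = contract X (flat \<eta> v Y)"
  by (simp add: covariant_form_def bil_contract sharp_flat[unfolded sharp_def])

lemma bil_\<eta>_sym: "bil (\<eta> v) \<xi> \<zeta> = bil (\<eta> v) \<zeta> \<xi>"
  unfolding bil_def by (subst sum.swap) (simp add: symmetric_nth[OF \<eta>_sym, of v] mult_ac)

lemma b_sym: "b v X Y = b v Y X"
  by (simp add: covariant_form_def bil_\<eta>_sym)

lemma gram_b: "det (\<eta> v) \<noteq> 0 \<Longrightarrow> gram b v = matrix_inv (\<eta> v)"
  using symmetric_nth[OF \<eta>_inv_sym] by (simp add: gram_def b_eq flat_def vec_eq_iff axis_vector_matrix)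

lemma open_\<eta>: "open {v. det (\<eta> v) \<noteq> 0}"
  by (intro entire_open_nonzero entireI cdiff_det cd)

lemma christoffel_gram:
  assumes "det (\<eta> v) \<noteq> 0"
  shows "christoffel pd (gram b) k i j v = christoffel pd (\<lambda>u. matrix_inv (\<eta> u)) k i j v"
proof -
  have "pd k (\<lambda>u. gram b u $ i $ j) v = pd k (\<lambda>u. matrix_inv (\<eta> u) $ i $ j) v" for k i j
    by (rule open_cong_pd(1)[OF open_\<eta>]) (use assms gram_b in auto)
  then show ?thesis by (simp add: christoffel_def gram_b[OF assms])
qed

lemma cdiff_christoffel:
  assumes "det (\<eta> v) \<noteq> 0"
  shows "cdiff (christoffel pd (\<lambda>u. matrix_inv (\<eta> u)) k i j) v"
proof -
  have "cdiff (\<lambda>v. - (\<Sum>l\<in>UNIV. matrix_inv (\<eta> v) $ i $ l * \<Gamma>1 l k j v)) v"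
    by (intro cdiff_intros cd cdiff_matrix_inv assms)
  moreover have "cdiff (christoffel pd (\<lambda>u. matrix_inv (\<eta> u)) k i j) v = cdiff (\<lambda>v. - (\<Sum>l\<in>UNIV. matrix_inv (\<eta> v) $ i $ l * \<Gamma>1 l k j v)) v"
    by (rule open_cong_pd(2)[OF open_\<eta>]) (use assms christoffel_\<eta>' in auto)
  ultimately show ?thesis by simp
qed

lemma cdiff_cov_deriv:
  assumes V: "open V" "\<And>v. v \<in> V \<Longrightarrow> det (\<eta> v) \<noteq> 0" and X: "vfield_on V X" and Y: "vfield_on V Y" and v: "v \<in> V"
  shows "cdiff (\<lambda>v. cov_deriv b X Y v $ k) v"
proof -
  have "cdiff (\<lambda>v. dird (X v) (\<lambda>u. Y u $ k) v + (\<Sum>i\<in>UNIV. \<Sum>j\<in>UNIV. christoffel pd (\<lambda>u. matrix_inv (\<eta> u)) k i j v * X v $ i * Y v $ j)) v"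
    by (intro cdiff_intros cdiff_christoffel V(2) v vfield_cdiff[OF X] vfield_cdiff[OF Y] cdiff_dird[OF V(1)] Y[unfolded vfield_on_def, rule_format])
  moreover have "cdiff (\<lambda>v. cov_deriv b X Y v $ k) v = cdiff (\<lambda>v. dird (X v) (\<lambda>u. Y u $ k) v + (\<Sum>i\<in>UNIV. \<Sum>j\<in>UNIV. christoffel pd (\<lambda>u. matrix_inv (\<eta> u)) k i j v * X v $ i * Y v $ j)) v"
    by (rule open_cong_pd(2)[OF V(1) v]) (simp add: cov_deriv_def christoffel_gram V(2))
  ultimately show ?thesis by simp
qed

definition mulv :: "complex^'n \<Rightarrow> complex^'n \<Rightarrow> complex^'n \<Rightarrow> complex^'n" where
  "mulv v X Y = sharp \<eta> v (formprod v (flat \<eta> v X) (flat \<eta> v Y))"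

end

context flat_frame
begin

text \<open>Flat functions absorb the Christoffel symbols: read through \<open>f a\<close>,
  covariant differentiation is ordinary differentiation. Together with \<open>dird_eqI\<close> this
  reduces tensor identities to scalar ones.\<close>

lemma cov_J:
  assumes v: "v \<in> V" and Y: "\<And>k. cdiff (\<lambda>u. Y u $ k) v"
  shows "dird (cov_deriv b X Y v) (f a) v = dird (X v) (\<lambda>u. dird (Y u) (f a) u) v"
proof -
  have "(\<Sum>k\<in>UNIV. (\<Sum>i\<in>UNIV. \<Sum>j\<in>UNIV. christoffel pd (gram b) k i j v * X v $ i * Y v $ j) * pd k (f a) v)
      = (\<Sum>j\<in>UNIV. Y v $ j * (\<Sum>i\<in>UNIV. X v $ i * (\<Sum>k\<in>UNIV. christoffel pd (\<lambda>u. matrix_inv (\<eta> u)) k i j v * pd k (f a) v)))"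
    unfolding christoffel_gram[OF V_\<eta>[OF v]] sum_distrib_left sum_distrib_right
    by (subst sum_swap3) (simp add: mult_ac)
  also have "\<dots> = (\<Sum>j\<in>UNIV. Y v $ j * dird (X v) (pd j (f a)) v)"
    using flat_f[of a] v by (simp add: flat_fun_def dird_expand)
  finally show ?thesis
    unfolding dird_expand[of "cov_deriv b X Y v"]
    by (simp add: dird_dird[OF open_V hol_f v Y] cov_deriv_def distrib_right sum.distrib)
qed

lemma dird_eqI:
  assumes v: "v \<in> V" and "\<And>a. dird X (f a) v = dird Y (f a) v"
  shows "X = Y"
proof -
  have "J v *v X = J v *v Y"
    using assms(2) by (simp add: vec_eq_iff matrix_vector_mult_def dird_expand mult.commute)
  then have "matrix_inv (J v) *v (J v *v X) = matrix_inv (J v) *v (J v *v Y)" by simp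
  then show ?thesis by (simp add: matrix_vector_mul_assoc matrix_inv_det[OF det_J[OF v]])
qed

lemma dird_diff_vec: "dird (X - Y) \<phi> v = dird X \<phi> v - dird Y \<phi> v"
  by (simp add: dird_def contract_diff)
lemma flat_connection:
  assumes V': "open V'" "V' \<subseteq> V" and X: "vfield_on V' X" and Y: "vfield_on V' Y" and Z: "vfield_on V' Z" and v: "v \<in> V'"
  shows "cov_deriv b X (cov_deriv b Y Z) v - cov_deriv b Y (cov_deriv b X Z) v - cov_deriv b (lie_bracket X Y) Z v = 0"
proof -
  have vV: "v \<in> V" using V' v by blast
  have \<eta>V': "\<And>u. u \<in> V' \<Longrightarrow> det (\<eta> u) \<noteq> 0" using V' V_\<eta> by blast
  have c: "dird (cov_deriv b X (cov_deriv b Y Z) v) (f a) v = dird (X v) (\<lambda>u. dird (Y u) (\<lambda>u. dird (Z u) (f a) u) u) v"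
    if X: "vfield_on V' X" and Y: "vfield_on V' Y" for X Y a
  proof -
    have "dird (cov_deriv b X (cov_deriv b Y Z) v) (f a) v = dird (X v) (\<lambda>u. dird (cov_deriv b Y Z u) (f a) u) v"
      by (rule cov_J[OF vV]) (rule cdiff_cov_deriv[OF V'(1) \<eta>V' Y Z v])
    also have "\<dots> = dird (X v) (\<lambda>u. dird (Y u) (\<lambda>u. dird (Z u) (f a) u) u) v"
      by (rule open_cong_pd(4)[OF V'(1) v]) (rule cov_J, use V' in blast, rule vfield_cdiff[OF Z])
    finally show ?thesis .
  qed
  have hol: "mholomorphic_on V' (\<lambda>u. dird (Z u) (f a) u)" for a
    unfolding mholomorphic_on_iff_cdiff using cdiff_dird[OF open_V hol_f _ vfield_cdiff[OF Z]] V' by blast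
  have "cov_deriv b X (cov_deriv b Y Z) v - cov_deriv b Y (cov_deriv b X Z) v = cov_deriv b (lie_bracket X Y) Z v"
  proof (rule dird_eqI[OF vV])
    fix a
    show "dird (cov_deriv b X (cov_deriv b Y Z) v - cov_deriv b Y (cov_deriv b X Z) v) (f a) v = dird (cov_deriv b (lie_bracket X Y) Z v) (f a) v"
      unfolding dird_diff_vec c[OF X Y] c[OF Y X] cov_J[OF vV vfield_cdiff[OF Z v]]
        dird_lie_bracket[OF V'(1) hol v vfield_cdiff[OF X v] vfield_cdiff[OF Y v]] ..
  qed
  then show ?thesis by simp
qed

text \<open>The components of a vector in the parallel frame of the gradients of the functions \<open>f a\<close>.\<close>

definition comp :: "complex^'n \<Rightarrow> complex^'n \<Rightarrow> complex^'n" where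
  "comp v X = matrix_inv (H v) *v (J v *v X)"

lemma H_comp: "v \<in> V \<Longrightarrow> dird X (f a) v = (\<Sum>b\<in>UNIV. H v $ a $ b * comp v X $ b)"
proof -
  assume v: "v \<in> V"
  have "H v *v comp v X = J v *v X"
    by (simp add: comp_def matrix_vector_mul_assoc matrix_mul_assoc matrix_inv_det[OF det_H[OF v]])
  then have "(H v *v comp v X) $ a = (J v *v X) $ a" by simp
  then show ?thesis by (simp add: matrix_vector_mult_def dird_expand mult.commute)
qed

lemma comp_eqI:
  assumes v: "v \<in> V" and "\<And>a. (\<Sum>b\<in>UNIV. H v $ a $ b * x $ b) = (\<Sum>b\<in>UNIV. H v $ a $ b * y $ b)"
  shows "x = y"
proof -
  have "H v *v x = H v *v y"
    using assms(2) by (simp add: vec_eq_iff matrix_vector_mult_def)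
  then have "matrix_inv (H v) *v (H v *v x) = matrix_inv (H v) *v (H v *v y)" by simp
  then show ?thesis by (simp add: matrix_vector_mul_assoc matrix_inv_det[OF det_H[OF v]])
qed

lemma flat_comp: "v \<in> V \<Longrightarrow> flat \<eta> v X = (\<Sum>a\<in>UNIV. comp v X $ a *s J v $ a)"
proof -
  assume v: "v \<in> V"
  let ?x = "comp v X"
  have "J v *v (\<eta> v *v (transpose (J v) *v ?x)) = J v *v X"
  proof -
    have "J v *v (\<eta> v *v (transpose (J v) *v ?x)) = H v *v ?x"
      by (simp only: H_def matrix_vector_mul_assoc matrix_mul_assoc)
    then show ?thesis by (simp add: comp_def matrix_vector_mul_assoc matrix_mul_assoc matrix_inv_det[OF det_H[OF v]])
  qed
  then have "matrix_inv (J v) *v (J v *v (\<eta> v *v (transpose (J v) *v ?x))) = matrix_inv (J v) *v (J v *v X)" by simp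
  then have X: "\<eta> v *v (transpose (J v) *v ?x) = X"
    by (simp add: matrix_vector_mul_assoc matrix_mul_assoc matrix_inv_det[OF det_J[OF v]])
  have "sharp \<eta> v (\<Sum>a\<in>UNIV. ?x $ a *s J v $ a) = \<eta> v *v (transpose (J v) *v ?x)"
  proof -
    have "(\<Sum>a\<in>UNIV. ?x $ a *s J v $ a) = transpose (J v) *v ?x"
      by (simp add: vec_eq_iff matrix_vector_mult_def transpose_nth mult.commute)
    then show ?thesis
      by (simp add: sharp_def vec_eq_iff vector_matrix_nth matrix_vector_mult_def symmetric_nth[OF \<eta>_sym, of v])
  qed
  then show ?thesis using X flat_sharp[OF V_\<eta>[OF v]] by metis
qed

lemma comp_add: "comp v (X + Y) = comp v X + comp v Y"
  by (simp add: comp_def matrix_vector_right_distrib)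
lemma comp_scale: "comp v (c *s X) = c *s comp v X"
  by (simp add: comp_def vec_eq_iff matrix_vector_mult_def sum_distrib_left mult_ac)

lemma cdiff_comp:
  assumes v: "v \<in> V" and "\<And>k. cdiff (\<lambda>u. X u $ k) v"
  shows "cdiff (\<lambda>u. comp u (X u) $ a) v"
  unfolding comp_def matrix_vector_mult_def vec_lambda_beta J_nth
  by (intro cdiff_intros cdiff_matrix_inv H_cdiff det_H cdV v assms(2))

lemma dird_comp_aux:
  assumes v: "v \<in> V" and Y: "\<And>k. cdiff (\<lambda>u. Y u $ k) v"
  shows "dird X (\<lambda>u. dird (Y u) (f a) u) v = (\<Sum>b\<in>UNIV. H v $ a $ b * dird X (\<lambda>u. comp u (Y u) $ b) v)"
proof -
  have "dird X (\<lambda>u. dird (Y u) (f a) u) v = dird X (\<lambda>u. \<Sum>b\<in>UNIV. H u $ a $ b * comp u (Y u) $ b) v"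
    by (rule open_cong_pd(4)[OF open_V v]) (rule H_comp)
  also have "\<dots> = (\<Sum>b\<in>UNIV. H v $ a $ b * dird X (\<lambda>u. comp u (Y u) $ b) v)"
    by (simp add: dird_sum dird_mult cdiff_intros H_cdiff[OF v] cdiff_comp[OF v Y] dird_H[OF v])
  finally show ?thesis .
qed

lemma dird_comp:
  assumes v: "v \<in> V" and Y: "\<And>k. cdiff (\<lambda>u. Y u $ k) v"
  shows "dird (X v) (\<lambda>u. comp u (Y u) $ a) v = comp v (cov_deriv b X Y v) $ a"
proof -
  have "(\<chi> a. dird (X v) (\<lambda>u. comp u (Y u) $ a) v) = comp v (cov_deriv b X Y v)"
  proof (rule comp_eqI[OF v])
    fix a
    show "(\<Sum>b\<in>UNIV. H v $ a $ b * (\<chi> a. dird (X v) (\<lambda>u. comp u (Y u) $ a) v) $ b) = (\<Sum>ba\<in>UNIV. H v $ a $ ba * comp v (cov_deriv b X Y v) $ ba)"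
      unfolding H_comp[OF v, symmetric] cov_J[OF v Y] by (simp add: dird_comp_aux[OF v Y])
  qed
  then show ?thesis by (simp add: vec_eq_iff)
qed

text \<open>The eigenvalue equation gives the weight - d_a to the derivatives of the
  \<open>f a\<close> along \<open>Y\<close>. Passing to components in the frame of gradients,
  \<open>H_deg\<close> converts this to d_b - \<kappa>.\<close>

lemma comp_lie_E:
  assumes v: "v \<in> V" and Y: "\<And>k. cdiff (\<lambda>u. Y u $ k) v"
  shows "comp v (lie_bracket E Y v) $ a = dird (E v) (\<lambda>u. comp u (Y u) $ a) v + (d a - \<kappa>) * comp v (Y v) $ a"
proof -
  have cE: "cdiff (\<lambda>u. E u $ k) v" for k by (simp add: cdiff_intros)
  have "comp v (lie_bracket E Y v) = (\<chi> a. dird (E v) (\<lambda>u. comp u (Y u) $ a) v + (d a - \<kappa>) * comp v (Y v) $ a)"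
  proof (rule comp_eqI[OF v])
    fix a
    have "dird (Y v) (\<lambda>u. dird (E u) (f a) u) v = dird (Y v) (\<lambda>u. d a * f a u + K a) v"
      by (rule open_cong_pd(4)[OF open_V v]) (rule eig)
    also have "\<dots> = d a * dird (Y v) (f a) v"
      by (simp add: dird_add dird_mult cdiff_intros cdV[OF v] dird_const)
    also have "\<dots> = - (\<Sum>b\<in>UNIV. H v $ a $ b * ((d b - \<kappa>) * comp v (Y v) $ b))"
    proof -
      have "d a * (H v $ a $ b * y) = - (H v $ a $ b * ((d b - \<kappa>) * y))" for b y
        using H_deg[OF v, of a b] by algebra
      then show ?thesis by (simp add: H_comp[OF v] sum_distrib_left sum_negf)
    qed
    finally show "(\<Sum>b\<in>UNIV. H v $ a $ b * comp v (lie_bracket E Y v) $ b) =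
        (\<Sum>b\<in>UNIV. H v $ a $ b * (\<chi> a. dird (E v) (\<lambda>u. comp u (Y u) $ a) v + (d a - \<kappa>) * comp v (Y v) $ a) $ b)"
      unfolding H_comp[OF v, symmetric] dird_lie_bracket[OF open_V hol_f v cE Y] dird_comp_aux[OF v Y]
      by (simp add: distrib_left sum.distrib)
  qed
  then show ?thesis by (simp add: vec_eq_iff)
qed

lemma b_comp: "v \<in> V \<Longrightarrow> b v X Y = (\<Sum>a\<in>UNIV. \<Sum>c\<in>UNIV. H v $ a $ c * comp v X $ a * comp v Y $ c)"
proof -
  assume v: "v \<in> V"
  have "b v X Y = (\<Sum>c\<in>UNIV. comp v Y $ c * dird X (f c) v)"
    unfolding b_eq[OF V_\<eta>[OF v]] flat_comp[OF v, of Y] contract_sum_right contract_scale_right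
    by (simp add: J_row dird_def)
  moreover have "dird X (f c) v = (\<Sum>a\<in>UNIV. H v $ a $ c * comp v X $ a)" for c
    unfolding H_comp[OF v] by (rule sum.cong[OF refl]) (simp only: symmetric_nth[OF H_sym, of v c])
  ultimately show ?thesis
    by (simp add: sum_distrib_left mult_ac) (rule sum.swap)
qed

end

section \<open>The Frobenius manifold structure\<close>

lemma lie_bracket_scale: "lie_bracket (\<lambda>v. c *s X v) Y v = c *s lie_bracket X Y v" if "\<And>k. cdiff (\<lambda>v. X v $ k) v"
proof -
  have "dird (Y v) (\<lambda>u. c * X u $ k) v = c * dird (Y v) (\<lambda>u. X u $ k) v" for k
    by (simp add: dird_mult cdiff_intros that dird_const)
  moreover have "dird (c *s X v) \<phi> v = c * dird (X v) \<phi> v" for \<phi>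
    by (simp add: dird_def contract_scale)
  ultimately show ?thesis by (simp add: vec_eq_iff lie_bracket_def right_diff_distrib)
qed

context flat_pencil
begin

lemma cdiff_formprod:
  assumes v: "det (\<eta> v) \<noteq> 0" "det (Bmat v) \<noteq> 0"
    and "\<And>k. cdiff (\<lambda>u. \<xi> u $ k) v" "\<And>k. cdiff (\<lambda>u. \<zeta> u $ k) v"
  shows "cdiff (\<lambda>u. formprod u (\<xi> u) (\<zeta> u) $ k) v"
proof -
  have B: "cdiff (\<lambda>u. Bmat u $ i $ j) v" for i j
    unfolding Bmat_def vec_lambda_beta by (intro cdiff_intros cdiff_christoffel v(1))
  show ?thesis
    unfolding formprod_def vector_matrix_nth Mmat_def vec_lambda_beta Rmat_def vector_minus_component Gam_nth matrix_mult_nth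
    by (intro cdiff_intros cd assms cdiff_matrix_inv B)
qed

lemma cdiff_flat:
  assumes "det (\<eta> v) \<noteq> 0" "\<And>k. cdiff (\<lambda>u. X u $ k) v"
  shows "cdiff (\<lambda>u. flat \<eta> u (X u) $ k) v"
  unfolding flat_def vector_matrix_nth by (intro cdiff_intros cdiff_matrix_inv cd assms)

lemma cdiff_mulv:
  assumes v: "det (\<eta> v) \<noteq> 0" "det (Bmat v) \<noteq> 0"
    and "\<And>k. cdiff (\<lambda>u. X u $ k) v" "\<And>k. cdiff (\<lambda>u. Y u $ k) v"
  shows "cdiff (\<lambda>u. mulv u (X u) (Y u) $ k) v"
  unfolding mulv_def sharp_def vector_matrix_nth
  by (intro cdiff_intros cd cdiff_formprod cdiff_flat assms)

definition unit_field :: "complex^'n \<Rightarrow> complex^'n" where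
  "unit_field v = (1 / \<kappa>) *s sharp \<eta> v (dlog v)"

abbreviation "Et \<equiv> \<lambda>v. (1 / \<kappa>) *s E v"

end

context eigen_frame
begin

text \<open>Structure constants of the product in the coframe of the differentials of the
  \<open>f a\<close>: \<open>a\<close> and \<open>c\<close> are the factors, \<open>e\<close> the
  component.\<close>

definition "we a c e v = (formprod v (J v $ a) (J v $ c) v* matrix_inv (J v)) $ e"

lemma formprod_we: "v \<in> V \<Longrightarrow> formprod v (J v $ a) (J v $ c) = (\<Sum>e\<in>UNIV. we a c e v *s J v $ e)"
  unfolding we_def by (rule expand_J)

lemma cdiff_we: "v \<in> V \<Longrightarrow> cdiff (we a c e) v"
proof -
  assume v: "v \<in> V"
  have "cdiff (\<lambda>v. (formprod v (J v $ a) (J v $ c) v* matrix_inv (J v)) $ e) v"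
    unfolding vector_matrix_nth
    by (intro cdiff_intros cdiff_formprod V_\<eta> det_B v cdiff_matrix_inv det_J) (simp_all add: cdV[OF v])
  then show ?thesis by (simp add: we_def[abs_def])
qed

definition "mm e v x y = (\<Sum>a\<in>UNIV. \<Sum>c\<in>UNIV. x $ a * y $ c * we a c e v)"

lemma formprod_mm:
  assumes v: "v \<in> V"
  shows "formprod v (flat \<eta> v X) (flat \<eta> v Y) = (\<Sum>e\<in>UNIV. mm e v (comp v X) (comp v Y) *s J v $ e)"
proof -
  have "formprod v (flat \<eta> v X) (flat \<eta> v Y) = (\<Sum>a\<in>UNIV. comp v X $ a *s (\<Sum>c\<in>UNIV. comp v Y $ c *s formprod v (J v $ a) (J v $ c)))"
    unfolding flat_comp[OF v] by (simp only: formprod_sum(1) formprod_scale(1)) (simp only: formprod_sum(2) formprod_scale(2))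
  also have "\<dots> = (\<Sum>a\<in>UNIV. \<Sum>c\<in>UNIV. \<Sum>e\<in>UNIV. (comp v X $ a * comp v Y $ c * we a c e v) *s J v $ e)"
    unfolding formprod_we[OF v] by (simp add: vec_eq_iff sum_distrib_left mult_ac)
  also have "\<dots> = (\<Sum>e\<in>UNIV. \<Sum>a\<in>UNIV. \<Sum>c\<in>UNIV. (comp v X $ a * comp v Y $ c * we a c e v) *s J v $ e)"
    by (subst sum.swap[of _ UNIV], subst sum.swap[of _ UNIV], subst sum.swap, rule sum.cong[OF refl], subst sum.swap, rule sum.cong[OF refl], rule refl)
  also have "\<dots> = (\<Sum>e\<in>UNIV. mm e v (comp v X) (comp v Y) *s J v $ e)"
    by (simp add: mm_def vec_eq_iff sum_distrib_right)
  finally show ?thesis .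
qed

lemma comp_mulv:
  assumes v: "v \<in> V"
  shows "comp v (mulv v X Y) $ e = mm e v (comp v X) (comp v Y)"
proof -
  have "(\<Sum>e\<in>UNIV. comp v (mulv v X Y) $ e *s J v $ e) = (\<Sum>e\<in>UNIV. mm e v (comp v X) (comp v Y) *s J v $ e)"
    unfolding flat_comp[OF v, symmetric] formprod_mm[OF v, symmetric] mulv_def by (rule flat_sharp[OF V_\<eta>[OF v]])
  then show ?thesis by (rule J_row_eqI[OF v])
qed

lemma b_mulv:
  assumes v: "v \<in> V"
  shows "b v (mulv v X Y) Z = (\<Sum>e\<in>UNIV. mm e v (comp v X) (comp v Y) * dird Z (f e) v)"
proof -
  have "b v (mulv v X Y) Z = contract Z (formprod v (flat \<eta> v X) (flat \<eta> v Y))"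
    by (subst b_sym) (simp add: b_eq[OF V_\<eta>[OF v]] mulv_def flat_sharp[OF V_\<eta>[OF v]])
  then show ?thesis
    unfolding formprod_mm[OF v] by (simp add: contract_sum_right contract_scale_right J_row dird_def)
qed

lemma mulv_commute: "v \<in> V \<Longrightarrow> mulv v X Y = mulv v Y X"
  unfolding mulv_def using formprod_commute by metis

text \<open>Reduction to the symmetry of \<open>Mmat v \<zeta> ** \<eta> v\<close>. Together with
  commutativity it generates all permutations of the three arguments.\<close>

lemma b_mulv_swap:
  assumes v: "v \<in> V"
  shows "b v (mulv v X Y) Z = b v (mulv v Z Y) X"
proof -
  have "b v (mulv v X Y) Z = bil (Mmat v (flat \<eta> v Y) ** \<eta> v) (flat \<eta> v X) (flat \<eta> v Z)" for X Z
    by (simp add: covariant_form_def mulv_def flat_sharp[OF V_\<eta>[OF v]] bil_contract formprod_def vector_matrix_mul_assoc)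
  moreover have "bil (Mmat v \<zeta> ** \<eta> v) \<xi> \<xi>' = bil (Mmat v \<zeta> ** \<eta> v) \<xi>' \<xi>" for \<zeta> \<xi> \<xi>'
    unfolding bil_def by (subst sum.swap, intro sum.cong refl, subst symmetric_nth[OF Mmat_sym(1)[OF v]], simp add: mult_ac)
  ultimately show ?thesis by metis
qed

lemma frobenius_algebra_mulv:
  assumes v: "v \<in> V" and nz: "\<And>i. m i > 0 \<Longrightarrow> v $ i \<noteq> 0"
  shows "frobenius_algebra (mulv v) (b v) (unit_field v)"
  unfolding frobenius_algebra_def
proof (intro conjI allI)
  note \<eta>v = V_\<eta>[OF v]
  show "Vector_Spaces.linear (*s) (*s) (mulv v X)" for X
    unfolding linear_vec_iff mulv_def by (simp add: flat_add flat_scale formprod_add formprod_scale sharp_add sharp_scale)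
  show "mulv v X Y = mulv v Y X" for X Y by (rule mulv_commute[OF v])
  show "mulv v (mulv v X Y) Z = mulv v X (mulv v Y Z)" for X Y Z
    by (simp add: mulv_def flat_sharp[OF \<eta>v] formprod_assoc[OF v])
  show "mulv v (unit_field v) X = X" for X
    unfolding mulv_def unit_field_def flat_scale flat_sharp[OF \<eta>v] formprod_scale
    by (simp add: formprod_def dlog_Mmat[OF v nz] sharp_scale \<kappa> sharp_flat[OF \<eta>v])
  show "Vector_Spaces.linear (*s) (*) (b v X)" for X
    unfolding linear_scalar_iff by (simp add: b_eq[OF \<eta>v] flat_add flat_scale contract_add_right contract_scale_right)
  show "b v X Y = b v Y X" for X Y by (rule b_sym)
  show "(\<forall>Y. b v X Y = 0) \<longrightarrow> X = 0" for X
  proof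
    assume "\<forall>Y. b v X Y = 0"
    then have "b v X (sharp \<eta> v (axis i 1)) = 0" for i by blast
    then show "X = 0" by (simp add: b_eq[OF \<eta>v] flat_sharp[OF \<eta>v] vec_eq_iff)
  qed
  show "b v (mulv v X Y) Z = b v X (mulv v Y Z)" for X Y Z
    by (metis b_mulv_swap[OF v] b_sym mulv_commute[OF v])
qed

text \<open>\<open>E\<close> is \<open>dlog\<close> raised by \<open>g\<close>. Symmetry moves
  \<open>Mmat\<close> across \<open>g\<close> until it acts on \<open>dlog\<close>, where it is
  multiplication by \<kappa>; the factor 1/\<kappa> in \<open>Et\<close> compensates.\<close>

lemma intersection:
  assumes v: "v \<in> V" and nz: "\<And>i. m i > 0 \<Longrightarrow> v $ i \<noteq> 0"
  shows "contract (Et v) (formprod v \<xi> \<zeta>) = bil (g v) \<xi> \<zeta>"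
proof -
  have E: "E v = dlog v v* g v"
  proof -
    have "g v *v dlog v = E v" unfolding dlog_def using g_dlog[OF nz] by simp
    then show ?thesis by (simp add: vec_eq_iff matrix_vector_mult_def vector_matrix_nth symmetric_nth[OF P.G_sym, of v])
  qed
  have "contract (E v) (\<xi> v* Mmat v \<zeta>) = bil (Mmat v \<zeta> ** g v) \<xi> (dlog v)"
  proof -
    have "contract (E v) (\<xi> v* Mmat v \<zeta>) = bil (g v) (dlog v) (\<xi> v* Mmat v \<zeta>)"
      by (simp add: E bil_contract)
    also have "\<dots> = bil (g v) (\<xi> v* Mmat v \<zeta>) (dlog v)"
      unfolding bil_def by (subst sum.swap, intro sum.cong refl, subst symmetric_nth[OF P.G_sym], simp add: mult_ac)
    finally show ?thesis by (simp add: bil_contract vector_matrix_mul_assoc)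
  qed
  also have "\<dots> = bil (Mmat v \<zeta> ** g v) (dlog v) \<xi>"
    unfolding bil_def by (subst sum.swap, intro sum.cong refl, subst symmetric_nth[OF Mmat_sym(2)[OF v]], simp add: mult_ac)
  also have "\<dots> = contract ((dlog v v* Mmat v \<zeta>) v* g v) \<xi>"
    by (simp add: bil_contract vector_matrix_mul_assoc)
  also have "\<dots> = \<kappa> * bil (g v) \<zeta> \<xi>"
  proof -
    have "dlog v v* Mmat v \<zeta> = \<kappa> *s \<zeta>" by (rule dlog_Mmat[OF v nz])
    then show ?thesis by (simp add: bil_contract vector_scale_matrix contract_scale)
  qed
  also have "bil (g v) \<zeta> \<xi> = bil (g v) \<xi> \<zeta>"
    unfolding bil_def by (subst sum.swap, intro sum.cong refl, subst symmetric_nth[OF P.G_sym], simp add: mult_ac)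
  finally show ?thesis by (simp add: formprod_def contract_scale \<kappa>)
qed

text \<open>For fixed \<open>a\<close> and \<open>c\<close> the product of the two differentials is
  a closed one-form, by \<open>curl_R_and_commute\<close>. When it is expanded in the coframe, the
  derivatives of the coframe are symmetric Hessians and drop out.\<close>

lemma curl_we:
  assumes v: "v \<in> V"
  shows "(\<Sum>e\<in>UNIV. pd i (we a c e) v * pd k (f e) v) = (\<Sum>e\<in>UNIV. pd k (we a c e) v * pd i (f e) v)"
proof -
  let ?\<omega> = "\<lambda>u. differential (f a) u v* R (f c) u"
  define w where "w = (\<lambda>u. formprod u (J u $ a) (J u $ c))"
  have wk: "w u $ k = (\<Sum>e\<in>UNIV. we a c e u * pd k (f e) u)" if "u \<in> V" for u k
    unfolding w_def formprod_we[OF that] by simp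
  have pdw: "pd i (\<lambda>u. w u $ k) v = (\<Sum>e\<in>UNIV. pd i (we a c e) v * pd k (f e) v) + (\<Sum>e\<in>UNIV. we a c e v * pd i (pd k (f e)) v)" for i k
  proof -
    have "pd i (\<lambda>u. w u $ k) v = pd i (\<lambda>u. \<Sum>e\<in>UNIV. we a c e u * pd k (f e) u) v"
      by (rule open_cong_pd(1)[OF open_V v wk])
    then show ?thesis by (simp add: pd_sum pd_mult cdiff_intros cdiff_we[OF v] cdV[OF v] sum.distrib)
  qed
  have c\<omega>: "cdiff (\<lambda>u. ?\<omega> u $ k) v" for k
    unfolding vector_matrix_nth differential_nth by (intro cdiff_intros cdV v)
  have "pd i (\<lambda>u. w u $ k) v = \<kappa> / d c * pd i (\<lambda>u. ?\<omega> u $ k) v" for i k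
  proof -
    have "pd i (\<lambda>u. w u $ k) v = pd i (\<lambda>u. \<kappa> / d c * ?\<omega> u $ k) v"
      by (rule open_cong_pd(1)[OF open_V v]) (simp only: w_def formprod_J J_row[symmetric] vector_smult_component)
    also have "\<dots> = \<kappa> / d c * pd i (\<lambda>u. ?\<omega> u $ k) v"
      using pd_mult[OF cdiff_const c\<omega>, of i "\<kappa> / d c" k] by (simp only: pd_const) simp
    finally show ?thesis .
  qed
  moreover have "pd i (\<lambda>u. ?\<omega> u $ k) v = pd k (\<lambda>u. ?\<omega> u $ i) v"
    using curl_R_and_commute(1)[OF open_V V_\<eta> flat_f flat_f v, of a c] by (simp add: curl_def vec_eq_iff)
  ultimately have "pd i (\<lambda>u. w u $ k) v = pd k (\<lambda>u. w u $ i) v" by simp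
  then show ?thesis unfolding pdw by (simp add: pd_commute[OF open_V hol_f v, of i k])
qed

text \<open>By \<open>E_R\<close> the Hessian of \<open>f c\<close> has degree d_c up to the weights
  of its indices, so degrees add under the product.\<close>

lemma E_we:
  assumes v: "v \<in> V"
  shows "dird (E v) (we a c e) v = (d a + d c - d e) * we a c e v"
proof -
  define w where "w = (\<lambda>u. formprod u (J u $ a) (J u $ c))"
  have wk: "w u $ k = (\<Sum>e\<in>UNIV. we a c e u * pd k (f e) u)" if "u \<in> V" for u k
    unfolding w_def formprod_we[OF that] by simp
  have 1: "dird (E v) (\<lambda>u. w u $ k) v = (d a + d c - \<theta> k) * w v $ k" for k
  proof -
    have wk2: "w u $ k = \<kappa> / d c * (\<Sum>i\<in>UNIV. R (f c) u $ i $ k * pd i (f a) u)" if "u \<in> V" for u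
      using that by (simp add: w_def formprod_J vector_matrix_nth)
    have "dird (E v) (\<lambda>u. w u $ k) v = dird (E v) (\<lambda>u. \<kappa> / d c * (\<Sum>i\<in>UNIV. R (f c) u $ i $ k * pd i (f a) u)) v"
      by (rule open_cong_pd(4)[OF open_V v wk2])
    also have "\<dots> = \<kappa> / d c * dird (E v) (\<lambda>u. \<Sum>i\<in>UNIV. R (f c) u $ i $ k * pd i (f a) u) v"
      by (subst dird_mult) (auto intro!: cdiff_intros cdV v simp: dird_const)
    also have "dird (E v) (\<lambda>u. \<Sum>i\<in>UNIV. R (f c) u $ i $ k * pd i (f a) u) v
        = (\<Sum>i\<in>UNIV. (d a + d c - \<theta> k) * (R (f c) v $ i $ k * pd i (f a) v))"
    proof -
      have "dird (E v) (\<lambda>u. R (f c) u $ i $ k) v = (d c + \<theta> i - \<theta> k) * R (f c) v $ i $ k" for i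
        by (rule E_R[OF open_V hol_f eig v])
      then have "dird (E v) (\<lambda>u. \<Sum>i\<in>UNIV. R (f c) u $ i $ k * pd i (f a) u) v
          = (\<Sum>i\<in>UNIV. (d c + \<theta> i - \<theta> k) * R (f c) v $ i $ k * pd i (f a) v + R (f c) v $ i $ k * ((d a - \<theta> i) * pd i (f a) v))"
        by (simp add: dird_sum dird_mult cdiff_intros cdV[OF v] E_J[OF v])
      also have "\<dots> = (\<Sum>i\<in>UNIV. (d a + d c - \<theta> k) * (R (f c) v $ i $ k * pd i (f a) v))"
        by (rule sum.cong[OF refl]) (simp add: algebra_simps)
      finally show ?thesis .
    qed
    finally show ?thesis unfolding wk2[OF v] by (simp add: sum_distrib_left mult_ac)
  qed
  have 2: "dird (E v) (\<lambda>u. w u $ k) v = (\<Sum>e\<in>UNIV. dird (E v) (we a c e) v * pd k (f e) v + we a c e v * ((d e - \<theta> k) * pd k (f e) v))" for k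
  proof -
    have "dird (E v) (\<lambda>u. w u $ k) v = dird (E v) (\<lambda>u. \<Sum>e\<in>UNIV. we a c e u * pd k (f e) u) v"
      by (rule open_cong_pd(4)[OF open_V v wk])
    then show ?thesis by (simp add: dird_sum dird_mult cdiff_intros cdiff_we[OF v] cdV[OF v] E_J[OF v])
  qed
  have "(\<Sum>e\<in>UNIV. dird (E v) (we a c e) v *s J v $ e) = (\<Sum>e\<in>UNIV. ((d a + d c - d e) * we a c e v) *s J v $ e)"
  proof -
    have "(\<Sum>e\<in>UNIV. dird (E v) (we a c e) v * pd k (f e) v) = (\<Sum>e\<in>UNIV. (d a + d c - d e) * we a c e v * pd k (f e) v)" for k
    proof -
      have "(\<Sum>e\<in>UNIV. dird (E v) (we a c e) v * pd k (f e) v) =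
          dird (E v) (\<lambda>u. w u $ k) v - (\<Sum>e\<in>UNIV. we a c e v * ((d e - \<theta> k) * pd k (f e) v))"
        unfolding 2 by (simp add: sum.distrib)
      also have "\<dots> = (\<Sum>e\<in>UNIV. (d a + d c - d e) * we a c e v * pd k (f e) v)"
        unfolding 1 wk[OF v] sum_distrib_left sum_subtractf[symmetric] by (rule sum.cong[OF refl]) (simp add: algebra_simps)
      finally show ?thesis .
    qed
    then show ?thesis by (simp add: vec_eq_iff)
  qed
  then show ?thesis by (rule J_row_eqI[OF v])
qed

lemma cdiff_mm:
  assumes "v \<in> V" "\<And>k. cdiff (\<lambda>u. X u $ k) v" "\<And>k. cdiff (\<lambda>u. Y u $ k) v"
  shows "cdiff (\<lambda>u. mm e u (comp u (X u)) (comp u (Y u))) v"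
  unfolding mm_def by (intro cdiff_intros cdiff_comp cdiff_we assms)

lemma dird_mm:
  assumes v: "v \<in> V" and X: "\<And>k. cdiff (\<lambda>u. X u $ k) v" and Y: "\<And>k. cdiff (\<lambda>u. Y u $ k) v"
  shows "dird W (\<lambda>u. mm e u (comp u (X u)) (comp u (Y u))) v =
      mm e v (\<chi> a. dird W (\<lambda>u. comp u (X u) $ a) v) (comp v (Y v)) + mm e v (comp v (X v)) (\<chi> a. dird W (\<lambda>u. comp u (Y u) $ a) v)
      + (\<Sum>a\<in>UNIV. \<Sum>c\<in>UNIV. comp v (X v) $ a * comp v (Y v) $ c * dird W (we a c e) v)"
  unfolding mm_def
  by (simp add: dird_sum dird_mult cdiff_intros cdiff_comp[OF v X] cdiff_comp[OF v Y] cdiff_we[OF v] sum.distrib[symmetric] algebra_simps)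

text \<open>The frame of gradients is parallel, so the covariant derivatives of the arguments cancel
  and only derivatives of the structure constants remain.\<close>

lemma nabla_c_eq:
  assumes v: "v \<in> V" and X: "\<And>k. cdiff (\<lambda>u. X u $ k) v" and Y: "\<And>k. cdiff (\<lambda>u. Y u $ k) v" and Z: "\<And>k. cdiff (\<lambda>u. Z u $ k) v"
  shows "nabla_c b mulv W X Y Z v = (\<Sum>a\<in>UNIV. \<Sum>c\<in>UNIV. comp v (X v) $ a * comp v (Y v) $ c *
     (\<Sum>e\<in>UNIV. dird (W v) (we a c e) v * dird (Z v) (f e) v))"
proof -
  have cx: "(\<chi> a. dird (W v) (\<lambda>u. comp u (Y u) $ a) v) = comp v (cov_deriv b W Y v)" if "\<And>k. cdiff (\<lambda>u. Y u $ k) v" for Y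
    by (simp add: vec_eq_iff dird_comp[OF v that])
  have "dird (W v) (\<lambda>u. b u (mulv u (X u) (Y u)) (Z u)) v =
     dird (W v) (\<lambda>u. \<Sum>e\<in>UNIV. mm e u (comp u (X u)) (comp u (Y u)) * dird (Z u) (f e) u) v"
    by (rule open_cong_pd(4)[OF open_V v b_mulv])
  also have "\<dots> = (\<Sum>e\<in>UNIV. dird (W v) (\<lambda>u. mm e u (comp u (X u)) (comp u (Y u))) v * dird (Z v) (f e) v)
     + (\<Sum>e\<in>UNIV. mm e v (comp v (X v)) (comp v (Y v)) * dird (cov_deriv b W Z v) (f e) v)"
    by (simp add: dird_sum dird_mult cdiff_intros cdiff_mm[OF v X Y] cdiff_dird[OF open_V hol_f v Z] cov_J[OF v Z] sum.distrib)
  finally have "nabla_c b mulv W X Y Z v = (\<Sum>e\<in>UNIV. (\<Sum>a\<in>UNIV. \<Sum>c\<in>UNIV. comp v (X v) $ a * comp v (Y v) $ c * dird (W v) (we a c e) v) * dird (Z v) (f e) v)"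
    unfolding nabla_c_def b_mulv[OF v] dird_mm[OF v X Y] cx[OF X] cx[OF Y]
    by (simp add: distrib_right sum.distrib)
  also have "\<dots> = (\<Sum>e\<in>UNIV. \<Sum>c\<in>UNIV. \<Sum>a\<in>UNIV. comp v (X v) $ a * comp v (Y v) $ c * (dird (W v) (we a c e) v * dird (Z v) (f e) v))"
    by (simp add: sum_distrib_right sum_distrib_left mult_ac) (rule sum.cong[OF refl], rule sum.swap)
  also have "\<dots> = (\<Sum>a\<in>UNIV. \<Sum>c\<in>UNIV. comp v (X v) $ a * comp v (Y v) $ c *
     (\<Sum>e\<in>UNIV. dird (W v) (we a c e) v * dird (Z v) (f e) v))"
    by (subst sum_swap3) (simp add: sum_distrib_left)
  finally show ?thesis .
qed

text \<open>Closedness of the structure forms is what exchanges the direction of differentiation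
  with the last argument.\<close>

lemma nabla_c_swap_last:
  assumes v: "v \<in> V" and W: "\<And>k. cdiff (\<lambda>u. W u $ k) v" and X: "\<And>k. cdiff (\<lambda>u. X u $ k) v" and Y: "\<And>k. cdiff (\<lambda>u. Y u $ k) v" and Z: "\<And>k. cdiff (\<lambda>u. Z u $ k) v"
  shows "nabla_c b mulv W X Y Z v = nabla_c b mulv Z X Y W v"
proof -
  have "(\<Sum>e\<in>UNIV. dird (W v) (we a c e) v * dird (Z v) (f e) v) = (\<Sum>e\<in>UNIV. dird (Z v) (we a c e) v * dird (W v) (f e) v)" for a c
  proof -
    have "(\<Sum>e\<in>UNIV. dird W (we a c e) v * dird Z (f e) v) = (\<Sum>i\<in>UNIV. \<Sum>k\<in>UNIV. W $ i * Z $ k * (\<Sum>e\<in>UNIV. pd i (we a c e) v * pd k (f e) v))" for W Z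
      unfolding dird_expand sum_product by (subst sum_swap3, subst sum.swap, simp add: sum_distrib_left mult_ac)
    note this[of "W v" "Z v"]
    also have "(\<Sum>i\<in>UNIV. \<Sum>k\<in>UNIV. W v $ i * Z v $ k * (\<Sum>e\<in>UNIV. pd i (we a c e) v * pd k (f e) v))
       = (\<Sum>i\<in>UNIV. \<Sum>k\<in>UNIV. Z v $ i * W v $ k * (\<Sum>e\<in>UNIV. pd i (we a c e) v * pd k (f e) v))"
      by (subst sum.swap) (intro sum.cong refl, subst curl_we[OF v], simp add: mult_ac)
    finally show ?thesis using \<open>\<And>W Z. (\<Sum>e\<in>UNIV. dird W (we a c e) v * dird Z (f e) v) = _ W Z\<close> by simp
  qed
  then show ?thesis by (simp add: nabla_c_eq[OF v X Y Z] nabla_c_eq[OF v X Y W])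
qed

end

lemma (in flat_pencil) cdiff_Et: "cdiff (\<lambda>u. Et u $ k) v"
  unfolding vector_smult_component vec_lambda_beta by (intro cdiff_intros)

context eigen_frame
begin

section \<open>The Euler vector field\<close>

lemma dird_scale_vec': "dird (c *s X) \<phi> v = c * dird X \<phi> v"
  by (simp add: dird_def contract_scale)

lemma cdiff_E: "cdiff (\<lambda>u. E u $ k) v"
  by (simp add: cdiff_intros)

text \<open>Along \<open>E\<close> the structure constants have degree d_a + d_c - d_e and the
  component of the product adds d_e - \<kappa>, in total d_a + d_c - \<kappa>. The brackets of the
  two factors account for d_a + d_c - 2 \<kappa>. The difference is one \<kappa>, which the scaling
  of \<open>E\<close> turns into 1.\<close>

lemma euler_product:
  assumes v: "v \<in> V" and X: "\<And>k. cdiff (\<lambda>u. X u $ k) v" and Y: "\<And>k. cdiff (\<lambda>u. Y u $ k) v"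
  shows "lie_bracket Et (\<lambda>u. mulv u (X u) (Y u)) v =
     mulv v (lie_bracket Et X v) (Y v) + mulv v (X v) (lie_bracket Et Y v) + mulv v (X v) (Y v)"
proof -
  note c = cdiff_mulv[OF V_\<eta>[OF v] det_B[OF v] X Y]
  let ?x = "comp v (X v)" and ?y = "comp v (Y v)"
  let ?Ex = "\<chi> a. dird (E v) (\<lambda>u. comp u (X u) $ a) v" and ?Ey = "\<chi> a. dird (E v) (\<lambda>u. comp u (Y u) $ a) v"
  have lx: "comp v (lie_bracket E X v) = (\<chi> a. ?Ex $ a + (d a - \<kappa>) * ?x $ a)" 
    and ly: "comp v (lie_bracket E Y v) = (\<chi> a. ?Ey $ a + (d a - \<kappa>) * ?y $ a)"
    by (simp_all add: vec_eq_iff comp_lie_E[OF v X] comp_lie_E[OF v Y])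
  have comp_inj: "A = B" if "\<And>e. comp v A $ e = comp v B $ e" for A B
    by (rule dird_eqI[OF v]) (simp add: H_comp[OF v] that)
  have "lie_bracket E (\<lambda>u. mulv u (X u) (Y u)) v =
     mulv v (lie_bracket E X v) (Y v) + mulv v (X v) (lie_bracket E Y v) + \<kappa> *s mulv v (X v) (Y v)"
  proof (rule comp_inj)
    fix e
    have "comp v (lie_bracket E (\<lambda>u. mulv u (X u) (Y u)) v) $ e =
       dird (E v) (\<lambda>u. mm e u (comp u (X u)) (comp u (Y u))) v + (d e - \<kappa>) * mm e v ?x ?y"
      unfolding comp_lie_E[OF v c] comp_mulv[OF v]
      by (subst open_cong_pd(4)[OF open_V v comp_mulv]) auto
    also have "\<dots> = (\<Sum>a\<in>UNIV. \<Sum>c\<in>UNIV. (?Ex $ a * ?y $ c + ?x $ a * ?Ey $ c + (d a + d c - \<kappa>) * ?x $ a * ?y $ c) * we a c e v)"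
      unfolding dird_mm[OF v X Y] E_we[OF v] unfolding mm_def sum_distrib_left sum.distrib[symmetric]
      by (intro sum.cong refl) (simp add: algebra_simps)
    also have "\<dots> = mm e v (\<chi> a. ?Ex $ a + (d a - \<kappa>) * ?x $ a) ?y + mm e v ?x (\<chi> a. ?Ey $ a + (d a - \<kappa>) * ?y $ a) + \<kappa> * mm e v ?x ?y"
      unfolding mm_def sum_distrib_left sum.distrib[symmetric]
      by (intro sum.cong refl) (simp add: algebra_simps)
    finally show "comp v (lie_bracket E (\<lambda>u. mulv u (X u) (Y u)) v) $ e =
        comp v (mulv v (lie_bracket E X v) (Y v) + mulv v (X v) (lie_bracket E Y v) + \<kappa> *s mulv v (X v) (Y v)) $ e"
      by (simp add: comp_add comp_scale comp_mulv[OF v] lx ly)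
  qed
  moreover have "mulv v (c *s A) B = c *s mulv v A B" "mulv v A (c *s B) = c *s mulv v A B" for c A B
    by (simp_all add: mulv_def flat_scale formprod_scale sharp_scale)
  ultimately show ?thesis
    unfolding lie_bracket_scale[OF cdiff_E] by (simp add: vector_add_ldistrib \<kappa>)
qed

text \<open>Only pairs with d_a + d_c = \<kappa> contribute, and for them the bracket weights d_a -
  \<kappa> and d_c - \<kappa> add up to - \<kappa>. After division by \<kappa> the defect is 2 - d =
  1, hence the charge 1.\<close>

lemma euler_metric:
  assumes v: "v \<in> V" and X: "\<And>k. cdiff (\<lambda>u. X u $ k) v" and Y: "\<And>k. cdiff (\<lambda>u. Y u $ k) v"
  shows "dird (Et v) (\<lambda>u. b u (X u) (Y u)) v =
     b v (lie_bracket Et X v) (Y v) + b v (X v) (lie_bracket Et Y v) + (2 - 1) * b v (X v) (Y v)"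
proof -
  let ?x = "comp v (X v)" and ?y = "comp v (Y v)"
  let ?Ex = "\<chi> a. dird (E v) (\<lambda>u. comp u (X u) $ a) v" and ?Ey = "\<chi> a. dird (E v) (\<lambda>u. comp u (Y u) $ a) v"
  have lx: "comp v (lie_bracket E X v) = (\<chi> a. ?Ex $ a + (d a - \<kappa>) * ?x $ a)" 
    and ly: "comp v (lie_bracket E Y v) = (\<chi> a. ?Ey $ a + (d a - \<kappa>) * ?y $ a)"
    by (simp_all add: vec_eq_iff comp_lie_E[OF v X] comp_lie_E[OF v Y])
  have "dird (E v) (\<lambda>u. b u (X u) (Y u)) v = dird (E v) (\<lambda>u. \<Sum>a\<in>UNIV. \<Sum>c\<in>UNIV. H u $ a $ c * comp u (X u) $ a * comp u (Y u) $ c) v"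
    by (rule open_cong_pd(4)[OF open_V v b_comp])
  also have "\<dots> = (\<Sum>a\<in>UNIV. \<Sum>c\<in>UNIV. H v $ a $ c * (?Ex $ a * ?y $ c + ?x $ a * ?Ey $ c))"
    by (simp add: dird_sum dird_mult cdiff_intros cdiff_comp[OF v X] cdiff_comp[OF v Y] H_cdiff[OF v] dird_H[OF v] algebra_simps)
  also have "\<dots> = (\<Sum>a\<in>UNIV. \<Sum>c\<in>UNIV. H v $ a $ c * (\<chi> a. ?Ex $ a + (d a - \<kappa>) * ?x $ a) $ a * ?y $ c)
      + (\<Sum>a\<in>UNIV. \<Sum>c\<in>UNIV. H v $ a $ c * ?x $ a * (\<chi> a. ?Ey $ a + (d a - \<kappa>) * ?y $ a) $ c)
      + \<kappa> * (\<Sum>a\<in>UNIV. \<Sum>c\<in>UNIV. H v $ a $ c * ?x $ a * ?y $ c)"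
    unfolding sum_distrib_left sum.distrib[symmetric]
  proof (intro sum.cong refl)
    fix a c
    show "H v $ a $ c * (?Ex $ a * ?y $ c + ?x $ a * ?Ey $ c) =
        H v $ a $ c * (\<chi> a. ?Ex $ a + (d a - \<kappa>) * ?x $ a) $ a * ?y $ c
       + H v $ a $ c * ?x $ a * (\<chi> a. ?Ey $ a + (d a - \<kappa>) * ?y $ a) $ c + \<kappa> * (H v $ a $ c * ?x $ a * ?y $ c)"
      using H_deg[OF v, of a c] unfolding vec_lambda_beta by algebra
  qed
  finally have "dird (E v) (\<lambda>u. b u (X u) (Y u)) v = b v (lie_bracket E X v) (Y v) + b v (X v) (lie_bracket E Y v) + \<kappa> * b v (X v) (Y v)"
    by (simp add: b_comp[OF v] lx ly)
  moreover have "b v (c *s A) B = c * b v A B" "b v A (c *s B) = c * b v A B" for c A B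
    by (simp_all add: b_eq[OF V_\<eta>[OF v]] flat_scale contract_scale contract_scale_right)
  ultimately show ?thesis
    unfolding lie_bracket_scale[OF cdiff_E] dird_scale_vec' by (simp add: algebra_simps \<kappa>)
qed

lemma cov_E: "v \<in> V \<Longrightarrow> dird (cov_deriv b X Et v) (f a) v = d a / \<kappa> * dird (X v) (f a) v"
proof -
  assume v: "v \<in> V"
  have "dird (cov_deriv b X Et v) (f a) v = dird (X v) (\<lambda>u. dird (Et u) (f a) u) v"
    by (rule cov_J[OF v]) (rule cdiff_Et)
  also have "\<dots> = dird (X v) (\<lambda>u. (1 / \<kappa>) * (d a * f a u + K a)) v"
    by (rule open_cong_pd(4)[OF open_V v]) (simp add: dird_scale_vec' eig)
  also have "\<dots> = d a / \<kappa> * dird (X v) (f a) v"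
    by (subst dird_mult) (auto intro!: cdiff_intros cdV v simp: dird_const dird_add dird_mult cdiff_intros cdV[OF v])
  finally show ?thesis .
qed

lemma euler_flat:
  assumes V': "open V'" "V' \<subseteq> V" and X: "vfield_on V' X" and Y: "vfield_on V' Y" and v: "v \<in> V'"
  shows "cov_deriv b X (cov_deriv b Y Et) v - cov_deriv b (cov_deriv b X Y) Et v = 0"
proof -
  have vV: "v \<in> V" using V' v by blast
  have \<eta>V': "\<And>u. u \<in> V' \<Longrightarrow> det (\<eta> u) \<noteq> 0" using V' V_\<eta> by blast
  have Et: "vfield_on V' Et" unfolding vfield_on_def mholomorphic_on_iff_cdiff by (intro allI ballI cdiff_Et)
  have "cov_deriv b X (cov_deriv b Y Et) v = cov_deriv b (cov_deriv b X Y) Et v"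
  proof (rule dird_eqI[OF vV])
    fix a
    have "dird (cov_deriv b X (cov_deriv b Y Et) v) (f a) v = dird (X v) (\<lambda>u. dird (cov_deriv b Y Et u) (f a) u) v"
      by (rule cov_J[OF vV]) (rule cdiff_cov_deriv[OF V'(1) \<eta>V' Y Et v])
    also have "\<dots> = dird (X v) (\<lambda>u. d a / \<kappa> * dird (Y u) (f a) u) v"
      by (rule open_cong_pd(4)[OF V'(1) v]) (use V' cov_E in blast)
    also have "\<dots> = d a / \<kappa> * dird (X v) (\<lambda>u. dird (Y u) (f a) u) v"
      by (subst dird_mult[OF cdiff_const cdiff_dird[OF open_V hol_f vV vfield_cdiff[OF Y v]]]) (simp add: dird_const)
    also have "\<dots> = dird (cov_deriv b (cov_deriv b X Y) Et v) (f a) v"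
      unfolding cov_E[OF vV] cov_J[OF vV vfield_cdiff[OF Y v]] ..
    finally show "dird (cov_deriv b X (cov_deriv b Y Et) v) (f a) v = dird (cov_deriv b (cov_deriv b X Y) Et v) (f a) v" .
  qed
  then show ?thesis by simp
qed

text \<open>In flat coordinates the covariant derivative of \<open>Et\<close> is diagonal with
  entries d_a / \<kappa>, and the Jacobian conjugates it to the standard frame.\<close>

lemma euler_diagonalizable:
  assumes v: "v \<in> V"
  shows "diagonalizable_matrix (\<chi> k j. cov_deriv b (\<lambda>_. axis j 1) Et v $ k)"
proof -
  let ?A = "\<chi> k j. cov_deriv b (\<lambda>_. axis j 1) Et v $ k" and ?D = "diagm (\<lambda>a. d a / \<kappa>)"
  have "J v ** ?A = ?D ** J v"
  proof -
    have "(J v ** ?A) $ a $ j = d a / \<kappa> * pd j (f a) v" for a j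
      using cov_E[OF v, of "\<lambda>_. axis j 1" a] by (simp add: matrix_mult_nth dird_expand[of "cov_deriv _ _ _ _"] mult.commute)
    then show ?thesis by (simp add: vec_eq_iff diagm_mult)
  qed
  then have "matrix_inv (J v) ** (J v ** ?A) = matrix_inv (J v) ** (?D ** J v)" by simp
  then have A: "?A = matrix_inv (J v) ** ?D ** J v"
    by (simp add: matrix_mul_assoc matrix_inv_det[OF det_J[OF v]])
  have inv: "matrix_inv (matrix_inv (J v)) = J v" "det (matrix_inv (J v)) \<noteq> 0"
    using matrix_inv_unique'[OF matrix_inv_det(2)[OF det_J[OF v]]] by auto
  show ?thesis
    unfolding diagonalizable_matrix_def
    by (rule exI[of _ "matrix_inv (J v)"], rule exI[of _ ?D]) (use A inv in \<open>auto simp: invertible_det_nz diagm_def\<close>)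
qed

text \<open>Commutativity and invariance of the form permute the last three arguments. One exchange
  of the direction with an argument, supplied by \<open>nabla_c_swap_last\<close>, then generates
  the full symmetry.\<close>

lemma nabla_c_symmetric:
  assumes V': "open V'" "V' \<subseteq> V" and W: "vfield_on V' W" and X: "vfield_on V' X" and Y: "vfield_on V' Y" and Z: "vfield_on V' Z" and v: "v \<in> V'"
  shows "nabla_c b mulv W X Y Z v = nabla_c b mulv X W Y Z v"
    and "nabla_c b mulv W X Y Z v = nabla_c b mulv W Y X Z v"
    and "nabla_c b mulv W X Y Z v = nabla_c b mulv W X Z Y v"
proof -
  have vV: "v \<in> V" using V' v by blast
  have s1: "nabla_c b mulv W X Y Z v = nabla_c b mulv W Y X Z v" for W X Y Z
  proof -
    have "dird (W v) (\<lambda>u. b u (mulv u (X u) (Y u)) (Z u)) v = dird (W v) (\<lambda>u. b u (mulv u (Y u) (X u)) (Z u)) v"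
      by (rule open_cong_pd(4)[OF open_V vV]) (simp add: mulv_commute)
    then show ?thesis unfolding nabla_c_def by (simp add: mulv_commute[OF vV, of "X v"] mulv_commute[OF vV, of "cov_deriv b W X v"])
  qed
  have s2: "nabla_c b mulv W X Y Z v = nabla_c b mulv W Z Y X v" for W X Y Z
  proof -
    have "dird (W v) (\<lambda>u. b u (mulv u (X u) (Y u)) (Z u)) v = dird (W v) (\<lambda>u. b u (mulv u (Z u) (Y u)) (X u)) v"
      by (rule open_cong_pd(4)[OF open_V vV]) (rule b_mulv_swap)
    then show ?thesis unfolding nabla_c_def
      using b_mulv_swap[OF vV, of "cov_deriv b W X v"] b_mulv_swap[OF vV, of "X v"] by simp
  qed
  note c = vfield_cdiff[OF _ v]
  show "nabla_c b mulv W X Y Z v = nabla_c b mulv W Y X Z v" by (rule s1)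
  show "nabla_c b mulv W X Y Z v = nabla_c b mulv W X Z Y v" by (metis s1 s2)
  have "nabla_c b mulv W X Y Z v = nabla_c b mulv W Z Y X v" by (rule s2)
  also have "\<dots> = nabla_c b mulv X Z Y W v" by (rule nabla_c_swap_last[OF vV c[OF W] c[OF Z] c[OF Y] c[OF X]])
  also have "\<dots> = nabla_c b mulv X W Y Z v" by (rule s2)
  finally show "nabla_c b mulv W X Y Z v = nabla_c b mulv X W Y Z v" .
qed

section \<open>The second metric in flat coordinates\<close>

abbreviation "\<tau> \<equiv> \<lambda>v. \<chi> a. f a v"

lemma jacobian_\<tau>: "jacobian \<tau> v = J v"
  by (simp add: jacobian_def J_def)

text \<open>Metric compatibility of the candidate symbols dt^a R t^c: the two connection terms of
  \<open>g\<close> combine with the second derivatives of the two coordinates.\<close>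

lemma pd_metric_g:
  assumes v: "v \<in> V"
  shows "pd k (\<lambda>v. (J v ** g v ** transpose (J v)) $ a $ c) v = (J v $ a v* R (f c) v) $ k + (J v $ c v* R (f a) v) $ k"
proof -
  have nth: "(J v ** g v ** transpose (J v)) $ a $ c = (\<Sum>i\<in>UNIV. \<Sum>j\<in>UNIV. pd i (f a) v * g v $ i $ j * pd j (f c) v)" for v
    by (simp add: matrix_mult_nth transpose_nth sum_distrib_right) (rule sum.swap)
  have R: "(J v $ a v* R (f c) v) $ k = (\<Sum>i\<in>UNIV. \<Sum>j\<in>UNIV. pd i (f a) v * g v $ i $ j * pd k (pd j (f c)) v) + (\<Sum>i\<in>UNIV. \<Sum>j\<in>UNIV. pd i (f a) v * \<Gamma>0 i j k v * pd j (f c) v)" for a c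
    by (simp add: vector_matrix_nth P.rhess_def matrix_mult_nth Gam_nth Hess_def distrib_right distrib_left sum.distrib sum_distrib_right sum_distrib_left mult_ac pd_commute[OF open_V hol_f v, of k])
  have "pd k (\<lambda>v. (J v ** g v ** transpose (J v)) $ a $ c) v = ((\<Sum>i\<in>UNIV. \<Sum>j\<in>UNIV. pd i (f a) v * g v $ i $ j * pd k (pd j (f c)) v)
      + (\<Sum>i\<in>UNIV. \<Sum>j\<in>UNIV. pd i (f a) v * \<Gamma>0 i j k v * pd j (f c) v))
      + ((\<Sum>i\<in>UNIV. \<Sum>j\<in>UNIV. pd k (pd i (f a)) v * g v $ i $ j * pd j (f c) v)
      + (\<Sum>i\<in>UNIV. \<Sum>j\<in>UNIV. pd i (f a) v * \<Gamma>0 j i k v * pd j (f c) v))"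
    unfolding nth by (simp add: pd_sum pd_mult cdiff_intros cdV[OF v] cd P.metric sum.distrib[symmetric] algebra_simps)
  also have "(\<Sum>i\<in>UNIV. \<Sum>j\<in>UNIV. pd k (pd i (f a)) v * g v $ i $ j * pd j (f c) v) = (\<Sum>i\<in>UNIV. \<Sum>j\<in>UNIV. pd i (f c) v * g v $ i $ j * pd k (pd j (f a)) v)"
    by (subst sum.swap, intro sum.cong refl, subst symmetric_nth[OF P.G_sym], simp add: mult_ac)
  also have "(\<Sum>i\<in>UNIV. \<Sum>j\<in>UNIV. pd i (f a) v * \<Gamma>0 j i k v * pd j (f c) v) = (\<Sum>i\<in>UNIV. \<Sum>j\<in>UNIV. pd i (f c) v * \<Gamma>0 i j k v * pd j (f a) v)"
    by (subst sum.swap) (simp add: mult_ac)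
  finally show ?thesis by (simp only: R)
qed

text \<open>The components of dt^a R t^c in the coframe are holomorphic on all of \<open>V\<close>;
  where \<open>g\<close> is invertible they meet the conditions of
  \<open>contra_christoffel_unique\<close> and hence are the Christoffel symbols.\<close>

lemma christoffel_coords:
  "\<exists>\<Gamma>. contra_christoffel_on V \<tau> g \<Gamma> \<and>
     (\<forall>v\<in>V. \<forall>a c. formprod v (J v $ a) (J v $ c) = (\<Sum>e\<in>UNIV. (\<kappa> / d c * \<Gamma> a c e v) *s J v $ e))"
proof -
  define \<Gamma> where "\<Gamma> = (\<lambda>a c e v. (J v $ a v* R (f c) v v* matrix_inv (J v)) $ e)"
  have cd\<Gamma>: "cdiff (\<Gamma> a c e) v" if v: "v \<in> V" for a c e v
  proof -
    have "cdiff (\<lambda>v. (J v $ a v* R (f c) v v* matrix_inv (J v)) $ e) v"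
      unfolding vector_matrix_nth by (intro cdiff_intros cdiff_matrix_inv det_J v cdV) (simp_all add: cdV[OF v])
    then show ?thesis by (simp add: \<Gamma>_def)
  qed
  have "contra_christoffel_on V \<tau> g \<Gamma>"
    unfolding contra_christoffel_on_def
  proof (intro allI conjI ballI impI)
    show "mholomorphic_on V (\<Gamma> a c e)" for a c e using cd\<Gamma> by (simp add: mholomorphic_on_iff_cdiff)
    fix a c e v assume v: "v \<in> V" and g: "det (g v) \<noteq> 0"
    have cm: "coord_metric \<tau> g v = J v ** g v ** transpose (J v)" for v
      by (simp add: coord_metric_def jacobian_\<tau>)
    show "\<Gamma> a c e v = contra_christoffel (coord_pd \<tau>) (coord_metric \<tau> g) a c e v"
    proof (rule contra_christoffel_unique[symmetric, where \<Gamma> = "\<lambda>a c e. \<Gamma> a c e v" and Y = "\<lambda>c. coord_vec \<tau> c v"])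
      show "coord_pd \<tau> i h v = dird (coord_vec \<tau> i v) h v" for i h by (simp add: coord_pd_def)
      show "cdiff (\<lambda>v. coord_metric \<tau> g v $ i $ j) v" for i j
        unfolding cm matrix_mult_nth transpose_nth J_nth by (intro cdiff_intros cdV v cd)
      show "det (coord_metric \<tau> g v) \<noteq> 0"
        using g det_J[OF v] by (simp add: cm det_mul)
      show "transpose (coord_metric \<tau> g v) = coord_metric \<tau> g v"
        by (simp add: cm matrix_transpose_mul P.G_sym matrix_mul_assoc)
      show "(\<Sum>s\<in>UNIV. coord_metric \<tau> g v $ i $ s * \<Gamma> j k s v) = (\<Sum>s\<in>UNIV. coord_metric \<tau> g v $ j $ s * \<Gamma> i k s v)" for i j k
      proof -
        have "(\<Sum>s\<in>UNIV. coord_metric \<tau> g v $ i $ s * \<Gamma> j k s v) = bil (R (f k) v ** g v) (J v $ j) (J v $ i)" for i j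
        proof -
          have "(\<Sum>s\<in>UNIV. coord_metric \<tau> g v $ i $ s * \<Gamma> j k s v) = (J v $ j v* R (f k) v v* matrix_inv (J v) v* coord_metric \<tau> g v) $ i"
            unfolding vector_matrix_nth[of _ "coord_metric \<tau> g v"] \<Gamma>_def
            by (rule sum.cong[OF refl]) (subst symmetric_nth, simp_all add: cm matrix_transpose_mul P.G_sym matrix_mul_assoc)
          also have "J v $ j v* R (f k) v v* matrix_inv (J v) v* coord_metric \<tau> g v = J v $ j v* (R (f k) v ** g v) v* transpose (J v)"
            unfolding cm vector_matrix_mul_assoc by (simp add: matrix_mul_assoc[symmetric]) (simp add: matrix_mul_assoc matrix_inv_det[OF det_J[OF v]])
          also have "(J v $ j v* (R (f k) v ** g v) v* transpose (J v)) $ i = bil (R (f k) v ** g v) (J v $ j) (J v $ i)"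
          proof -
            have "(x v* transpose (J v)) $ i = contract x (J v $ i)" for x
              unfolding vector_matrix_nth transpose_nth contract_def by (simp only: mult.commute)
            then show ?thesis by (simp only: bil_contract)
          qed
          finally show ?thesis .
        qed
        moreover have "bil (R (f k) v ** g v) (J v $ j) (J v $ i) = bil (R (f k) v ** g v) (J v $ i) (J v $ j)"
          unfolding bil_def by (subst sum.swap, intro sum.cong refl, subst symmetric_nth[OF P.rhess_sym[OF open_V hol_f v]], simp add: mult_ac)
        ultimately show ?thesis by simp
      qed
      show "coord_pd \<tau> k (\<lambda>v. coord_metric \<tau> g v $ i $ j) v = \<Gamma> i j k v + \<Gamma> j i k v" for i j k
      proof -
        have "coord_pd \<tau> k (\<lambda>v. coord_metric \<tau> g v $ i $ j) v = (\<Sum>l\<in>UNIV. matrix_inv (J v) $ l $ k * pd l (\<lambda>v. (J v ** g v ** transpose (J v)) $ i $ j) v)"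
          by (simp add: coord_pd_def coord_vec_def dird_expand jacobian_\<tau> cm)
        then show ?thesis
          unfolding pd_metric_g[OF v] by (simp add: \<Gamma>_def vector_matrix_nth[of _ "matrix_inv _"] distrib_left sum.distrib)
      qed
    qed
  qed
  moreover have "formprod v (J v $ a) (J v $ c) = (\<Sum>e\<in>UNIV. (\<kappa> / d c * \<Gamma> a c e v) *s J v $ e)" if v: "v \<in> V" for v a c
  proof -
    have "J v $ a v* R (f c) v = (\<Sum>e\<in>UNIV. \<Gamma> a c e v *s J v $ e)"
      unfolding \<Gamma>_def by (rule expand_J[OF v])
    then show ?thesis unfolding formprod_J[OF v] by (simp add: vec_eq_iff sum_distrib_left mult_ac)
  qed
  ultimately show ?thesis by blast
qed

lemma E_coords:
  assumes v: "v \<in> V" and K: "\<And>a. K a = 0"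
  shows "Et v = (\<Sum>a\<in>UNIV. (d a * f a v / \<kappa>) *s coord_vec \<tau> a v)"
proof -
  have "Et v = matrix_inv (J v) *v (J v *v Et v)"
    by (simp add: matrix_vector_mul_assoc matrix_inv_det[OF det_J[OF v]])
  also have "J v *v Et v = (\<chi> a. d a * f a v / \<kappa>)"
    using eig[OF v] K by (simp add: vec_eq_iff matrix_vector_mult_def dird_expand sum_distrib_left[symmetric] mult_ac sum_divide_distrib[symmetric])
  finally show ?thesis
    by (simp add: coord_vec_def jacobian_\<tau> vec_eq_iff matrix_vector_mult_def mult.commute)
qed

end

context flat_pencil
begin

lemma eigen_frame_restrict:
  assumes "eigen_frame g \<eta> \<Gamma>0 \<Gamma>1 \<theta> \<kappa> m v0 v1 V f d K" "open V'" "V' \<subseteq> V"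
  shows "eigen_frame g \<eta> \<Gamma>0 \<Gamma>1 \<theta> \<kappa> m v0 v1 V' f d K"
proof -
  interpret F: eigen_frame g \<eta> \<Gamma>0 \<Gamma>1 \<theta> \<kappa> m v0 v1 V f d K by fact
  show ?thesis
    by unfold_locales (use assms(2,3) F.V_\<eta> F.flat_f F.eig F.det_J' F.d in \<open>auto simp: flat_fun_def mholomorphic_on_def\<close>)
qed

text \<open>All fields are defined globally, and each axiom is an equation at a point depending only
  on germs. It can be verified in a frame shrunk into the domain of the given vector fields.\<close>

theorem frobenius_manifold:
  assumes M: "M = {v. det (\<eta> v) \<noteq> 0 \<and> (\<forall>i. m i > 0 \<longrightarrow> v $ i \<noteq> 0)}"
    and frames: "\<And>v. v \<in> M \<Longrightarrow> \<exists>V f K. v \<in> V \<and> eigen_frame g \<eta> \<Gamma>0 \<Gamma>1 \<theta> \<kappa> m v0 v1 V f d K"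
  shows "generalized_frobenius_manifold M b mulv unit_field Et 1"
proof -
  have open_M: "open M"
  proof -
    have "M = {v. det (\<eta> v) \<noteq> 0} \<inter> {v. \<forall>i. m i > 0 \<longrightarrow> v $ i \<noteq> 0}" using M by auto
    then show ?thesis using open_Int[OF open_\<eta> open_nonzero_coords] by simp
  qed
  have ev: "det (\<eta> v) \<noteq> 0" "\<And>i. m i > 0 \<Longrightarrow> v $ i \<noteq> 0" if "v \<in> M" for v using that M by auto
  have local: "\<exists>V f K. v \<in> V \<and> V \<subseteq> V' \<and> eigen_frame g \<eta> \<Gamma>0 \<Gamma>1 \<theta> \<kappa> m v0 v1 V f d K" if "v \<in> V'" "open V'" "V' \<subseteq> M" for v V'
  proof -
    obtain V f K where V: "v \<in> V" "eigen_frame g \<eta> \<Gamma>0 \<Gamma>1 \<theta> \<kappa> m v0 v1 V f d K" using frames \<open>v \<in> V'\<close> \<open>V' \<subseteq> M\<close> by blast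
    then interpret F: eigen_frame g \<eta> \<Gamma>0 \<Gamma>1 \<theta> \<kappa> m v0 v1 V f d K by simp
    have "eigen_frame g \<eta> \<Gamma>0 \<Gamma>1 \<theta> \<kappa> m v0 v1 (V \<inter> V') f d K"
      by (rule eigen_frame_restrict[OF V(2)]) (use F.open_V \<open>open V'\<close> in auto)
    then show ?thesis using V(1) \<open>v \<in> V'\<close> by blast
  qed
  have sub: "vfield_on V X \<Longrightarrow> V1 \<subseteq> V \<Longrightarrow> vfield_on V1 X" for V V1 and X :: "complex^'n \<Rightarrow> complex^'n"
    by (auto simp: vfield_on_def mholomorphic_on_def)
  have detB: "det (Bmat v) \<noteq> 0" if "v \<in> M" for v
    using frames[OF that] eigen_frame.det_B by blast
  show ?thesis
    unfolding generalized_frobenius_manifold_def euler_vector_field_def flat_metric_on_def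
  proof (intro conjI ballI allI impI; (elim conjE)?)
    show "open M" by (rule open_M)
    show fr: "frobenius_algebra (mulv v) (b v) (unit_field v)" if "v \<in> M" for v
      using frames[OF that] eigen_frame.frobenius_algebra_mulv ev(2)[OF that] by blast
    show "vfield_on M (\<lambda>v. mulv v X Y)" for X Y
      unfolding vfield_on_def mholomorphic_on_iff_cdiff
      by (intro allI ballI cdiff_mulv ev detB cdiff_const)
    show "vfield_on M unit_field"
      unfolding vfield_on_def mholomorphic_on_iff_cdiff unit_field_def sharp_def vector_matrix_nth vector_smult_component
      by (intro allI ballI cdiff_intros cd dlog_pd(1) ev(2))
    show "Vector_Spaces.linear (*s) (*) (b v X)" if "v \<in> M" for v X
      using fr[OF that] unfolding frobenius_algebra_def by blast
    show "b v X Y = b v Y X" for v X Y by (rule b_sym)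
    show "X = 0" if "v \<in> M" "\<forall>Y. b v X Y = 0" for v X
      using fr[OF that(1)] that(2) unfolding frobenius_algebra_def by blast
    show "mholomorphic_on M (\<lambda>v. b v X Y)" for X Y
      unfolding mholomorphic_on_iff_cdiff covariant_form_def bil_def
      by (intro ballI cdiff_intros cd cdiff_flat ev cdiff_const)
    show "cov_deriv b X (cov_deriv b Y Z) v - cov_deriv b Y (cov_deriv b X Z) v - cov_deriv b (lie_bracket X Y) Z v = 0"
      if "open V" "V \<subseteq> M" "vfield_on V X" "vfield_on V Y" "vfield_on V Z" "v \<in> V" for V X Y Z v
    proof -
      note prems = that
      obtain V1 f K where V1: "v \<in> V1" "V1 \<subseteq> V" "eigen_frame g \<eta> \<Gamma>0 \<Gamma>1 \<theta> \<kappa> m v0 v1 V1 f d K" using local[OF prems(6,1,2)] by blast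
      interpret F: eigen_frame g \<eta> \<Gamma>0 \<Gamma>1 \<theta> \<kappa> m v0 v1 V1 f d K by (rule V1(3))
      show ?thesis
        by (rule F.flat_connection[OF F.open_V subset_refl sub[OF that(3) V1(2)] sub[OF that(4) V1(2)] sub[OF that(5) V1(2)] V1(1)])
    qed
    show "nabla_c b mulv W X Y Z v = nabla_c b mulv X W Y Z v"
      "nabla_c b mulv W X Y Z v = nabla_c b mulv W Y X Z v"
      "nabla_c b mulv W X Y Z v = nabla_c b mulv W X Z Y v"
      if "open V" "V \<subseteq> M" "vfield_on V W" "vfield_on V X" "vfield_on V Y" "vfield_on V Z" "v \<in> V" for V W X Y Z v
    proof -
      note prems = that
      obtain V1 f K where V1: "v \<in> V1" "V1 \<subseteq> V" "eigen_frame g \<eta> \<Gamma>0 \<Gamma>1 \<theta> \<kappa> m v0 v1 V1 f d K" using local[OF prems(7,1,2)] by blast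
      interpret F: eigen_frame g \<eta> \<Gamma>0 \<Gamma>1 \<theta> \<kappa> m v0 v1 V1 f d K by (rule V1(3))
      note * = F.nabla_c_symmetric[OF F.open_V subset_refl sub[OF that(3) V1(2)] sub[OF that(4) V1(2)] sub[OF that(5) V1(2)] sub[OF that(6) V1(2)] V1(1)]
      show "nabla_c b mulv W X Y Z v = nabla_c b mulv X W Y Z v" by (rule *(1))
      show "nabla_c b mulv W X Y Z v = nabla_c b mulv W Y X Z v" by (rule *(2))
      show "nabla_c b mulv W X Y Z v = nabla_c b mulv W X Z Y v" by (rule *(3))
    qed
    show "vfield_on M Et" unfolding vfield_on_def mholomorphic_on_iff_cdiff by (intro allI ballI cdiff_Et)
    show "diagonalizable_matrix (\<chi> k j. cov_deriv b (\<lambda>_. axis j 1) Et v $ k)" if "v \<in> M" for v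
      using frames[OF that] eigen_frame.euler_diagonalizable by blast
    show "cov_deriv b X (cov_deriv b Y Et) v - cov_deriv b (cov_deriv b X Y) Et v = 0"
      "lie_bracket Et (\<lambda>u. mulv u (X u) (Y u)) v = mulv v (lie_bracket Et X v) (Y v) + mulv v (X v) (lie_bracket Et Y v) + mulv v (X v) (Y v)"
      "dird (Et v) (\<lambda>u. b u (X u) (Y u)) v = b v (lie_bracket Et X v) (Y v) + b v (X v) (lie_bracket Et Y v) + (2 - 1) * b v (X v) (Y v)"
      if "open V" "V \<subseteq> M" "vfield_on V X" "vfield_on V Y" "v \<in> V" for V X Y v
    proof -
      note prems = that
      obtain V1 f K where V1: "v \<in> V1" "V1 \<subseteq> V" "eigen_frame g \<eta> \<Gamma>0 \<Gamma>1 \<theta> \<kappa> m v0 v1 V1 f d K" using local[OF prems(5,1,2)] by blast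
      interpret F: eigen_frame g \<eta> \<Gamma>0 \<Gamma>1 \<theta> \<kappa> m v0 v1 V1 f d K by (rule V1(3))
      note c = vfield_cdiff[OF that(3,5)] vfield_cdiff[OF that(4,5)]
      show "cov_deriv b X (cov_deriv b Y Et) v - cov_deriv b (cov_deriv b X Y) Et v = 0"
        by (rule F.euler_flat[OF F.open_V subset_refl sub[OF that(3) V1(2)] sub[OF that(4) V1(2)] V1(1)])
      show "lie_bracket Et (\<lambda>u. mulv u (X u) (Y u)) v = mulv v (lie_bracket Et X v) (Y v) + mulv v (X v) (lie_bracket Et Y v) + mulv v (X v) (Y v)"
        by (rule F.euler_product[OF V1(1) c])
      show "dird (Et v) (\<lambda>u. b u (X u) (Y u)) v = b v (lie_bracket Et X v) (Y v) + b v (X v) (lie_bracket Et Y v) + (2 - 1) * b v (X v) (Y v)"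
        by (rule F.euler_metric[OF V1(1) c])
    qed
  qed
qed

end

section \<open>Root systems\<close>

lemma reflect_linear: "linear (reflect \<beta>)"
  by (rule linearI) (simp_all add: reflect_def algebra_simps inner_add_left add_divide_distrib)

lemma reflect_inner:
  assumes "\<beta> \<noteq> 0"
  shows "reflect \<beta> u \<bullet> reflect \<beta> v = u \<bullet> v"
  using assms by (simp add: reflect_def inner_diff_left inner_diff_right inner_commute field_simps power2_eq_square)

lemma reflect_reflect: "\<beta> \<noteq> 0 \<Longrightarrow> reflect \<beta> (reflect \<beta> v) = v"
  by (simp add: reflect_def inner_diff_left algebra_simps)

lemma reflect_self: "\<beta> \<noteq> 0 \<Longrightarrow> reflect \<beta> \<beta> = - \<beta>"
  by (simp add: reflect_def algebra_simps scaleR_2)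

lemma reflect_coroot: "reflect \<beta> v = v - (v \<bullet> coroot \<beta>) *\<^sub>R \<beta>"
  by (simp add: reflect_def coroot_def)

lemma reflect_minus: "reflect (- \<beta>) = reflect \<beta>"
  by (rule ext) (simp add: reflect_def)

lemma reflect_conj:
  assumes "\<gamma> \<noteq> 0"
  shows "reflect (reflect \<gamma> \<beta>) v = reflect \<gamma> (reflect \<beta> (reflect \<gamma> v))"
proof -
  have "v \<bullet> reflect \<gamma> \<beta> = reflect \<gamma> v \<bullet> \<beta>"
    using reflect_inner[OF assms, of v "reflect \<gamma> \<beta>"] reflect_reflect[OF assms, of \<beta>] by metis
  then have "reflect (reflect \<gamma> \<beta>) v = v - (2 * (reflect \<gamma> v \<bullet> \<beta>) / (\<beta> \<bullet> \<beta>)) *\<^sub>R reflect \<gamma> \<beta>"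
    unfolding reflect_def[of "reflect \<gamma> \<beta>"] reflect_inner[OF assms] by simp
  also have "\<dots> = reflect \<gamma> (reflect \<beta> (reflect \<gamma> v))"
    unfolding reflect_def[of \<beta>]
    by (simp add: linear_diff[OF reflect_linear] linear_scale[OF reflect_linear] reflect_reflect[OF assms])
  finally show ?thesis .
qed

locale root_data =
  fixes R :: "'v::euclidean_space set" and \<alpha> :: "'l::finite \<Rightarrow> 'v"
  assumes roots: "root_system R" and reduced: "reduced_roots R" and irreducible: "irreducible_roots R"
    and rational: "\<forall>\<beta>\<in>R. \<beta> \<bullet> \<beta> \<in> \<rat>" and simple: "simple_roots R \<alpha>"
begin

abbreviation "\<omega> \<equiv> fund_weight \<alpha>"
abbreviation "srefl i \<equiv> reflect (\<alpha> i)"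

lemma root_nonzero: "\<beta> \<in> R \<Longrightarrow> \<beta> \<noteq> 0" and reflect_root: "\<beta> \<in> R \<Longrightarrow> \<gamma> \<in> R \<Longrightarrow> reflect \<beta> \<gamma> \<in> R"
  and finite_R: "finite R" and span_R: "span R = UNIV"
  using roots by (auto simp: root_system_def)

lemma neg_root: "\<beta> \<in> R \<Longrightarrow> - \<beta> \<in> R"
  using reflect_root[of \<beta> \<beta>] reflect_self[of \<beta>] root_nonzero[of \<beta>] by simp

lemma \<alpha>_root: "\<alpha> i \<in> R" and inj_\<alpha>: "inj \<alpha>" and indep_\<alpha>: "independent (range \<alpha>)"
  using simple by (auto simp: simple_roots_def)

lemma \<alpha>_nonzero [simp]: "\<alpha> i \<noteq> 0" by (rule root_nonzero[OF \<alpha>_root])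
lemma \<alpha>_pos [simp]: "\<alpha> i \<bullet> \<alpha> i > 0" by simp

lemma root_coeffs:
  assumes "\<beta> \<in> R"
  obtains n :: "'l \<Rightarrow> int" where "\<beta> = (\<Sum>i\<in>UNIV. of_int (n i) *\<^sub>R \<alpha> i)" "(\<forall>i. n i \<ge> 0) \<or> (\<forall>i. n i \<le> 0)"
  using simple assms unfolding simple_roots_def by blast

lemma span_\<alpha>: "span (range \<alpha>) = UNIV"
proof -
  have "R \<subseteq> span (range \<alpha>)"
  proof
    fix \<beta> assume "\<beta> \<in> R"
    then obtain n :: "'l \<Rightarrow> int" where n: "\<beta> = (\<Sum>i\<in>UNIV. of_int (n i) *\<^sub>R \<alpha> i)" by (rule root_coeffs)
    show "\<beta> \<in> span (range \<alpha>)" unfolding n by (intro span_sum span_scale span_base rangeI)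
  qed
  then have "span R \<subseteq> span (range \<alpha>)" by (rule span_minimal) (rule subspace_span)
  then show ?thesis using span_R by auto
qed

lemma inner_\<alpha>_eqI:
  assumes "\<And>i. u \<bullet> \<alpha> i = v \<bullet> \<alpha> i"
  shows "u = v"
proof -
  have "(u - v) \<bullet> x = 0" if "x \<in> span (range \<alpha>)" for x
    using that by (induction rule: span_induct_alt) (use assms in \<open>auto simp: inner_diff_left inner_add_right\<close>)
  then have "(u - v) \<bullet> (u - v) = 0" using span_\<alpha> by auto
  then show ?thesis by simp
qed

lemma coroot_inner: "u \<bullet> coroot \<beta> = 2 * (u \<bullet> \<beta>) / (\<beta> \<bullet> \<beta>)"
  by (simp add: coroot_def)

text \<open>Existence: prescribe a linear functional on the independent simple roots and represent
  it by a vector. Uniqueness: the simple roots span. So the definite description in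
  \<open>fund_weight\<close> denotes.\<close>

lemma fund_weight_coroot: "\<omega> i \<bullet> coroot (\<alpha> j) = (if i = j then 1 else 0)"
proof -
  define h where "h = (\<lambda>x. if x = \<alpha> i then \<alpha> i \<bullet> \<alpha> i / 2 else 0 :: real)"
  obtain g where g: "linear g" "\<And>x. x \<in> range \<alpha> \<Longrightarrow> g x = h x"
    using linear_independent_extend[OF indep_\<alpha>, of h] by blast
  define w where "w = adjoint g 1"
  have w: "w \<bullet> x = g x" for x
    using adjoint_works[OF g(1), of x 1] by (simp add: w_def inner_commute)
  have 1: "\<forall>j. w \<bullet> coroot (\<alpha> j) = (if i = j then 1 else 0)"
    using inj_\<alpha> by (auto simp: coroot_inner w g(2) h_def inj_eq)
  have "w' = w" if "\<forall>j. w' \<bullet> coroot (\<alpha> j) = (if i = j then 1 else 0)" for w'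
  proof (rule inner_\<alpha>_eqI)
    fix k
    have "w' \<bullet> coroot (\<alpha> k) = w \<bullet> coroot (\<alpha> k)" using that 1 by metis
    then show "w' \<bullet> \<alpha> k = w \<bullet> \<alpha> k" by (simp add: coroot_inner)
  qed
  then have "\<forall>j. \<omega> i \<bullet> coroot (\<alpha> j) = (if i = j then 1 else 0)"
    unfolding fund_weight_def using 1 by (rule_tac theI) auto
  then show ?thesis by blast
qed

lemma fund_weight_\<alpha>: "\<omega> i \<bullet> \<alpha> j = (if i = j then \<alpha> j \<bullet> \<alpha> j / 2 else 0)"
  using fund_weight_coroot[of i j] by (auto simp: coroot_inner field_simps split: if_splits)

lemma \<alpha>_fund_weight: "\<alpha> j \<bullet> \<omega> i = (if i = j then \<alpha> j \<bullet> \<alpha> j / 2 else 0)"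
  by (simp only: inner_commute[of "\<alpha> j" "\<omega> i"] fund_weight_\<alpha>)

lemma weight_expand: "x = (\<Sum>j\<in>UNIV. (x \<bullet> coroot (\<alpha> j)) *\<^sub>R \<omega> j)"
  by (rule inner_\<alpha>_eqI) (simp add: inner_sum_left fund_weight_\<alpha> coroot_inner if_distrib[of "\<lambda>x. _ * x"] cong: if_cong)

text \<open>The i-th coordinate with respect to the simple roots; suitably rescaled, the fundamental
  weights are the dual basis.\<close>

definition cf :: "'l \<Rightarrow> 'v \<Rightarrow> real" where "cf i x = 2 * (x \<bullet> \<omega> i) / (\<alpha> i \<bullet> \<alpha> i)"

lemma cf_sum: "cf i (\<Sum>k\<in>UNIV. c k *\<^sub>R \<alpha> k) = c i"
  by (simp add: cf_def inner_sum_left \<alpha>_fund_weight if_distrib[of "\<lambda>x. _ * x"] cong: if_cong)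

lemma cf_add: "cf i (x + y) = cf i x + cf i y" and cf_diff: "cf i (x - y) = cf i x - cf i y"
  and cf_scale: "cf i (c *\<^sub>R x) = c * cf i x" and cf_minus: "cf i (- x) = - cf i x"
  by (simp_all add: cf_def inner_add_left inner_diff_left algebra_simps add_divide_distrib diff_divide_distrib)

lemma cf_\<alpha>: "cf i (\<alpha> j) = (if i = j then 1 else 0)"
  by (simp add: cf_def \<alpha>_fund_weight)

lemma cf_expand: "x = (\<Sum>k\<in>UNIV. cf k x *\<^sub>R \<alpha> k)"
proof -
  have "x \<in> span (range \<alpha>)" using span_\<alpha> by simp
  then show ?thesis
  proof (induction rule: span_induct_alt)
    case base then show ?case by (simp add: cf_def)
  next
    case (step c x y)
    then obtain j where x: "x = \<alpha> j" by auto
    have "(\<Sum>k\<in>UNIV. cf k (c *\<^sub>R x + y) *\<^sub>R \<alpha> k) = (\<Sum>k\<in>UNIV. (if k = j then c else 0) *\<^sub>R \<alpha> k) + (\<Sum>k\<in>UNIV. cf k y *\<^sub>R \<alpha> k)"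
      by (simp add: cf_add cf_scale x cf_\<alpha> scaleR_add_left sum.distrib if_distrib[of "\<lambda>x. _ * x"] cong: if_cong)
    also have "(\<Sum>k\<in>UNIV. (if k = j then c else 0) *\<^sub>R \<alpha> k) = c *\<^sub>R x"
      by (simp add: x if_distrib[of "\<lambda>x. x *\<^sub>R _"] cong: if_cong)
    finally show ?case using step by simp
  qed
qed

lemma cf_root:
  assumes "\<beta> \<in> R"
  shows "cf i \<beta> \<in> \<int>" and "(\<forall>i. cf i \<beta> \<ge> 0) \<or> (\<forall>i. cf i \<beta> \<le> 0)"
proof -
  obtain n :: "'l \<Rightarrow> int" where n: "\<beta> = (\<Sum>i\<in>UNIV. of_int (n i) *\<^sub>R \<alpha> i)" "(\<forall>i. n i \<ge> 0) \<or> (\<forall>i. n i \<le> 0)"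
    using assms by (rule root_coeffs)
  have cf: "cf i \<beta> = of_int (n i)" for i using n(1) cf_sum by metis
  show "cf i \<beta> \<in> \<int>" "(\<forall>i. cf i \<beta> \<ge> 0) \<or> (\<forall>i. cf i \<beta> \<le> 0)" using n(2) by (auto simp: cf)
qed

definition "pos = {\<beta> \<in> R. \<forall>i. cf i \<beta> \<ge> 0}"

lemma \<alpha>_in_pos: "\<alpha> i \<in> pos"
  by (simp add: pos_def \<alpha>_root cf_\<alpha>)

lemma cf_reflect: "k \<noteq> i \<Longrightarrow> cf k (srefl i x) = cf k x"
  by (simp add: reflect_coroot cf_diff cf_scale cf_\<alpha>)

text \<open>Since the root system is reduced, a positive root other than \<alpha>_i has another
  simple coordinate that is positive. The reflection does not change that coordinate, and the
  coordinates of a root share one sign.\<close>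

lemma reflect_pos:
  assumes "\<beta> \<in> pos" "\<beta> \<noteq> \<alpha> i"
  shows "srefl i \<beta> \<in> pos"
proof -
  have \<beta>: "\<beta> \<in> R" "\<And>i. cf i \<beta> \<ge> 0" using assms by (auto simp: pos_def)
  have "\<exists>k. k \<noteq> i \<and> cf k \<beta> > 0"
  proof (rule ccontr)
    assume "\<not> ?thesis"
    then have "cf k \<beta> = 0" if "k \<noteq> i" for k using \<beta>(2)[of k] that by force
    then have "(\<Sum>k\<in>UNIV. cf k \<beta> *\<^sub>R \<alpha> k) = (\<Sum>k\<in>UNIV. (if k = i then cf i \<beta> *\<^sub>R \<alpha> i else 0))"
      by (intro sum.cong) auto
    then have eq: "\<beta> = cf i \<beta> *\<^sub>R \<alpha> i" using cf_expand[of \<beta>] by simp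
    then have "cf i \<beta> = 1 \<or> cf i \<beta> = -1"
      using reduced \<alpha>_root[of i] \<beta>(1) unfolding reduced_roots_def by metis
    then have "cf i \<beta> = 1" using \<beta>(2)[of i] by linarith
    then show False using eq assms(2) by simp
  qed
  then obtain k where k: "k \<noteq> i" "cf k \<beta> > 0" by blast
  have R: "srefl i \<beta> \<in> R" by (rule reflect_root[OF \<alpha>_root \<beta>(1)])
  have "cf k (srefl i \<beta>) > 0" using k by (simp add: cf_reflect)
  then have "\<not> (\<forall>i. cf i (srefl i' \<beta>) \<le> 0)" if "i' = i" for i' using that by (metis not_le)
  then show ?thesis using cf_root(2)[OF R] R unfolding pos_def by blast
qed

lemma pos_or_neg: "\<beta> \<in> R \<Longrightarrow> \<beta> \<in> pos \<or> - \<beta> \<in> pos"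
  using cf_root(2)[of \<beta>] neg_root by (auto simp: pos_def cf_minus)

text \<open>Induction on the height. A positive root has positive inner product with some simple
  root, and unless the two coincide, the reflection gives a positive root of smaller height.\<close>

lemma pos_induct [consumes 1, case_names simple reflect]:
  assumes "\<beta> \<in> pos" and "\<And>i. P (\<alpha> i)" and "\<And>i \<gamma>. \<gamma> \<in> pos \<Longrightarrow> P \<gamma> \<Longrightarrow> P (srefl i \<gamma>)"
  shows "P \<beta>"
proof -
  define ht where "ht = (\<lambda>\<beta>. \<Sum>i\<in>UNIV. cf i \<beta>)"
  have "\<forall>\<beta>\<in>pos. nat \<lfloor>ht \<beta>\<rfloor> = n \<longrightarrow> P \<beta>" for n
  proof (induction n rule: less_induct)
    case (less n)
    show ?case
    proof (intro ballI impI)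
      fix \<beta> assume \<beta>: "\<beta> \<in> pos" "nat \<lfloor>ht \<beta>\<rfloor> = n"
      have R: "\<beta> \<in> R" and nn: "\<And>i. cf i \<beta> \<ge> 0" using \<beta> by (auto simp: pos_def)
      have "\<exists>i. \<beta> \<bullet> \<alpha> i > 0"
      proof (rule ccontr)
        assume "\<not> ?thesis"
        then have "\<beta> \<bullet> \<alpha> i \<le> 0" for i by (simp add: not_less)
        then have "(\<Sum>k\<in>UNIV. cf k \<beta> * (\<beta> \<bullet> \<alpha> k)) \<le> 0" using nn by (intro sum_nonpos mult_nonneg_nonpos)
        moreover have "\<beta> \<bullet> \<beta> = (\<Sum>k\<in>UNIV. cf k \<beta> * (\<beta> \<bullet> \<alpha> k))"
          by (subst (2) cf_expand[of \<beta>]) (simp add: inner_sum_right)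
        ultimately show False using root_nonzero[OF R] inner_gt_zero_iff[of \<beta>] by linarith
      qed
      then obtain i where i: "\<beta> \<bullet> \<alpha> i > 0" by blast
      show "P \<beta>"
      proof (cases "\<beta> = \<alpha> i")
        case False
        have g: "srefl i \<beta> \<in> pos" by (rule reflect_pos[OF \<beta>(1) False])
        have "ht (srefl i \<beta>) = ht \<beta> - \<beta> \<bullet> coroot (\<alpha> i)"
          by (simp add: ht_def reflect_coroot cf_diff cf_scale sum_subtractf cf_\<alpha> if_distrib[of "\<lambda>x. _ * x"] cong: if_cong)
        moreover have "\<beta> \<bullet> coroot (\<alpha> i) > 0" using i by (simp add: coroot_inner)
        moreover have "ht \<beta> \<in> \<int>" "ht (srefl i \<beta>) \<in> \<int>" "ht (srefl i \<beta>) \<ge> 0"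
          using cf_root(1) R g unfolding ht_def by (auto intro!: sum_nonneg simp: pos_def)
        ultimately have "nat \<lfloor>ht (srefl i \<beta>)\<rfloor> < n"
          using \<beta>(2) by (auto elim!: Ints_cases simp: nat_less_iff)
        then have "P (srefl i \<beta>)" using less g by blast
        then have "P (srefl i (srefl i \<beta>))" using assms(3)[OF g] by blast
        then show ?thesis by (simp add: reflect_reflect)
      qed (use assms(2) in auto)
    qed
  qed
  then show ?thesis using assms(1) by blast
qed

section \<open>Words in simple reflections\<close>

fun word :: "'l list \<Rightarrow> 'v \<Rightarrow> 'v" where
  "word [] v = v"
| "word (i # w) v = srefl i (word w v)"

lemma word_append: "word (u @ w) v = word u (word w v)"
  by (induction u) auto

lemma word_rev: "word (rev w) (word w v) = v"
  by (induction w arbitrary: v) (auto simp: word_append reflect_reflect)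

lemma word_inner: "word w u \<bullet> word w v = u \<bullet> v"
  by (induction w) (auto simp: reflect_inner)

text \<open>Along \<open>pos_induct\<close>, the reflection in a positive root is obtained from a
  simple one by repeated conjugation with simple reflections.\<close>

lemma reflect_word: "\<beta> \<in> R \<Longrightarrow> \<exists>w. \<forall>v. reflect \<beta> v = word w v"
proof -
  have *: "\<exists>w. \<forall>v. reflect \<beta> v = word w v" if "\<beta> \<in> pos" for \<beta>
    using that
  proof (induction rule: pos_induct)
    case (simple i)
    show ?case by (rule exI[of _ "[i]"]) simp
  next
    case (reflect i \<gamma>)
    then obtain w where "\<forall>v. reflect \<gamma> v = word w v" by blast
    then show ?case by (intro exI[of _ "i # w @ [i]"]) (simp add: reflect_conj word_append)
  qed
  assume "\<beta> \<in> R"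
  then show ?thesis using pos_or_neg[of \<beta>] * reflect_minus by metis
qed

lemma weyl_word:
  assumes "\<sigma> \<in> weyl_group R"
  shows "\<exists>w. \<forall>v. \<sigma> v = word w v"
  using assms
proof induction
  case weyl_id
  show ?case by (rule exI[of _ "[]"]) simp
next
  case (weyl_reflect \<sigma> \<beta>)
  then obtain w w' where "\<forall>v. \<sigma> v = word w v" "\<forall>v. reflect \<beta> v = word w' v" using reflect_word by blast
  then show ?case by (intro exI[of _ "w' @ w"]) (simp add: word_append)
qed

lemma word_weyl: "word w \<in> weyl_group R"
proof (induction w)
  case Nil
  have "word [] = id" by auto
  then show ?case using weyl_id by metis
next
  case (Cons i w)
  have "word (i # w) = srefl i \<circ> word w" by auto
  then show ?case using weyl_reflect[OF Cons \<alpha>_root] by metis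
qed

lemma weyl_linear: "\<sigma> \<in> weyl_group R \<Longrightarrow> linear \<sigma>"
proof (induction rule: weyl_group.induct)
  case weyl_id
  show ?case by (rule linear_id)
next
  case (weyl_reflect \<sigma> \<beta>)
  then show ?case using linear_compose[OF _ reflect_linear] by blast
qed

lemma weyl_root: "\<sigma> \<in> weyl_group R \<Longrightarrow> \<beta> \<in> R \<Longrightarrow> \<sigma> \<beta> \<in> R"
  by (induction arbitrary: \<beta> rule: weyl_group.induct) (auto intro: reflect_root)

lemma finite_weyl: "finite (weyl_group R)"
proof (rule finite_imageD)
  let ?r = "\<lambda>\<sigma> :: 'v \<Rightarrow> 'v. restrict \<sigma> R"
  have "?r ` weyl_group R \<subseteq> R \<rightarrow>\<^sub>E R" using weyl_root by auto
  then show "finite (?r ` weyl_group R)" using finite_PiE[OF finite_R] finite_R finite_subset by metis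
  show "inj_on ?r (weyl_group R)"
  proof (rule inj_onI)
    fix \<sigma> \<tau> assume *: "\<sigma> \<in> weyl_group R" "\<tau> \<in> weyl_group R" "?r \<sigma> = ?r \<tau>"
    have "\<sigma> x = \<tau> x" if "x \<in> R" for x using fun_cong[OF *(3), of x] that by simp
    then have "\<sigma> x = \<tau> x" if "x \<in> span R" for x
      using linear_eq_on_span[OF weyl_linear[OF *(1)] weyl_linear[OF *(2)] _ that] by blast
    then show "\<sigma> = \<tau>" using span_R by auto
  qed
qed

text \<open>The exchange argument: if \<open>w\<^sup>-\<^sup>1 \<beta>\<close> is negative, then \<open>s_\<beta> w\<close> has a shorter expression.\<close>

lemma exchange:
  assumes "\<beta> \<in> pos" "word (rev w) \<beta> \<notin> pos"
  shows "\<exists>w'. length w' < length w \<and> (\<forall>v. reflect \<beta> (word w v) = word w' v)"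
  using assms
proof (induction w arbitrary: \<beta>)
  case (Cons j u)
  show ?case
  proof (cases "\<beta> = \<alpha> j")
    case True
    then show ?thesis by (intro exI[of _ u]) (simp add: reflect_reflect)
  next
    case False
    have "srefl j \<beta> \<in> pos" by (rule reflect_pos[OF Cons.prems(1) False])
    moreover have "word (rev u) (srefl j \<beta>) \<notin> pos" using Cons.prems(2) by (simp add: word_append)
    ultimately obtain u' where u': "length u' < length u" "\<forall>v. reflect (srefl j \<beta>) (word u v) = word u' v"
      using Cons.IH by blast
    have "reflect \<beta> (word (j # u) v) = word (j # u') v" for v
    proof -
      have "word u' v = srefl j (reflect \<beta> (srefl j (word u v)))"
        using u'(2) reflect_conj[OF \<alpha>_nonzero] by metis
      then show ?thesis by (simp add: reflect_reflect)
    qed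
    then show ?thesis using u'(1) by (intro exI[of _ "j # u'"]) auto
  qed
qed auto

text \<open>Induction on the length of the word. The outermost reflection subtracts a multiple of
  \<alpha>_i; if this multiple is negative, the exchange argument yields a shorter word for the same
  transformation.\<close>

lemma dominant_word:
  assumes "\<And>i. \<mu> \<bullet> coroot (\<alpha> i) \<in> \<nat>"
  shows "\<exists>n :: 'l \<Rightarrow> nat. word w \<mu> = \<mu> - (\<Sum>k\<in>UNIV. real (n k) *\<^sub>R \<alpha> k)"
proof -
  have dom: "\<mu> \<bullet> \<alpha> i \<ge> 0" for i
  proof -
    have "\<mu> \<bullet> coroot (\<alpha> i) \<ge> 0" using assms[of i] by (auto elim!: Nats_cases)
    then show ?thesis by (simp add: coroot_inner zero_le_divide_iff zero_le_mult_iff inner_ge_zero) (metis \<alpha>_pos less_asym not_le)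
  qed
  have int: "\<alpha> k \<bullet> coroot (\<alpha> i) \<in> \<int>" for k i
    using roots \<alpha>_root unfolding root_system_def by blast
  show ?thesis
  proof (induction "length w" arbitrary: w rule: less_induct)
    case less
    show ?case
    proof (cases w)
      case Nil
      then show ?thesis by (intro exI[of _ "\<lambda>_. 0"]) simp
    next
      case (Cons i u)
      obtain n :: "'l \<Rightarrow> nat" where n: "word u \<mu> = \<mu> - (\<Sum>k\<in>UNIV. real (n k) *\<^sub>R \<alpha> k)"
        using less[of u] Cons by auto
      let ?c = "word u \<mu> \<bullet> coroot (\<alpha> i)"
      show ?thesis
      proof (cases "?c \<ge> 0")
        case True
        have "?c \<in> \<int>"
          unfolding n inner_diff_left inner_sum_left inner_scaleR_left
          using assms[of i] Nats_subset_Ints by (auto intro!: Ints_diff Ints_sum Ints_mult int)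
        then obtain c :: nat where c: "?c = real c"
          using True by (auto elim!: Ints_cases) (metis nat_0_le of_int_of_nat_eq)
        have "word w \<mu> = word u \<mu> - real c *\<^sub>R \<alpha> i"
          using Cons by (simp add: reflect_coroot c)
        also have "\<dots> = \<mu> - (\<Sum>k\<in>UNIV. real (n k) *\<^sub>R \<alpha> k) - real c *\<^sub>R \<alpha> i"
          by (simp only: n)
        also have "real c *\<^sub>R \<alpha> i = (\<Sum>k\<in>UNIV. real (if k = i then c else 0) *\<^sub>R \<alpha> k)"
          by (simp add: if_distrib[of "\<lambda>x. real x *\<^sub>R _"] cong: if_cong)
        finally have "word w \<mu> = \<mu> - (\<Sum>k\<in>UNIV. real (n k + (if k = i then c else 0)) *\<^sub>R \<alpha> k)"
          by (simp add: scaleR_add_left sum.distrib)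
        then show ?thesis by (rule exI[of _ "\<lambda>k. n k + (if k = i then c else 0)"])
      next
        case False
        then have neg: "word u \<mu> \<bullet> \<alpha> i < 0"
          by (simp add: coroot_inner not_le divide_less_0_iff mult_less_0_iff) (metis \<alpha>_pos less_asym)
        \<comment> \<open>If this root were positive, its inner product with the dominant
          \<open>\<mu>\<close> would be nonnegative; but that product is
          \<open>word u \<mu> \<bullet> \<alpha> i\<close>.\<close>
        have "word (rev u) (\<alpha> i) \<notin> pos"
        proof
          assume p: "word (rev u) (\<alpha> i) \<in> pos"
          have "\<mu> \<bullet> word (rev u) (\<alpha> i) = word u \<mu> \<bullet> \<alpha> i"
            using word_inner[of "rev u" "word u \<mu>" "\<alpha> i"] by (simp add: word_rev)
          moreover have "\<mu> \<bullet> word (rev u) (\<alpha> i) = (\<Sum>k\<in>UNIV. cf k (word (rev u) (\<alpha> i)) * (\<mu> \<bullet> \<alpha> k))"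
            by (subst cf_expand[of "word (rev u) (\<alpha> i)"]) (simp add: inner_sum_right)
          moreover have "\<dots> \<ge> 0" using p dom by (intro sum_nonneg mult_nonneg_nonneg) (auto simp: pos_def)
          ultimately show False using neg by linarith
        qed
        then obtain w' where w': "length w' < length u" "\<forall>v. srefl i (word u v) = word w' v"
          using exchange[OF \<alpha>_in_pos] by blast
        then have "word w \<mu> = word w' \<mu>" using Cons by simp
        then show ?thesis using less[of w'] w'(1) Cons by simp
      qed
    qed
  qed
qed

lemma fund_weight_orbit:
  assumes "\<sigma> \<in> weyl_group R"
  shows "\<exists>n :: 'l \<Rightarrow> nat. \<sigma> (\<omega> j) = \<omega> j - (\<Sum>k\<in>UNIV. real (n k) *\<^sub>R \<alpha> k)"
  using weyl_word[OF assms] dominant_word[of "\<omega> j"] fund_weight_coroot[of j] by (metis Nats_0 Nats_1)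

lemma weyl_inverse:
  assumes "\<sigma> \<in> weyl_group R"
  obtains \<tau> where "\<tau> \<in> weyl_group R" "\<And>v. \<tau> (\<sigma> v) = v" "\<And>v. \<sigma> (\<tau> v) = v"
proof -
  obtain w where w: "\<forall>v. \<sigma> v = word w v" using weyl_word[OF assms] by blast
  show thesis
    by (rule that[of "word (rev w)"]) (use w word_rev[of w] word_rev[of "rev w"] word_weyl in auto)
qed

lemma weyl_inner: "\<sigma> \<in> weyl_group R \<Longrightarrow> \<sigma> u \<bullet> \<sigma> v = u \<bullet> v"
  using weyl_word word_inner by metis

text \<open>Connectedness of the Dynkin diagram. If \<open>S\<close> were proper, every root would
  be supported in \<open>S\<close> or in its complement: along \<open>pos_induct\<close>, a
  reflection in a simple root of the other part acts trivially. The two families are orthogonal and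
  contradict irreducibility.\<close>

lemma connected_simple_roots:
  assumes "i0 \<in> S" and closed: "\<And>i j. i \<in> S \<Longrightarrow> \<alpha> i \<bullet> \<alpha> j \<noteq> 0 \<Longrightarrow> j \<in> S"
  shows "S = UNIV"
proof (rule ccontr)
  assume "S \<noteq> UNIV"
  then obtain j0 where j0: "j0 \<notin> S" by blast
  define A where "A = {\<beta> \<in> R. \<forall>k. k \<notin> S \<longrightarrow> cf k \<beta> = 0}"
  define B where "B = {\<beta> \<in> R. \<forall>k. k \<in> S \<longrightarrow> cf k \<beta> = 0}"
  have orth: "\<alpha> i \<bullet> \<alpha> j = 0" if "i \<in> S" "j \<notin> S" for i j using closed that by blast
  have AB: "\<beta> \<bullet> \<gamma> = 0" if "\<forall>k. k \<notin> S \<longrightarrow> cf k \<beta> = 0" "\<forall>k. k \<in> S \<longrightarrow> cf k \<gamma> = 0" for \<beta> \<gamma>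
  proof -
    have "\<beta> \<bullet> \<gamma> = (\<Sum>k\<in>UNIV. \<Sum>l\<in>UNIV. cf k \<beta> * (cf l \<gamma> * (\<alpha> k \<bullet> \<alpha> l)))"
      by (subst cf_expand[of \<beta>], subst cf_expand[of \<gamma>]) (simp add: inner_sum_left inner_sum_right sum_distrib_left, subst sum.swap, simp add: mult_ac)
    also have "\<dots> = 0"
      by (intro sum.neutral ballI) (use that orth in \<open>metis mult_eq_0_iff\<close>)
    finally show ?thesis .
  qed
  have pos: "\<beta> \<in> A \<union> B" if "\<beta> \<in> pos" for \<beta>
    using that
  proof (induction rule: pos_induct)
    case (simple i)
    show ?case by (cases "i \<in> S") (auto simp: A_def B_def \<alpha>_root cf_\<alpha>)
  next
    case (reflect i \<gamma>)
    have R: "srefl i \<gamma> \<in> R" using reflect by (auto simp: pos_def intro: reflect_root \<alpha>_root)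
    have fx: "srefl i \<gamma> = \<gamma>" if "\<gamma> \<bullet> \<alpha> i = 0" using that by (simp add: reflect_def)
    show ?case
    proof (cases "\<gamma> \<in> A")
      case True
      show ?thesis
      proof (cases "i \<in> S")
        case True
        then have "cf k (srefl i \<gamma>) = 0" if "k \<notin> S" for k
          using \<open>\<gamma> \<in> A\<close> that cf_reflect[of k i \<gamma>] by (auto simp: A_def)
        then have "srefl i \<gamma> \<in> A" using R by (simp add: A_def)
        then show ?thesis by blast
      next
        case False
        then have "\<gamma> \<bullet> \<alpha> i = 0" using \<open>\<gamma> \<in> A\<close> by (intro AB) (auto simp: A_def cf_\<alpha>)
        then show ?thesis using fx reflect by simp
      qed
    next
      case False
      then have gB: "\<gamma> \<in> B" using reflect by blast
      show ?thesis
      proof (cases "i \<in> S")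
        case False
        then have "cf k (srefl i \<gamma>) = 0" if "k \<in> S" for k
          using gB that cf_reflect[of k i \<gamma>] by (auto simp: B_def)
        then have "srefl i \<gamma> \<in> B" using R by (simp add: B_def)
        then show ?thesis by blast
      next
        case True
        then have "\<alpha> i \<bullet> \<gamma> = 0" using gB by (intro AB) (auto simp: B_def cf_\<alpha>)
        then show ?thesis using fx reflect by (simp add: inner_commute)
      qed
    qed
  qed
  have un: "A \<union> B = R"
  proof
    show "R \<subseteq> A \<union> B"
    proof
      fix \<beta> assume \<beta>: "\<beta> \<in> R"
      have "- x \<in> A \<union> B \<Longrightarrow> x \<in> R \<Longrightarrow> x \<in> A \<union> B" for x by (auto simp: A_def B_def cf_minus)
      then show "\<beta> \<in> A \<union> B" using pos pos_or_neg[OF \<beta>] \<beta> by blast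
    qed
  qed (auto simp: A_def B_def)
  have "\<beta> = 0" if "\<beta> \<in> A \<inter> B" for \<beta>
  proof -
    have "cf k \<beta> = 0" for k using that by (cases "k \<in> S") (auto simp: A_def B_def)
    then have "(\<Sum>k\<in>UNIV. cf k \<beta> *\<^sub>R \<alpha> k) = 0" by simp
    then show ?thesis using cf_expand[of \<beta>] by simp
  qed
  then have disj: "A \<inter> B = {}" using root_nonzero by (auto simp: A_def)
  have "\<alpha> i0 \<in> A" "\<alpha> j0 \<in> B" using assms(1) j0 by (auto simp: A_def B_def \<alpha>_root cf_\<alpha>)
  moreover have "\<forall>\<beta>\<in>A. \<forall>\<gamma>\<in>B. \<beta> \<bullet> \<gamma> = 0" using AB by (auto simp: A_def B_def)
  ultimately show False using irreducible un disj unfolding irreducible_roots_def by blast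
qed

lemma simple_inner_nonpos: "i \<noteq> j \<Longrightarrow> \<alpha> i \<bullet> \<alpha> j \<le> 0"
proof -
  assume ij: "i \<noteq> j"
  have "srefl i (\<alpha> j) \<in> pos" using reflect_pos[OF \<alpha>_in_pos[of j], of i] ij inj_\<alpha> by (auto simp: inj_eq)
  then have "cf i (srefl i (\<alpha> j)) \<ge> 0" by (simp add: pos_def)
  then have "\<alpha> j \<bullet> coroot (\<alpha> i) \<le> 0" using ij by (simp add: reflect_coroot cf_diff cf_scale cf_\<alpha>)
  then show ?thesis by (simp add: coroot_inner inner_commute divide_le_0_iff mult_le_0_iff) (metis \<alpha>_pos less_asym not_less)
qed

text \<open>The simple roots form an obtuse basis, and a dual basis of such a basis is acute. With
  \<omega>_j split into its positive and negative part \<open>p - n\<close>, one has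
  \<open>p \<bullet> n \<le> 0\<close> and \<open>\<omega> j \<bullet> n \<ge> 0\<close>, which
  forces \<open>n = 0\<close>.\<close>

lemma fund_weight_inner_nonneg: "\<omega> i \<bullet> \<omega> j \<ge> 0"
proof -
  define p n where "p = (\<Sum>k\<in>UNIV. max (cf k (\<omega> j)) 0 *\<^sub>R \<alpha> k)" and "n = (\<Sum>k\<in>UNIV. max (- cf k (\<omega> j)) 0 *\<^sub>R \<alpha> k)"
  have \<omega>: "\<omega> j = p - n"
  proof -
    have "p - n = (\<Sum>k\<in>UNIV. (max (cf k (\<omega> j)) 0 - max (- cf k (\<omega> j)) 0) *\<^sub>R \<alpha> k)"
      by (simp add: p_def n_def sum_subtractf scaleR_diff_left)
    also have "\<dots> = (\<Sum>k\<in>UNIV. cf k (\<omega> j) *\<^sub>R \<alpha> k)" by (intro sum.cong) auto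
    finally show ?thesis using cf_expand by simp
  qed
  have "p \<bullet> n = (\<Sum>k\<in>UNIV. \<Sum>l\<in>UNIV. max (cf k (\<omega> j)) 0 * (max (- cf l (\<omega> j)) 0 * (\<alpha> k \<bullet> \<alpha> l)))"
    by (simp add: p_def n_def inner_sum_left inner_sum_right sum_distrib_left) (subst sum.swap, simp add: mult_ac)
  also have "\<dots> \<le> 0"
  proof (intro sum_nonpos)
    fix k l
    show "max (cf k (\<omega> j)) 0 * (max (- cf l (\<omega> j)) 0 * (\<alpha> k \<bullet> \<alpha> l)) \<le> 0"
    proof (cases "k = l")
      case True
      then show ?thesis by (cases "cf k (\<omega> j) \<ge> 0") (auto simp: max_def)
    next
      case False
      then show ?thesis using simple_inner_nonpos[OF False] by (intro mult_nonneg_nonpos) auto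
    qed
  qed
  finally have pn: "p \<bullet> n \<le> 0" .
  have "\<omega> j \<bullet> n = (\<Sum>k\<in>UNIV. max (- cf k (\<omega> j)) 0 * (\<omega> j \<bullet> \<alpha> k))"
    by (simp add: n_def inner_sum_right)
  also have "\<dots> \<ge> 0" by (intro sum_nonneg mult_nonneg_nonneg) (auto simp: fund_weight_\<alpha>)
  finally have "n \<bullet> n \<le> 0" using pn by (simp add: \<omega> inner_diff_left)
  then have "n = 0" by (metis inner_eq_zero_iff inner_ge_zero order_antisym)
  then have "\<omega> j = p" using \<omega> by simp
  then have "\<omega> i \<bullet> \<omega> j = \<omega> i \<bullet> p" by (rule arg_cong)
  also have "\<dots> = (\<Sum>k\<in>UNIV. max (cf k (\<omega> j)) 0 * (\<omega> i \<bullet> \<alpha> k))"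
    by (simp add: p_def inner_sum_right)
  also have "\<dots> \<ge> 0" by (intro sum_nonneg mult_nonneg_nonneg) (auto simp: fund_weight_\<alpha>)
  finally show ?thesis .
qed

end

section \<open>Exponential polynomials\<close>

abbreviation "tpi \<equiv> 2 * complex_of_real pi * \<i>"

definition ex :: "int^'l \<Rightarrow> complex^'l::finite \<Rightarrow> complex" where
  "ex k x = exp (tpi * (\<Sum>j\<in>UNIV. of_int (k $ j) * x $ j))"

lemma ex_add: "ex k (x + y) = ex k x * ex k y"
  by (simp add: ex_def exp_add[symmetric] distrib_left sum.distrib)

lemma ex_nonzero [simp]: "ex k x \<noteq> 0" by (simp add: ex_def)

text \<open>Dedekind's argument: translate a relation by a point separating two characters and
  subtract a multiple of the original, which shortens it. The domain \<open>X\<close> is a parameter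
  because the argument is also applied on a union of parallel walls, which is closed under
  addition.\<close>

lemma characters_independent:
  fixes ch :: "'i \<Rightarrow> 'a \<Rightarrow> complex" and pl :: "'a \<Rightarrow> 'a \<Rightarrow> 'a"
  assumes "finite K" and pl: "\<And>x y. x \<in> X \<Longrightarrow> y \<in> X \<Longrightarrow> pl x y \<in> X"
    and mult: "\<And>i x y. x \<in> X \<Longrightarrow> y \<in> X \<Longrightarrow> ch i (pl x y) = ch i x * ch i y"
    and ne: "x0 \<in> X" "\<And>i. ch i x0 \<noteq> 0"
    and "\<And>i j. i \<in> K \<Longrightarrow> j \<in> K \<Longrightarrow> i \<noteq> j \<Longrightarrow> \<exists>x\<in>X. ch i x \<noteq> ch j x"
    and "\<And>x. x \<in> X \<Longrightarrow> (\<Sum>i\<in>K. c i * ch i x) = 0"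
    and "i \<in> K"
  shows "c i = 0"
  using assms(1,6-8)
proof (induction K arbitrary: c i rule: finite_induct)
  case (insert k K)
  have *: "c j = 0" if j: "j \<in> K" for j
  proof -
    obtain y where y: "y \<in> X" "ch j y \<noteq> ch k y" using insert.prems(1)[of j k] j insert.hyps by auto
    have "(\<Sum>i\<in>K. (c i * (ch i y - ch k y)) * ch i x) = 0" if x: "x \<in> X" for x
    proof -
      have 1: "(\<Sum>i\<in>insert k K. c i * ch i (pl y x)) = 0" by (rule insert.prems(2)[OF pl[OF y(1) x]])
      have 2: "ch k y * (\<Sum>i\<in>insert k K. c i * ch i x) = 0" by (simp only: insert.prems(2)[OF x] mult_zero_right)
      have "(\<Sum>i\<in>K. (c i * (ch i y - ch k y)) * ch i x)
        = (\<Sum>i\<in>insert k K. c i * ch i (pl y x)) - ch k y * (\<Sum>i\<in>insert k K. c i * ch i x)"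
        using insert.hyps by (simp add: mult[OF y(1) x] sum_distrib_left sum_subtractf algebra_simps)
      then show ?thesis using 1 2 by simp
    qed
    then have "c j * (ch j y - ch k y) = 0"
      using insert.IH[of "\<lambda>i. c i * (ch i y - ch k y)" j] insert.prems(1) j by blast
    then show ?thesis using y(2) by simp
  qed
  have "(\<Sum>i\<in>insert k K. c i * ch i x0) = 0" by (rule insert.prems(2)[OF ne(1)])
  then have "c k = 0" using insert.hyps * ne(2) by (simp add: sum.neutral)
  then show ?case using * insert.prems(3) by auto
qed simp

lemma ex_distinct:
  assumes "k \<noteq> k'"
  shows "\<exists>x. ex k x \<noteq> ex k' x"
proof -
  obtain j where j: "k $ j \<noteq> k' $ j" using assms by (auto simp: vec_eq_iff)
  \<comment> \<open>Chosen so that the two exponents differ by one half; the exponentials are then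
    negatives of each other.\<close>
  define a :: complex where "a = 1 / (2 * (of_int (k $ j) - of_int (k' $ j)))"
  have e: "ex k (axis j a) = exp (tpi * (of_int (k $ j) * a))" for k
    by (simp add: ex_def axis_def if_distrib[of "\<lambda>x. _ * x"] cong: if_cong)
  have "of_int (k $ j) - of_int (k' $ j) \<noteq> (0::complex)" using j by (simp flip: of_int_diff)
  then have "2 * complex_of_real pi * \<i> * (of_int (k $ j) * a) = tpi * (of_int (k' $ j) * a) + \<i> * complex_of_real pi"
    by (simp add: a_def field_simps)
  then have "ex k (axis j a) = - ex k' (axis j a)"
    unfolding e by (simp add: exp_add)
  then show ?thesis by (intro exI[of _ "axis j a"]) (metis ex_nonzero add.inverse_inverse eq_neg_iff_add_eq_0 mult_2 mult_eq_0_iff zero_neq_numeral)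
qed

lemma ex_independent:
  assumes "finite K" "\<And>x. (\<Sum>k\<in>K. c k * ex k x) = 0" "k \<in> K"
  shows "c k = 0"
  by (rule characters_independent[where X = UNIV and pl = "(+)" and ch = ex, OF assms(1)])
    (use assms ex_distinct in \<open>auto simp: ex_add\<close>)

lemma eval_exp_alt: "finite K \<Longrightarrow> Poly_Mapping.keys f \<subseteq> K \<Longrightarrow> eval_exp f l x = (\<Sum>k\<in>K. poly (Poly_Mapping.lookup f k) l * ex k x)"
  unfolding eval_exp_def ex_def by (rule sum.mono_neutral_left) (auto simp: in_keys_iff)

lemma eval_exp_keys: "eval_exp f l x = (\<Sum>k\<in>Poly_Mapping.keys f. poly (Poly_Mapping.lookup f k) l * ex k x)"
  by (rule eval_exp_alt) auto

lemma eval_exp_add: "eval_exp (f + g) l x = eval_exp f l x + eval_exp g l x"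
proof -
  let ?K = "Poly_Mapping.keys f \<union> Poly_Mapping.keys g"
  have "Poly_Mapping.keys (f + g) \<subseteq> ?K" by (rule Poly_Mapping.keys_add)
  then show ?thesis
    by (simp add: eval_exp_alt[of ?K] lookup_add distrib_right sum.distrib)
qed

lemma eval_exp_single: "eval_exp (Poly_Mapping.single k p) l x = poly p l * ex k x"
  by (subst eval_exp_alt[of "{k}"]) auto

lemma eval_exp_sum: "finite A \<Longrightarrow> eval_exp (\<Sum>a\<in>A. f a) l x = (\<Sum>a\<in>A. eval_exp (f a) l x)"
proof (induction A rule: finite_induct)
  case empty
  show ?case by (simp add: eval_exp_def)
qed (simp add: eval_exp_add)

text \<open>Equality is tested at nonzero \<open>l\<close> only, since \<lambda> is an exponential.
  A polynomial that vanishes off one point is zero.\<close>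

lemma eval_exp_unique:
  assumes "\<And>l x. l \<noteq> 0 \<Longrightarrow> eval_exp f l x = eval_exp g l x"
  shows "f = g"
proof (rule poly_mapping_eqI)
  fix k
  let ?K = "insert k (Poly_Mapping.keys f \<union> Poly_Mapping.keys g)"
  have "poly (Poly_Mapping.lookup f k - Poly_Mapping.lookup g k) l = 0" if l: "l \<noteq> 0" for l
  proof (rule ex_independent[of ?K "\<lambda>k. poly (Poly_Mapping.lookup f k - Poly_Mapping.lookup g k) l"])
    fix x
    have "eval_exp f l x - eval_exp g l x = (\<Sum>k\<in>?K. poly (Poly_Mapping.lookup f k - Poly_Mapping.lookup g k) l * ex k x)"
      by (subst (1 2) eval_exp_alt[of ?K]) (auto simp: left_diff_distrib sum_subtractf)
    then show "(\<Sum>k\<in>?K. poly (Poly_Mapping.lookup f k - Poly_Mapping.lookup g k) l * ex k x) = 0" using assms[OF l, of x] by simp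
  qed auto
  then have sub: "UNIV - {0} \<subseteq> {l. poly (Poly_Mapping.lookup f k - Poly_Mapping.lookup g k) l = 0}" by auto
  have "Poly_Mapping.lookup f k - Poly_Mapping.lookup g k = 0"
  proof (rule ccontr)
    assume "Poly_Mapping.lookup f k - Poly_Mapping.lookup g k \<noteq> 0"
    then have "finite {l. poly (Poly_Mapping.lookup f k - Poly_Mapping.lookup g k) l = 0}" by (rule poly_roots_finite)
    then have "finite (UNIV - {0::complex})" using sub finite_subset by blast
    then show False using infinite_UNIV_char_0[where 'a = complex] by simp
  qed
  then show "Poly_Mapping.lookup f k = Poly_Mapping.lookup g k" by simp
qed

lemma cdiff_ex: "cdiff (ex k) x" and pd_ex: "pd s (ex k) x = tpi * of_int (k $ s) * ex k x"
proof -
  have c: "cdiff (\<lambda>x. tpi * (\<Sum>j\<in>UNIV. of_int (k $ j) * x $ j)) x"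
    by (intro cdiff_intros)
  have p: "pd s (\<lambda>x. tpi * (\<Sum>j\<in>UNIV. of_int (k $ j) * x $ j)) x = tpi * of_int (k $ s)"
    by (simp add: pd_mult pd_sum pd_const pd_coord cdiff_intros if_distrib[of "\<lambda>x. _ * x"] cong: if_cong)
  show "cdiff (ex k) x" using cdiff_exp[OF c] by (simp add: ex_def[abs_def])
  show "pd s (ex k) x = tpi * of_int (k $ s) * ex k x"
    using pd_exp[OF c, of s] unfolding p by (simp add: ex_def[abs_def] mult_ac)
qed

lemma cdiff_eval_exp: "cdiff (eval_exp f l) x"
proof -
  have "cdiff (\<lambda>x. \<Sum>k\<in>Poly_Mapping.keys f. poly (Poly_Mapping.lookup f k) l * ex k x) x" by (intro cdiff_intros cdiff_ex)
  moreover have "eval_exp f l = (\<lambda>x. \<Sum>k\<in>Poly_Mapping.keys f. poly (Poly_Mapping.lookup f k) l * ex k x)" by (rule ext) (rule eval_exp_keys)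
  ultimately show ?thesis by simp
qed

lemma pd_eval_exp: "pd s (eval_exp f l) x = (\<Sum>k\<in>Poly_Mapping.keys f. poly (Poly_Mapping.lookup f k) l * (tpi * of_int (k $ s) * ex k x))"
proof -
  have "eval_exp f l = (\<lambda>x. \<Sum>k\<in>Poly_Mapping.keys f. poly (Poly_Mapping.lookup f k) l * ex k x)" by (rule ext) (rule eval_exp_keys)
  then show ?thesis by (simp add: pd_sum pd_mult cdiff_intros cdiff_ex pd_const pd_ex)
qed

section \<open>Weights\<close>

locale weight_data = root_data R \<alpha> for R :: "'v::euclidean_space set" and \<alpha> :: "'l::finite \<Rightarrow> 'v" +
  fixes m :: "'l \<Rightarrow> nat"
  assumes m_nonzero: "\<exists>j. m j \<noteq> 0"
begin

abbreviation "\<Omega> \<equiv> weight \<alpha> m"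
abbreviation "\<theta> \<equiv> theta \<alpha> m"
abbreviation "\<kappa> \<equiv> kappa \<alpha> m"
abbreviation "thc j \<equiv> complex_of_real (\<theta> j)"
abbreviation "kc \<equiv> complex_of_real \<kappa>"

lemma weight_\<alpha>: "\<Omega> \<bullet> \<alpha> r = real (m r) * (\<alpha> r \<bullet> \<alpha> r) / 2"
  by (simp add: weight_def inner_sum_left fund_weight_\<alpha> if_distrib[of "\<lambda>x. _ * x"] cong: if_cong)

lemma theta_nonneg: "\<theta> j \<ge> 0"
  by (simp add: theta_def weight_def inner_sum_right sum_nonneg fund_weight_inner_nonneg)

text \<open>Rational root lengths give a common denominator \<open>N\<close>, so the group generated
  by the pairings is discrete. Its least positive element generates it by division with remainder,
  and a positive generator is unique.\<close>

lemma kappa_props: "\<kappa> > 0" "\<exists>n::nat. \<Omega> \<bullet> \<alpha> r = real n * \<kappa>"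
proof -
  define q where "q = (\<lambda>r. \<Omega> \<bullet> \<alpha> r)"
  define G where "G = range (\<lambda>n :: 'l \<Rightarrow> int. \<Sum>r\<in>UNIV. of_int (n r) * q r)"
  have q0: "q r \<ge> 0" and qr: "q r \<in> \<rat>" for r
    using rational \<alpha>_root by (auto simp: q_def weight_\<alpha>)
  have "\<exists>N::nat. N > 0 \<and> (\<forall>r\<in>A. real N * q r \<in> \<int>)" if "finite A" for A
    using that
  proof (induction A rule: finite_induct)
    case empty
    show ?case by (rule exI[of _ 1]) simp
  next
    case (insert r A)
    then obtain N where N: "N > 0" "\<forall>r\<in>A. real N * q r \<in> \<int>" by blast
    obtain a b where ab: "b > 0" "q r = real_of_int a / real_of_int b" using qr[of r] by (rule Rats_cases')
    have 1: "real (nat b) * q r = real_of_int a" using ab by simp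
    have "real (N * nat b) * q t \<in> \<int>" if "t \<in> insert r A" for t
    proof (cases "t = r")
      case True
      have "real (N * nat b) * q t = real N * (real (nat b) * q r)" by (simp add: True)
      then show ?thesis unfolding 1 by (simp only:) (intro Ints_mult Ints_of_nat Ints_of_int)
    next
      case False
      then have "real N * q t \<in> \<int>" using N that by blast
      then have "real (nat b) * (real N * q t) \<in> \<int>" by (rule Ints_mult[OF Ints_of_nat])
      then show ?thesis by (simp add: mult_ac)
    qed
    then show ?case using N(1) ab(1) by (intro exI[of _ "N * nat b"]) auto
  qed
  then obtain N :: nat where N: "N > 0" "\<And>r. real N * q r \<in> \<int>" by (metis UNIV_I finite)
  have GN: "real N * x \<in> \<int>" if "x \<in> G" for x
  proof -
    obtain n :: "'l \<Rightarrow> int" where "x = (\<Sum>r\<in>UNIV. of_int (n r) * q r)" using \<open>x \<in> G\<close> unfolding G_def by blast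
    then have "real N * x = (\<Sum>r\<in>UNIV. of_int (n r) * (real N * q r))" by (simp add: sum_distrib_left mult.left_commute)
    also have "\<dots> \<in> \<int>" by (intro Ints_sum Ints_mult[OF Ints_of_int] N(2))
    finally show ?thesis .
  qed
  have G_lin: "x + of_int i * y \<in> G" if xy: "x \<in> G" "y \<in> G" for x y i
  proof -
    obtain a c :: "'l \<Rightarrow> int" where "x = (\<Sum>r\<in>UNIV. of_int (a r) * q r)" "y = (\<Sum>r\<in>UNIV. of_int (c r) * q r)"
      using xy unfolding G_def by blast
    then have "x + of_int i * y = (\<Sum>r\<in>UNIV. of_int (a r + i * c r) * q r)"
      by (simp add: sum_distrib_left sum.distrib[symmetric] distrib_right mult.assoc)
    then show ?thesis unfolding G_def by (rule range_eqI[of _ _ "\<lambda>r. a r + i * c r"])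
  qed
  have qG: "q r \<in> G" for r
  proof -
    have "q r = (\<Sum>k\<in>UNIV. of_int (if k = r then 1 else 0) * q k)"
      by (simp add: if_distrib[of "\<lambda>x. of_int x * _"] cong: if_cong)
    then show ?thesis unfolding G_def by (rule range_eqI[of _ _ "\<lambda>k. if k = r then 1 else 0"])
  qed
  have G0: "0 \<in> G" unfolding G_def by (rule range_eqI[of _ _ "\<lambda>_. 0"]) simp
  define T where "T = {k::nat. k > 0 \<and> real k / real N \<in> G}"
  obtain j where "m j \<noteq> 0" using m_nonzero by blast
  then have "q j > 0" by (simp add: q_def weight_\<alpha>)
  moreover obtain i where i: "real N * q j = of_int i" using N(2)[of j] by (rule Ints_cases)
  ultimately have "i > 0" using N(1) by (metis mult_pos_pos of_int_0_less_iff of_nat_0_less_iff)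
  then have "nat i \<in> T" using i N(1) qG[of j] by (simp add: T_def) (metis N(1) nonzero_mult_div_cancel_left of_nat_0_eq_iff neq0_conv)
  define k0 where "k0 = (LEAST k. k \<in> T)"
  have k0: "k0 \<in> T" unfolding k0_def using \<open>nat i \<in> T\<close> by (rule LeastI)
  have k0_least: "k0 \<le> k" if "k \<in> T" for k unfolding k0_def using that by (rule Least_le)
  define \<kappa>0 where "\<kappa>0 = real k0 / real N"
  have \<kappa>0: "\<kappa>0 > 0" "\<kappa>0 \<in> G" using k0 N(1) by (auto simp: \<kappa>0_def T_def)
  have G_eq: "G = range (\<lambda>n :: int. of_int n * \<kappa>0)"
  proof
    show "range (\<lambda>n :: int. of_int n * \<kappa>0) \<subseteq> G" using G_lin[OF G0 \<kappa>0(2)] by auto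
    show "G \<subseteq> range (\<lambda>n :: int. of_int n * \<kappa>0)"
    proof
      fix x assume x: "x \<in> G"
      then obtain i where i: "real N * x = of_int i" using GN by (metis Ints_cases)
      have xi: "x = of_int i / real N" using i N(1) by (simp add: field_simps)
      have k0p: "k0 > 0" using k0 by (simp add: T_def)
      define r where "r = i mod int k0"
      have "of_int r / real N = x + of_int (- (i div int k0)) * \<kappa>0"
      proof -
        have "i = int k0 * (i div int k0) + r" by (simp add: r_def)
        then have "real_of_int i = real k0 * of_int (i div int k0) + of_int r"
          by (metis of_int_add of_int_mult of_int_of_nat_eq)
        then show ?thesis using N(1) by (simp add: xi \<kappa>0_def field_simps)
      qed
      then have rG: "of_int r / real N \<in> G" using G_lin[OF x \<kappa>0(2)] by metis
      have r: "0 \<le> r" "r < int k0" using k0p by (auto simp: r_def)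
      have "r = 0"
      proof (rule ccontr)
        assume "r \<noteq> 0"
        then have "nat r \<in> T" using r rG by (simp add: T_def)
        then show False using k0_least[of "nat r"] r by linarith
      qed
      then have "x = of_int (i div int k0) * \<kappa>0"
        using \<open>of_int r / real N = x + of_int (- (i div int k0)) * \<kappa>0\<close> by simp
      then show "x \<in> range (\<lambda>n :: int. of_int n * \<kappa>0)" by blast
    qed
  qed
  have uniq: "k = \<kappa>0" if k: "k > 0" "G = range (\<lambda>n :: int. of_int n * k)" for k
  proof -
    have "k \<in> G" unfolding k(2) by (rule range_eqI[of _ _ 1]) simp
    then obtain a :: int where a: "k = of_int a * \<kappa>0" using G_eq by blast
    have "\<kappa>0 \<in> range (\<lambda>n :: int. of_int n * k)" using \<kappa>0(2) k(2) by simp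
    then obtain c :: int where c: "\<kappa>0 = of_int c * k" by blast
    have "a > 0"
    proof (rule ccontr)
      assume "\<not> a > 0"
      then have "real_of_int a * \<kappa>0 \<le> 0" using \<kappa>0(1) by (intro mult_nonpos_nonneg) auto
      then show False using a k(1) by simp
    qed
    have "k = of_int (a * c) * k" using a c by simp
    then have "real_of_int (a * c) = 1" using k(1) by simp
    then have "a * c = 1" by linarith
    then have "a = 1" using \<open>a > 0\<close> by (simp add: zmult_eq_1_iff)
    then show ?thesis using a by simp
  qed
  have "\<kappa> = \<kappa>0"
    unfolding kappa_def
    by (rule the_equality) (use \<kappa>0(1) G_eq uniq in \<open>auto simp: G_def q_def\<close>)
  then show "\<kappa> > 0" using \<kappa>0(1) by simp
  show "\<exists>n::nat. \<Omega> \<bullet> \<alpha> r = real n * \<kappa>"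
  proof -
    obtain n :: int where n: "q r = of_int n * \<kappa>0" using qG[of r] G_eq by blast
    then have "n \<ge> 0" using q0[of r] \<kappa>0(1) by (metis mult_neg_pos not_less of_int_less_0_iff)
    then show ?thesis using n \<open>\<kappa> = \<kappa>0\<close> by (intro exI[of _ "nat n"]) (simp add: q_def)
  qed
qed

text \<open>The weight \<open>\<sigma>\<^sup>-\<^sup>1 \<omega>_j\<close>, together with the power of \<open>\<lambda>\<close> that it contributes to \<open>y^j\<close>.\<close>

lemma weyl_term:
  assumes "\<sigma> \<in> weyl_group R"
  shows "\<exists>n k N. (\<forall>u. \<omega> j \<bullet> \<sigma> u = \<omega> j \<bullet> u - (\<Sum>i\<in>UNIV. real (n i) * (\<alpha> i \<bullet> u))) \<and>
     (\<forall>r. real_of_int (k $ r) = \<omega> j \<bullet> coroot (\<alpha> r) - (\<Sum>i\<in>UNIV. real (n i) * (\<alpha> i \<bullet> coroot (\<alpha> r)))) \<and>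
     real N * \<kappa> = (\<Sum>i\<in>UNIV. real (n i) * (\<alpha> i \<bullet> \<Omega>)) \<and>
     (N = 0 \<longrightarrow> m j > 0 \<longrightarrow> (\<forall>i. n i = 0)) \<and> (\<sigma> (\<omega> j) = \<omega> j \<longleftrightarrow> (\<forall>i. n i = (0::nat)))"
proof -
  obtain \<tau> where \<tau>: "\<tau> \<in> weyl_group R" "\<And>v. \<tau> (\<sigma> v) = v" "\<And>v. \<sigma> (\<tau> v) = v"
    using weyl_inverse[OF assms] by blast
  obtain n :: "'l \<Rightarrow> nat" where n: "\<tau> (\<omega> j) = \<omega> j - (\<Sum>k\<in>UNIV. real (n k) *\<^sub>R \<alpha> k)"
    using fund_weight_orbit[OF \<tau>(1)] by blast
  let ?s = "\<Sum>k\<in>UNIV. real (n k) *\<^sub>R \<alpha> k"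
  have 1: "\<omega> j \<bullet> \<sigma> u = \<omega> j \<bullet> u - (\<Sum>i\<in>UNIV. real (n i) * (\<alpha> i \<bullet> u))" for u
    using weyl_inner[OF \<tau>(1), of "\<omega> j" "\<sigma> u"] by (simp add: \<tau>(2) n inner_diff_left inner_sum_left)
  have "\<omega> j \<bullet> coroot (\<alpha> r) - (\<Sum>i\<in>UNIV. real (n i) * (\<alpha> i \<bullet> coroot (\<alpha> r))) \<in> \<int>" for r
  proof -
    have "\<alpha> i \<bullet> coroot (\<alpha> r) \<in> \<int>" for i using roots \<alpha>_root unfolding root_system_def by blast
    then show ?thesis by (auto simp: fund_weight_coroot intro!: Ints_diff Ints_sum Ints_mult)
  qed
  then have k: "real_of_int \<lfloor>\<omega> j \<bullet> coroot (\<alpha> r) - (\<Sum>i\<in>UNIV. real (n i) * (\<alpha> i \<bullet> coroot (\<alpha> r)))\<rfloor>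
      = \<omega> j \<bullet> coroot (\<alpha> r) - (\<Sum>i\<in>UNIV. real (n i) * (\<alpha> i \<bullet> coroot (\<alpha> r)))" for r
    by (rule of_int_floor_cancel[THEN iffD2, OF Ints_cases]) blast
  obtain N :: "'l \<Rightarrow> nat" where N: "\<And>r. \<Omega> \<bullet> \<alpha> r = real (N r) * \<kappa>" using kappa_props(2) by metis
  have sum0: "(\<forall>i. n i = 0) \<longleftrightarrow> ?s = 0"
    using cf_sum[of _ "\<lambda>k. real (n k)"] by (auto simp: cf_def)
  have \<sigma>j: "\<sigma> (\<omega> j) = \<omega> j \<longleftrightarrow> (\<forall>i. n i = 0)"
  proof -
    have "\<sigma> (\<omega> j) = \<omega> j \<longleftrightarrow> \<tau> (\<omega> j) = \<omega> j" using \<tau> by metis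
    then show ?thesis by (simp add: n sum0)
  qed
  \<comment> \<open>If no power of \<lambda> occurs, the coefficient of \<alpha>_j in the difference
    between \<omega>_j and its image is zero, because \<Omega> pairs positively with \<alpha>_j. So
    \<omega>_j is orthogonal to the difference, and equality of lengths forces the difference to
    vanish.\<close>
  have "\<forall>i. n i = 0" if z: "(\<Sum>r\<in>UNIV. n r * N r) = 0" and mj: "m j > 0"
  proof -
    have "\<Omega> \<bullet> \<alpha> j > 0" using mj by (simp add: weight_\<alpha>)
    then have "N j > 0" unfolding N by (metis mult_eq_0_iff neq0_conv of_nat_0 less_irrefl)
    moreover have "n j * N j = 0" using z by simp
    ultimately have nj: "n j = 0" by simp
    have "\<omega> j \<bullet> ?s = 0"
      by (simp add: inner_sum_right fund_weight_\<alpha> nj if_distrib[of "\<lambda>x. _ * x"] cong: if_cong)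
    moreover have "\<tau> (\<omega> j) \<bullet> \<tau> (\<omega> j) = \<omega> j \<bullet> \<omega> j" by (rule weyl_inner[OF \<tau>(1)])
    ultimately have "?s \<bullet> ?s = 0"
      by (simp add: n inner_diff_left inner_diff_right inner_commute[of ?s "\<omega> j"])
    then show ?thesis using sum0 by simp
  qed
  moreover have "real (\<Sum>r\<in>UNIV. n r * N r) * \<kappa> = (\<Sum>i\<in>UNIV. real (n i) * (\<alpha> i \<bullet> \<Omega>))"
    by (simp add: sum_distrib_right inner_commute[of _ \<Omega>] N mult.assoc)
  ultimately show ?thesis
    using 1 k \<sigma>j by (intro exI[of _ n] exI[of _ "\<chi> r. \<lfloor>\<omega> j \<bullet> coroot (\<alpha> r) - (\<Sum>i\<in>UNIV. real (n i) * (\<alpha> i \<bullet> coroot (\<alpha> r)))\<rfloor>"] exI[of _ "\<Sum>r\<in>UNIV. n r * N r"]) auto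
qed

end

section \<open>Generators\<close>

lemma pd_translate: "pd i (\<lambda>u. f (u + a)) v = pd i f (v + a)"
  by (simp add: pd_def add_ac)

lemma tendsto_det:
  fixes A :: "'a \<Rightarrow> complex^'n::finite^'n"
  assumes "\<And>i j. ((\<lambda>t. A t $ i $ j) \<longlongrightarrow> B $ i $ j) F"
  shows "((\<lambda>t. det (A t)) \<longlongrightarrow> det B) F"
  unfolding det_def by (intro tendsto_sum tendsto_mult tendsto_prod tendsto_const assms)

lemma det_scale_rows:
  fixes A :: "complex^'n::finite^'n"
  shows "det (\<chi> j s. c j * A $ j $ s) = (\<Prod>j\<in>UNIV. c j) * det A"
proof -
  have "(\<chi> j s. c j * A $ j $ s) = diagm c ** A" by (simp add: vec_eq_iff diagm_mult)
  moreover have "det (diagm c) = (\<Prod>j\<in>UNIV. c j)"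
    using det_diagonal[of "diagm c"] by (simp add: diagm_def)
  ultimately show ?thesis by (simp add: det_mul)
qed

context weight_data
begin

text \<open>Fixes one choice of the data of \<open>weyl_term\<close> for every summand of y^j:
  simple root coefficients, exponent vector, power of \<lambda>.\<close>

definition term_data :: "'l \<Rightarrow> ('v \<Rightarrow> 'v) \<Rightarrow> ('l \<Rightarrow> nat) \<times> (int^'l) \<times> nat" where
  "term_data j \<sigma> = (SOME (n, k, N). (\<forall>u. \<omega> j \<bullet> \<sigma> u = \<omega> j \<bullet> u - (\<Sum>i\<in>UNIV. real (n i) * (\<alpha> i \<bullet> u))) \<and>
     (\<forall>r. real_of_int (k $ r) = \<omega> j \<bullet> coroot (\<alpha> r) - (\<Sum>i\<in>UNIV. real (n i) * (\<alpha> i \<bullet> coroot (\<alpha> r)))) \<and>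
     real N * \<kappa> = (\<Sum>i\<in>UNIV. real (n i) * (\<alpha> i \<bullet> \<Omega>)) \<and>
     (N = 0 \<longrightarrow> m j > 0 \<longrightarrow> (\<forall>i. n i = 0)) \<and> (\<sigma> (\<omega> j) = \<omega> j \<longleftrightarrow> (\<forall>i. n i = (0::nat))))"

definition "tn j \<sigma> = fst (term_data j \<sigma>)"
definition "tk j \<sigma> = fst (snd (term_data j \<sigma>))"
definition "tN j \<sigma> = snd (snd (term_data j \<sigma>))"

lemma term_data:
  assumes "\<sigma> \<in> weyl_group R"
  shows "\<omega> j \<bullet> \<sigma> u = \<omega> j \<bullet> u - (\<Sum>i\<in>UNIV. real (tn j \<sigma> i) * (\<alpha> i \<bullet> u))"
    and "real_of_int (tk j \<sigma> $ r) = \<omega> j \<bullet> coroot (\<alpha> r) - (\<Sum>i\<in>UNIV. real (tn j \<sigma> i) * (\<alpha> i \<bullet> coroot (\<alpha> r)))"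
    and "real (tN j \<sigma>) * \<kappa> = (\<Sum>i\<in>UNIV. real (tn j \<sigma> i) * (\<alpha> i \<bullet> \<Omega>))"
    and "tN j \<sigma> = 0 \<Longrightarrow> m j > 0 \<Longrightarrow> tn j \<sigma> i = 0"
    and "\<sigma> (\<omega> j) = \<omega> j \<longleftrightarrow> (\<forall>i. tn j \<sigma> i = 0)"
proof -
  let ?P = "\<lambda>(n, k, N). (\<forall>u. \<omega> j \<bullet> \<sigma> u = \<omega> j \<bullet> u - (\<Sum>i\<in>UNIV. real (n i) * (\<alpha> i \<bullet> u))) \<and>
     (\<forall>r. real_of_int (k $ r) = \<omega> j \<bullet> coroot (\<alpha> r) - (\<Sum>i\<in>UNIV. real (n i) * (\<alpha> i \<bullet> coroot (\<alpha> r)))) \<and>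
     real N * \<kappa> = (\<Sum>i\<in>UNIV. real (n i) * (\<alpha> i \<bullet> \<Omega>)) \<and>
     (N = 0 \<longrightarrow> m j > 0 \<longrightarrow> (\<forall>i. n i = 0)) \<and> (\<sigma> (\<omega> j) = \<omega> j \<longleftrightarrow> (\<forall>i. n i = (0::nat)))"
  have "\<exists>p. ?P p" using weyl_term[OF assms, of j] by auto
  then have "?P (term_data j \<sigma>)" unfolding term_data_def by (rule someI_ex)
  then have *: "?P (tn j \<sigma>, tk j \<sigma>, tN j \<sigma>)" by (simp add: tn_def tk_def tN_def)
  then show "\<omega> j \<bullet> \<sigma> u = \<omega> j \<bullet> u - (\<Sum>i\<in>UNIV. real (tn j \<sigma> i) * (\<alpha> i \<bullet> u))"
    "real_of_int (tk j \<sigma> $ r) = \<omega> j \<bullet> coroot (\<alpha> r) - (\<Sum>i\<in>UNIV. real (tn j \<sigma> i) * (\<alpha> i \<bullet> coroot (\<alpha> r)))"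
    "real (tN j \<sigma>) * \<kappa> = (\<Sum>i\<in>UNIV. real (tn j \<sigma> i) * (\<alpha> i \<bullet> \<Omega>))"
    "\<sigma> (\<omega> j) = \<omega> j \<longleftrightarrow> (\<forall>i. tn j \<sigma> i = 0)"
    by auto
  show "tN j \<sigma> = 0 \<Longrightarrow> m j > 0 \<Longrightarrow> tn j \<sigma> i = 0" using * by auto
qed

definition "stab j = card {\<sigma> \<in> weyl_group R. \<sigma> (\<omega> j) = \<omega> j}"

lemma stab_pos: "stab j > 0"
proof -
  have "id \<in> {\<sigma> \<in> weyl_group R. \<sigma> (\<omega> j) = \<omega> j}" by (simp add: weyl_id)
  then show ?thesis unfolding stab_def using finite_weyl by (subst card_gt_0_iff) auto
qed

text \<open>The prefactor exp(-2 pi \<i> \<theta>_j c) turns the dependence of each summand on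
  \<open>c\<close> into a nonnegative power of \<lambda>. This is why y^j is an element of the
  ring.\<close>

lemma basic_fun_expand:
  "basic_fun R \<alpha> m j c x = (\<Sum>\<sigma>\<in>weyl_group R. 1 / of_nat (stab j) * lam \<alpha> m c ^ tN j \<sigma> * ex (tk j \<sigma>) x)"
proof -
  have "exp (- 2 * complex_of_real pi * \<i> * thc j * c) * exp (tpi *
        cpairing (\<omega> j) (map_prod \<sigma> \<sigma> (xpoint \<alpha> m c x))) = lam \<alpha> m c ^ tN j \<sigma> * ex (tk j \<sigma>) x"
    if \<sigma>: "\<sigma> \<in> weyl_group R" for \<sigma>
  proof -
    have L: "\<omega> j \<bullet> \<sigma> (a *\<^sub>R \<Omega> + (\<Sum>r\<in>UNIV. y r *\<^sub>R coroot (\<alpha> r))) = a * (\<theta> j - real (tN j \<sigma>) * \<kappa>) + (\<Sum>r\<in>UNIV. y r * real_of_int (tk j \<sigma> $ r))" for a y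
    proof -
      have "\<omega> j \<bullet> \<sigma> (a *\<^sub>R \<Omega> + (\<Sum>r\<in>UNIV. y r *\<^sub>R coroot (\<alpha> r))) = a * (\<omega> j \<bullet> \<sigma> \<Omega>) + (\<Sum>r\<in>UNIV. y r * (\<omega> j \<bullet> \<sigma> (coroot (\<alpha> r))))"
        using weyl_linear[OF \<sigma>] by (simp add: linear_add linear_sum linear_scale inner_add_right inner_sum_right)
      also have "\<omega> j \<bullet> \<sigma> \<Omega> = \<theta> j - real (tN j \<sigma>) * \<kappa>"
        unfolding term_data(1)[OF \<sigma>] term_data(3)[OF \<sigma>] by (simp add: theta_def)
      also have "(\<Sum>r\<in>UNIV. y r * (\<omega> j \<bullet> \<sigma> (coroot (\<alpha> r)))) = (\<Sum>r\<in>UNIV. y r * real_of_int (tk j \<sigma> $ r))"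
        unfolding term_data(1)[OF \<sigma>] term_data(2)[OF \<sigma>] ..
      finally show ?thesis .
    qed
    have cp: "cpairing (\<omega> j) (map_prod \<sigma> \<sigma> (xpoint \<alpha> m c x)) = c * of_real (\<theta> j - real (tN j \<sigma>) * \<kappa>) + (\<Sum>r\<in>UNIV. of_int (tk j \<sigma> $ r) * x $ r)"
      by (simp add: cpairing_def xpoint_def L complex_eq_iff Re_sum Im_sum mult.commute)
    have "- 2 * complex_of_real pi * \<i> * thc j * c + tpi * cpairing (\<omega> j) (map_prod \<sigma> \<sigma> (xpoint \<alpha> m c x))
       = of_nat (tN j \<sigma>) * (- 2 * complex_of_real pi * \<i> * kc * c) + tpi * (\<Sum>r\<in>UNIV. of_int (tk j \<sigma> $ r) * x $ r)"
      unfolding cp by (simp add: algebra_simps)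
    then show ?thesis
      by (simp only: exp_add[symmetric] lam_def exp_of_nat_mult[symmetric] ex_def)
  qed
  then show ?thesis
    unfolding basic_fun_def stab_def[symmetric]
    by (simp add: sum_distrib_left mult.assoc mult.left_commute[of "exp _" "1 / _"])
qed

lemma lam_surj: "l \<noteq> 0 \<Longrightarrow> \<exists>c. lam \<alpha> m c = l"
proof -
  assume l: "l \<noteq> 0"
  have "kc \<noteq> 0" using kappa_props(1) by simp
  then have "lam \<alpha> m (- Ln l / (tpi * kc)) = exp (Ln l)"
    unfolding lam_def by (intro arg_cong[of _ _ exp]) (simp add: field_simps)
  then show ?thesis using l by auto
qed

lemma basic_generator_eval:
  "eval_exp (basic_generator R \<alpha> m j) l x = (\<Sum>\<sigma>\<in>weyl_group R. 1 / of_nat (stab j) * l ^ tN j \<sigma> * ex (tk j \<sigma>) x)"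
proof -
  define f where "f = (\<Sum>\<sigma>\<in>weyl_group R. Poly_Mapping.single (tk j \<sigma>) (monom (1 / of_nat (stab j)) (tN j \<sigma>)) :: 'l exp_poly)"
  have f: "eval_exp f l x = (\<Sum>\<sigma>\<in>weyl_group R. 1 / of_nat (stab j) * l ^ tN j \<sigma> * ex (tk j \<sigma>) x)" for l x
    by (simp add: f_def eval_exp_sum[OF finite_weyl] eval_exp_single poly_monom)
  have "basic_generator R \<alpha> m j = f"
    unfolding basic_generator_def
  proof (rule the_equality)
    show "\<forall>c x. eval_exp f (lam \<alpha> m c) x = basic_fun R \<alpha> m j c x"
      by (simp add: f basic_fun_expand)
    fix g assume g: "\<forall>c x. eval_exp g (lam \<alpha> m c) x = basic_fun R \<alpha> m j c x"
    show "g = f"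
    proof (rule eval_exp_unique)
      fix l :: complex and x assume "l \<noteq> 0"
      then obtain c where "lam \<alpha> m c = l" using lam_surj by blast
      moreover have "eval_exp g (lam \<alpha> m c) x = eval_exp f (lam \<alpha> m c) x"
        using g by (simp add: f basic_fun_expand)
      ultimately show "eval_exp g l x = eval_exp f l x" by simp
    qed
  qed
  then show ?thesis by (simp add: f)
qed

end

section \<open>Pencil generators and regular points of the map x to z\<close>

locale generators = weight_data R \<alpha> m for R :: "'v::euclidean_space set" and \<alpha> :: "'l::finite \<Rightarrow> 'v" and m +
  fixes z :: "'l \<Rightarrow> 'l exp_poly"
  assumes pencil_gen: "pencil_generators R \<alpha> m z"
begin

lemma proper: "z j \<in> invariant_ring R \<alpha> m" "quasi_homogeneous \<alpha> m (\<theta> j) (z j)"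
  "eval_exp (z j) 0 x = eval_exp (basic_generator R \<alpha> m j) 0 x"
  using pencil_gen by (auto simp: pencil_generators_def proper_generators_def)

lemma zmap_nth: "zmap z l x $ j = eval_exp (z j) l x"
  by (simp add: zmap_def)

lemma entire_zmap: "entire (\<lambda>x. zmap z l x $ j)"
  unfolding zmap_nth by (rule entireI) (rule cdiff_eval_exp)

lemma zmap0: "zmap z 0 x $ j = (\<Sum>\<sigma>\<in>weyl_group R. 1 / of_nat (stab j) * 0 ^ tN j \<sigma> * ex (tk j \<sigma>) x)"
  by (simp add: zmap_nth proper(3) basic_generator_eval)

lemma tk_axis:
  assumes "\<sigma> \<in> weyl_group R" "\<And>i. tn j \<sigma> i = 0"
  shows "tk j \<sigma> $ r = (if r = j then 1 else 0)"
proof -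
  have "real_of_int (tk j \<sigma> $ r) = real_of_int (if r = j then 1 else 0)"
    by (simp add: term_data(2)[OF assms(1)] assms(2) fund_weight_coroot)
  then show ?thesis by (simp only: of_int_eq_iff)
qed

lemma tN_0: "\<sigma> \<in> weyl_group R \<Longrightarrow> (\<And>i. tn j \<sigma> i = 0) \<Longrightarrow> tN j \<sigma> = 0"
  using term_data(3)[of \<sigma> j] kappa_props(1) by simp

lemma sum_stab: "(\<Sum>\<sigma>\<in>weyl_group R. if \<forall>i. tn j \<sigma> i = 0 then c else 0) = of_nat (stab j) * (c::complex)"
proof -
  have "(\<Sum>\<sigma>\<in>weyl_group R. if \<forall>i. tn j \<sigma> i = 0 then c else 0) = (\<Sum>\<sigma>\<in>{\<sigma> \<in> weyl_group R. \<sigma> (\<omega> j) = \<omega> j}. c)"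
    using finite_weyl by (intro sum.mono_neutral_cong_right) (auto simp: term_data(5))
  then show ?thesis by (simp add: stab_def)
qed

text \<open>When m_j is positive, every summand from outside the stabilizer of \<omega>_j carries a
  positive power of \<lambda>. At \<lambda> = 0 one exponential is left, and \<open>stab j\<close>
  accounts for its multiplicity.\<close>

lemma zmap0_S:
  assumes "m j > 0"
  shows "zmap z 0 x $ j = exp (tpi * x $ j)"
proof -
  have "zmap z 0 x $ j = (\<Sum>\<sigma>\<in>weyl_group R. if \<forall>i. tn j \<sigma> i = 0 then 1 / of_nat (stab j) * exp (tpi * x $ j) else 0)"
    unfolding zmap0
  proof (rule sum.cong[OF refl])
    fix \<sigma> assume \<sigma>: "\<sigma> \<in> weyl_group R"
    show "1 / of_nat (stab j) * 0 ^ tN j \<sigma> * ex (tk j \<sigma>) x = (if \<forall>i. tn j \<sigma> i = 0 then 1 / of_nat (stab j) * exp (tpi * x $ j) else 0)"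
    proof (cases "\<forall>i. tn j \<sigma> i = 0")
      case True
      have "ex (tk j \<sigma>) x = exp (tpi * x $ j)"
        using True by (simp add: ex_def tk_axis[OF \<sigma>] if_distrib[of "\<lambda>x. of_int x * _"] cong: if_cong)
      then show ?thesis using True tN_0[OF \<sigma>] by simp
    next
      case False
      then have "tN j \<sigma> \<noteq> 0" using term_data(4)[OF \<sigma> _ assms] by blast
      then show ?thesis using False by (auto simp: power_0_left)
    qed
  qed
  then show ?thesis using stab_pos[of j] by (simp add: sum_stab)
qed

text \<open>This translation multiplies exp(2 pi \<i> x^r) by exp(\<theta>_r s); accompanied by a
  rescaling of \<lambda> by exp(\<kappa> s) it realizes the grading.\<close>

definition "shift s x = x + s *s (\<chi> r. thc r / (tpi))"

lemma zmap_shift: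
  "zmap z (exp (kc * s) * l) (shift s x) $ j = exp (thc j * s) * zmap z l x $ j"
proof -
  have e: "ex k (shift s x) = exp (s * (\<Sum>j\<in>UNIV. of_int (k $ j) * thc j)) * ex k x" for k
  proof -
    have "2 * complex_of_real pi * \<i> * (\<Sum>j\<in>UNIV. of_int (k $ j) * (shift s x $ j)) =
      s * (\<Sum>j\<in>UNIV. of_int (k $ j) * thc j) + tpi * (\<Sum>j\<in>UNIV. of_int (k $ j) * x $ j)"
      by (simp add: shift_def sum_distrib_left sum.distrib[symmetric] distrib_left) (intro sum.cong refl, simp add: field_simps)
    then show ?thesis by (simp add: ex_def exp_add)
  qed
  have "poly (Poly_Mapping.lookup (z j) k) (exp (kc * s) * l) * ex k (shift s x)
      = exp (thc j * s) * (poly (Poly_Mapping.lookup (z j) k) l * ex k x)" for k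
  proof -
    let ?p = "Poly_Mapping.lookup (z j) k"
    have "coeff ?p n * (exp (kc * s) * l) ^ n * exp (s * (\<Sum>j\<in>UNIV. of_int (k $ j) * thc j))
      = exp (thc j * s) * (coeff ?p n * l ^ n)" for n
    proof (cases "coeff ?p n = 0")
      case False
      then have "(\<Sum>j\<in>UNIV. of_int (k $ j) * \<theta> j) + real n * \<kappa> = \<theta> j"
        using proper(2)[of j] by (simp add: quasi_homogeneous_def)
      then have "complex_of_real ((\<Sum>j\<in>UNIV. of_int (k $ j) * \<theta> j) + real n * \<kappa>) = thc j" by (rule arg_cong)
      then have deg: "thc j = (\<Sum>j\<in>UNIV. of_int (k $ j) * thc j) + of_nat n * kc"
        by simp
      have "of_nat n * (kc * s) + s * (\<Sum>j\<in>UNIV. of_int (k $ j) * thc j) = thc j * s"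
        by (subst deg) (simp add: algebra_simps)
      then have "exp (kc * s) ^ n * exp (s * (\<Sum>j\<in>UNIV. of_int (k $ j) * thc j)) = exp (thc j * s)"
        by (simp only: exp_of_nat_mult[symmetric] exp_add[symmetric])
      then show ?thesis by (simp add: power_mult_distrib mult_ac)
    qed simp
    then have "(\<Sum>n\<le>degree ?p. coeff ?p n * (exp (kc * s) * l) ^ n) * exp (s * (\<Sum>j\<in>UNIV. of_int (k $ j) * thc j))
      = exp (thc j * s) * (\<Sum>n\<le>degree ?p. coeff ?p n * l ^ n)"
      unfolding sum_distrib_left sum_distrib_right by (intro sum.cong refl)
    then show ?thesis unfolding poly_altdef[of ?p] e by (simp add: mult.assoc[symmetric])
  qed
  then show ?thesis
    unfolding zmap_nth eval_exp_keys sum_distrib_left by (intro sum.cong refl)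
qed

lemma zmap_shift': "eval_exp (z j) (exp (kc * s) * l) (x + s *s (\<chi> r. thc r / (tpi)))
   = exp (thc j * s) * eval_exp (z j) l x"
  using zmap_shift[of s l x j] by (simp add: shift_def zmap_nth)

lemma pd_zmap_shift: "pd r (eval_exp (z j) (exp (kc * s) * l)) (shift s x) = exp (thc j * s) * pd r (eval_exp (z j) l) x"
proof -
  have "pd r (eval_exp (z j) (exp (kc * s) * l)) (shift s x) = pd r (\<lambda>x. exp (thc j * s) * eval_exp (z j) l x) x"
    unfolding shift_def pd_translate[symmetric] zmap_shift' ..
  then show ?thesis by (simp add: pd_mult cdiff_intros cdiff_eval_exp pd_const)
qed

lemma pd2_zmap_shift: "pd q (pd r (eval_exp (z j) (exp (kc * s) * l))) (shift s x) = exp (thc j * s) * pd q (pd r (eval_exp (z j) l)) x"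
proof -
  have "pd q (pd r (eval_exp (z j) (exp (kc * s) * l))) (shift s x) = pd q (\<lambda>x. exp (thc j * s) * pd r (eval_exp (z j) l) x) x"
    unfolding shift_def pd_translate[symmetric, of q] using pd_zmap_shift unfolding shift_def by presburger
  moreover have "entire (eval_exp (z j) l)" by (rule entireI) (rule cdiff_eval_exp)
  ultimately show ?thesis by (simp add: pd_mult cdiff_intros entire_cdiff[OF mholomorphic_on_pd[OF open_UNIV]] pd_const)
qed

lemma jacobian_zmap: "jacobian (zmap z l) x $ j $ r = pd r (eval_exp (z j) l) x"
  by (simp add: jacobian_def zmap_nth[abs_def])

lemma det_jacobian_shift:
  "det (jacobian (zmap z (exp (kc * s) * l)) (shift s x)) = (\<Prod>j\<in>UNIV. exp (thc j * s)) * det (jacobian (zmap z l) x)"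
proof -
  have "jacobian (zmap z (exp (kc * s) * l)) (shift s x) = (\<chi> j r. exp (thc j * s) * jacobian (zmap z l) x $ j $ r)"
    by (simp add: vec_eq_iff jacobian_zmap pd_zmap_shift)
  then show ?thesis by (simp add: det_scale_rows)
qed

text \<open>Far out in the positive chamber, the leading exponential \<open>exp(2\<pi>i x^j)\<close> of \<open>z^j\<close> dominates.\<close>

lemma det_jacobian_0: "\<exists>x. det (jacobian (zmap z 0) x) \<noteq> 0"
proof (rule ccontr)
  assume no: "\<not> ?thesis"
  \<comment> \<open>\<open>v\<close> pairs to 1 with every simple root, so it measures heights. At
    the imaginary points \<open>X t\<close> below all exponentials are real, and a summand that
    subtracts simple roots from the leading weight is smaller by the factor exp(-2 pi t) for each of
    them.\<close>
  define v where "v = (\<Sum>k\<in>UNIV. (2 / (\<alpha> k \<bullet> \<alpha> k)) *\<^sub>R \<omega> k)"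
  have \<alpha>v: "\<alpha> k \<bullet> v = 1" for k
    by (simp add: v_def inner_sum_right \<alpha>_fund_weight if_distrib[of "\<lambda>x. _ * x"] cong: if_cong)
  define \<rho> where "\<rho> r = cf r v * (\<alpha> r \<bullet> \<alpha> r) / 2" for r
  have v: "v = (\<Sum>r\<in>UNIV. \<rho> r *\<^sub>R coroot (\<alpha> r))"
    by (subst cf_expand) (simp add: \<rho>_def coroot_def)
  define X where "X t = (\<chi> r. - \<i> * complex_of_real t * complex_of_real (\<rho> r))" for t :: real
  have ex: "ex (tk j \<sigma>) (X t) = exp (complex_of_real (2 * pi * t * (\<omega> j \<bullet> v - (\<Sum>i\<in>UNIV. real (tn j \<sigma> i)))))"
    if \<sigma>: "\<sigma> \<in> weyl_group R" for \<sigma> t j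
  proof -
    have "(\<Sum>r\<in>UNIV. real_of_int (tk j \<sigma> $ r) * \<rho> r) = \<omega> j \<bullet> v - (\<Sum>i\<in>UNIV. real (tn j \<sigma> i) * (\<alpha> i \<bullet> v))"
    proof -
      have wv: "w \<bullet> v = (\<Sum>r\<in>UNIV. (w \<bullet> coroot (\<alpha> r)) * \<rho> r)" for w
        by (subst v) (simp add: inner_sum_right mult.commute)
      show ?thesis
        unfolding term_data(2)[OF \<sigma>] wv
        by (simp add: left_diff_distrib sum_subtractf sum_distrib_left sum_distrib_right mult.assoc) (rule sum.swap)
    qed
    then have "complex_of_real (\<Sum>r\<in>UNIV. real_of_int (tk j \<sigma> $ r) * \<rho> r) = complex_of_real (\<omega> j \<bullet> v - (\<Sum>i\<in>UNIV. real (tn j \<sigma> i) * (\<alpha> i \<bullet> v)))"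
      by (rule arg_cong)
    then have "(\<Sum>r\<in>UNIV. complex_of_int (tk j \<sigma> $ r) * complex_of_real (\<rho> r)) = complex_of_real (\<omega> j \<bullet> v - (\<Sum>i\<in>UNIV. real (tn j \<sigma> i)))"
      by (simp add: \<alpha>v)
    note E = this
    have "2 * complex_of_real pi * \<i> * (\<Sum>r\<in>UNIV. complex_of_int (tk j \<sigma> $ r) * X t $ r) = complex_of_real (2 * pi * t * (\<omega> j \<bullet> v - (\<Sum>i\<in>UNIV. real (tn j \<sigma> i))))"
    proof -
      have "(\<Sum>r\<in>UNIV. complex_of_int (tk j \<sigma> $ r) * X t $ r) = (- \<i> * complex_of_real t) * (\<Sum>r\<in>UNIV. complex_of_int (tk j \<sigma> $ r) * complex_of_real (\<rho> r))"
        unfolding X_def sum_distrib_left by (intro sum.cong refl) (simp only: vec_lambda_beta mult_ac)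
      then have "(\<Sum>r\<in>UNIV. complex_of_int (tk j \<sigma> $ r) * X t $ r) = (- \<i> * complex_of_real t) * complex_of_real (\<omega> j \<bullet> v - (\<Sum>i\<in>UNIV. real (tn j \<sigma> i)))"
        unfolding E .
      then show ?thesis by (simp only: complex_eq_iff) simp
    qed
    then show ?thesis by (simp only: ex_def)
  qed
  define M where "M t = (\<chi> j s. exp (complex_of_real (- 2 * pi * t * (\<omega> j \<bullet> v))) * jacobian (zmap z 0) (X t) $ j $ s)" for t
  have M: "M t $ j $ s = (\<Sum>\<sigma>\<in>weyl_group R. 1 / of_nat (stab j) * 0 ^ tN j \<sigma> * (tpi * of_int (tk j \<sigma> $ s)) * exp (complex_of_real (- 2 * pi * t * (\<Sum>i\<in>UNIV. real (tn j \<sigma> i)))))" for t j s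
  proof -
    define c where "c \<sigma> = 1 / of_nat (stab j) * (0::complex) ^ tN j \<sigma>" for \<sigma>
    have "eval_exp (z j) 0 = (\<lambda>x. \<Sum>\<sigma>\<in>weyl_group R. c \<sigma> * ex (tk j \<sigma>) x)"
      using zmap0[of _ j] unfolding zmap_nth c_def by (rule ext)
    then have jac: "jacobian (zmap z 0) (X t) $ j $ s = (\<Sum>\<sigma>\<in>weyl_group R. c \<sigma> * (tpi * of_int (tk j \<sigma> $ s) * ex (tk j \<sigma>) (X t)))"
      by (simp add: jacobian_zmap pd_sum pd_mult cdiff_intros cdiff_ex pd_const pd_ex)
    have *: "exp (complex_of_real (- 2 * pi * t * (\<omega> j \<bullet> v))) * ex (tk j \<sigma>) (X t) = exp (complex_of_real (- 2 * pi * t * (\<Sum>i\<in>UNIV. real (tn j \<sigma> i))))"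
      if "\<sigma> \<in> weyl_group R" for \<sigma>
      unfolding ex[OF that] exp_add[symmetric] of_real_add[symmetric] by (intro arg_cong[of _ _ exp] arg_cong[of _ _ complex_of_real]) (simp add: algebra_simps)
    have "exp (complex_of_real (- 2 * pi * t * (\<omega> j \<bullet> v))) * (c \<sigma> * (tpi * of_int (tk j \<sigma> $ s) * ex (tk j \<sigma>) (X t)))
       = c \<sigma> * (tpi * of_int (tk j \<sigma> $ s)) * exp (complex_of_real (- 2 * pi * t * (\<Sum>i\<in>UNIV. real (tn j \<sigma> i))))"
      if "\<sigma> \<in> weyl_group R" for \<sigma>
      unfolding *[OF that, symmetric] by (simp only: mult_ac)
    then have "exp (complex_of_real (- 2 * pi * t * (\<omega> j \<bullet> v))) * (\<Sum>\<sigma>\<in>weyl_group R. c \<sigma> * (tpi * of_int (tk j \<sigma> $ s) * ex (tk j \<sigma>) (X t)))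
       = (\<Sum>\<sigma>\<in>weyl_group R. c \<sigma> * (tpi * of_int (tk j \<sigma> $ s)) * exp (complex_of_real (- 2 * pi * t * (\<Sum>i\<in>UNIV. real (tn j \<sigma> i)))))"
      unfolding sum_distrib_left by (intro sum.cong refl)
    then show ?thesis
      unfolding M_def vec_lambda_beta c_def[symmetric] jac .
  qed
  have lim: "((\<lambda>t. M t $ j $ s) \<longlongrightarrow> diagm (\<lambda>_. tpi) $ j $ s) at_top" for j s
  proof -
    have "((\<lambda>t. M t $ j $ s) \<longlongrightarrow> (\<Sum>\<sigma>\<in>weyl_group R. if \<forall>i. tn j \<sigma> i = 0 then 1 / of_nat (stab j) * (if s = j then tpi else 0) else 0)) at_top"
      unfolding M
    proof (rule tendsto_sum)
      fix \<sigma> assume \<sigma>: "\<sigma> \<in> weyl_group R"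
      show "((\<lambda>t. 1 / of_nat (stab j) * 0 ^ tN j \<sigma> * (tpi * of_int (tk j \<sigma> $ s)) * exp (complex_of_real (- 2 * pi * t * (\<Sum>i\<in>UNIV. real (tn j \<sigma> i)))))
          \<longlongrightarrow> (if \<forall>i. tn j \<sigma> i = 0 then 1 / of_nat (stab j) * (if s = j then tpi else 0) else 0)) at_top"
      proof (cases "\<forall>i. tn j \<sigma> i = 0")
        case True
        then show ?thesis using tN_0[OF \<sigma>] by (simp add: tk_axis[OF \<sigma>])
      next
        case False
        define S where "S = (\<Sum>i\<in>UNIV. real (tn j \<sigma> i))"
        obtain i where "tn j \<sigma> i \<noteq> 0" using False by blast
        then have "S > 0" unfolding S_def by (intro sum_pos2[of UNIV i]) auto
        then have "filterlim (\<lambda>t. t * (2 * pi * S)) at_top at_top"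
          using filterlim_tendsto_pos_mult_at_top[OF tendsto_const _ filterlim_ident, of "2 * pi * S"] by (simp add: mult.commute)
        then have "filterlim (\<lambda>t. - (t * (2 * pi * S))) at_bot at_top" by (simp add: filterlim_uminus_at_bot)
        then have "((\<lambda>t. exp (- (t * (2 * pi * S)))) \<longlongrightarrow> 0) at_top"
          by (rule filterlim_compose[OF exp_at_bot])
        then have "((\<lambda>t. complex_of_real (exp (- (t * (2 * pi * S))))) \<longlongrightarrow> of_real 0) at_top" by (rule tendsto_of_real)
        then have "((\<lambda>t. exp (complex_of_real (- 2 * pi * t * S))) \<longlongrightarrow> 0) at_top"
          by (simp add: exp_of_real[symmetric] mult_ac)
        then have "((\<lambda>t. 1 / of_nat (stab j) * 0 ^ tN j \<sigma> * (tpi * of_int (tk j \<sigma> $ s)) * exp (complex_of_real (- 2 * pi * t * S))) \<longlongrightarrow> 0) at_top"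
          by (rule tendsto_mult_right_zero)
        then show ?thesis unfolding S_def if_not_P[OF False] .
      qed
    qed
    moreover have "(\<Sum>\<sigma>\<in>weyl_group R. if \<forall>i. tn j \<sigma> i = 0 then 1 / of_nat (stab j) * (if s = j then tpi else 0) else 0) = diagm (\<lambda>_. tpi) $ j $ s"
      unfolding sum_stab using stab_pos[of j] by (auto simp: diagm_def)
    ultimately show ?thesis by simp
  qed
  have "((\<lambda>t. det (M t)) \<longlongrightarrow> det (diagm (\<lambda>_. tpi) :: complex^'l^'l)) at_top"
    by (rule tendsto_det) (rule lim)
  moreover have "det (M t) = 0" for t
    unfolding M_def det_scale_rows using no by simp
  ultimately have "((\<lambda>t::real. 0) \<longlongrightarrow> det (diagm (\<lambda>_. tpi) :: complex^'l^'l)) at_top" by simp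
  then have "det (diagm (\<lambda>_. tpi) :: complex^'l^'l) = 0"
    by (simp add: tendsto_const_iff)
  then show False using det_diagm[of "\<lambda>_::'l. 2 * complex_of_real pi * \<i>"] by simp
qed

text \<open>By continuity the regular point at \<lambda> = 0 stays regular for small \<lambda>.
  Quasi-homogeneity brings an arbitrary \<lambda> into that range at the price of a shift of
  \<open>x\<close>.\<close>

lemma det_jacobian: "\<exists>x. det (jacobian (zmap z l) x) \<noteq> 0"
proof -
  obtain x0 where x0: "det (jacobian (zmap z 0) x0) \<noteq> 0" using det_jacobian_0 by blast
  have "((\<lambda>l. det (jacobian (zmap z l) x0)) \<longlongrightarrow> det (jacobian (zmap z 0) x0)) (nhds 0)"
    by (rule tendsto_det, unfold jacobian_zmap pd_eval_exp) (intro tendsto_intros filterlim_ident)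
  then have "eventually (\<lambda>l. det (jacobian (zmap z l) x0) \<noteq> 0) (nhds 0)"
    using x0 by (rule tendsto_imp_eventually_ne)
  then obtain e where e: "e > 0" "\<And>l. norm l < e \<Longrightarrow> det (jacobian (zmap z l) x0) \<noteq> 0"
    by (auto simp: eventually_nhds_metric dist_norm)
  define s where "s = (ln (e / (norm l + 1)) - 1) / \<kappa>"
  have "\<kappa> * s = ln (e / (norm l + 1)) - 1" using kappa_props(1) by (simp add: s_def)
  moreover have "e / (norm l + 1) > 0" using e(1) by (simp add: add_nonneg_pos)
  ultimately have "exp (\<kappa> * s) = e / (norm l + 1) * exp (- 1)"
    by (simp add: exp_diff exp_minus divide_inverse)
  then have "norm (exp (kc * complex_of_real s) * l) = e / (norm l + 1) * exp (- 1) * norm l"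
    by (simp add: norm_mult norm_exp_eq_Re)
  also have "\<dots> \<le> e / (norm l + 1) * 1 * norm l"
    using e(1) by (intro mult_right_mono mult_left_mono) auto
  also have "\<dots> < e" using e(1) by (simp add: field_simps add_pos_nonneg)
  finally have "det (jacobian (zmap z (exp (kc * complex_of_real s) * l)) x0) \<noteq> 0" by (rule e(2))
  moreover define y where "y = x0 - complex_of_real s *s (\<chi> r. thc r / (tpi))"
  then have "x0 = shift (complex_of_real s) y" by (simp add: shift_def)
  ultimately have "det (jacobian (zmap z l) y) \<noteq> 0"
    using det_jacobian_shift[of "complex_of_real s" l y] by auto
  then show ?thesis by blast
qed

end

section \<open>The flat pencil of a set of pencil generators\<close>

definition mono :: "nat^'l \<Rightarrow> complex^'l::finite \<Rightarrow> complex" where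
  "mono k v = (\<Prod>j\<in>UNIV. (v $ j) ^ (k $ j))"

definition lin_coeff :: "'l::finite zpoly \<Rightarrow> complex^'l \<Rightarrow> complex" where
  "lin_coeff P v = (\<Sum>k\<in>Poly_Mapping.keys P. coeff (Poly_Mapping.lookup P k) 1 * mono k v)"

lemma eval_z_mono: "eval_z P l v = (\<Sum>k\<in>Poly_Mapping.keys P. poly (Poly_Mapping.lookup P k) l * mono k v)"
  by (simp add: eval_z_def mono_def)

lemma eval_z_alt: "finite K \<Longrightarrow> Poly_Mapping.keys P \<subseteq> K \<Longrightarrow> eval_z P l v = (\<Sum>k\<in>K. poly (Poly_Mapping.lookup P k) l * mono k v)"
  unfolding eval_z_mono by (rule sum.mono_neutral_left) (auto simp: in_keys_iff)

lemma cdiff_mono: "(\<And>j. cdiff (\<lambda>v. F v $ j) v) \<Longrightarrow> cdiff (\<lambda>v. mono k (F v)) v"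
  unfolding mono_def by (intro cdiff_intros)

lemma cdiff_eval_z: "(\<And>j. cdiff (\<lambda>v. F v $ j) v) \<Longrightarrow> cdiff (\<lambda>v. eval_z P l (F v)) v"
  unfolding eval_z_mono by (intro cdiff_intros cdiff_mono)

lemma entire_eval_z: "entire (eval_z P l)"
  by (rule entireI) (rule cdiff_eval_z[of "\<lambda>v. v"], rule cdiff_coord)

lemma cdiff_lin_coeff: "cdiff (lin_coeff P) v"
proof -
  have "cdiff (\<lambda>v. \<Sum>k\<in>Poly_Mapping.keys P. coeff (Poly_Mapping.lookup P k) 1 * mono k v) v"
    by (intro cdiff_intros cdiff_mono[of "\<lambda>v. v"])
  then show ?thesis by (simp add: lin_coeff_def[abs_def])
qed

lemma poly_linear: "degree (p :: complex poly) \<le> 1 \<Longrightarrow> poly p l = poly p 0 + l * coeff p 1"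
proof -
  assume "degree p \<le> 1"
  then have "poly p x = (\<Sum>n\<le>1. coeff p n * x ^ n)" for x
    unfolding poly_altdef by (intro sum.mono_neutral_left) (auto simp: coeff_eq_0)
  then show ?thesis by simp
qed

lemma eval_z_linear: "linear_in_lambda P \<Longrightarrow> eval_z P l v = eval_z P 0 v + l * lin_coeff P v"
proof -
  assume "linear_in_lambda P"
  then have "poly (Poly_Mapping.lookup P k) l = poly (Poly_Mapping.lookup P k) 0 + l * coeff (Poly_Mapping.lookup P k) 1" for k
    using poly_linear unfolding linear_in_lambda_def by blast
  then show ?thesis
    unfolding eval_z_mono lin_coeff_def sum_distrib_left sum.distrib[symmetric] by (intro sum.cong refl) (simp add: algebra_simps)
qed

lemma mono_exp: "mono k (\<chi> j. exp (tpi * x $ j)) = ex (\<chi> j. int (k $ j)) x"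
  by (simp add: mono_def ex_def exp_of_nat_mult[symmetric] exp_sum[symmetric] sum_distrib_left mult_ac)

lemma mono_independent:
  assumes "finite K" "\<And>v. (\<Sum>k\<in>K. c k * mono k v) = 0" "k \<in> K"
  shows "c k = 0"
proof (rule characters_independent[where X = UNIV and pl = "(+)" and ch = "\<lambda>k. ex (\<chi> j. int (k $ j))", OF assms(1)])
  show "(\<Sum>k\<in>K. c k * ex (\<chi> j. int (k $ j)) x) = 0" for x
    using assms(2)[of "\<chi> j. exp (tpi * x $ j)"] by (simp only: mono_exp)
  show "\<exists>x\<in>UNIV. ex (\<chi> n. int (i $ n)) x \<noteq> ex (\<chi> n. int (j $ n)) x" if "i \<noteq> j" for i j :: "nat^'b"
    using ex_distinct[of "\<chi> n. int (i $ n)" "\<chi> n. int (j $ n)"] that by (auto simp: vec_eq_iff)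
qed (use assms in \<open>auto simp: ex_add\<close>)

lemma eval_z_unique:
  assumes "\<And>l v. eval_z P l v = eval_z Q l v"
  shows "P = Q"
proof (rule poly_mapping_eqI)
  fix k
  let ?K = "insert k (Poly_Mapping.keys P \<union> Poly_Mapping.keys Q)"
  have "poly (Poly_Mapping.lookup P k - Poly_Mapping.lookup Q k) l = 0" for l
  proof (rule mono_independent[of ?K "\<lambda>k. poly (Poly_Mapping.lookup P k - Poly_Mapping.lookup Q k) l"])
    fix v
    have "eval_z P l v - eval_z Q l v = (\<Sum>k\<in>?K. poly (Poly_Mapping.lookup P k - Poly_Mapping.lookup Q k) l * mono k v)"
      by (subst (1 2) eval_z_alt[of ?K]) (auto simp: left_diff_distrib sum_subtractf)
    then show "(\<Sum>k\<in>?K. poly (Poly_Mapping.lookup P k - Poly_Mapping.lookup Q k) l * mono k v) = 0" using assms by simp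
  qed auto
  then have "poly (Poly_Mapping.lookup P k) = poly (Poly_Mapping.lookup Q k)" by (simp add: fun_eq_iff)
  then show "Poly_Mapping.lookup P k = Poly_Mapping.lookup Q k" by (simp only: poly_eq_poly_eq_iff)
qed

text \<open>Euler's identity: differentiate the scaling flow at time zero.\<close>

lemma homogeneous_dird:
  fixes \<theta> :: "'n::finite \<Rightarrow> complex"
  assumes f: "cdiff f v" and h: "\<And>s. f (\<chi> r. exp (\<theta> r * s) * v $ r) = exp (c * s) * f v"
  shows "dird (\<chi> r. \<theta> r * v $ r) f v = c * f v"
proof -
  have 1: "((\<lambda>s. \<chi> r. exp (\<theta> r * s) * v $ r) has_derivative (\<lambda>h. h *s (\<chi> r. \<theta> r * v $ r))) (at 0)"
    by (rule has_derivative_vec) (auto intro!: derivative_eq_intros simp: has_field_derivative_def[symmetric] fun_eq_iff)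
  have 2: "(\<chi> r. exp (\<theta> r * 0) * v $ r) = v" by (simp add: vec_eq_iff)
  have "((\<lambda>s. f (\<chi> r. exp (\<theta> r * s) * v $ r)) has_derivative (\<lambda>h. contract (h *s (\<chi> r. \<theta> r * v $ r)) (differential f v))) (at 0)"
    by (rule has_derivative_compose[OF 1]) (simp only: 2 cdiff_has_derivative[OF f])
  moreover have "(\<lambda>h. contract (h *s (\<chi> r. \<theta> r * v $ r)) (differential f v)) = (*) (dird (\<chi> r. \<theta> r * v $ r) f v)"
    by (rule ext) (simp add: contract_scale dird_def)
  ultimately have "((\<lambda>s. exp (c * s) * f v) has_field_derivative dird (\<chi> r. \<theta> r * v $ r) f v) (at 0)"
    unfolding h by (simp add: has_field_derivative_def)
  moreover have "((\<lambda>s. exp (c * s) * f v) has_field_derivative c * f v) (at 0)"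
    by (auto intro!: derivative_eq_intros)
  ultimately show ?thesis by (rule DERIV_unique)
qed

context generators
begin

lemma eq_0_zmap: "entire f \<Longrightarrow> (\<And>x. det (jacobian (zmap z l) x) \<noteq> 0 \<Longrightarrow> f (zmap z l x) = 0) \<Longrightarrow> f v = 0"
  using det_jacobian[of l] entire_eq_0_image[OF _ entire_zmap] by blast

text \<open>The values of the generators fill an open set, so the expressing polynomial is unique.
  Hence the definite description picks the one whose linearity is part of
  \<open>pencil_generators\<close>.\<close>

lemma metric_poly: "expresses_metric \<alpha> z i j (metric_poly \<alpha> z i j)" "linear_in_lambda (metric_poly \<alpha> z i j)"
proof -
  obtain P where P: "expresses_metric \<alpha> z i j P" "linear_in_lambda P"
    using pencil_gen unfolding pencil_generators_def by blast
  have "Q = P" if "expresses_metric \<alpha> z i j Q" for Q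
  proof (rule eval_z_unique)
    fix l v
    have "eval_z Q l v - eval_z P l v = 0"
      by (rule eq_0_zmap[where l = l and f = "\<lambda>v. eval_z Q l v - eval_z P l v" and v = v])
        (use that P(1) in \<open>auto simp: expresses_metric_def intro!: entireI cdiff_intros entire_cdiff[OF entire_eval_z]\<close>)
    then show "eval_z Q l v = eval_z P l v" by simp
  qed
  then have "metric_poly \<alpha> z i j = P" unfolding metric_poly_def using P(1) by (rule_tac the_equality)
  then show "expresses_metric \<alpha> z i j (metric_poly \<alpha> z i j)" "linear_in_lambda (metric_poly \<alpha> z i j)" using P by auto
qed

text \<open>Fundamental weights and simple coroots are dual bases, so their Gram matrices are
  inverse to each other.\<close>

lemma coroot_gram_inv_eq: "coroot_gram_inv \<alpha> = (\<chi> i j. \<omega> i \<bullet> \<omega> j)"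
  unfolding coroot_gram_inv_def
proof (rule matrix_inv_unique'(1))
  have "(\<Sum>j\<in>UNIV. (coroot (\<alpha> i) \<bullet> coroot (\<alpha> j)) * (\<omega> j \<bullet> \<omega> k)) = (if i = k then 1 else 0)" for i k
  proof -
    have "coroot (\<alpha> i) \<bullet> \<omega> k = (\<Sum>j\<in>UNIV. (coroot (\<alpha> i) \<bullet> coroot (\<alpha> j)) *\<^sub>R \<omega> j) \<bullet> \<omega> k"
      using weight_expand[of "coroot (\<alpha> i)"] by simp
    then show ?thesis by (simp add: inner_sum_left inner_commute[of "coroot (\<alpha> i)" "\<omega> k"] fund_weight_coroot eq_commute)
  qed
  then show "(\<chi> i j. coroot (\<alpha> i) \<bullet> coroot (\<alpha> j)) ** (\<chi> i j. \<omega> i \<bullet> \<omega> j) = mat 1"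
    by (simp add: vec_eq_iff matrix_matrix_mult_def mat_def)
qed

text \<open>The constant contravariant metric in the coordinates \<open>x\<close>, with the factor
  1/(4 pi^2) of the definition of the pencil included.\<close>

definition "acc = (\<chi> r s. complex_of_real (\<omega> r \<bullet> \<omega> s) / (4 * (complex_of_real pi)\<^sup>2))"

lemma acc_gram: "(\<Sum>s\<in>UNIV. acc $ r $ s * complex_of_real (coroot (\<alpha> s) \<bullet> coroot (\<alpha> k))) = (if r = k then 1 else 0) / (4 * (complex_of_real pi)\<^sup>2)"
proof -
  have "coroot (\<alpha> k) \<bullet> \<omega> r = (\<Sum>j\<in>UNIV. (coroot (\<alpha> k) \<bullet> coroot (\<alpha> j)) *\<^sub>R \<omega> j) \<bullet> \<omega> r"
    using weight_expand[of "coroot (\<alpha> k)"] by simp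
  then have "(\<Sum>s\<in>UNIV. (\<omega> r \<bullet> \<omega> s) * (coroot (\<alpha> s) \<bullet> coroot (\<alpha> k))) = (if r = k then 1 else 0)"
    by (simp add: inner_sum_left inner_commute[of "coroot (\<alpha> k)"] fund_weight_coroot inner_commute[of "\<omega> _" "\<omega> r"] mult.commute)
  then have "complex_of_real (\<Sum>s\<in>UNIV. (\<omega> r \<bullet> \<omega> s) * (coroot (\<alpha> s) \<bullet> coroot (\<alpha> k))) = (if r = k then 1 else 0)" by simp
  then show ?thesis by (simp add: acc_def sum_divide_distrib[symmetric])
qed

lemma det_acc: "det acc \<noteq> 0"
proof (rule matrix_inv_unique'(2))
  show "acc ** (\<chi> s k. 4 * (complex_of_real pi)\<^sup>2 * complex_of_real (coroot (\<alpha> s) \<bullet> coroot (\<alpha> k))) = mat 1"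
    using acc_gram by (simp add: vec_eq_iff matrix_mult_nth mat_def mult.left_commute[of _ "4 * _"] sum_distrib_left[symmetric])
qed

lemma acc_sym: "transpose acc = acc"
  by (simp add: acc_def vec_eq_iff transpose_nth inner_commute)

abbreviation "G l \<equiv> g_pencil \<alpha> z l"
abbreviation "g \<equiv> g_metric \<alpha> z"
abbreviation "\<eta> \<equiv> eta_metric \<alpha> z"

lemma G_nth: "G l v $ i $ j = eval_z (metric_poly \<alpha> z i j) l v"
  by (simp add: g_pencil_def)

lemma \<eta>_nth: "\<eta> v $ i $ j = lin_coeff (metric_poly \<alpha> z i j) v"
proof -
  have "(\<lambda>l. G l v $ i $ j) = (\<lambda>l. eval_z (metric_poly \<alpha> z i j) 0 v + l * lin_coeff (metric_poly \<alpha> z i j) v)"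
    unfolding G_nth by (rule ext) (rule eval_z_linear[OF metric_poly(2)])
  moreover have "((\<lambda>l. eval_z (metric_poly \<alpha> z i j) 0 v + l * lin_coeff (metric_poly \<alpha> z i j) v) has_field_derivative lin_coeff (metric_poly \<alpha> z i j) v) (at 0)"
    by (auto intro!: derivative_eq_intros)
  ultimately show ?thesis by (simp add: eta_metric_def DERIV_imp_deriv)
qed

lemma G_eq: "G l v = (\<chi> i j. g v $ i $ j + l * \<eta> v $ i $ j)"
  by (simp add: vec_eq_iff g_metric_def G_nth \<eta>_nth eval_z_linear[OF metric_poly(2), of _ _ l])

lemma G_zmap: "G l (zmap z l x) = jacobian (zmap z l) x ** acc ** transpose (jacobian (zmap z l) x)"
proof -
  have "G l (zmap z l x) $ i $ j = (\<Sum>r\<in>UNIV. \<Sum>s\<in>UNIV. jacobian (zmap z l) x $ i $ r * acc $ r $ s * jacobian (zmap z l) x $ j $ s)" for i j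
    using metric_poly(1)[of i j] unfolding expresses_metric_def G_nth
    by (simp add: jacobian_def acc_def coroot_gram_inv_eq sum_distrib_left)
  also have "(\<Sum>r\<in>UNIV. \<Sum>s\<in>UNIV. jacobian (zmap z l) x $ i $ r * acc $ r $ s * jacobian (zmap z l) x $ j $ s)
    = (jacobian (zmap z l) x ** acc ** transpose (jacobian (zmap z l) x)) $ i $ j" for i j
    by (simp add: matrix_mult_nth transpose_nth sum_distrib_right) (rule sum.swap)
  finally show ?thesis by (simp add: vec_eq_iff)
qed

definition Q :: "'l \<Rightarrow> 'l \<Rightarrow> 'l \<Rightarrow> 'l zpoly" where
  "Q i j k = (SOME Q. linear_in_lambda Q \<and> (\<forall>l v. det (G l v) \<noteq> 0 \<longrightarrow> contra_christoffel pd (G l) i j k v = eval_z Q l v))"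

lemma Q: "linear_in_lambda (Q i j k)" "det (G l v) \<noteq> 0 \<Longrightarrow> contra_christoffel pd (G l) i j k v = eval_z (Q i j k) l v"
proof -
  have "linear_in_lambda (Q i j k) \<and> (\<forall>l v. det (G l v) \<noteq> 0 \<longrightarrow> contra_christoffel pd (G l) i j k v = eval_z (Q i j k) l v)"
    unfolding Q_def by (rule someI_ex) (use pencil_gen in \<open>unfold pencil_generators_def, blast\<close>)
  then show "linear_in_lambda (Q i j k)" "det (G l v) \<noteq> 0 \<Longrightarrow> contra_christoffel pd (G l) i j k v = eval_z (Q i j k) l v" by auto
qed

definition "\<Gamma>0 i j k = eval_z (Q i j k) 0"
definition "\<Gamma>1 i j k = lin_coeff (Q i j k)"

lemma \<Gamma>_eq: "eval_z (Q i j k) l v = \<Gamma>0 i j k v + l * \<Gamma>1 i j k v"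
  unfolding \<Gamma>0_def \<Gamma>1_def by (rule eval_z_linear[OF Q(1)])

definition "x0 l = (SOME x. det (jacobian (zmap z l) x) \<noteq> 0)"

text \<open>Only the map depends on \<open>l\<close>; the constant metric upstairs is the same for
  the whole pencil.\<close>

lemma pullback: "pullback (zmap z l) acc (G l) (\<lambda>i j k. eval_z (Q i j k) l) (x0 l)"
proof
  show "entire (\<lambda>x. zmap z l x $ k)" for k by (rule entire_zmap)
  show "entire (\<lambda>v. G l v $ i $ j)" for i j unfolding G_nth by (rule entire_eval_z)
  show "det (jacobian (zmap z l) (x0 l)) \<noteq> 0" unfolding x0_def by (rule someI_ex[OF det_jacobian])
qed (use acc_sym det_acc G_zmap Q(2) entire_eval_z in auto)

section \<open>Homogeneity of the pencil\<close>

definition "scl s v = (\<chi> r. exp (thc r * s) * v $ r)"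

lemma zmap_scl: "zmap z (exp (kc * s) * l) (shift s x) = scl s (zmap z l x)"
  by (simp add: vec_eq_iff scl_def zmap_shift)

lemma jacobian_scl: "jacobian (zmap z (exp (kc * s) * l)) (shift s x) $ j $ r = exp (thc j * s) * jacobian (zmap z l) x $ j $ r"
  by (simp add: jacobian_zmap pd_zmap_shift)

lemma G_scl: "G (exp (kc * s) * l) (scl s v) $ i $ j = exp ((thc i + thc j) * s) * G l v $ i $ j"
proof -
  interpret p: pullback "zmap z l" acc "G l" "\<lambda>i j k. eval_z (Q i j k) l" "x0 l" by (rule pullback)
  interpret p': pullback "zmap z (exp (kc * s) * l)" acc "G (exp (kc * s) * l)" "\<lambda>i j k. eval_z (Q i j k) (exp (kc * s) * l)" "x0 (exp (kc * s) * l)" by (rule pullback)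
  have "G (exp (kc * s) * l) (scl s v) $ i $ j - exp ((thc i + thc j) * s) * G l v $ i $ j = 0"
  proof (rule eq_0_zmap[where l = l and v = v and f = "\<lambda>v. G (exp (kc * s) * l) (scl s v) $ i $ j - exp ((thc i + thc j) * s) * G l v $ i $ j"])
    show "entire (\<lambda>v. G (exp (kc * s) * l) (scl s v) $ i $ j - exp ((thc i + thc j) * s) * G l v $ i $ j)"
      unfolding G_nth by (intro entireI cdiff_intros cdiff_eval_z) (simp_all add: scl_def cdiff_intros)
    fix x
    have "G (exp (kc * s) * l) (scl s (zmap z l x)) $ i $ j = exp ((thc i + thc j) * s) * G l (zmap z l x) $ i $ j"
      unfolding zmap_scl[symmetric] p'.G_nth p.G_nth jacobian_scl distrib_right exp_add
      by (simp add: sum_distrib_left mult_ac)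
    then show "G (exp (kc * s) * l) (scl s (zmap z l x)) $ i $ j - exp ((thc i + thc j) * s) * G l (zmap z l x) $ i $ j = 0" by simp
  qed
  then show ?thesis by simp
qed

lemma g_scl: "g (scl s v) $ i $ j = exp ((thc i + thc j) * s) * g v $ i $ j"
  using G_scl[of s 0 v i j] by (simp add: g_metric_def)

lemma \<eta>_scl: "\<eta> (scl s v) $ i $ j = exp ((thc i + thc j - kc) * s) * \<eta> v $ i $ j"
proof -
  have "exp (kc * s) * \<eta> (scl s v) $ i $ j = exp ((thc i + thc j) * s) * \<eta> v $ i $ j"
    using G_scl[of s 1 v i j] by (simp add: G_eq g_scl distrib_left)
  then show ?thesis by (simp add: left_diff_distrib exp_diff field_simps)
qed

text \<open>At regular images \<open>Gam_F\<close> determines the symbols from the Jacobian and the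
  Hessians, and each of these scales by a known exponential under \<open>shift\<close>. The value
  \<lambda> = 0 is fixed by the rescaling, so both sides refer to the same metric.\<close>

lemma \<Gamma>0_scl: "\<Gamma>0 i j k (scl s v) = exp ((thc i + thc j - thc k) * s) * \<Gamma>0 i j k v"
proof -
  interpret p: pullback "zmap z 0" acc "G 0" "\<lambda>i j k. eval_z (Q i j k) 0" "x0 0" by (rule pullback)
  have e: "entire (\<Gamma>0 i j k)" for i j k unfolding \<Gamma>0_def by (rule entire_eval_z)
  have "\<Gamma>0 i j k (scl s v) - exp ((thc i + thc j - thc k) * s) * \<Gamma>0 i j k v = 0"
  proof (rule eq_0_zmap[where l = 0 and v = v and f = "\<lambda>v. \<Gamma>0 i j k (scl s v) - exp ((thc i + thc j - thc k) * s) * \<Gamma>0 i j k v"])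
    show "entire (\<lambda>v. \<Gamma>0 i j k (scl s v) - exp ((thc i + thc j - thc k) * s) * \<Gamma>0 i j k v)"
      unfolding \<Gamma>0_def by (intro entireI cdiff_intros cdiff_eval_z entire_cdiff[OF entire_eval_z]) (simp_all add: scl_def cdiff_intros)
    fix x assume x: "det (jacobian (zmap z 0) x) \<noteq> 0"
    let ?Z = "jacobian (zmap z 0)"
    have Zs: "?Z (shift s x) $ j $ r = exp (thc j * s) * ?Z x $ j $ r" for j r
      using jacobian_scl[of s 0 x j r] by simp
    have hs: "p.hess (axis j 1) (shift s x) $ q $ r = exp (thc j * s) * p.hess (axis j 1) x $ q $ r" for j q r
      using pd2_zmap_shift[of r q j s 0 x] by (simp add: p.hess_def axis_def zmap_nth[abs_def] if_distrib[of "\<lambda>x. x * _"] cong: if_cong)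
    have x': "det (?Z (shift s x)) \<noteq> 0" using det_jacobian_shift[of s 0 x] x by simp
    have row: "(\<Sum>k\<in>UNIV. \<Gamma>0 i j k (zmap z 0 y) * ?Z y $ k $ t) = (\<Sum>q\<in>UNIV. \<Sum>r\<in>UNIV. ?Z y $ i $ r * acc $ r $ q * p.hess (axis j 1) y $ q $ t)"
      if "det (?Z y) \<noteq> 0" for y i j t
    proof -
      have "(Gam (\<lambda>i j k. eval_z (Q i j k) 0) (zmap z 0 y) (axis j 1) ** ?Z y) $ i $ t = (?Z y ** acc ** p.hess (axis j 1) y) $ i $ t"
        by (simp only: p.Gam_F[OF that])
      then show ?thesis by (simp add: matrix_mult_nth Gam_nth axis_def \<Gamma>0_def sum_distrib_right if_distrib[of "\<lambda>x. _ * x"] cong: if_cong)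
    qed
    define u where "u = (\<chi> k. \<Gamma>0 i j k (scl s (zmap z 0 x)) * exp (thc k * s) - exp ((thc i + thc j) * s) * \<Gamma>0 i j k (zmap z 0 x))"
    have "(u v* ?Z x) $ t = 0" for t
    proof -
      have "(\<Sum>k\<in>UNIV. \<Gamma>0 i j k (scl s (zmap z 0 x)) * (exp (thc k * s) * ?Z x $ k $ t))
         = exp ((thc i + thc j) * s) * (\<Sum>k\<in>UNIV. \<Gamma>0 i j k (zmap z 0 x) * ?Z x $ k $ t)"
        using row[OF x', of i j t] zmap_scl[of s 0 x] unfolding row[OF x] Zs hs distrib_right exp_add
        by (simp add: sum_distrib_left mult_ac)
      then show ?thesis by (simp add: vector_matrix_nth u_def right_diff_distrib sum_subtractf sum_distrib_left mult_ac)
    qed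
    then have "(u v* ?Z x) v* matrix_inv (?Z x) = 0" by (simp add: vec_eq_iff vector_matrix_nth)
    then have "u = 0" by (simp add: vector_matrix_mul_assoc matrix_inv_det[OF x])
    then have "\<Gamma>0 i j k (scl s (zmap z 0 x)) * exp (thc k * s) = exp ((thc i + thc j) * s) * \<Gamma>0 i j k (zmap z 0 x)"
      by (simp add: u_def vec_eq_iff)
    then show "\<Gamma>0 i j k (scl s (zmap z 0 x)) - exp ((thc i + thc j - thc k) * s) * \<Gamma>0 i j k (zmap z 0 x) = 0"
      by (simp add: left_diff_distrib exp_diff field_simps)
  qed
  then show ?thesis by simp
qed

lemma euler_zmap0: "(\<Sum>r\<in>UNIV. thc r * jacobian (zmap z 0) x $ j $ r) = tpi * thc j * zmap z 0 x $ j"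
proof -
  let ?u = "\<chi> r. thc r / (tpi)"
  have "((\<lambda>s. eval_exp (z j) 0 (x + s *s ?u)) has_field_derivative dird ?u (eval_exp (z j) 0) (x + 0 *s ?u)) (at 0)"
    by (rule has_field_derivative_line) (rule cdiff_eval_exp)
  moreover have "(\<lambda>s. eval_exp (z j) 0 (x + s *s ?u)) = (\<lambda>s. exp (thc j * s) * eval_exp (z j) 0 x)"
    using zmap_shift'[of j _ 0 x] by auto
  moreover have "((\<lambda>s. exp (thc j * s) * eval_exp (z j) 0 x) has_field_derivative thc j * eval_exp (z j) 0 x) (at 0)"
    by (auto intro!: derivative_eq_intros)
  ultimately have "dird ?u (eval_exp (z j) 0) x = thc j * eval_exp (z j) 0 x"
    using DERIV_unique by fastforce
  then have "(\<Sum>r\<in>UNIV. thc r * jacobian (zmap z 0) x $ j $ r) / (tpi) = thc j * zmap z 0 x $ j"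
    by (simp add: dird_expand jacobian_zmap zmap_nth sum_divide_distrib)
  then show ?thesis by (simp add: field_simps)
qed

text \<open>At \<lambda> = 0 each z^q with m_q positive is exp(2 pi \<i> x^q), so the logarithmic
  form pulls back to a constant form with components -2 pi \<i> m_q. Raised by the constant metric
  it becomes the direction of \<open>shift\<close>, whose image is the Euler field.\<close>

lemma g_dlog_zmap0:
  "(\<Sum>i\<in>UNIV. g (zmap z 0 x) $ k $ i * (- of_nat (m i) / zmap z 0 x $ i)) = thc k * zmap z 0 x $ k"
proof -
  let ?Z = "jacobian (zmap z 0) x" and ?z = "zmap z 0 x"
  have t: "(\<Sum>i\<in>UNIV. ?Z $ i $ q * (- of_nat (m i) / ?z $ i)) = - 2 * complex_of_real pi * \<i> * of_nat (m q)" for q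
  proof -
    have "?Z $ i $ q * (- of_nat (m i) / ?z $ i) = (if i = q then - 2 * complex_of_real pi * \<i> * of_nat (m q) else 0)" for i
    proof (cases "m i > 0")
      case True
      have ef: "eval_exp (z i) 0 = (\<lambda>x. exp (tpi * x $ i))"
        using zmap0_S[OF True] by (auto simp: zmap_nth)
      have "?Z $ i $ q = exp (tpi * x $ i) * (tpi * (if q = i then 1 else 0))"
        unfolding jacobian_zmap ef by (simp add: pd_exp pd_mult cdiff_intros pd_const pd_coord)
      then show ?thesis using True by (simp add: zmap0_S[OF True])
    qed auto
    then show ?thesis by simp
  qed
  have w: "(\<Sum>q\<in>UNIV. acc $ r $ q * of_nat (m q)) = thc r / (4 * (complex_of_real pi)\<^sup>2)" for r
  proof -
    have "\<theta> r = (\<Sum>q\<in>UNIV. (\<omega> r \<bullet> \<omega> q) * real (m q))"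
      by (simp add: theta_def weight_def inner_sum_right mult.commute)
    then show ?thesis by (simp add: acc_def sum_divide_distrib)
  qed
  have "(\<Sum>i\<in>UNIV. g ?z $ k $ i * (- of_nat (m i) / ?z $ i)) = (\<Sum>r\<in>UNIV. ?Z $ k $ r * (\<Sum>q\<in>UNIV. acc $ r $ q * (\<Sum>i\<in>UNIV. ?Z $ i $ q * (- of_nat (m i) / ?z $ i))))"
  proof -
    have "g ?z = ?Z ** (acc ** transpose ?Z)" using G_zmap[of 0 x] by (simp add: g_metric_def matrix_mul_assoc)
    then have "g ?z *v (\<chi> i. - of_nat (m i) / ?z $ i) = ?Z *v (acc *v (transpose ?Z *v (\<chi> i. - of_nat (m i) / ?z $ i)))"
      by (simp only: matrix_vector_mul_assoc)
    then have "(g ?z *v (\<chi> i. - of_nat (m i) / ?z $ i)) $ k = (?Z *v (acc *v (transpose ?Z *v (\<chi> i. - of_nat (m i) / ?z $ i)))) $ k" by (simp only:)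
    then show ?thesis by (simp only: matrix_vector_mult_def vec_lambda_beta transpose_nth)
  qed
  also have "\<dots> = - 2 * complex_of_real pi * \<i> * (\<Sum>r\<in>UNIV. ?Z $ k $ r * (thc r / (4 * (complex_of_real pi)\<^sup>2)))"
    unfolding t w[symmetric] by (simp add: sum_distrib_left mult_ac)
  also have "\<dots> = - 2 * complex_of_real pi * \<i> / (4 * (complex_of_real pi)\<^sup>2) * (\<Sum>r\<in>UNIV. thc r * ?Z $ k $ r)"
    by (simp add: sum_distrib_left sum_divide_distrib mult_ac)
  also have "\<dots> = thc k * ?z $ k"
    unfolding euler_zmap0 by (simp add: power2_eq_square field_simps)
  finally show ?thesis .
qed

text \<open>Multiplied by the coordinates in the support \<open>S\<close> of \<open>m\<close>, the
  equation becomes one between entire functions and spreads from the image of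
  \<open>zmap z 0\<close>.\<close>

lemma g_dlog:
  assumes nz: "\<And>i. m i > 0 \<Longrightarrow> v $ i \<noteq> 0"
  shows "g v *v (\<chi> i. - of_nat (m i) / v $ i) = (\<chi> r. thc r * v $ r)"
proof -
  define S where "S = {i. m i > 0}"
  define h where "h = (\<lambda>k v. (\<Sum>i\<in>UNIV. g v $ k $ i * (- of_nat (m i) * (\<Prod>q\<in>S - {i}. v $ q))) - thc k * v $ k * (\<Prod>q\<in>S. v $ q))"
  have h: "h k v = (\<Prod>q\<in>S. v $ q) * ((\<Sum>i\<in>UNIV. g v $ k $ i * (- of_nat (m i) / v $ i)) - thc k * v $ k)"
    if "\<And>i. m i > 0 \<Longrightarrow> v $ i \<noteq> 0" for k v
  proof -
    have "of_nat (m i) * (\<Prod>q\<in>S - {i}. v $ q) = (\<Prod>q\<in>S. v $ q) * (of_nat (m i) / v $ i)" for i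
    proof (cases "m i > 0")
      case True
      then have "(\<Prod>q\<in>S. v $ q) = v $ i * (\<Prod>q\<in>S - {i}. v $ q)" by (subst prod.remove[of S i]) (auto simp: S_def)
      then show ?thesis using that[OF True] by simp
    qed simp
    then have "(\<Sum>i\<in>UNIV. g v $ k $ i * (- of_nat (m i) * (\<Prod>q\<in>S - {i}. v $ q))) = (\<Sum>i\<in>UNIV. (\<Prod>q\<in>S. v $ q) * (g v $ k $ i * (- of_nat (m i) / v $ i)))"
      by (intro sum.cong refl) simp
    then show ?thesis by (simp add: h_def right_diff_distrib sum_distrib_left mult_ac)
  qed
  have "h k v = 0" for k
  proof (rule eq_0_zmap[where l = 0])
    show "entire (h k)"
      unfolding h_def g_metric_def G_nth by (intro entireI cdiff_intros entire_cdiff[OF entire_eval_z])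
    fix x
    have "\<And>i. m i > 0 \<Longrightarrow> zmap z 0 x $ i \<noteq> 0" by (simp add: zmap0_S)
    then show "h k (zmap z 0 x) = 0" by (subst h, blast, simp only: g_dlog_zmap0 diff_self mult_zero_right)
  qed
  moreover have "(\<Prod>q\<in>S. v $ q) \<noteq> 0" using nz by (simp add: S_def)
  ultimately have "(\<Sum>i\<in>UNIV. g v $ k $ i * (- of_nat (m i) / v $ i)) = thc k * v $ k" for k
    using h[of v k, OF nz] by simp
  then show ?thesis by (simp add: vec_eq_iff matrix_vector_mult_def)
qed

definition "v1 = (SOME v. det (\<eta> v) \<noteq> 0)"

lemma det_v1: "det (\<eta> v1) \<noteq> 0"
proof -
  have "closure {v. det (\<eta> v) \<noteq> 0} = UNIV" using pencil_gen unfolding pencil_generators_def by (elim conjE)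
  then show ?thesis unfolding v1_def by (rule_tac someI_ex) (rule ccontr, simp)
qed

sublocale flat_pencil g \<eta> \<Gamma>0 \<Gamma>1 "\<lambda>r. thc r" "kc" m "zmap z 0 (x0 0)" v1
proof (rule flat_pencil.intro)
  show "flat_pair (\<lambda>v. \<chi> i j. g v $ i $ j + l * \<eta> v $ i $ j) (\<lambda>i j k v. \<Gamma>0 i j k v + l * \<Gamma>1 i j k v)" for l
  proof -
    interpret p: pullback "zmap z l" acc "G l" "\<lambda>i j k. eval_z (Q i j k) l" "x0 l" by (rule pullback)
    have "(\<lambda>v. \<chi> i j. g v $ i $ j + l * \<eta> v $ i $ j) = G l" by (rule ext) (rule G_eq[symmetric])
    moreover have "(\<lambda>i j k v. \<Gamma>0 i j k v + l * \<Gamma>1 i j k v) = (\<lambda>i j k. eval_z (Q i j k) l)" by (intro ext) (rule \<Gamma>_eq[symmetric])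
    moreover have "flat_pair (G l) (\<lambda>i j k. eval_z (Q i j k) l)" by unfold_locales
    ultimately show ?thesis by simp
  qed
  have e: "cdiff (\<lambda>v. g v $ i $ j) v" "cdiff (\<lambda>v. \<eta> v $ i $ j) v" "cdiff (\<Gamma>0 i j k) v" for i j k v
    unfolding g_metric_def G_nth \<eta>_nth \<Gamma>0_def by (rule entire_cdiff[OF entire_eval_z] cdiff_lin_coeff)+
  show "dird (\<chi> r. thc r * v $ r) (\<lambda>v. g v $ i $ j) v = (thc i + thc j) * g v $ i $ j" for i j v
    by (rule homogeneous_dird[OF e(1)]) (rule g_scl[unfolded scl_def])
  show "dird (\<chi> r. thc r * v $ r) (\<lambda>v. \<eta> v $ i $ j) v = (thc i + thc j - kc) * \<eta> v $ i $ j" for i j v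
    by (rule homogeneous_dird[OF e(2)]) (rule \<eta>_scl[unfolded scl_def])
  show "dird (\<chi> r. thc r * v $ r) (\<Gamma>0 i j k) v = (thc i + thc j - thc k) * \<Gamma>0 i j k v" for i j k v
    by (rule homogeneous_dird[OF e(3)]) (rule \<Gamma>0_scl[unfolded scl_def])
  show "kc \<noteq> 0" using kappa_props(1) by simp
  show "g v *v (\<chi> i. - of_nat (m i) / v $ i) = (\<chi> r. thc r * v $ r)" if "\<And>i. m i > 0 \<Longrightarrow> v $ i \<noteq> 0" for v
    by (rule g_dlog) (rule that)
  show "det (g (zmap z 0 (x0 0))) \<noteq> 0"
  proof -
    interpret p: pullback "zmap z 0" acc "G 0" "\<lambda>i j k. eval_z (Q i j k) 0" "x0 0" by (rule pullback)
    show ?thesis using p.det_G_F[OF p.x0] by (simp add: g_metric_def)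
  qed
  show "det (\<eta> v1) \<noteq> 0" by (rule det_v1)
qed

end

section \<open>Flat coordinates on the universal cover\<close>

lemma det_eq_0_left_kernel:
  fixes A :: "complex^'n::finite^'n"
  assumes "det A = 0"
  obtains c where "c \<noteq> 0" "c v* A = 0"
proof -
  have "\<nexists>B. B ** transpose A = mat 1"
    using assms invertible_det_nz[of "transpose A"] by (auto simp: invertible_left_inverse)
  then obtain c where "c \<noteq> 0" "transpose A *v c = 0" unfolding matrix_left_invertible_ker by blast
  then show thesis using that[of c] by simp
qed

text \<open>Constant loops at two points are freely homotopic in a simply connected set, and the
  track of the base point is a path between them.\<close>

lemma simply_connected_imp_connected':
  fixes S :: "'a::topological_space set"
  assumes "simply_connected S"
  shows "connected S"
proof -
  have "path_component S a b" if "a \<in> S" "b \<in> S" for a b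
  proof -
    have "homotopic_loops S (\<lambda>_. a) (\<lambda>_. b)"
      using assms that unfolding simply_connected_def
      by (elim allE impE) (auto simp: path_def pathstart_def pathfinish_def path_image_def)
    from homotopic_loops_imp_path_component_value[OF this, of 0] show ?thesis by simp
  qed
  then have "path_connected S" by (simp add: path_connected_component)
  then show ?thesis by (rule path_connected_imp_connected)
qed

locale flat_cover = flat_pencil g \<eta> \<Gamma>0 \<Gamma>1 \<theta> \<kappa> m v0 v1
  for g \<eta> :: "complex^'n::finite \<Rightarrow> complex^'n^'n" and \<Gamma>0 \<Gamma>1 \<theta> \<kappa> m v0 v1 +
  fixes C :: "'w::topological_space set" and p :: "'w \<Rightarrow> complex^'n" and t :: "'n \<Rightarrow> 'w \<Rightarrow> complex" and d :: "'n \<Rightarrow> complex"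
  assumes cover: "covering_space C p {v. det (\<eta> v) \<noteq> 0}" and connected: "connected C"
    and basis: "flat_eigenbasis C p \<eta> E t d"
begin

lemma section_nonzero: "local_section C p V s \<Longrightarrow> v \<in> V \<Longrightarrow> det (\<eta> v) \<noteq> 0"
proof -
  assume "local_section C p V s" "v \<in> V"
  then have "s v \<in> C" "p (s v) = v" unfolding local_section_def by auto
  then have "v \<in> p ` C" by force
  then show "det (\<eta> v) \<noteq> 0" by (simp add: covering_space_imp_surjective[OF cover])
qed

text \<open>Domains are shrunk to balls because uniqueness for linear systems is proved on convex
  sets; openness of the image serves the connectedness argument on the cover.\<close>

lemma section_through:
  assumes w: "w \<in> C"
  obtains V s where "local_section C p V s" "p w \<in> V" "convex V" "s (p w) = w" "openin (top_of_set C) (s ` V)"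
proof -
  obtain T u q where T: "w \<in> T" "openin (top_of_set C) T" "p w \<in> u" "openin (top_of_set {v. det (\<eta> v) \<noteq> 0}) u" "homeomorphism T u p q"
    by (rule covering_space_local_homeomorphism[OF cover w])
  have "open u" using T(4) open_\<eta> by (rule openin_open_trans)
  then obtain e where e: "e > 0" "ball (p w) e \<subseteq> u" using T(3) open_contains_ball by blast
  have s: "local_section C p (ball (p w) e) q"
    unfolding local_section_def
  proof (intro conjI ballI)
    show "continuous_on (ball (p w) e) q" using T(5) e(2) by (meson continuous_on_subset homeomorphism_cont2)
    show "q ` ball (p w) e \<subseteq> C" using homeomorphism_image2[OF T(5)] e(2) openin_imp_subset[OF T(2)] by blast
    show "p (q v) = v" if "v \<in> ball (p w) e" for v using homeomorphism_apply2[OF T(5)] e(2) that by blast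
  qed simp
  have "openin (top_of_set T) (q ` ball (p w) e)"
  proof (rule homeomorphism_imp_open_map[OF homeomorphism_symD[OF T(5)]])
    show "openin (top_of_set u) (ball (p w) e)" using e(2) by (intro open_subset) auto
  qed
  then have "openin (top_of_set C) (q ` ball (p w) e)" using T(2) openin_trans by blast
  then show thesis using that[OF s] e(1) T(1) homeomorphism_apply1[OF T(5)] by simp
qed

text \<open>Near a common value both sections stay in a sheet on which \<open>p\<close> is
  injective.\<close>

lemma sections_agree:
  assumes s: "local_section C p V s" "local_section C p V' s'" and v: "v \<in> V" "v \<in> V'" "s v = s' v"
  shows "eventually (\<lambda>u. s u = s' u) (nhds v)"
proof -
  have "s v \<in> C" using s v unfolding local_section_def by blast
  then obtain T u q where T: "s v \<in> T" "openin (top_of_set C) T" "homeomorphism T u p q"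
    by (rule covering_space_local_homeomorphism[OF cover])
  have 1: "\<exists>U. open U \<and> v \<in> U \<and> U \<subseteq> V \<and> s ` U \<subseteq> T" if "local_section C p V s" "v \<in> V" "s v \<in> T" for V s
  proof -
    have "openin (top_of_set V) (V \<inter> s -` T)"
      using that(1) T(2) by (intro continuous_openin_preimage[of V s C]) (auto simp: local_section_def)
    then have "open (V \<inter> s -` T)" using that(1) by (auto simp: local_section_def intro: openin_open_trans)
    then show ?thesis using that(2,3) by (intro exI[of _ "V \<inter> s -` T"]) auto
  qed
  obtain U U' where U: "open U" "v \<in> U" "U \<subseteq> V" "s ` U \<subseteq> T" "open U'" "v \<in> U'" "U' \<subseteq> V'" "s' ` U' \<subseteq> T"
    using 1[OF s(1) v(1)] 1[OF s(2) v(2)] T(1) v(3) by metis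
  have "s x = s' x" if "x \<in> U \<inter> U'" for x
  proof -
    have "x \<in> V" "x \<in> V'" using U that by auto
    then have "p (s x) = p (s' x)" using s unfolding local_section_def by metis
    moreover have "s x \<in> T" "s' x \<in> T" using U that by auto
    ultimately show ?thesis using homeomorphism_apply1[OF T(3)] by metis
  qed
  then show ?thesis unfolding eventually_nhds using U by (intro exI[of _ "U \<inter> U'"]) auto
qed

lemma flat_section: "local_section C p V s \<Longrightarrow> flat_fun V (\<lambda>v. t a (s v))"
proof -
  assume s: "local_section C p V s"
  have "t a \<in> flat_functions C p \<eta>" using basis unfolding flat_eigenbasis_def by (elim conjE allE)
  then show ?thesis using s unfolding flat_functions_def flat_fun_def comp_def mem_Collect_eq by (elim allE impE)
qed

lemma cdiff_section:
  assumes "local_section C p V s" "v \<in> V"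
  shows "cdiff (\<lambda>v. t a (s v)) v" and "cdiff (pd i (\<lambda>v. t a (s v))) v"
proof -
  have "mholomorphic_on V (\<lambda>v. t a (s v))" using flat_section[OF assms(1)] unfolding flat_fun_def by blast
  moreover have "open V" using assms(1) unfolding local_section_def by blast
  ultimately show "cdiff (\<lambda>v. t a (s v)) v" "cdiff (pd i (\<lambda>v. t a (s v))) v"
    using mholomorphic_on_cdiff[OF _ assms(2)] mholomorphic_on_pd by blast+
qed

text \<open>The partial derivatives of a combination of flat functions solve a linear first-order
  system with Christoffel symbols as coefficients. By \<open>linear_system_zero\<close>, a critical
  point makes them vanish on the whole convex domain.\<close>

lemma constant_on_section:
  assumes s: "local_section C p V s" and V: "convex V"
    and v: "v \<in> V" "\<And>j. (\<Sum>a\<in>UNIV. c a * pd j (\<lambda>v. t a (s v)) v) = 0" and w: "w \<in> V"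
  shows "(\<Sum>a\<in>UNIV. c a * pd j (\<lambda>v. t a (s v)) w) = 0"
    and "(\<Sum>a\<in>UNIV. c a * t a (s w)) = (\<Sum>a\<in>UNIV. c a * t a (s v))"
proof -
  have op: "open V" using s unfolding local_section_def by blast
  note cd = cdiff_section[OF s]
  let ?f = "\<lambda>j v. \<Sum>a\<in>UNIV. c a * pd j (\<lambda>v. t a (s v)) v"
  have f: "pd j (\<lambda>v. \<Sum>a\<in>UNIV. c a * t a (s v)) u = ?f j u" if "u \<in> V" for u j
    by (simp add: pd_sum pd_mult cdiff_intros cd[OF that] pd_const)
  have eq: "pd i (?f j) u = (\<Sum>k\<in>UNIV. christoffel pd (\<lambda>u. matrix_inv (\<eta> u)) k i j u * ?f k u)" if u: "u \<in> V" for i j u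
  proof -
    have "pd i (?f j) u = (\<Sum>a\<in>UNIV. c a * pd i (pd j (\<lambda>v. t a (s v))) u)"
      by (simp add: pd_sum pd_mult cdiff_intros cd[OF u] pd_const)
    also have "\<dots> = (\<Sum>a\<in>UNIV. c a * (\<Sum>k\<in>UNIV. christoffel pd (\<lambda>u. matrix_inv (\<eta> u)) k i j u * pd k (\<lambda>v. t a (s v)) u))"
      using flat_section[OF s] u unfolding flat_fun_def by simp
    also have "\<dots> = (\<Sum>k\<in>UNIV. christoffel pd (\<lambda>u. matrix_inv (\<eta> u)) k i j u * ?f k u)"
      by (simp add: sum_distrib_left mult_ac) (rule sum.swap)
    finally show ?thesis .
  qed
  have hol: "mholomorphic_on V (?f j)" for j
    unfolding mholomorphic_on_iff_cdiff by (intro ballI cdiff_intros cd)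
  have A: "continuous_on V (\<lambda>u. christoffel pd (\<lambda>u. matrix_inv (\<eta> u)) k i j u)" for i j k
    by (rule continuous_on_mholomorphic)
      (unfold mholomorphic_on_iff_cdiff, intro ballI cdiff_christoffel section_nonzero[OF s])
  have z: "?f j u = 0" if "u \<in> V" for j u
    by (rule linear_system_zero[OF op V, where f = ?f and A = "\<lambda>i j k. christoffel pd (\<lambda>u. matrix_inv (\<eta> u)) k i j" and v = v])
      (use hol A eq v that in auto)
  then show "?f j w = 0" using w .
  show "(\<Sum>a\<in>UNIV. c a * t a (s w)) = (\<Sum>a\<in>UNIV. c a * t a (s v))"
  proof (rule mholomorphic_const_on_convex[OF op V])
    show "mholomorphic_on V (\<lambda>w. \<Sum>a\<in>UNIV. c a * t a (s w))"
      unfolding mholomorphic_on_iff_cdiff by (intro ballI cdiff_intros cd)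
    show "pd i (\<lambda>w. \<Sum>a\<in>UNIV. c a * t a (s w)) u = 0" if "u \<in> V" for i u
      using f[OF that] z[OF that] by simp
  qed (use v w in auto)
qed

text \<open>A singular Jacobian gives a combination of the \<open>t a\<close> with a critical point.
  Constancy then propagates from section to section over the connected cover and contradicts
  independence modulo constants.\<close>

lemma det_section:
  assumes s: "local_section C p V s" and v: "v \<in> V"
  shows "det (\<chi> a i. pd i (\<lambda>v. t a (s v)) v) \<noteq> 0"
proof
  assume "det (\<chi> a i. pd i (\<lambda>v. t a (s v)) v) = 0"
  then obtain c where c: "c \<noteq> 0" "c v* (\<chi> a i. pd i (\<lambda>v. t a (s v)) v) = 0" by (rule det_eq_0_left_kernel)
  have c0: "(\<Sum>a\<in>UNIV. c $ a * pd j (\<lambda>v. t a (s v)) v) = 0" for j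
    using c(2) by (simp add: vec_eq_iff vector_matrix_nth mult.commute)
  define F where "F w = (\<Sum>a\<in>UNIV. c $ a * t a w)" for w
  \<comment> \<open>Criticality is expressed through some section; the choice is immaterial, since
    by \<open>sections_agree\<close> two sections through \<open>w\<close> coincide near its
    projection.\<close>
  define crit where "crit w \<longleftrightarrow> (\<exists>V s. local_section C p V s \<and> p w \<in> V \<and> s (p w) = w \<and>
    (\<forall>j. (\<Sum>a\<in>UNIV. c $ a * pd j (\<lambda>v. t a (s v)) (p w)) = 0))" for w
  have sv: "s v \<in> C" "p (s v) = v" using s v unfolding local_section_def by auto
  have "F w = F (s v) \<and> crit w" if w: "w \<in> C" for w
  proof (rule connected_induction_simple[OF connected sv(1) w])
    show "F (s v) = F (s v) \<and> crit (s v)" unfolding crit_def using s v c0 sv(2) by auto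
    fix w assume "w \<in> C"
    then obtain V' s' where s': "local_section C p V' s'" "p w \<in> V'" "convex V'" "s' (p w) = w" "openin (top_of_set C) (s' ` V')"
      by (rule section_through)
    have step: "F y = F (s v) \<and> crit y" if x: "x \<in> s' ` V'" "F x = F (s v)" "crit x" and y: "y \<in> s' ` V'" for x y
    proof -
      obtain a b where ab: "a \<in> V'" "x = s' a" "b \<in> V'" "y = s' b" using x(1) y by blast
      then have pab: "p x = a" "p y = b" using s'(1) unfolding local_section_def by auto
      obtain V'' s'' where s'': "local_section C p V'' s''" "a \<in> V''" "s'' a = x"
        "\<And>j. (\<Sum>e\<in>UNIV. c $ e * pd j (\<lambda>v. t e (s'' v)) a) = 0"
        using x(3) unfolding crit_def pab by blast
      have "eventually (\<lambda>u. s'' u = s' u) (nhds a)"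
        by (rule sections_agree[OF s''(1) s'(1) s''(2) ab(1)]) (simp add: s''(3) ab(2))
      then have "eventually (\<lambda>u. t e (s'' u) = t e (s' u)) (nhds a)" for e by (rule eventually_mono) simp
      then have "pd j (\<lambda>v. t e (s'' v)) a = pd j (\<lambda>v. t e (s' v)) a" for e j by (rule eventually_cong_pd(1))
      then have a0: "(\<Sum>e\<in>UNIV. c $ e * pd j (\<lambda>v. t e (s' v)) a) = 0" for j using s''(4)[of j] by simp
      note b0 = constant_on_section[OF s'(1,3) ab(1) a0 ab(3)]
      have "F y = F x" unfolding F_def ab(2,4) by (rule b0(2))
      moreover have "crit y" unfolding crit_def pab using s'(1) ab b0(1) by blast
      ultimately show ?thesis using x(2) by simp
    qed
    show "\<exists>T. openin (top_of_set C) T \<and> w \<in> T \<and> (\<forall>x\<in>T. \<forall>y\<in>T. (F x = F (s v) \<and> crit x) \<longrightarrow> (F y = F (s v) \<and> crit y))"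
    proof (intro exI[of _ "s' ` V'"] conjI ballI impI)
      show "openin (top_of_set C) (s' ` V')" by (rule s'(5))
      show "w \<in> s' ` V'" using imageI[OF s'(2), of s'] by (simp only: s'(4))
    qed (use step in blast)+
  qed
  then have "\<forall>w\<in>C. (\<Sum>a\<in>UNIV. c $ a * t a w) = F (s v)" by (simp add: F_def)
  then have "\<forall>a. c $ a = 0" using basis unfolding flat_eigenbasis_def by blast
  then show False using c(1) by (simp add: vec_eq_iff)
qed

definition "K0 a = (SOME K. (d a \<noteq> 0 \<longrightarrow> K = 0) \<and> (\<forall>V s. local_section C p V s \<longrightarrow>
           (\<forall>v\<in>V. dird (E v) (t a \<circ> s) v = d a * t a (s v) + K)))"

lemma K0: "d a \<noteq> 0 \<Longrightarrow> K0 a = 0" "local_section C p V s \<Longrightarrow> v \<in> V \<Longrightarrow> dird (E v) (\<lambda>v. t a (s v)) v = d a * t a (s v) + K0 a"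
proof -
  have "(d a \<noteq> 0 \<longrightarrow> K0 a = 0) \<and> (\<forall>V s. local_section C p V s \<longrightarrow>
           (\<forall>v\<in>V. dird (E v) (t a \<circ> s) v = d a * t a (s v) + K0 a))"
    unfolding K0_def
  proof (rule someI_ex)
    show "\<exists>K. (d a \<noteq> 0 \<longrightarrow> K = 0) \<and> (\<forall>V s. local_section C p V s \<longrightarrow> (\<forall>v\<in>V. dird (E v) (t a \<circ> s) v = d a * t a (s v) + K))"
      using basis unfolding flat_eigenbasis_def by (elim conjE allE)
  qed
  then have K: "d a \<noteq> 0 \<longrightarrow> K0 a = 0" "\<forall>V s. local_section C p V s \<longrightarrow> (\<forall>v\<in>V. dird (E v) (\<lambda>v. t a (s v)) v = d a * t a (s v) + K0 a)"
    unfolding comp_def by (rule conjunct1, rule conjunct2)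
  show "d a \<noteq> 0 \<Longrightarrow> K0 a = 0" using K(1) by (rule mp)
  assume s: "local_section C p V s" "v \<in> V"
  show "dird (E v) (\<lambda>v. t a (s v)) v = d a * t a (s v) + K0 a"
    by (rule K(2)[rule_format, OF s])
qed

lemma flat_frame:
  assumes "local_section C p V s"
  shows "flat_frame g \<eta> \<Gamma>0 \<Gamma>1 \<theta> \<kappa> m v0 v1 V (\<lambda>a v. t a (s v)) d K0"
  by unfold_locales
    (use assms section_nonzero flat_section K0(2) det_section in \<open>auto simp: local_section_def\<close>)

lemma frame_at:
  assumes "det (\<eta> v) \<noteq> 0"
  obtains V s where "local_section C p V s" "v \<in> V" "convex V"
proof -
  have "v \<in> p ` C" using assms by (simp add: covering_space_imp_surjective[OF cover])
  then obtain w where w: "w \<in> C" "p w = v" by blast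
  obtain V s where "local_section C p V s" "p w \<in> V" "convex V" by (rule section_through[OF w(1)])
  then show thesis using that w(2) by blast
qed

end

section \<open>Flat coordinates of degree zero\<close>

context flat_frame
begin

text \<open>With the diagonal matrix of degrees, \<open>H_deg\<close> is a matrix equation;
  multiplying it by the inverse of \<open>H\<close> from both sides gives the same relation for the
  inverse.\<close>

lemma inv_H_deg:
  assumes v: "v \<in> V"
  shows "(d a + d e - \<kappa>) * matrix_inv (H v) $ a $ e = 0"
proof -
  let ?Hi = "matrix_inv (H v)"
  have "diagm d ** H v + H v ** diagm d = diagm (\<lambda>_. \<kappa>) ** H v"
  proof -
    have "d a * H v $ a $ e + H v $ a $ e * d e = \<kappa> * H v $ a $ e" for a e
      using H_deg[OF v, of a e] by (simp add: algebra_simps)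
    then show ?thesis by (simp add: vec_eq_iff diagm_mult mult_diagm)
  qed
  then have "?Hi ** (diagm d ** H v + H v ** diagm d) ** ?Hi = ?Hi ** (diagm (\<lambda>_. \<kappa>) ** H v) ** ?Hi" by simp
  then have "?Hi ** diagm d ** (H v ** ?Hi) + (?Hi ** H v) ** diagm d ** ?Hi = ?Hi ** diagm (\<lambda>_. \<kappa>) ** (H v ** ?Hi)"
    by (simp only: matrix_add_ldistrib matrix_add_rdistrib matrix_mul_assoc)
  then have "?Hi ** diagm d + diagm d ** ?Hi = ?Hi ** diagm (\<lambda>_. \<kappa>)"
    by (simp add: matrix_inv_det[OF det_H[OF v]])
  then have "(?Hi ** diagm d + diagm d ** ?Hi) $ a $ e = (?Hi ** diagm (\<lambda>_. \<kappa>)) $ a $ e" by simp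
  then show ?thesis by (simp add: diagm_mult mult_diagm algebra_simps)
qed

text \<open>
  \<open>H\<close> and its inverse pair degree \<open>d\<close> with degree \<open>\<kappa> - d\<close>, while \<open>J R \<eta> J\<^sup>T\<close> is symmetric and lives in degree \<open>0\<close>.
\<close>

lemma R_square_zero:
  assumes v: "v \<in> V" and d0: "d c = 0"
  shows "R (f c) v ** R (f c) v = 0"
proof -
  let ?R = "R (f c) v" and ?J = "J v" and ?Hi = "matrix_inv (H v)"
  define N where "N = ?J ** (?R ** \<eta> v) ** transpose ?J"
  have "transpose N = N"
    unfolding N_def using R_\<eta>_sym[OF open_V flat_f v V_\<eta>[OF v]] by (simp add: matrix_transpose_mul matrix_mul_assoc)
  then have N_sym: "N $ a $ e = N $ e $ a" for a e by (rule symmetric_nth)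
  \<comment> \<open>With d_c = 0, \<open>JR_symmetric\<close> leaves d_e times this row equal to
    zero. Symmetry then confines \<open>N\<close> to the block of degree zero, on which the inverse
    of \<open>H\<close> vanishes because \<kappa> is nonzero.\<close>
  have "?J $ e v* ?R = 0" if "d e \<noteq> 0" for e
    using JR_symmetric[OF v, of c e] d0 that by (simp add: vec_eq_iff)
  then have "N $ e = 0" if "d e \<noteq> 0" for e
    using that unfolding N_def by (simp add: matrix_mul_assoc row_mult)
  then have N0: "N $ a $ e = 0" if "d a \<noteq> 0 \<or> d e \<noteq> 0" for a e
    using that N_sym[of a e] by (auto simp: vec_eq_iff)
  have Hi0: "?Hi $ a $ e = 0" if "d a = 0" "d e = 0" for a e
    using inv_H_deg[OF v, of a e] that \<kappa> by simp
  have "N $ a $ e * ?Hi $ e $ n * N $ n $ k = 0" for a e n k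
    using N0[of a e] N0[of n k] Hi0[of e n] by (cases "d e = 0"; cases "d n = 0") auto
  then have "(\<Sum>n\<in>UNIV. \<Sum>e\<in>UNIV. N $ a $ e * ?Hi $ e $ n * N $ n $ k) = 0" for a k by (simp only: sum.neutral_const)
  then have NHN: "N ** ?Hi ** N = 0"
    by (simp add: vec_eq_iff matrix_mult_nth sum_distrib_right)
  have "?J ** (\<eta> v ** transpose ?J ** ?Hi) = mat 1"
    using matrix_inv_det(1)[OF det_H[OF v]] by (simp add: H_def matrix_mul_assoc)
  then have "(\<eta> v ** transpose ?J ** ?Hi) ** ?J = mat 1" by (simp only: matrix_left_right_inverse)
  moreover have "N ** ?Hi ** ?J = (?J ** ?R) ** ((\<eta> v ** transpose ?J ** ?Hi) ** ?J)"
    unfolding N_def by (simp only: matrix_mul_assoc)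
  ultimately have JR: "N ** ?Hi ** ?J = ?J ** ?R" by (simp only: matrix_mul_rid)
  have "?J ** (?R ** ?R) = (?J ** ?R) ** ?R" by (rule matrix_mul_assoc)
  also have "\<dots> = (N ** ?Hi ** ?J) ** ?R" by (simp only: JR)
  also have "\<dots> = N ** ?Hi ** (?J ** ?R)" by (simp only: matrix_mul_assoc)
  also have "\<dots> = N ** ?Hi ** (N ** ?Hi ** ?J)" by (simp only: JR)
  also have "\<dots> = (N ** ?Hi ** N) ** ?Hi ** ?J" by (simp only: matrix_mul_assoc)
  also have "\<dots> = 0" unfolding NHN by (simp add: vec_eq_iff matrix_mult_nth)
  finally have "matrix_inv ?J ** (?J ** (?R ** ?R)) = 0" by (simp add: vec_eq_iff matrix_mult_nth)
  then show ?thesis by (simp add: matrix_mul_assoc matrix_inv_det[OF det_J[OF v]])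
qed

end

section \<open>Solutions of the eikonal equation vanishing on a non-characteristic hyperplane\<close>

lemma higher_deriv_sum:
  fixes z :: complex
  assumes "finite A" "\<And>j. j \<in> A \<Longrightarrow> f j holomorphic_on S" "open S" "z \<in> S"
  shows "(deriv ^^ n) (\<lambda>w. \<Sum>j\<in>A. f j w) z = (\<Sum>j\<in>A. (deriv ^^ n) (f j) z)"
  using assms(1,2)
proof (induction A rule: finite_induct)
  case (insert a A)
  have "(deriv ^^ n) (\<lambda>w. f a w + (\<Sum>j\<in>A. f j w)) z = (deriv ^^ n) (f a) z + (deriv ^^ n) (\<lambda>w. \<Sum>j\<in>A. f j w) z"
    by (rule higher_deriv_add[of _ S]) (use insert.prems assms(3,4) in \<open>auto intro!: holomorphic_intros\<close>)
  then show ?case using insert by simp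
next
  case empty
  have "(deriv ^^ n) (\<lambda>w::complex. 0) = (\<lambda>w. 0)" by (induction n) auto
  then show ?case by simp
qed

text \<open>If \<open>q\<close> vanishes to order \<open>r\<close>, the derivative of order
  \<open>2 * r\<close> of its square is a binomial coefficient times the square of its r-th
  derivative. The products on the right vanish to order \<open>2 * r + 2\<close>.\<close>

lemma square_vanishing_order:
  fixes q :: "complex \<Rightarrow> complex" and b :: "'n::finite \<Rightarrow> complex \<Rightarrow> complex"
  assumes S: "open S" "z \<in> S" and q: "q holomorphic_on S" and b: "\<And>j. b j holomorphic_on S"
    and eq: "\<And>s. s \<in> S \<Longrightarrow> q s * q s = (\<Sum>j\<in>UNIV. \<Sum>l\<in>UNIV. \<beta> j l * (b j s * b l s))"
    and b0: "\<And>j k. k \<le> r \<Longrightarrow> (deriv ^^ k) (b j) z = 0"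
    and q0: "\<And>k. k < r \<Longrightarrow> (deriv ^^ k) q z = 0"
  shows "(deriv ^^ r) q z = 0"
proof -
  have bb: "(deriv ^^ (2 * r)) (\<lambda>s. \<beta> j l * (b j s * b l s)) z = 0" for j l
  proof -
    have "(deriv ^^ (2 * r)) (\<lambda>s. b j s * b l s) z = (\<Sum>k = 0..2 * r. of_nat (2 * r choose k) * (deriv ^^ k) (b j) z * (deriv ^^ (2 * r - k)) (b l) z)"
      by (rule higher_deriv_mult[OF b b S])
    also have "\<dots> = 0"
    proof (rule sum.neutral, rule ballI)
      fix k
      show "of_nat (2 * r choose k) * (deriv ^^ k) (b j) z * (deriv ^^ (2 * r - k)) (b l) z = 0"
        using b0[of k j] b0[of "2 * r - k" l] by (cases "k \<le> r") auto
    qed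
    moreover have "(deriv ^^ (2 * r)) (\<lambda>s. \<beta> j l * (b j s * b l s)) z = \<beta> j l * (deriv ^^ (2 * r)) (\<lambda>s. b j s * b l s) z"
      by (rule higher_deriv_cmult[of _ S]) (use b S in \<open>auto intro!: holomorphic_intros\<close>)
    ultimately show ?thesis by simp
  qed
  have "(deriv ^^ (2 * r)) (\<lambda>s. q s * q s) z = (deriv ^^ (2 * r)) (\<lambda>s. \<Sum>j\<in>UNIV. \<Sum>l\<in>UNIV. \<beta> j l * (b j s * b l s)) z"
    by (rule higher_deriv_transform_within_open[of _ S]) (use q b S eq in \<open>auto intro!: holomorphic_intros\<close>)
  also have "\<dots> = (\<Sum>j\<in>UNIV. (deriv ^^ (2 * r)) (\<lambda>s. \<Sum>l\<in>UNIV. \<beta> j l * (b j s * b l s)) z)"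
    by (rule higher_deriv_sum[of _ _ S]) (use b S in \<open>auto intro!: holomorphic_intros\<close>)
  also have "\<dots> = (\<Sum>j\<in>UNIV. \<Sum>l\<in>UNIV. (deriv ^^ (2 * r)) (\<lambda>s. \<beta> j l * (b j s * b l s)) z)"
    by (intro sum.cong refl higher_deriv_sum[of _ _ S]) (use b S in \<open>auto intro!: holomorphic_intros\<close>)
  finally have "(deriv ^^ (2 * r)) (\<lambda>s. q s * q s) z = 0" by (simp only: bb sum.neutral_const)
  moreover have "(deriv ^^ (2 * r)) (\<lambda>s. q s * q s) z = (\<Sum>k = 0..2 * r. of_nat (2 * r choose k) * (deriv ^^ k) q z * (deriv ^^ (2 * r - k)) q z)"
    by (rule higher_deriv_mult[OF q q S])
  moreover have "\<dots> = (\<Sum>k\<in>{r}. of_nat (2 * r choose k) * (deriv ^^ k) q z * (deriv ^^ (2 * r - k)) q z)"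
  proof (rule sum.mono_neutral_right)
    show "\<forall>k\<in>{0..2 * r} - {r}. of_nat (2 * r choose k) * (deriv ^^ k) q z * (deriv ^^ (2 * r - k)) q z = 0"
    proof
      fix k assume "k \<in> {0..2 * r} - {r}"
      then have "k < r \<or> 2 * r - k < r" by auto
      then show "of_nat (2 * r choose k) * (deriv ^^ k) q z * (deriv ^^ (2 * r - k)) q z = 0"
        using q0[of k] q0[of "2 * r - k"] by auto
    qed
  qed auto
  ultimately have "of_nat (2 * r choose r) * ((deriv ^^ r) q z * (deriv ^^ r) q z) = 0" by (simp add: mult_2)
  moreover have "2 * r choose r \<noteq> 0" by (simp add: binomial_eq_0_iff)
  ultimately show ?thesis by simp
qed

lemma higher_deriv_line: "(deriv ^^ n) (\<lambda>s. f (y + s *s axis i 1)) = (\<lambda>s. (pd i ^^ n) f (y + s *s axis i 1))"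
proof (induction n)
  case (Suc n)
  have "deriv (\<lambda>s. g (y + s *s axis i 1)) s = pd i g (y + s *s axis i 1)" for g s
  proof -
    have ax: "y + s *s axis i 1 + axis i t = y + (s + t) *s axis i 1" for t
      using axis_scale[of i t] by (simp add: vector_sadd_rdistrib add.assoc)
    have "(\<lambda>t. g (y + s *s axis i 1 + axis i t)) = (\<lambda>s. g (y + s *s axis i 1)) \<circ> (\<lambda>t. s + t)"
      by (intro ext) (simp only: o_def ax)
    note E = this
    show ?thesis unfolding pd_def E by (rule deriv_shift_0)
  qed
  then show ?case by (simp add: Suc fun_eq_iff)
qed simp

lemma hol_pd_pow: "open B \<Longrightarrow> mholomorphic_on B f \<Longrightarrow> mholomorphic_on B ((pd i ^^ n) f)"
  by (induction n) (auto intro: mholomorphic_on_pd)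

lemma pd_pow_commute:
  assumes B: "open B" "mholomorphic_on B f" and x: "x \<in> B"
  shows "(pd i ^^ n) (pd j f) x = pd j ((pd i ^^ n) f) x"
  using x
proof (induction n arbitrary: x)
  case (Suc n)
  have "pd i ((pd i ^^ n) (pd j f)) x = pd i (pd j ((pd i ^^ n) f)) x"
    by (rule open_cong_pd(1)[OF B(1) Suc.prems]) (rule Suc.IH)
  also have "\<dots> = pd j (pd i ((pd i ^^ n) f)) x" by (rule pd_commute[OF B(1) hol_pd_pow[OF B] Suc.prems])
  finally show ?case by simp
qed simp

lemma holomorphic_line:
  assumes "mholomorphic_on B f"
  shows "(\<lambda>s. f (y + s *s u)) holomorphic_on {s. y + s *s u \<in> B}"
proof -
  have "(\<lambda>s. f (y + s *s u)) field_differentiable at s" if "y + s *s u \<in> B" for s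
    using has_field_derivative_line[OF mholomorphic_on_cdiff[OF assms that]] unfolding field_differentiable_def by blast
  then show ?thesis by (auto simp: holomorphic_on_def intro: field_differentiable_at_within)
qed

lemma line_preimage:
  fixes B :: "(complex^'n::finite) set"
  assumes "open B" "convex B"
  shows "open {s. y + s *s u \<in> B}" and "convex {s. y + s *s u \<in> B}"
proof -
  have "continuous_on UNIV (\<lambda>s. y + s *s u)"
    by (intro continuous_intros bounded_linear.continuous_on[OF bounded_linear_scale])
  then have "open ((\<lambda>s. y + s *s u) -` B)" using assms(1) by (rule open_vimage[rotated])
  then show "open {s. y + s *s u \<in> B}" by (simp add: vimage_def)
  show "convex {s. y + s *s u \<in> B}"
  proof (rule convexI)
    fix a b and p q :: real assume *: "a \<in> {s. y + s *s u \<in> B}" "b \<in> {s. y + s *s u \<in> B}" "0 \<le> p" "0 \<le> q" "p + q = 1"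
    then have "p *\<^sub>R (y + a *s u) + q *\<^sub>R (y + b *s u) \<in> B" using assms(2) by (auto dest: convexD)
    moreover have "p *\<^sub>R (y + a *s u) + q *\<^sub>R (y + b *s u) = y + (p *\<^sub>R a + q *\<^sub>R b) *s u"
    proof -
      have "p *\<^sub>R (y + a *s u) + q *\<^sub>R (y + b *s u) = (p + q) *\<^sub>R y + (p *\<^sub>R a + q *\<^sub>R b) *s u"
        by (simp add: vec_eq_iff algebra_simps)
      then show ?thesis using *(5) by simp
    qed
    ultimately show "p *\<^sub>R a + q *\<^sub>R b \<in> {s. y + s *s u \<in> B}" by simp
  qed
qed

text \<open>Since \<open>a\<close> maps \<open>c\<close> to a multiple of the i-th axis, that axis
  is normal to the hyperplane and the equation has no cross terms: the square of the normal
  derivative is a quadratic form in tangential ones (\<open>quad\<close>). By induction on the order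
  all normal derivatives vanish on the hyperplane: \<open>square_vanishing_order\<close> gains one
  order at each step, and analyticity along normal lines concludes.
  \<open>\<sigma> \<noteq> 0\<close> says that the hyperplane is not characteristic.\<close>

lemma eikonal_zero:
  fixes B :: "(complex^'n::finite) set" and c :: "complex^'n"
  assumes B: "open B" "convex B" and \<psi>: "mholomorphic_on B \<psi>"
    and wall: "\<And>x. x \<in> B \<Longrightarrow> (\<Sum>j\<in>UNIV. c $ j * x $ j) = k \<Longrightarrow> \<psi> x = 0"
    and eik: "\<And>x. x \<in> B \<Longrightarrow> (\<Sum>j\<in>UNIV. \<Sum>l\<in>UNIV. pd j \<psi> x * a $ j $ l * pd l \<psi> x) = 0"
    and a: "transpose a = a" "\<And>j. (\<Sum>l\<in>UNIV. a $ j $ l * c $ l) = (if j = i then \<sigma> else 0)" "\<sigma> \<noteq> 0" "c $ i = 1"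
    and x0: "x0 \<in> B" "(\<Sum>j\<in>UNIV. c $ j * x0 $ j) = k"
  shows "eventually (\<lambda>x. \<psi> x = 0) (nhds x0)"
proof -
  let ?e = "axis i 1 :: complex^'n"
  \<comment> \<open>The tangential part of the gradient: \<open>axis j 1 - c $ j *s axis i 1\<close>
    is tangent to the hyperplane because \<open>c $ i = 1\<close>.\<close>
  define D where "D = (\<lambda>j x. pd j \<psi> x - c $ j * pd i \<psi> x)"
  have hol: "mholomorphic_on B (pd j \<psi>)" for j by (rule mholomorphic_on_pd[OF B(1) \<psi>])
  have tangent: "pd j h y = c $ j * pd i h y"
    if h: "mholomorphic_on B h" "\<And>x. x \<in> B \<Longrightarrow> (\<Sum>j\<in>UNIV. c $ j * x $ j) = k \<Longrightarrow> h x = 0"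
      and y: "y \<in> B" "(\<Sum>j\<in>UNIV. c $ j * y $ j) = k" for h y j
  proof -
    define u where "u = axis j 1 - c $ j *s ?e"
    have "(\<Sum>j\<in>UNIV. c $ j * u $ j) = 0"
      using a(4) by (simp add: u_def axis_def right_diff_distrib sum_subtractf if_distrib[of "\<lambda>x. _ * x"] cong: if_cong)
    then have on: "(\<Sum>j\<in>UNIV. c $ j * (y + s *s u) $ j) = k" for s
      using y(2) by (simp add: distrib_left sum.distrib mult.left_commute[of _ s] sum_distrib_left[symmetric])
    have "((\<lambda>s. h (y + s *s u)) has_field_derivative dird u h (y + 0 *s u)) (at 0)"
      by (rule has_field_derivative_line) (use mholomorphic_on_cdiff[OF h(1)] y in simp)
    moreover have "((\<lambda>s. h (y + s *s u)) has_field_derivative 0) (at 0)"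
    proof (rule DERIV_cong_ev[THEN iffD2, OF refl _ refl])
      have "eventually (\<lambda>s. s \<in> {s. y + s *s u \<in> B}) (nhds 0)"
        by (rule eventually_nhds_in_open[OF line_preimage(1)[OF B]]) (simp add: y(1))
      then show "eventually (\<lambda>s. h (y + s *s u) = 0) (nhds 0)"
        by (rule eventually_mono) (use h(2) on in simp)
    qed (rule DERIV_const)
    ultimately have "dird u h y = 0" using DERIV_unique by fastforce
    then show ?thesis
      by (simp add: dird_expand u_def axis_def left_diff_distrib sum_subtractf if_distrib[of "\<lambda>x. x * _"] if_distrib[of "\<lambda>x. _ * x"] cong: if_cong)
  qed
  have quad: "pd i \<psi> x * pd i \<psi> x = (\<Sum>j\<in>UNIV. \<Sum>l\<in>UNIV. (- a $ j $ l / \<sigma>) * (D j x * D l x))" if x: "x \<in> B" for x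
  proof -
    let ?q = "pd i \<psi> x"
    have ac: "(\<Sum>j\<in>UNIV. a $ j $ l * c $ j) = (if l = i then \<sigma> else 0)" for l
      using a(2)[of l] symmetric_nth[OF a(1)] by simp
    have "0 = (\<Sum>j\<in>UNIV. \<Sum>l\<in>UNIV. (D j x + c $ j * ?q) * a $ j $ l * (D l x + c $ l * ?q))"
      using eik[OF x] by (simp add: D_def)
    also have "\<dots> = (\<Sum>j\<in>UNIV. \<Sum>l\<in>UNIV. a $ j $ l * (D j x * D l x)) + ?q * (\<Sum>j\<in>UNIV. D j x * (\<Sum>l\<in>UNIV. a $ j $ l * c $ l))
        + ?q * (\<Sum>j\<in>UNIV. \<Sum>l\<in>UNIV. a $ j $ l * c $ j * D l x) + ?q * ?q * (\<Sum>j\<in>UNIV. c $ j * (\<Sum>l\<in>UNIV. a $ j $ l * c $ l))"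
      by (simp add: sum_distrib_left sum.distrib[symmetric] algebra_simps)
    also have "(\<Sum>j\<in>UNIV. \<Sum>l\<in>UNIV. a $ j $ l * c $ j * D l x) = (\<Sum>l\<in>UNIV. (\<Sum>j\<in>UNIV. a $ j $ l * c $ j) * D l x)"
      by (subst sum.swap) (simp add: sum_distrib_right)
    also have "(\<Sum>j\<in>UNIV. D j x * (\<Sum>l\<in>UNIV. a $ j $ l * c $ l)) = \<sigma> * D i x"
      unfolding a(2) by (simp add: if_distrib[of "\<lambda>x. _ * x"] cong: if_cong)
    also have "(\<Sum>l\<in>UNIV. (\<Sum>j\<in>UNIV. a $ j $ l * c $ j) * D l x) = \<sigma> * D i x"
      unfolding ac by (simp add: if_distrib[of "\<lambda>x. x * _"] cong: if_cong)
    also have "(\<Sum>j\<in>UNIV. c $ j * (\<Sum>l\<in>UNIV. a $ j $ l * c $ l)) = \<sigma>"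
      unfolding a(2) using a(4) by (simp add: if_distrib[of "\<lambda>x. _ * x"] cong: if_cong)
    finally have "\<sigma> * (?q * ?q) = - (\<Sum>j\<in>UNIV. \<Sum>l\<in>UNIV. a $ j $ l * (D j x * D l x))"
      using a(4) by (simp add: D_def eq_neg_iff_add_eq_0 algebra_simps)
    then have "?q * ?q = - (\<Sum>j\<in>UNIV. \<Sum>l\<in>UNIV. a $ j $ l * (D j x * D l x)) / \<sigma>"
      using a(3) by (simp add: field_simps)
    then show ?thesis by (simp add: sum_negf[symmetric] sum_divide_distrib)
  qed
  have zero: "(pd i ^^ n) \<psi> y = 0" if "y \<in> B" "(\<Sum>j\<in>UNIV. c $ j * y $ j) = k" for n y
    using that
  proof (induction n arbitrary: y rule: less_induct)
    case (less n)
    show ?case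
    proof (cases n)
      case 0
      then show ?thesis using wall less.prems by simp
    next
      case (Suc r)
      define S where "S = {s. y + s *s ?e \<in> B}"
      have S: "open S" "0 \<in> S" unfolding S_def using line_preimage(1)[OF B] less.prems(1) by simp_all
      have hl: "(\<lambda>s. pd j \<psi> (y + s *s ?e)) holomorphic_on S" for j
        unfolding S_def by (rule holomorphic_line[OF hol])
      have dq: "(deriv ^^ k') (\<lambda>s. pd j \<psi> (y + s *s ?e)) 0 = pd j ((pd i ^^ k') \<psi>) y" for j k'
        unfolding higher_deriv_line using pd_pow_commute[OF B(1) \<psi> less.prems(1)] by simp
      have "(deriv ^^ r) (\<lambda>s. pd i \<psi> (y + s *s ?e)) 0 = 0"
      proof (rule square_vanishing_order[OF S hl])
        show "(\<lambda>s. D j (y + s *s ?e)) holomorphic_on S" for j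
          unfolding D_def by (intro holomorphic_intros hl)
        show "pd i \<psi> (y + s *s ?e) * pd i \<psi> (y + s *s ?e) = (\<Sum>j\<in>UNIV. \<Sum>l\<in>UNIV. (- a $ j $ l / \<sigma>) * (D j (y + s *s ?e) * D l (y + s *s ?e)))"
          if "s \<in> S" for s by (rule quad) (use that S_def in simp)
        show "(deriv ^^ k') (\<lambda>s. D j (y + s *s ?e)) 0 = 0" if k': "k' \<le> r" for j k'
        proof -
          have "(deriv ^^ k') (\<lambda>s. pd j \<psi> (y + s *s ?e) - c $ j * pd i \<psi> (y + s *s ?e)) 0
            = (deriv ^^ k') (\<lambda>s. pd j \<psi> (y + s *s ?e)) 0 - (deriv ^^ k') (\<lambda>s. c $ j * pd i \<psi> (y + s *s ?e)) 0"
            by (rule higher_deriv_diff[OF _ _ S]) (intro holomorphic_intros hl)+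
          also have "(deriv ^^ k') (\<lambda>s. c $ j * pd i \<psi> (y + s *s ?e)) 0 = c $ j * (deriv ^^ k') (\<lambda>s. pd i \<psi> (y + s *s ?e)) 0"
            by (rule higher_deriv_cmult[OF hl S(2,1)])
          also have "(deriv ^^ k') (\<lambda>s. pd j \<psi> (y + s *s ?e)) 0 - c $ j * (deriv ^^ k') (\<lambda>s. pd i \<psi> (y + s *s ?e)) 0 = 0"
          proof -
            have "pd j ((pd i ^^ k') \<psi>) y = c $ j * pd i ((pd i ^^ k') \<psi>) y"
            proof (rule tangent[OF hol_pd_pow[OF B(1) \<psi>] _ less.prems])
              fix x assume x: "x \<in> B" "(\<Sum>j\<in>UNIV. c $ j * x $ j) = k"
              show "(pd i ^^ k') \<psi> x = 0" by (rule less.IH[OF _ x]) (use k' Suc in simp)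
            qed
            then show ?thesis unfolding dq by simp
          qed
          finally show ?thesis by (simp add: D_def)
        qed
        show "(deriv ^^ k') (\<lambda>s. pd i \<psi> (y + s *s ?e)) 0 = 0" if "k' < r" for k'
          unfolding dq using less.IH[of "Suc k'", OF _ less.prems] that Suc by simp
      qed
      then show ?thesis unfolding dq using Suc by simp
    qed
  qed
  \<comment> \<open>The parameter of \<open>x\<close> along the normal line; subtracting it moves
    \<open>x\<close> to its foot on the hyperplane. Near \<open>x0\<close> both points lie in
    \<open>B\<close>.\<close>
  define t where "t x = (\<Sum>j\<in>UNIV. c $ j * x $ j) - k" for x
  have "open {x. x - t x *s ?e \<in> B}"
  proof -
    have "continuous_on UNIV (\<lambda>x. x - t x *s ?e)"
      unfolding t_def by (intro continuous_intros bounded_linear.continuous_on[OF bounded_linear_scale])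
    then have "open ((\<lambda>x. x - t x *s ?e) -` B)" using B(1) by (rule open_vimage[rotated])
    then show ?thesis by (simp add: vimage_def)
  qed
  then have "open (B \<inter> {x. x - t x *s ?e \<in> B})" using B(1) by (intro open_Int)
  moreover have "x0 \<in> B \<inter> {x. x - t x *s ?e \<in> B}" using x0 by (simp add: t_def)
  ultimately have "eventually (\<lambda>x. x \<in> B \<inter> {x. x - t x *s ?e \<in> B}) (nhds x0)" by (rule eventually_nhds_in_open)
  then show ?thesis
  proof (rule eventually_mono)
    fix x assume x: "x \<in> B \<inter> {x. x - t x *s ?e \<in> B}"
    define y where "y = x - t x *s ?e"
    have y: "y \<in> B" "(\<Sum>j\<in>UNIV. c $ j * y $ j) = k"
      using x a(4) by (simp_all add: y_def right_diff_distrib sum_subtractf axis_def if_distrib[of "\<lambda>x. _ * x"] cong: if_cong)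
        (simp add: t_def)
    have "\<psi> (y + t x *s ?e) = 0"
    proof (rule holomorphic_fun_eq_0_on_connected[OF holomorphic_line[OF \<psi>] line_preimage(1)[OF B] convex_connected[OF line_preimage(2)[OF B]]])
      show "(deriv ^^ n) (\<lambda>s. \<psi> (y + s *s ?e)) 0 = 0" for n
        unfolding higher_deriv_line using zero[OF y] by simp
    qed (use x y in \<open>auto simp: y_def\<close>)
    then show "\<psi> x = 0" by (simp add: y_def)
  qed
qed

section \<open>Walls on which the metric does not degenerate\<close>

text \<open>Finite exponential sums at \<lambda> = 1. Their closure properties show that det \<eta>,
  pulled back to \<open>x\<close>, is one.\<close>

definition expsum :: "(complex^'l::finite \<Rightarrow> complex) \<Rightarrow> bool" where
  "expsum f \<longleftrightarrow> (\<exists>P. \<forall>x. f x = eval_exp P 1 x)"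

lemma expsum_eval: "expsum (\<lambda>x. eval_exp P 1 x)"
  unfolding expsum_def by blast

lemma expsum_ex: "expsum (\<lambda>x. c * ex k x)"
  unfolding expsum_def by (rule exI[of _ "Poly_Mapping.single k [:c:]"]) (simp add: eval_exp_single)

lemma expsum_const: "expsum (\<lambda>x. c)"
  using expsum_ex[of c 0] by (simp add: ex_def)

lemma expsum_add: "expsum f \<Longrightarrow> expsum g \<Longrightarrow> expsum (\<lambda>x. f x + g x)"
proof -
  assume "expsum f" "expsum g"
  then obtain P P' where "\<forall>x. f x = eval_exp P 1 x" "\<forall>x. g x = eval_exp P' 1 x" unfolding expsum_def by blast
  then show ?thesis unfolding expsum_def by (intro exI[of _ "P + P'"]) (simp add: eval_exp_add)
qed

lemma expsum_sum: "(\<And>a. a \<in> A \<Longrightarrow> expsum (f a)) \<Longrightarrow> expsum (\<lambda>x. \<Sum>a\<in>A. f a x)"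
  by (induction A rule: infinite_finite_induct) (auto simp: expsum_const expsum_add)

lemma expsum_mult: "expsum f \<Longrightarrow> expsum g \<Longrightarrow> expsum (\<lambda>x. f x * g x)"
proof -
  assume "expsum f" "expsum g"
  then obtain P P' where *: "\<forall>x. f x = eval_exp P 1 x" "\<forall>x. g x = eval_exp P' 1 x" unfolding expsum_def by blast
  let ?c = "\<lambda>P k. poly (Poly_Mapping.lookup P k) 1"
  have "ex k x * ex k' x = ex (k + k') x" for k k' :: "int^'a" and x
    by (simp add: ex_def exp_add[symmetric] distrib_left distrib_right sum.distrib)
  then have "f x * g x = (\<Sum>k\<in>Poly_Mapping.keys P. \<Sum>k'\<in>Poly_Mapping.keys P'. (?c P k * ?c P' k') * ex (k + k') x)" for x
    using * by (simp add: eval_exp_keys sum_product) (intro sum.cong refl, simp add: mult_ac)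
  then show ?thesis by (simp add: expsum_sum expsum_ex)
qed

lemma expsum_prod: "(\<And>a. a \<in> A \<Longrightarrow> expsum (f a)) \<Longrightarrow> expsum (\<lambda>x. \<Prod>a\<in>A. f a x)"
  by (induction A rule: infinite_finite_induct) (auto simp: expsum_const expsum_mult)

lemma expsum_power: "expsum f \<Longrightarrow> expsum (\<lambda>x. f x ^ n)"
  by (induction n) (auto simp: expsum_const expsum_mult)

lemma det_diagm_prod: "det (diagm c :: complex^'n::finite^'n) = (\<Prod>j\<in>UNIV. c j)"
  using det_diagonal[of "diagm c"] by (simp add: diagm_def)

lemma exp_decay: "a < 0 \<Longrightarrow> ((\<lambda>s. exp (complex_of_real s * complex_of_real a)) \<longlongrightarrow> 0) at_top"
proof -
  assume "a < 0"
  then have "filterlim (\<lambda>s. - a * s) at_top at_top"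
    by (intro filterlim_tendsto_pos_mult_at_top[OF tendsto_const _ filterlim_ident]) simp
  then have "filterlim (\<lambda>s. a * s) at_bot at_top" by (simp add: filterlim_uminus_at_bot)
  then have "((\<lambda>s. exp (a * s)) \<longlongrightarrow> 0) at_top" by (rule filterlim_compose[OF exp_at_bot])
  then have "((\<lambda>s. complex_of_real (exp (a * s))) \<longlongrightarrow> of_real 0) at_top" by (rule tendsto_of_real)
  then show ?thesis by (simp add: exp_of_real[symmetric] mult.commute)
qed

context generators
begin

text \<open>The complexified pairing with \<alpha>_i in coroot coordinates. Its integer levels are
  the walls of type \<open>i\<close>, and level \<open>k\<close> is fixed by the affine reflection
  \<open>wrefl i k\<close>.\<close>

definition "height i x = (\<Sum>r\<in>UNIV. complex_of_real (\<alpha> i \<bullet> coroot (\<alpha> r)) * x $ r)"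
definition "wrefl i k x = x - (height i x - of_int k) *s axis i (1::complex)"

lemma \<alpha>_coroot: "\<alpha> i \<bullet> coroot (\<alpha> i) = 2"
  by (simp add: coroot_inner)

lemma wrefl_nth: "wrefl i k x $ r = x $ r - (if r = i then height i x - of_int k else 0)"
  by (simp add: wrefl_def axis_def)

text \<open>At \<open>c = 0\<close> one has \<lambda> = 1 and the summand with the weight disappears
  from \<open>xpoint\<close>, so \<open>wrefl i k\<close> is the action of an affine Weyl group
  element.\<close>

lemma zmap_refl: "zmap z 1 (wrefl i k x) = zmap z 1 x"
proof -
  let ?\<phi> = "map_prod (\<lambda>u. u + of_int k *\<^sub>R coroot (\<alpha> i)) id \<circ> map_prod (reflect (\<alpha> i)) (reflect (\<alpha> i))"
  have "reflect (\<alpha> i) \<in> weyl_group R"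
    using weyl_reflect[OF weyl_id \<alpha>_root[of i]] by simp
  moreover have "(\<Sum>j\<in>UNIV. of_int (if j = i then k else 0) *\<^sub>R coroot (\<alpha> j)) = of_int k *\<^sub>R coroot (\<alpha> i)"
    by (simp add: if_distrib[of "\<lambda>x. x *\<^sub>R _"] if_distrib[of real_of_int] cong: if_cong)
  then have "of_int k *\<^sub>R coroot (\<alpha> i) \<in> coroot_lattice \<alpha>"
    unfolding coroot_lattice_def by (intro image_eqI[where x = "\<lambda>j. if j = i then k else 0"]) auto
  ultimately have \<phi>: "?\<phi> \<in> affine_weyl_group R \<alpha>" by (intro affine_comp affine_weyl affine_transl)
  have rfl: "reflect (\<alpha> i) u = u - (u \<bullet> \<alpha> i) *\<^sub>R coroot (\<alpha> i)" for u
    by (simp add: reflect_def coroot_def)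
  have sum: "(\<Sum>r\<in>UNIV. (y r - (if r = i then a else 0)) *\<^sub>R coroot (\<alpha> r)) = (\<Sum>r\<in>UNIV. y r *\<^sub>R coroot (\<alpha> r)) - a *\<^sub>R coroot (\<alpha> i)" for y a
    by (simp add: scaleR_left_diff_distrib sum_subtractf if_distrib[of "\<lambda>x. x *\<^sub>R _"] cong: if_cong)
  have inn: "(\<Sum>r\<in>UNIV. y r *\<^sub>R coroot (\<alpha> r)) \<bullet> \<alpha> i = (\<Sum>r\<in>UNIV. (\<alpha> i \<bullet> coroot (\<alpha> r)) * y r)" for y
    by (subst inner_commute) (simp add: inner_sum_right mult.commute)
  have Re: "Re (wrefl i k x $ r) = Re (x $ r) - (if r = i then (\<Sum>r\<in>UNIV. (\<alpha> i \<bullet> coroot (\<alpha> r)) * Re (x $ r)) - of_int k else 0)" for r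
    by (simp add: wrefl_nth height_def Re_sum)
  have Im: "Im (wrefl i k x $ r) = Im (x $ r) - (if r = i then (\<Sum>r\<in>UNIV. (\<alpha> i \<bullet> coroot (\<alpha> r)) * Im (x $ r)) else 0)" for r
    by (simp add: wrefl_nth height_def Im_sum)
  have "xpoint \<alpha> m 0 (wrefl i k x) = ?\<phi> (xpoint \<alpha> m 0 x)"
    unfolding xpoint_def Re Im sum by (simp add: rfl inn scaleR_left_diff_distrib)
  then have "eval_exp (z j) (lam \<alpha> m 0) (wrefl i k x) = eval_exp (z j) (lam \<alpha> m 0) x" for j
    using proper(1)[of j] \<phi> unfolding invariant_ring_def by blast
  then show ?thesis by (simp add: vec_eq_iff zmap_nth lam_def)
qed

text \<open>The chain rule for a locally invariant function. For \<open>r = i\<close> the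
  coefficient is 2, so on the wall itself the i-th derivative equals its own negative.\<close>

lemma pd_refl:
  assumes f: "cdiff f (wrefl i k x)" and inv: "eventually (\<lambda>u. f (wrefl i k u) = f u) (nhds x)"
  shows "pd r f x = pd r f (wrefl i k x) - complex_of_real (\<alpha> i \<bullet> coroot (\<alpha> r)) * pd i f (wrefl i k x)"
proof -
  have nth: "(\<lambda>u. wrefl i k u $ q) = (\<lambda>u. u $ q - (if q = i then 1 else 0) * (height i u - of_int k))" for q
    by (auto simp: wrefl_nth)
  have c: "cdiff (\<lambda>u. wrefl i k u $ q) x" for q
    unfolding nth height_def by (intro cdiff_intros)
  have p: "pd r (\<lambda>u. wrefl i k u $ q) x = (if q = r then 1 else 0) - (if q = i then complex_of_real (\<alpha> i \<bullet> coroot (\<alpha> r)) else 0)" for q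
    unfolding nth height_def
    by (simp add: pd_diff pd_mult pd_sum pd_const pd_coord cdiff_intros if_distrib[of "\<lambda>x. _ * x"] cong: if_cong)
  have "pd r f x = pd r (\<lambda>u. f (wrefl i k u)) x"
    by (rule eventually_cong_pd(1)[OF inv, symmetric])
  also have "\<dots> = (\<Sum>q\<in>UNIV. pd q f (wrefl i k x) * pd r (\<lambda>u. wrefl i k u $ q) x)"
    by (rule pd_chain(2)[OF f c])
  finally show ?thesis
    unfolding p by (simp add: right_diff_distrib sum_subtractf if_distrib[of "\<lambda>x. _ * x"] if_distrib[of "\<lambda>x. x * _"] mult.commute cong: if_cong)
qed

section \<open>Exponents of the determinant of the flat metric upstairs\<close>

abbreviation "F1 x \<equiv> det (\<eta> (zmap z 1 x))"

lemma expsum_F1: "expsum (\<lambda>x. F1 x)"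
proof -
  have "expsum (\<lambda>x. \<eta> (zmap z 1 x) $ i $ j)" for i j
    unfolding \<eta>_nth lin_coeff_def mono_def zmap_nth by (intro expsum_sum expsum_mult expsum_const expsum_prod expsum_power expsum_eval)
  then show ?thesis unfolding det_def by (intro expsum_sum expsum_mult expsum_const expsum_prod)
qed

text \<open>Rows and columns contribute each \<theta>_j once, and every row loses one \<kappa>. This
  produces the degree bound of \<open>F1_degree\<close>.\<close>

lemma det_\<eta>_scl:
  "det (\<eta> (scl s v)) = exp (s * complex_of_real (2 * (\<Sum>j\<in>UNIV. \<theta> j) - real CARD('l) * \<kappa>)) * det (\<eta> v)"
proof -
  have "\<eta> (scl s v) = diagm (\<lambda>i. exp ((thc i - kc) * s)) ** \<eta> v ** diagm (\<lambda>j. exp (thc j * s))"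
    by (simp add: vec_eq_iff mult_diagm diagm_mult \<eta>_scl exp_add[symmetric] mult_ac)
      (simp add: mult.assoc[symmetric] exp_add[symmetric] algebra_simps)
  then have "det (\<eta> (scl s v)) = exp (\<Sum>i\<in>UNIV. (thc i - kc) * s) * exp (\<Sum>j\<in>UNIV. thc j * s) * det (\<eta> v)"
    by (simp add: det_mul det_diagm_prod exp_sum)
  also have "exp (\<Sum>i\<in>UNIV. (thc i - kc) * s) * exp (\<Sum>j\<in>UNIV. thc j * s)
     = exp (s * complex_of_real (2 * (\<Sum>j\<in>UNIV. \<theta> j) - real CARD('l) * \<kappa>))"
    unfolding exp_add[symmetric] by (intro arg_cong[of _ _ exp]) (simp add: sum_distrib_left sum_subtractf algebra_simps)
  finally show ?thesis .
qed

lemma ex_shift: "ex k (shift s x) = exp (s * complex_of_real (\<Sum>j\<in>UNIV. of_int (k $ j) * \<theta> j)) * ex k x"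
proof -
  have "2 * complex_of_real pi * \<i> * (\<Sum>j\<in>UNIV. of_int (k $ j) * (shift s x $ j)) =
    s * complex_of_real (\<Sum>j\<in>UNIV. of_int (k $ j) * \<theta> j) + tpi * (\<Sum>j\<in>UNIV. of_int (k $ j) * x $ j)"
    by (simp add: shift_def sum_distrib_left sum.distrib[symmetric] distrib_left) (intro sum.cong refl, simp add: field_simps)
  then show ?thesis by (simp add: ex_def exp_add)
qed

lemma F1_shift:
  "F1 (shift (complex_of_real s) x) = exp (complex_of_real s * complex_of_real (2 * (\<Sum>j\<in>UNIV. \<theta> j) - real CARD('l) * \<kappa>)) *
     det (\<eta> (zmap z (exp (complex_of_real s * complex_of_real (- \<kappa>))) x))"
proof -
  have "exp (kc * complex_of_real s) * exp (complex_of_real s * complex_of_real (- \<kappa>)) = 1"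
    by (simp add: exp_add[symmetric] mult.commute)
  then have "zmap z 1 (shift (complex_of_real s) x) = scl (complex_of_real s) (zmap z (exp (complex_of_real s * complex_of_real (- \<kappa>))) x)"
    using zmap_scl[of "complex_of_real s" "exp (complex_of_real s * complex_of_real (- \<kappa>))" x] by simp
  then show ?thesis by (simp only: det_\<eta>_scl)
qed

text \<open>Along \<open>shift\<close>, \<open>F1\<close> is the exponential of rate
  \<open>D\<close> times det \<eta> at a value of \<lambda> tending to 0, and the latter has a
  limit. Exponents of the largest degree \<delta> > D would grow faster: after division by the rate
  \<delta> only they survive, their sum tends to 0, and independence of exponentials kills
  them.\<close>

lemma F1_degree:
  assumes K: "finite K" "\<And>x. F1 x = (\<Sum>k\<in>K. c k * ex k x)" and k: "k \<in> K" "c k \<noteq> 0"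
  shows "(\<Sum>j\<in>UNIV. of_int (k $ j) * \<theta> j) \<le> 2 * (\<Sum>j\<in>UNIV. \<theta> j) - real CARD('l) * \<kappa>"
proof (rule ccontr)
  define dg where "dg k = (\<Sum>j\<in>UNIV. of_int (k $ j) * \<theta> j)" for k :: "int^'l"
  define D where "D = 2 * (\<Sum>j\<in>UNIV. \<theta> j) - real CARD('l) * \<kappa>"
  assume "\<not> ?thesis"
  then have kD: "dg k > D" by (simp add: dg_def D_def)
  define L where "L = {k \<in> K. c k \<noteq> 0}"
  have L: "finite L" "k \<in> L" using K k by (auto simp: L_def)
  define \<delta> where "\<delta> = Max (dg ` L)"
  have \<delta>: "dg i \<le> \<delta>" if "i \<in> L" for i using that L(1) by (simp add: \<delta>_def)
  have "\<delta> \<in> dg ` L" unfolding \<delta>_def using L by (intro Max_in) auto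
  then obtain k' where k': "k' \<in> L" "dg k' = \<delta>" by blast
  have "\<delta> > D" using \<delta>[OF L(2)] kD by simp
  have FL: "F1 x = (\<Sum>k\<in>L. c k * ex k x)" for x
    unfolding K(2) L_def using K(1) by (intro sum.mono_neutral_right) auto
  have "(\<Sum>i\<in>L. (if dg i = \<delta> then c i else 0) * ex i x) = 0" for x
  proof -
    let ?e = "\<lambda>s a. exp (complex_of_real s * complex_of_real a)"
    have "?e s (D - \<delta>) * det (\<eta> (zmap z (?e s (- \<kappa>)) x)) = (\<Sum>i\<in>L. c i * ?e s (dg i - \<delta>) * ex i x)" for s
    proof -
      have "?e s (- \<delta>) * F1 (shift (complex_of_real s) x) = (\<Sum>i\<in>L. ?e s (- \<delta>) * (c i * (?e s (dg i) * ex i x)))"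
        unfolding FL ex_shift dg_def[symmetric] sum_distrib_left ..
      also have "\<dots> = (\<Sum>i\<in>L. c i * ?e s (dg i - \<delta>) * ex i x)"
        by (intro sum.cong refl) (simp add: right_diff_distrib exp_diff exp_minus field_simps)
      finally show ?thesis
        unfolding F1_shift D_def[symmetric] by (simp add: right_diff_distrib exp_diff exp_minus field_simps)
    qed
    moreover have "((\<lambda>s. ?e s (D - \<delta>) * det (\<eta> (zmap z (?e s (- \<kappa>)) x))) \<longlongrightarrow> 0 * det (\<eta> (zmap z 0 x))) at_top"
    proof (rule tendsto_mult)
      show "((\<lambda>s. ?e s (D - \<delta>)) \<longlongrightarrow> 0) at_top" using \<open>\<delta> > D\<close> by (intro exp_decay) simp
      have "((\<lambda>s. ?e s (- \<kappa>)) \<longlongrightarrow> 0) at_top" using kappa_props(1) by (intro exp_decay) simp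
      then have *: "((\<lambda>s. zmap z (?e s (- \<kappa>)) x $ j) \<longlongrightarrow> zmap z 0 x $ j) at_top" for j
        unfolding zmap_nth eval_exp_keys by (intro tendsto_intros)
      show "((\<lambda>s. det (\<eta> (zmap z (?e s (- \<kappa>)) x))) \<longlongrightarrow> det (\<eta> (zmap z 0 x))) at_top"
        by (rule tendsto_det, unfold \<eta>_nth lin_coeff_def mono_def) (intro tendsto_intros *)
    qed
    ultimately have 1: "((\<lambda>s. \<Sum>i\<in>L. c i * ?e s (dg i - \<delta>) * ex i x) \<longlongrightarrow> 0) at_top" by simp
    have 2: "((\<lambda>s. \<Sum>i\<in>L. c i * ?e s (dg i - \<delta>) * ex i x) \<longlongrightarrow> (\<Sum>i\<in>L. (if dg i = \<delta> then c i else 0) * ex i x)) at_top"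
    proof (rule tendsto_sum)
      fix i assume i: "i \<in> L"
      show "((\<lambda>s. c i * ?e s (dg i - \<delta>) * ex i x) \<longlongrightarrow> (if dg i = \<delta> then c i else 0) * ex i x) at_top"
      proof (cases "dg i = \<delta>")
        case False
        then have "((\<lambda>s. ?e s (dg i - \<delta>)) \<longlongrightarrow> 0) at_top" using \<delta>[OF i] by (intro exp_decay) simp
        from tendsto_mult[OF tendsto_mult[OF tendsto_const[of "c i"] this] tendsto_const[of "ex i x"]] False show ?thesis by simp
      qed simp
    qed
    show ?thesis using tendsto_unique[OF _ 2 1] by simp
  qed
  then have "(if dg k' = \<delta> then c k' else 0) = 0"
    by (rule ex_independent[OF L(1) _ k'(1), where c = "\<lambda>i. if dg i = \<delta> then c i else 0"])
  then show False using k' by (simp add: L_def)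
qed

text \<open>The simple root \<alpha>_i as an exponent vector, that is, a row of the Cartan
  matrix.\<close>

definition "cartan i = (\<chi> r. \<lfloor>\<alpha> i \<bullet> coroot (\<alpha> r)\<rfloor>)"

lemma cartan: "real_of_int (cartan i $ r) = \<alpha> i \<bullet> coroot (\<alpha> r)"
proof -
  have "\<alpha> i \<bullet> coroot (\<alpha> r) \<in> \<int>" using roots \<alpha>_root unfolding root_system_def by blast
  then show ?thesis by (simp add: cartan_def)
qed

lemma cartan_self: "cartan i $ i = 2"
  using cartan[of i i] by (simp add: \<alpha>_coroot)

definition "cscale a i = (\<chi> r. a * cartan i $ r)" for a :: int
text \<open>The simple reflection acting on weights in fundamental weight coordinates.\<close>

definition "sr i k = k - cscale (k $ i) i"

lemma ex_refl: "ex k (wrefl i 0 x) = ex (sr i k) x"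
proof -
  have h: "height i x = (\<Sum>r\<in>UNIV. of_int (cartan i $ r) * x $ r)"
    by (simp add: height_def flip: cartan)
  have "(\<Sum>j\<in>UNIV. of_int (k $ j) * wrefl i 0 x $ j) = (\<Sum>j\<in>UNIV. of_int (k $ j) * x $ j) - of_int (k $ i) * height i x"
    by (simp add: wrefl_nth right_diff_distrib sum_subtractf if_distrib[of "\<lambda>x. _ * x"] cong: if_cong)
  also have "\<dots> = (\<Sum>j\<in>UNIV. of_int (sr i k $ j) * x $ j)"
    by (simp add: h sr_def cscale_def left_diff_distrib sum_subtractf sum_distrib_left mult.assoc)
  finally show ?thesis by (simp add: ex_def)
qed

lemma sr_sr: "sr i (sr i k) = k"
  by (simp add: vec_eq_iff sr_def cscale_def cartan_self)

text \<open>A representative of the \<alpha>_i-string through \<open>k\<close>: the i-th coordinate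
  of \<alpha>_i is 2, so that coordinate can be reduced to its parity. On walls of type
  \<open>i\<close> all exponents of a string give the same function.\<close>

definition "nf i k = k - cscale (k $ i div 2) i"

lemma nf_i: "nf i k $ i = k $ i mod 2"
  by (simp add: nf_def cscale_def cartan_self minus_div_mult_eq_mod)

lemma ex_nf:
  assumes "height i x = of_int n"
  shows "ex (nf i k) x = ex k x"
proof -
  have h: "(\<Sum>r\<in>UNIV. of_int (cartan i $ r) * x $ r) = of_int n"
    using assms by (simp add: height_def flip: cartan)
  have "(\<Sum>j\<in>UNIV. of_int (nf i k $ j) * x $ j) = (\<Sum>j\<in>UNIV. of_int (k $ j) * x $ j) - of_int (k $ i div 2 * n)"
    by (simp add: nf_def cscale_def left_diff_distrib sum_subtractf h[symmetric] sum_distrib_left mult.assoc)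
  moreover have "exp (tpi * (w - of_int q)) = exp (tpi * w)" for w q
    using exp_integer_2pi[of "of_int q"] by (simp add: right_diff_distrib exp_diff mult_ac)
  ultimately show ?thesis by (simp only: ex_def)
qed

text \<open>Different parities are told apart at half the i-th basis vector, a point of height 1.
  For equal parity some other coordinate differs, and there is a point of height 0 at which the
  exponents differ by one half.\<close>

lemma nf_distinct:
  assumes "nf i k \<noteq> nf i k'"
  shows "\<exists>x. (\<exists>n::int. height i x = of_int n) \<and> ex (nf i k) x \<noteq> ex (nf i k') x"
proof (cases "k $ i mod 2 = k' $ i mod 2")
  case False
  define x where "x = axis i (1 / 2 :: complex)"
  have "height i x = of_int 1"
    by (simp add: height_def x_def axis_def if_distrib[of "\<lambda>x. _ * x"] \<alpha>_coroot cong: if_cong)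
  moreover have e: "ex p x = exp (complex_of_real pi * \<i> * of_int (p $ i))" for p
    by (simp add: ex_def x_def axis_def if_distrib[of "\<lambda>x. _ * x"] mult_ac cong: if_cong)
  have "(k $ i mod 2 = 0 \<and> k' $ i mod 2 = 1) \<or> (k $ i mod 2 = 1 \<and> k' $ i mod 2 = 0)" using False by presburger
  then have "ex (nf i k) x \<noteq> ex (nf i k') x" unfolding e nf_i by (auto simp: mult.commute)
  ultimately show ?thesis by blast
next
  case True
  then have "nf i k $ i = nf i k' $ i" by (simp add: nf_i)
  obtain r where r: "nf i k $ r \<noteq> nf i k' $ r" using assms by (auto simp: vec_eq_iff)
  then have ri: "r \<noteq> i" using \<open>nf i k $ i = nf i k' $ i\<close> by auto
  define D where "D = (of_int (nf i k $ r) - of_int (nf i k' $ r) :: complex)"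
  have D: "D \<noteq> 0" using r by (simp add: D_def flip: of_int_diff)
  define x where "x = (1 / (2 * D)) *s (axis r 1 - complex_of_real ((\<alpha> i \<bullet> coroot (\<alpha> r)) / 2) *s axis i 1)"
  have "height i x = 1 / (2 * D) * (complex_of_real (\<alpha> i \<bullet> coroot (\<alpha> r)) - complex_of_real (\<alpha> i \<bullet> coroot (\<alpha> i)) * complex_of_real ((\<alpha> i \<bullet> coroot (\<alpha> r)) / 2))"
  proof -
    let ?u = "axis r 1 - complex_of_real ((\<alpha> i \<bullet> coroot (\<alpha> r)) / 2) *s axis i 1"
    have "height i x = 1 / (2 * D) * height i ?u"
      unfolding height_def x_def vector_smult_component sum_distrib_left by (intro sum.cong refl) (simp only: mult_ac)
    also have "height i ?u = complex_of_real (\<alpha> i \<bullet> coroot (\<alpha> r)) - complex_of_real (\<alpha> i \<bullet> coroot (\<alpha> i)) * complex_of_real ((\<alpha> i \<bullet> coroot (\<alpha> r)) / 2)"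
      by (simp add: height_def axis_def right_diff_distrib sum_subtractf if_distrib[of "\<lambda>x. _ * x"] cong: if_cong)
    finally show ?thesis .
  qed
  then have "height i x = of_int 0" by (simp add: \<alpha>_coroot)
  moreover have "ex (nf i k) x = - ex (nf i k') x"
  proof -
    have s: "(\<Sum>j\<in>UNIV. of_int (p $ j) * x $ j) = 1 / (2 * D) * (of_int (p $ r) - of_int (p $ i) * complex_of_real ((\<alpha> i \<bullet> coroot (\<alpha> r)) / 2))" for p :: "int^'l"
    proof -
      let ?u = "axis r 1 - complex_of_real ((\<alpha> i \<bullet> coroot (\<alpha> r)) / 2) *s axis i 1"
      have "(\<Sum>j\<in>UNIV. of_int (p $ j) * x $ j) = 1 / (2 * D) * (\<Sum>j\<in>UNIV. of_int (p $ j) * ?u $ j)"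
        unfolding x_def vector_smult_component sum_distrib_left by (intro sum.cong refl) (simp only: mult_ac)
      also have "(\<Sum>j\<in>UNIV. of_int (p $ j) * ?u $ j) = of_int (p $ r) - of_int (p $ i) * complex_of_real ((\<alpha> i \<bullet> coroot (\<alpha> r)) / 2)"
        by (simp add: axis_def right_diff_distrib sum_subtractf if_distrib[of "\<lambda>x. _ * x"] cong: if_cong)
      finally show ?thesis .
    qed
    have "1 / (2 * D) * of_int (nf i k $ r) = 1 / (2 * D) * of_int (nf i k' $ r) + 1 / 2"
      using D by (simp add: D_def field_simps)
    then have "(\<Sum>j\<in>UNIV. of_int (nf i k $ j) * x $ j) = (\<Sum>j\<in>UNIV. of_int (nf i k' $ j) * x $ j) + 1 / 2"
      unfolding s \<open>nf i k $ i = nf i k' $ i\<close> right_diff_distrib by simp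
    then have "2 * complex_of_real pi * \<i> * (\<Sum>j\<in>UNIV. of_int (nf i k $ j) * x $ j) = tpi * (\<Sum>j\<in>UNIV. of_int (nf i k' $ j) * x $ j) + complex_of_real pi * \<i>"
      by (simp add: distrib_left)
    then show ?thesis by (simp add: ex_def exp_add mult.commute)
  qed
  then have "ex (nf i k) x \<noteq> ex (nf i k') x" using ex_nonzero[of "nf i k'" x] by (auto simp: eq_neg_iff_add_eq_0 mult_2[symmetric])
  ultimately show ?thesis by blast
qed

text \<open>
  If \<open>det \<eta>\<close> vanished on all walls, then grouping its exponents into \<open>\<alpha>_i\<close>-strings shows that every coordinate of a highest
  exponent is at least \<open>2\<close>, which exceeds the degree allowed by quasi-homogeneity.
\<close>

lemma wall_exists: "\<exists>i x n. height i x = of_int n \<and> F1 x \<noteq> 0"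
proof (rule ccontr)
  assume "\<not> ?thesis"
  then have wall0: "F1 x = 0" if "height i x = of_int n" for i x n using that by blast
  obtain P where P: "\<And>x. F1 x = eval_exp P 1 x" using expsum_F1 unfolding expsum_def by blast
  define c where "c k = poly (Poly_Mapping.lookup P k) 1" for k
  define K where "K = Poly_Mapping.keys P"
  have K: "finite K" "\<And>k. k \<notin> K \<Longrightarrow> c k = 0" by (auto simp: K_def c_def in_keys_iff)
  have F: "F1 x = (\<Sum>k\<in>K. c k * ex k x)" for x
    unfolding P K_def c_def by (rule eval_exp_keys)
  have F': "F1 x = (\<Sum>k\<in>K'. c k * ex k x)" if "finite K'" "K \<subseteq> K'" for K' x
    unfolding F using that K by (intro sum.mono_neutral_left) auto
  \<comment> \<open>Invariance of \<open>F1\<close> under the reflection, compared on a finite set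
    \<open>K'\<close> of exponents that the reflection preserves.\<close>
  have c_sr: "c (sr i k) = c k" for i k
  proof -
    define K' where "K' = insert k (insert (sr i k) (K \<union> sr i ` K))"
    have K': "finite K'" "K \<subseteq> K'" "k \<in> K'" "sr i ` K' = K'"
      using K(1) by (auto simp: K'_def sr_sr image_Un image_image)
    have "c (sr i k) - c k = 0"
    proof (rule ex_independent[OF K'(1) _ K'(3), where c = "\<lambda>k. c (sr i k) - c k"])
      fix x
      have inj: "inj_on (sr i) K'" by (rule inj_on_inverseI[of _ "sr i"]) (rule sr_sr)
      have "F1 (wrefl i 0 x) = (\<Sum>k\<in>K'. c k * ex (sr i k) x)"
        unfolding F'[OF K'(1,2)] ex_refl ..
      also have "\<dots> = (\<Sum>k\<in>sr i ` K'. c (sr i k) * ex k x)"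
        by (subst sum.reindex[OF inj]) (simp add: sr_sr)
      finally have "F1 (wrefl i 0 x) = (\<Sum>k\<in>K'. c (sr i k) * ex k x)" unfolding K'(4) .
      then show "(\<Sum>k\<in>K'. (c (sr i k) - c k) * ex k x) = 0"
        using F'[OF K'(1,2), of x] by (simp add: zmap_refl left_diff_distrib sum_subtractf)
    qed
    then show ?thesis by simp
  qed
  have "\<exists>k\<in>K. c k \<noteq> 0"
  proof (rule ccontr)
    assume "\<not> ?thesis"
    then have "F1 x = 0" for x using F by simp
    note z = this
    have "det (\<eta> v1) = 0"
    proof (rule eq_0_zmap[where f = "\<lambda>v. det (\<eta> v)" and l = 1])
      show "entire (\<lambda>v. det (\<eta> v))" by (rule entireI) (rule cdiff_det, rule entire_cdiff[OF entire_\<eta>])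
    qed (rule z)
    then show False using det_v1 by simp
  qed
  then have ne: "{k \<in> K. c k \<noteq> 0} \<noteq> {}" by blast
  define v where "v = (\<Sum>k\<in>UNIV. (2 / (\<alpha> k \<bullet> \<alpha> k)) *\<^sub>R \<omega> k)"
  have \<alpha>v: "\<alpha> k \<bullet> v = 1" for k
    by (simp add: v_def inner_sum_right \<alpha>_fund_weight if_distrib[of "\<lambda>x. _ * x"] cong: if_cong)
  \<comment> \<open>Normalized so that adding \<alpha>_i to an exponent raises it by 1; a highest
    exponent with nonzero coefficient is then selected.\<close>
  define ht where "ht k = (\<Sum>r\<in>UNIV. real_of_int (k $ r) * (\<omega> r \<bullet> v))" for k :: "int^'l"
  have ht: "ht (k + cscale a i) = ht k + of_int a" for k a i
  proof -
    have "1 = (\<Sum>j\<in>UNIV. (\<alpha> i \<bullet> coroot (\<alpha> j)) *\<^sub>R \<omega> j) \<bullet> v"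
      using weight_expand[of "\<alpha> i"] \<alpha>v[of i] by simp
    then have "(\<Sum>r\<in>UNIV. real_of_int (cartan i $ r) * (\<omega> r \<bullet> v)) = 1" by (simp add: inner_sum_left cartan)
    then show ?thesis by (simp add: ht_def cscale_def distrib_right sum.distrib mult.assoc sum_distrib_left[symmetric])
  qed
  obtain k where k: "k \<in> K" "c k \<noteq> 0" and max: "\<And>k'. k' \<in> K \<Longrightarrow> c k' \<noteq> 0 \<Longrightarrow> ht k' \<le> ht k"
  proof -
    have fin: "finite {k \<in> K. c k \<noteq> 0}" using K(1) by simp
    have "Max (ht ` {k \<in> K. c k \<noteq> 0}) \<in> ht ` {k \<in> K. c k \<noteq> 0}" using fin ne by (intro Max_in) auto
    then obtain k where "k \<in> {k \<in> K. c k \<noteq> 0}" "ht k = Max (ht ` {k \<in> K. c k \<noteq> 0})" by auto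
    then show thesis using that[of k] fin by auto
  qed
  \<comment> \<open>Vanishing on the walls of type \<open>i\<close> makes the coefficients in each
    \<alpha>_i-string add up to zero. If k_i were at most 1, only \<open>k\<close> and its
    reflection would contribute to the string of \<open>k\<close>, with equal nonzero
    coefficients.\<close>
  have k2: "k $ i \<ge> 2" for i
  proof (rule ccontr)
    assume ki: "\<not> k $ i \<ge> 2"
    have sum0: "(\<Sum>q\<in>{q \<in> K. nf i q = nf i k}. c q) = 0"
    proof (rule characters_independent[where X = "{x. \<exists>n::int. height i x = of_int n}" and pl = "(+)" and ch = ex and K = "nf i ` K" and ?x0.0 = 0
          and c = "\<lambda>p. \<Sum>q\<in>{q \<in> K. nf i q = p}. c q"])
      show "finite (nf i ` K)" using K(1) by simp
      show "x + y \<in> {x. \<exists>n::int. height i x = of_int n}" if "x \<in> {x. \<exists>n::int. height i x = of_int n}" "y \<in> {x. \<exists>n::int. height i x = of_int n}" for x y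
      proof -
        have "height i (x + y) = height i x + height i y" by (simp add: height_def distrib_left sum.distrib)
        then show ?thesis using that by (auto simp flip: of_int_add)
      qed
      show "ex p (x + y) = ex p x * ex p y" for p x y by (rule ex_add)
      show "0 \<in> {x. \<exists>n::int. height i x = of_int n}" by (auto simp: height_def intro!: exI[of _ 0])
      show "ex p 0 \<noteq> 0" for p by simp
      show "\<exists>x\<in>{x. \<exists>n::int. height i x = of_int n}. ex p x \<noteq> ex p' x" if "p \<in> nf i ` K" "p' \<in> nf i ` K" "p \<noteq> p'" for p p'
        using nf_distinct[of i] that by blast
      show "(\<Sum>p\<in>nf i ` K. (\<Sum>q\<in>{q \<in> K. nf i q = p}. c q) * ex p x) = 0" if xw: "x \<in> {x. \<exists>n::int. height i x = of_int n}" for x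
      proof -
        obtain n :: int where n: "height i x = of_int n" using xw by blast
        have "0 = (\<Sum>q\<in>K. c q * ex q x)" using wall0[OF n] F[of x] by simp
        also have "\<dots> = (\<Sum>p\<in>nf i ` K. \<Sum>q\<in>{q \<in> K. nf i q = p}. c q * ex q x)" by (rule sum.image_gen[OF K(1)])
        also have "\<dots> = (\<Sum>p\<in>nf i ` K. \<Sum>q\<in>{q \<in> K. nf i q = p}. c q * ex p x)"
          by (intro sum.cong refl) (use ex_nf[OF n] in auto)
        finally show ?thesis by (simp add: sum_distrib_right)
      qed
      show "nf i k \<in> nf i ` K" using k(1) by blast
    qed
    have other: "c q = 0" if q: "q \<in> K" "nf i q = nf i k" "q \<notin> {k, sr i k}" for q
    proof (rule ccontr)
      assume cq: "c q \<noteq> 0"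
      \<comment> \<open>The position of \<open>q\<close> in the string of \<open>k\<close>. Neither
        \<open>q\<close> nor its reflection is higher than \<open>k\<close>, so - k_i \<le> t \<le>
        0; for k_i \<le> 1 only the two ends are left.\<close>
      define t where "t = q $ i div 2 - k $ i div 2"
      have qt: "q = k + cscale t i"
      proof -
        have "q $ r = k $ r + t * cartan i $ r" for r
        proof -
          have "nf i q $ r = nf i k $ r" using q(2) by simp
          then show ?thesis by (simp add: nf_def cscale_def t_def left_diff_distrib)
        qed
        then show ?thesis by (simp add: vec_eq_iff cscale_def)
      qed
      have "ht q \<le> ht k" by (rule max[OF q(1) cq])
      then have t0: "t \<le> 0" unfolding qt ht by simp
      have "q $ i = k $ i + 2 * t" unfolding qt by (simp add: cscale_def cartan_self)
      then have "sr i q $ r = (k + cscale (- k $ i - t) i) $ r" for r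
        by (simp add: sr_def qt cscale_def cartan_self algebra_simps)
      then have "sr i q = k + cscale (- k $ i - t) i" unfolding vec_eq_iff by blast
      moreover have csq: "c (sr i q) \<noteq> 0" using cq by (simp add: c_sr)
      moreover have "sr i q \<in> K" using csq K(2) by blast
      ultimately have "- k $ i - t \<le> 0" using max[of "sr i q"] by (simp add: ht)
      then have "t = 0 \<or> t = - k $ i" using t0 ki by linarith
      then show False
      proof
        assume "t = 0"
        then have "q = k" using qt by (simp add: vec_eq_iff cscale_def)
        then show False using q(3) by simp
      next
        assume "t = - k $ i"
        then have "q = sr i k" unfolding qt sr_def by (simp add: vec_eq_iff cscale_def)
        then show False using q(3) by simp
      qed
    qed
    have sk: "sr i k \<in> K" using K(2)[of "sr i k"] k(2) c_sr[of i k] by auto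
    have nfs: "nf i (sr i k) = nf i k"
    proof -
      have "sr i k $ i = - (k $ i)" by (simp add: sr_def cscale_def cartan_self)
      moreover have "(- (k $ i)) div 2 = k $ i div 2 - k $ i" by presburger
      ultimately show ?thesis by (simp add: vec_eq_iff nf_def cscale_def left_diff_distrib) (simp add: sr_def cscale_def)
    qed
    have "(\<Sum>q\<in>{q \<in> K. nf i q = nf i k}. c q) = (\<Sum>q\<in>{k, sr i k}. c q)"
      by (rule sum.mono_neutral_right) (use K(1) k(1) sk nfs other in auto)
    moreover have "(\<Sum>q\<in>{k, sr i k}. c q) \<noteq> 0"
      using k(2) c_sr[of i k] by (cases "sr i k = k") auto
    ultimately show False using sum0 by simp
  qed
  have "(\<Sum>j\<in>UNIV. of_int (k $ j) * \<theta> j) \<le> 2 * (\<Sum>j\<in>UNIV. \<theta> j) - real CARD('l) * \<kappa>"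
    by (rule F1_degree[OF K(1) F k])
  moreover have "2 * (\<Sum>j\<in>UNIV. \<theta> j) \<le> (\<Sum>j\<in>UNIV. of_int (k $ j) * \<theta> j)"
    unfolding sum_distrib_left
  proof (rule sum_mono)
    fix j
    have "(2::real) \<le> of_int (k $ j)" using k2[of j] by simp
    then show "2 * \<theta> j \<le> of_int (k $ j) * \<theta> j" using theta_nonneg[of j] by (rule mult_right_mono)
  qed
  moreover have "real CARD('l) * \<kappa> > 0" using kappa_props(1) by simp
  ultimately show False by linarith
qed

end

section \<open>Degrees of flat coordinates are nonzero\<close>

locale covered_generators = generators R \<alpha> m z
  for R :: "'v::euclidean_space set" and \<alpha> :: "'l::finite \<Rightarrow> 'v" and m z +
  fixes C :: "'w::topological_space set" and p :: "'w \<Rightarrow> complex^'l" and t :: "'l \<Rightarrow> 'w \<Rightarrow> complex" and d :: "'l \<Rightarrow> complex"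
  assumes cov: "covering_space C p (UNIV - D_eta \<alpha> z)" and sc: "simply_connected C"
    and eb: "flat_eigenbasis C p (eta_metric \<alpha> z) (E_field \<alpha> m) t d"
begin

sublocale flat_cover g \<eta> \<Gamma>0 \<Gamma>1 "\<lambda>r. thc r" "kc" m "zmap z 0 (x0 0)" v1 C p t d
proof
  have "UNIV - D_eta \<alpha> z = {v. det (\<eta> v) \<noteq> 0}" by (auto simp: D_eta_def)
  then show "covering_space C p {v. det (\<eta> v) \<noteq> 0}" using cov by simp
  show "connected C" by (rule simply_connected_imp_connected'[OF sc])
  have "E_field \<alpha> m = (\<lambda>v. \<chi> r. thc r * v $ r)" by (intro ext) (simp add: E_field_def)
  then show "flat_eigenbasis C p \<eta> (\<lambda>v. \<chi> r. thc r * v $ r) t d" using eb by simp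
qed

abbreviation "Zx \<equiv> jacobian (zmap z 1)"
abbreviation "lift s a x \<equiv> t a (s (zmap z 1 x))"

lemma open_zmap_preimage: "open V \<Longrightarrow> open {x. zmap z 1 x \<in> V}"
proof -
  assume V: "open V"
  have "continuous_on UNIV (\<lambda>x. \<chi> j. zmap z 1 x $ j)"
    by (intro continuous_on_vec_lambda entire_continuous entire_zmap)
  then have "continuous_on UNIV (zmap z 1)" by simp
  from open_vimage[OF V this] show ?thesis by (simp add: vimage_def)
qed

lemma section_open: "local_section C p V s \<Longrightarrow> open V"
  by (simp add: local_section_def)

lemma lift_pd:
  assumes s: "local_section C p V s" and x: "zmap z 1 x \<in> V"
  shows "cdiff (lift s a) x"
    and "pd j (lift s a) x = (\<Sum>k\<in>UNIV. pd k (\<lambda>v. t a (s v)) (zmap z 1 x) * Zx x $ k $ j)"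
    and "pd i (pd j (lift s a)) x = (\<Sum>k\<in>UNIV. (\<Sum>l\<in>UNIV. pd l (pd k (\<lambda>v. t a (s v))) (zmap z 1 x) * Zx x $ l $ i) * Zx x $ k $ j
       + pd k (\<lambda>v. t a (s v)) (zmap z 1 x) * pd i (pd j (\<lambda>x. zmap z 1 x $ k)) x)"
proof -
  have c: "cdiff (\<lambda>x. zmap z 1 x $ k) x" "cdiff (pd j (\<lambda>x. zmap z 1 x $ k)) x" for k j x
    using entire_cdiff[OF entire_zmap] entire_cdiff[OF mholomorphic_on_pd[OF open_UNIV entire_zmap]] by blast+
  have 1: "cdiff (lift s a) u \<and> pd j (lift s a) u = (\<Sum>k\<in>UNIV. pd k (\<lambda>v. t a (s v)) (zmap z 1 u) * pd j (\<lambda>x. zmap z 1 x $ k) u)"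
    if "zmap z 1 u \<in> V" for u j
    by (rule conjI) (rule pd_chain[OF cdiff_section(1)[OF s that] c(1)])+
  show "cdiff (lift s a) x" using 1[OF x] by blast
  show "pd j (lift s a) x = (\<Sum>k\<in>UNIV. pd k (\<lambda>v. t a (s v)) (zmap z 1 x) * Zx x $ k $ j)"
    using 1[OF x, of j] by (simp add: jacobian_def)
  have W: "open {x. zmap z 1 x \<in> V}" by (rule open_zmap_preimage[OF section_open[OF s]])
  note ch = pd_chain[OF cdiff_section(2)[OF s x] c(1)]
  have "pd i (pd j (lift s a)) x = pd i (\<lambda>u. \<Sum>k\<in>UNIV. pd k (\<lambda>v. t a (s v)) (zmap z 1 u) * pd j (\<lambda>x. zmap z 1 x $ k) u) x"
    by (rule open_cong_pd(1)[OF W]) (use x 1 in auto)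
  also have "\<dots> = (\<Sum>k\<in>UNIV. pd i (\<lambda>u. pd k (\<lambda>v. t a (s v)) (zmap z 1 u)) x * pd j (\<lambda>x. zmap z 1 x $ k) x
       + pd k (\<lambda>v. t a (s v)) (zmap z 1 x) * pd i (pd j (\<lambda>x. zmap z 1 x $ k)) x)"
    by (simp add: pd_sum pd_mult cdiff_intros c ch(1) add.commute)
  finally show "pd i (pd j (lift s a)) x = (\<Sum>k\<in>UNIV. (\<Sum>l\<in>UNIV. pd l (pd k (\<lambda>v. t a (s v))) (zmap z 1 x) * Zx x $ l $ i) * Zx x $ k $ j
       + pd k (\<lambda>v. t a (s v)) (zmap z 1 x) * pd i (pd j (\<lambda>x. zmap z 1 x $ k)) x)"
    unfolding ch(2) by (simp add: jacobian_def)
qed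

text \<open>At \<lambda> = 1 the coordinates \<open>x\<close> are flat for g + \<eta>, and by
  \<open>rhess_pencil\<close> the Hessian may be taken for this member of the pencil. Upstairs it is
  the plain matrix of second derivatives, raised by \<open>acc\<close>.\<close>

lemma R_lift:
  assumes s: "local_section C p V s" and x: "zmap z 1 x \<in> V" and Z: "det (Zx x) \<noteq> 0"
  shows "P.rhess (\<lambda>v. t a (s v)) (zmap z 1 x) ** Zx x = Zx x ** acc ** Hess (lift s a) x"
proof -
  interpret q: pullback "zmap z 1" acc "G 1" "\<lambda>i j k. eval_z (Q i j k) 1" "x0 1" by (rule pullback)
  let ?f = "\<lambda>v. t a (s v)" and ?v = "zmap z 1 x"
  have E1: "(\<lambda>v. \<chi> i j. g v $ i $ j + 1 * \<eta> v $ i $ j) = G 1" by (rule ext) (rule G_eq[symmetric])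
  have E2: "(\<lambda>i j k v. \<Gamma>0 i j k v + 1 * \<Gamma>1 i j k v) = (\<lambda>i j k. eval_z (Q i j k) 1)" by (intro ext) (rule \<Gamma>_eq[symmetric])
  have "q.rhess ?f ?v = P.rhess ?f ?v"
    using rhess_pencil[OF flat_section[OF s, where a = a] x section_nonzero[OF s x], where l = 1] unfolding E1 E2 .
  note E = this[symmetric]
  have "P.rhess ?f ?v ** Zx x = Zx x ** acc ** (transpose (Zx x) ** Hess ?f ?v ** Zx x + q.hess (differential ?f ?v) x)"
    unfolding E q.rhess_def by (simp only: matrix_add_rdistrib matrix_add_ldistrib q.Gam_F[OF Z] q.G_F matrix_mul_assoc)
  also have "transpose (Zx x) ** Hess ?f ?v ** Zx x + q.hess (differential ?f ?v) x = Hess (lift s a) x"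
  proof -
    have "(transpose (Zx x) ** Hess ?f ?v ** Zx x + q.hess (differential ?f ?v) x) $ i $ j = Hess (lift s a) x $ i $ j" for i j
      unfolding Hess_def vec_lambda_beta lift_pd(3)[OF s x]
      by (simp add: matrix_mult_nth transpose_nth q.hess_def sum.distrib mult.commute[of "Zx x $ _ $ _"] pd_commute[OF open_UNIV entire_zmap])
    then show ?thesis by (simp add: vec_eq_iff)
  qed
  finally show ?thesis .
qed

lemma lift_hol:
  assumes s: "local_section C p V s"
  shows "mholomorphic_on {x. zmap z 1 x \<in> V} (lift s a)"
  unfolding mholomorphic_on_iff_cdiff using lift_pd(1)[OF s] by blast

text \<open>Upstairs, \<open>R_square_zero\<close> says that the matrix of second derivatives
  squares to zero with \<open>acc\<close> in between. Its i-th diagonal entry is the eikonal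
  equation for the i-th partial derivative.\<close>

lemma lift_eikonal:
  assumes s: "local_section C p V s" and x: "zmap z 1 x \<in> V" and d0: "d a = 0"
  shows "(\<Sum>j\<in>UNIV. \<Sum>l\<in>UNIV. pd j (pd i (lift s a)) x * acc $ j $ l * pd l (pd i (lift s a)) x) = 0"
proof -
  let ?W = "{x. zmap z 1 x \<in> V}" and ?H = "Hess (lift s a)"
  interpret F: flat_frame g \<eta> \<Gamma>0 \<Gamma>1 "\<lambda>r. thc r" "kc" m "zmap z 0 (x0 0)" v1 V "\<lambda>a v. t a (s v)" d K0
    by (rule flat_frame[OF s])
  have W: "open ?W" by (rule open_zmap_preimage[OF section_open[OF s]])
  note hol = mholomorphic_on_pd[OF W mholomorphic_on_pd[OF W lift_hol[OF s]]]
  obtain y0 where y0: "det (Zx y0) \<noteq> 0" using det_jacobian by blast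
  show ?thesis
  proof (rule continuous_eq_0_dense[where f = "\<lambda>x. det (Zx x)" and V = ?W and v = x and ?v0.0 = y0
        and g = "\<lambda>x. \<Sum>j\<in>UNIV. \<Sum>l\<in>UNIV. pd j (pd i (lift s a)) x * acc $ j $ l * pd l (pd i (lift s a)) x"])
    show "entire (\<lambda>x. det (Zx x))"
      unfolding jacobian_def by (rule entireI, rule cdiff_det, unfold vec_lambda_beta, rule entire_cdiff[OF mholomorphic_on_pd[OF open_UNIV entire_zmap]])
    show "continuous_on ?W (\<lambda>x. \<Sum>j\<in>UNIV. \<Sum>l\<in>UNIV. pd j (pd i (lift s a)) x * acc $ j $ l * pd l (pd i (lift s a)) x)"
      by (intro continuous_intros continuous_on_mholomorphic hol)
    fix u assume u: "u \<in> ?W" "det (Zx u) \<noteq> 0"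
    have uV: "zmap z 1 u \<in> V" using u(1) by simp
    let ?R = "P.rhess (\<lambda>v. t a (s v)) (zmap z 1 u)"
    note RZ = R_lift[OF s uV u(2), of a]
    have RR: "?R ** ?R = 0" by (rule F.R_square_zero[OF uV d0])
    have "(Zx u ** acc) ** (?H u ** acc ** ?H u) = (Zx u ** acc ** ?H u) ** acc ** ?H u" by (simp only: matrix_mul_assoc)
    also have "\<dots> = (?R ** Zx u) ** acc ** ?H u" by (simp only: RZ)
    also have "\<dots> = ?R ** (Zx u ** acc ** ?H u)" by (simp only: matrix_mul_assoc)
    also have "\<dots> = ?R ** (?R ** Zx u)" by (simp only: RZ)
    also have "\<dots> = ?R ** ?R ** Zx u" by (rule matrix_mul_assoc)
    also have "\<dots> = 0" unfolding RR by (simp add: vec_eq_iff matrix_mult_nth)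
    finally have "matrix_inv (Zx u ** acc) ** ((Zx u ** acc) ** (?H u ** acc ** ?H u)) = 0" by (simp add: vec_eq_iff matrix_mult_nth)
    moreover have "det (Zx u ** acc) \<noteq> 0" using u(2) det_acc by (simp add: det_mul)
    ultimately have "(matrix_inv (Zx u ** acc) ** (Zx u ** acc)) ** (?H u ** acc ** ?H u) = 0 \<and> matrix_inv (Zx u ** acc) ** (Zx u ** acc) = mat 1"
      using matrix_inv_det[of "Zx u ** acc"] by (simp only: matrix_mul_assoc simp_thms)
    then have "?H u ** acc ** ?H u = 0" by (metis matrix_mul_lid)
    then have "(?H u ** acc ** ?H u) $ i $ i = 0" by simp
    moreover have "(?H u ** acc ** ?H u) $ i $ i = (\<Sum>j\<in>UNIV. \<Sum>l\<in>UNIV. pd j (pd i (lift s a)) u * acc $ j $ l * pd l (pd i (lift s a)) u)"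
      by (simp add: matrix_mult_nth Hess_def sum_distrib_right pd_commute[OF W lift_hol[OF s] u(1), of i]) (rule sum.swap)
    ultimately show "(\<Sum>j\<in>UNIV. \<Sum>l\<in>UNIV. pd j (pd i (lift s a)) u * acc $ j $ l * pd l (pd i (lift s a)) u) = 0" by simp
  qed (use y0 W x in auto)
qed

text \<open>\<open>lift\<close> factors through \<open>zmap\<close> and so is invariant under the
  reflection; on the wall its i-th derivative is its own negative. The wall is not characteristic,
  because \<open>acc\<close> maps its defining form \<open>c\<close> to a nonzero multiple of the
  i-th axis.\<close>

lemma lift_wall_zero:
  assumes s: "local_section C p V s" and x1: "zmap z 1 x1 \<in> V" and h: "height i x1 = of_int n" and d0: "d a = 0"
  shows "eventually (\<lambda>x. pd i (lift s a) x = 0) (nhds x1)"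
proof -
  let ?W = "{x. zmap z 1 x \<in> V}"
  have W: "open ?W" by (rule open_zmap_preimage[OF section_open[OF s]])
  then obtain e where e: "e > 0" "ball x1 e \<subseteq> ?W" using x1 open_contains_ball by blast
  define c where "c = (\<chi> r. complex_of_real (\<alpha> i \<bullet> coroot (\<alpha> r)) / 2)"
  have hc: "height i x = of_int n \<longleftrightarrow> (\<Sum>j\<in>UNIV. c $ j * x $ j) = of_int n / 2" for x
    by (simp add: height_def c_def sum_divide_distrib[symmetric])
  show ?thesis
  proof (rule eikonal_zero[where B = "ball x1 e" and c = c and a = acc and i = i and k = "of_int n / 2" and \<sigma> = "complex_of_real ((\<alpha> i \<bullet> \<alpha> i) / (16 * pi\<^sup>2))"])
    show "mholomorphic_on (ball x1 e) (pd i (lift s a))"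
      using mholomorphic_on_pd[OF W lift_hol[OF s]] e(2) unfolding mholomorphic_on_def by blast
    show "pd i (lift s a) x = 0" if "x \<in> ball x1 e" "(\<Sum>j\<in>UNIV. c $ j * x $ j) = of_int n / 2" for x
    proof -
      have hx: "height i x = of_int n" using that(2) hc by blast
      have fx: "wrefl i n x = x" by (simp add: wrefl_def hx)
      have "pd i (lift s a) x = pd i (lift s a) (wrefl i n x) - complex_of_real (\<alpha> i \<bullet> coroot (\<alpha> i)) * pd i (lift s a) (wrefl i n x)"
        by (rule pd_refl) (use lift_pd(1)[OF s] that(1) e(2) in \<open>auto simp: fx zmap_refl\<close>)
      then show ?thesis unfolding fx \<alpha>_coroot by simp
    qed
    show "(\<Sum>j\<in>UNIV. \<Sum>l\<in>UNIV. pd j (pd i (lift s a)) x * acc $ j $ l * pd l (pd i (lift s a)) x) = 0" if "x \<in> ball x1 e" for x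
      by (rule lift_eikonal[OF s _ d0]) (use that e(2) in auto)
    \<comment> \<open>The pairing of \<omega>_j with \<alpha>_i is zero or half the squared length
      of \<alpha>_i; \<open>acc\<close> and \<open>c\<close> add the denominators 4 pi^2 and
      2.\<close>
    show "(\<Sum>l\<in>UNIV. acc $ j $ l * c $ l) = (if j = i then complex_of_real ((\<alpha> i \<bullet> \<alpha> i) / (16 * pi\<^sup>2)) else 0)" for j
    proof -
      have "\<omega> j \<bullet> \<alpha> i = \<omega> j \<bullet> (\<Sum>l\<in>UNIV. (\<alpha> i \<bullet> coroot (\<alpha> l)) *\<^sub>R \<omega> l)"
        using weight_expand[of "\<alpha> i"] by simp
      then have "(\<Sum>l\<in>UNIV. (\<omega> j \<bullet> \<omega> l) * (\<alpha> i \<bullet> coroot (\<alpha> l))) = (if j = i then (\<alpha> i \<bullet> \<alpha> i) / 2 else 0)"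
        by (simp add: inner_sum_right fund_weight_\<alpha> mult.commute)
      then have "complex_of_real (\<Sum>l\<in>UNIV. (\<omega> j \<bullet> \<omega> l) * (\<alpha> i \<bullet> coroot (\<alpha> l))) = complex_of_real (if j = i then (\<alpha> i \<bullet> \<alpha> i) / 2 else 0)"
        by (rule arg_cong)
      moreover have "(\<Sum>l\<in>UNIV. acc $ j $ l * c $ l) = complex_of_real (\<Sum>l\<in>UNIV. (\<omega> j \<bullet> \<omega> l) * (\<alpha> i \<bullet> coroot (\<alpha> l))) / (8 * (complex_of_real pi)\<^sup>2)"
        unfolding of_real_sum sum_divide_distrib acc_def c_def vec_lambda_beta by (intro sum.cong refl) simp
      ultimately show ?thesis by simp
    qed
  qed (use e h hc acc_sym in \<open>auto simp: c_def \<alpha>_coroot\<close>)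
qed

section \<open>Annihilators of the coordinates of nonzero degree\<close>

definition hB :: "complex^'l \<Rightarrow> complex^'l^'l" where
  "hB v = (\<chi> k j. (if k = j then det (\<eta> v) * thc j else 0) -
     (\<Sum>i\<in>UNIV. (thc i * v $ i) * (\<Sum>l\<in>UNIV. adjugate (\<eta> v) $ i $ l * \<Gamma>1 l k j v)))"

text \<open>Denominators are cleared by det \<eta> and the adjugate. What is built from
  \<open>hB\<close> is entire and can be continued across the zeros of det \<eta>.\<close>

lemma hB_eq: "det (\<eta> v) \<noteq> 0 \<Longrightarrow> hB v $ k $ j = det (\<eta> v) * Bmat v $ k $ j"
proof -
  assume nz: "det (\<eta> v) \<noteq> 0"
  have "adjugate (\<eta> v) $ i $ l = det (\<eta> v) * matrix_inv (\<eta> v) $ i $ l" for i l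
    using matrix_inv_adjugate[OF nz, of i l] nz by simp
  then show ?thesis
    by (simp add: hB_def Bmat_def christoffel_\<eta>'[OF nz] distrib_left right_diff_distrib sum_distrib_left sum_negf mult_ac)
qed

text \<open>Up to powers of det \<eta>, a polynomial in \<open>Bmat\<close> whose roots are the
  listed degrees. Differentials of flat coordinates are left eigenvectors: a listed degree is
  annihilated, any other is rescaled.\<close>

definition killer :: "complex list \<Rightarrow> complex^'l \<Rightarrow> complex^'l^'l" where
  "killer ds v = foldr (\<lambda>e M. (hB v - diagm (\<lambda>_. det (\<eta> v) * e)) ** M) ds (mat 1)"

lemma cdiff_killer: "cdiff (\<lambda>v. killer ds v $ i $ j) v"
proof (induction ds arbitrary: i j)
  case Nil
  show ?case by (simp add: killer_def cdiff_const)
next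
  case (Cons e ds)
  have c_if: "cdiff (\<lambda>v. if i = j then f v else 0) v" if "cdiff f v" for i j :: 'l and f
    using that by (cases "i = j") (simp_all add: cdiff_const)
  have "cdiff (\<lambda>v. hB v $ i $ j) v" for i j
    unfolding hB_def vec_lambda_beta by (intro cdiff_intros c_if cdiff_det cdiff_adjugate cd)
  moreover have "cdiff (\<lambda>v. diagm (\<lambda>_. det (\<eta> v) * e) $ i $ j) v" for i j :: 'l
    unfolding diagm_def vec_lambda_beta by (intro cdiff_intros c_if cdiff_det cd)
  moreover have "killer (e # ds) v = (hB v - diagm (\<lambda>_. det (\<eta> v) * e)) ** killer ds v" for v by (simp add: killer_def)
  ultimately show ?case
    by (simp only: matrix_mult_nth vector_minus_component) (intro cdiff_intros Cons.IH)
qed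

lemma killer_row:
  assumes nz: "det (\<eta> v) \<noteq> 0" and u: "u v* Bmat v = q *s u"
  shows "u v* killer ds v = (\<Prod>e\<leftarrow>ds. det (\<eta> v) * (q - e)) *s u"
proof (induction ds)
  case Nil
  show ?case by (simp add: killer_def)
next
  case (Cons e ds)
  have "(u v* (hB v - diagm (\<lambda>_. det (\<eta> v) * e))) $ j = (det (\<eta> v) * (q - e)) * u $ j" for j
  proof -
    have "(u v* Bmat v) $ j = q * u $ j" by (simp add: u)
    then have "(\<Sum>i\<in>UNIV. hB v $ i $ j * u $ i) = det (\<eta> v) * q * u $ j"
      by (simp add: hB_eq[OF nz] vector_matrix_nth mult.assoc sum_distrib_left[symmetric])
    then show ?thesis
      by (simp add: vector_matrix_nth left_diff_distrib sum_subtractf diagm_def if_distrib[of "\<lambda>x. x * _"] if_distrib[of "\<lambda>x. _ * x"] algebra_simps cong: if_cong)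
  qed
  then have *: "u v* (hB v - diagm (\<lambda>_. det (\<eta> v) * e)) = (det (\<eta> v) * (q - e)) *s u" by (simp add: vec_eq_iff)
  have "u v* killer (e # ds) v = (u v* (hB v - diagm (\<lambda>_. det (\<eta> v) * e))) v* killer ds v"
    by (simp add: killer_def vector_matrix_mul_assoc)
  also have "\<dots> = (det (\<eta> v) * (q - e)) *s ((\<Prod>e\<leftarrow>ds. det (\<eta> v) * (q - e)) *s u)"
    unfolding * vector_scale_matrix Cons.IH ..
  finally show ?case by (simp add: vector_smult_assoc)
qed

text \<open>With all nonzero degrees listed, and where det \<eta> is nonzero, this vector vanishes
  exactly when no flat coordinate of degree zero varies in the i-th direction. Unlike those
  coordinates it is entire in \<open>x\<close>.\<close>

definition "kcol ds i x = killer ds (zmap z 1 x) *v (\<chi> k. Zx x $ k $ i)"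

lemma entire_kcol: "entire (\<lambda>x. kcol ds i x $ k)"
proof (rule entireI)
  fix x
  have "cdiff (\<lambda>x. Zx x $ q $ i) x" for q
    unfolding jacobian_def vec_lambda_beta by (rule entire_cdiff[OF mholomorphic_on_pd[OF open_UNIV entire_zmap]])
  moreover have "cdiff (\<lambda>x. killer ds (zmap z 1 x) $ k $ q) x" for q
    by (rule pd_chain(1)[where f = "\<lambda>v. killer ds v $ k $ q"]) (rule cdiff_killer, rule entire_cdiff[OF entire_zmap])
  ultimately show "cdiff (\<lambda>x. kcol ds i x $ k) x"
    unfolding kcol_def matrix_vector_mult_def vec_lambda_beta by (intro cdiff_intros)
qed

lemma wrefl_wrefl: "wrefl i 0 (wrefl i 0 x) = x"
proof -
  have "height i (wrefl i 0 x) = height i x - height i x * complex_of_real (\<alpha> i \<bullet> coroot (\<alpha> i))"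
    by (simp add: height_def[of i "wrefl i 0 x"] wrefl_nth right_diff_distrib sum_subtractf if_distrib[of "\<lambda>x. _ * x"] mult.commute cong: if_cong)
      (simp add: height_def mult.commute)
  then show ?thesis by (simp add: vec_eq_iff wrefl_nth \<alpha>_coroot)
qed

text \<open>The reflection in \<alpha>_j changes the i-th column of the Jacobian by a nonzero
  multiple of the j-th, while \<open>zmap\<close>, and with it \<open>killer\<close>, is
  unchanged.\<close>

lemma kcol_reflect:
  assumes "\<And>x. kcol ds i x = 0" and ij: "\<alpha> i \<bullet> \<alpha> j \<noteq> 0"
  shows "kcol ds j y = 0"
proof -
  define x where "x = wrefl j 0 y"
  have y: "wrefl j 0 x = y" by (simp add: x_def wrefl_wrefl)
  let ?A = "complex_of_real (\<alpha> j \<bullet> coroot (\<alpha> i))"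
  have zz: "zmap z 1 x = zmap z 1 y" using zmap_refl[of j 0 x] unfolding y by (rule sym)
  have "Zx x $ k $ i = Zx y $ k $ i - ?A * Zx y $ k $ j" for k
    unfolding jacobian_def vec_lambda_beta y[symmetric]
    by (rule pd_refl) (auto simp: entire_cdiff[OF entire_zmap] zmap_refl)
  then have "kcol ds i x = kcol ds i y - ?A *s kcol ds j y"
    unfolding kcol_def zz
    by (simp add: vec_eq_iff matrix_vector_mult_def right_diff_distrib sum_subtractf sum_distrib_left mult_ac)
  then have "?A *s kcol ds j y = 0" using assms(1) by simp
  moreover have "?A \<noteq> 0" using ij by (simp add: coroot_inner inner_commute)
  ultimately show ?thesis by (simp add: vec_eq_iff)
qed

text \<open>
  Suppose \<open>d a = 0\<close>. Near a generic wall point all flat coordinates of degree \<open>0\<close> are constant in the direction of the wall's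
  reflection, so \<open>killer\<close>, which annihilates the other flat coordinates, makes a column of the Jacobian vanish identically.
  By reflections this spreads over the whole Dynkin diagram.
\<close>

lemma d_nonzero: "d a \<noteq> 0"
proof
  assume d0: "d a = 0"
  obtain ds where ds: "set ds = d ` {a. d a \<noteq> 0}" using finite_list[of "d ` {a. d a \<noteq> 0}"] by auto
  obtain i x1 n where w: "height i x1 = of_int n" "F1 x1 \<noteq> 0" using wall_exists by blast
  obtain V s where s: "local_section C p V s" "zmap z 1 x1 \<in> V" by (rule frame_at[OF w(2)])
  interpret F: flat_frame g \<eta> \<Gamma>0 \<Gamma>1 "\<lambda>r. thc r" "kc" m "zmap z 0 (x0 0)" v1 V "\<lambda>a v. t a (s v)" d K0
    by (rule flat_frame[OF s(1)])
  have JB: "F.J v $ a v* Bmat v = d a *s F.J v $ a" if "v \<in> V" for v a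
  proof -
    have "(F.J v ** Bmat v) $ a = (diagm d ** F.J v) $ a" by (simp only: F.J_B[OF that])
    then show ?thesis by (simp add: row_mult[symmetric] vec_eq_iff diagm_mult)
  qed
  have "eventually (\<lambda>x. \<forall>a. d a = 0 \<longrightarrow> pd i (lift s a) x = 0) (nhds x1)"
    by (rule eventually_all_finite) (use lift_wall_zero[OF s w(1)] in auto)
  moreover have "eventually (\<lambda>x. x \<in> {x. zmap z 1 x \<in> V}) (nhds x1)"
    by (rule eventually_nhds_in_open[OF open_zmap_preimage[OF section_open[OF s(1)]]]) (simp add: s(2))
  ultimately have ev: "eventually (\<lambda>x. kcol ds i x = 0) (nhds x1)"
  proof eventually_elim
    case (elim x)
    then have x: "zmap z 1 x \<in> V" by simp
    let ?J = "F.J (zmap z 1 x)" and ?K = "killer ds (zmap z 1 x)" and ?u = "\<chi> k. Zx x $ k $ i"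
    have "(?J *v kcol ds i x) $ a = 0" for a
    proof -
      let ?\<pi> = "\<Prod>e\<leftarrow>ds. det (\<eta> (zmap z 1 x)) * (d a - e)"
      have "(?J *v kcol ds i x) $ a = ((?J ** ?K) *v ?u) $ a" by (simp add: kcol_def matrix_vector_mul_assoc)
      also have "\<dots> = (\<Sum>k\<in>UNIV. (?J $ a v* ?K) $ k * Zx x $ k $ i)"
        unfolding row_mult[symmetric] by (simp add: matrix_vector_mult_def)
      also have "?J $ a v* ?K = ?\<pi> *s ?J $ a" by (rule killer_row[OF F.V_\<eta>[OF x] JB[OF x]])
      also have "(\<Sum>k\<in>UNIV. (?\<pi> *s ?J $ a) $ k * Zx x $ k $ i) = ?\<pi> * pd i (lift s a) x"
        unfolding lift_pd(2)[OF s(1) x] by (simp add: sum_distrib_left mult.assoc)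
      also have "\<dots> = 0"
      proof (cases "d a = 0")
        case False
        then have "d a \<in> set ds" using ds by auto
        then have "?\<pi> = 0" by (auto simp: prod_list_zero_iff)
        then show ?thesis by simp
      qed (use elim in auto)
      finally show ?thesis .
    qed
    then have "matrix_inv ?J *v (?J *v kcol ds i x) = 0" by (simp add: vec_eq_iff matrix_vector_mult_def)
    then show "kcol ds i x = 0" by (simp add: matrix_vector_mul_assoc matrix_inv_det[OF F.det_J[OF x]])
  qed
  have "kcol ds i x $ k = 0" for x k
  proof (rule mholomorphic_eq_0[OF open_UNIV convex_UNIV entire_kcol UNIV_I _ UNIV_I])
    show "eventually (\<lambda>x. kcol ds i x $ k = 0) (nhds x1)" using ev by (rule eventually_mono) simp
  qed
  then have "i \<in> {i. \<forall>x. kcol ds i x = 0}" by (simp add: vec_eq_iff)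
  then have "{i. \<forall>x. kcol ds i x = 0} = UNIV"
    by (rule connected_simple_roots) (use kcol_reflect in blast)
  then have all: "kcol ds i x = 0" for i x by blast
  \<comment> \<open>With all columns annihilated, \<open>killer\<close> is zero at such a point. But
    there the differential of \<open>t a\<close>, of degree zero, is an eigenvector of it with
    nonzero eigenvalue.\<close>
  have "\<exists>x. det (Zx x) \<noteq> 0 \<and> F1 x \<noteq> 0"
  proof (rule ccontr)
    assume *: "\<not> ?thesis"
    have "det (\<eta> v1) = 0"
    proof (rule eq_0_zmap[where f = "\<lambda>v. det (\<eta> v)" and l = 1])
      show "entire (\<lambda>v. det (\<eta> v))" by (rule entireI) (rule cdiff_det, rule entire_cdiff[OF entire_\<eta>])
    qed (use * in blast)
    then show False using det_v1 by simp
  qed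
  then obtain x where x: "det (Zx x) \<noteq> 0" "F1 x \<noteq> 0" by blast
  let ?K = "killer ds (zmap z 1 x)"
  have "?K ** Zx x = 0"
    using all[of _ x] by (simp add: kcol_def vec_eq_iff matrix_vector_mult_def matrix_mult_nth)
  then have "?K ** (Zx x ** matrix_inv (Zx x)) = 0" by (simp add: matrix_mul_assoc)
  then have K0: "?K = 0" by (simp add: matrix_inv_det[OF x(1)])
  obtain V' s' where s': "local_section C p V' s'" "zmap z 1 x \<in> V'" by (rule frame_at[OF x(2)])
  interpret F': flat_frame g \<eta> \<Gamma>0 \<Gamma>1 "\<lambda>r. thc r" "kc" m "zmap z 0 (x0 0)" v1 V' "\<lambda>a v. t a (s' v)" d K0
    by (rule flat_frame[OF s'(1)])
  let ?J = "F'.J (zmap z 1 x)"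
  have "(?J ** Bmat (zmap z 1 x)) $ a = (diagm d ** ?J) $ a" by (simp only: F'.J_B[OF s'(2)])
  then have "?J $ a v* Bmat (zmap z 1 x) = d a *s ?J $ a" by (simp add: row_mult[symmetric] vec_eq_iff diagm_mult)
  from killer_row[OF x(2) this, of ds] have "(\<Prod>e\<leftarrow>ds. F1 x * (d a - e)) *s ?J $ a = 0"
    unfolding K0 by (simp add: vec_eq_iff vector_matrix_nth)
  moreover have "(\<Prod>e\<leftarrow>ds. F1 x * (d a - e)) \<noteq> 0"
    using x(2) ds d0 by (auto simp: prod_list_zero_iff)
  ultimately have J0: "?J $ a = 0" by (simp add: vec_eq_iff)
  have "(?J ** matrix_inv ?J) $ a $ a = 0" unfolding matrix_mult_nth J0 by simp
  then show False by (simp add: matrix_inv_det[OF F'.det_J[OF s'(2)]] mat_def)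
qed

end

section \<open>The generalized Frobenius manifold\<close>

context covered_generators
begin

lemma eigen_frame:
  assumes "local_section C p V s"
  shows "eigen_frame g \<eta> \<Gamma>0 \<Gamma>1 (\<lambda>r. thc r) (kc) m (zmap z 0 (x0 0)) v1 V (\<lambda>a v. t a (s v)) d K0"
  by (intro eigen_frame.intro flat_frame assms eigen_frame_axioms.intro d_nonzero)

lemma M_D_eq: "M_D \<alpha> m z = {v. det (\<eta> v) \<noteq> 0 \<and> (\<forall>i. m i > 0 \<longrightarrow> v $ i \<noteq> 0)}"
  by (auto simp: M_D_def D_eta_def)

lemma E_field_eq: "E_field \<alpha> m v = (\<chi> r. thc r * v $ r)"
  by (simp add: E_field_def)

lemma frobenius: "generalized_frobenius_manifold (M_D \<alpha> m z) (covariant_form \<eta>) mulv unit_field Et 1"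
proof (rule frobenius_manifold[OF M_D_eq])
  fix v assume "v \<in> M_D \<alpha> m z"
  then have "det (\<eta> v) \<noteq> 0" by (simp add: M_D_eq)
  then obtain V s where s: "local_section C p V s" "v \<in> V" by (rule frame_at)
  show "\<exists>V f K. v \<in> V \<and> eigen_frame g \<eta> \<Gamma>0 \<Gamma>1 (\<lambda>r. thc r) (kc) m (zmap z 0 (x0 0)) v1 V f d K"
    using s(2) eigen_frame[OF s(1)] by blast
qed

text \<open>All branches \<open>L r\<close> of the logarithm of z^r have the differential dz^r /
  z^r, so the gradient agrees with the global expression by \<open>dlog\<close>.\<close>

lemma unit_field_log:
  assumes V: "open V" and L: "\<And>r. m r > 0 \<Longrightarrow> mholomorphic_on V (L r)" "\<And>r v. m r > 0 \<Longrightarrow> v \<in> V \<Longrightarrow> exp (L r v) = v $ r"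
    and v: "v \<in> V"
  shows "unit_field v = - (1 / kc) *s grad \<eta> (\<lambda>u. \<Sum>r\<in>{r. m r > 0}. of_nat (m r) * L r u) v"
proof -
  have c: "cdiff (L r) v" if "r \<in> {r. m r > 0}" for r using L(1) that mholomorphic_on_cdiff[OF _ v] by blast
  have pL: "pd i (L r) v = (if i = r then 1 / v $ r else 0)" if r: "r \<in> {r. m r > 0}" for i r
  proof -
    have r': "m r > 0" using r by simp
    have "pd i (\<lambda>u. exp (L r u)) v = pd i (\<lambda>u. u $ r) v"
      by (rule open_cong_pd(1)[OF V v]) (rule L(2)[OF r'])
    then have "exp (L r v) * pd i (L r) v = (if i = r then 1 else 0)"
      by (simp add: pd_exp[OF c[OF r]] pd_coord)
    moreover have "v $ r \<noteq> 0" using L(2)[OF r' v] by (metis exp_not_eq_zero)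
    ultimately show ?thesis by (simp add: L(2)[OF r' v] field_simps split: if_splits)
  qed
  have "pd i (\<lambda>u. \<Sum>r\<in>{r. m r > 0}. of_nat (m r) * L r u) v = of_nat (m i) / v $ i" for i
  proof -
    have "pd i (\<lambda>u. \<Sum>r\<in>{r. m r > 0}. of_nat (m r) * L r u) v = (\<Sum>r\<in>{r. m r > 0}. of_nat (m r) * pd i (L r) v)"
      by (subst pd_sum) (auto simp: pd_mult cdiff_intros c pd_const)
    also have "\<dots> = (\<Sum>r\<in>{r. m r > 0}. if i = r then of_nat (m i) / v $ i else 0)"
      by (intro sum.cong refl) (simp add: pL)
    also have "\<dots> = of_nat (m i) / v $ i" by simp
    finally show ?thesis .
  qed
  then have D: "differential (\<lambda>u. \<Sum>r\<in>{r. m r > 0}. of_nat (m r) * L r u) v = (- 1) *s dlog v"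
    by (simp add: vec_eq_iff dlog_def)
  show ?thesis
    unfolding unit_field_def grad_def sharp_def D vector_scale_matrix by (simp add: vec_eq_iff)
qed

lemma intersection_form_eq:
  assumes v: "v \<in> M_D \<alpha> m z"
  shows "intersection_form (covariant_form \<eta>) mulv Et v \<xi> \<zeta> = bil (g v) \<xi> \<zeta>"
proof -
  have nz: "det (\<eta> v) \<noteq> 0" "\<And>i. m i > 0 \<Longrightarrow> v $ i \<noteq> 0" using v by (auto simp: M_D_eq)
  obtain V s where s: "local_section C p V s" "v \<in> V" by (rule frame_at[OF nz(1)])
  interpret F: eigen_frame g \<eta> \<Gamma>0 \<Gamma>1 "\<lambda>r. thc r" "kc" m "zmap z 0 (x0 0)" v1 V "\<lambda>a v. t a (s v)" d K0
    by (rule eigen_frame[OF s(1)])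
  have inv: "matrix_inv (matrix_inv (\<eta> v)) = \<eta> v"
    by (rule matrix_inv_unique'(1)) (simp add: matrix_inv_det[OF nz(1)])
  have A: "\<eta> v *v \<xi> = \<xi> v* \<eta> v" for \<xi>
    using transpose_matrix_vector[of "\<eta> v" \<xi>] by (simp add: \<eta>_sym)
  have "transpose (matrix_inv (\<eta> v)) = matrix_inv (\<eta> v)" using transpose_matrix_inv[OF nz(1)] by (simp add: \<eta>_sym)
  then have B: "matrix_inv (\<eta> v) *v \<xi> = \<xi> v* matrix_inv (\<eta> v)" for \<xi>
    using transpose_matrix_vector[of "matrix_inv (\<eta> v)" \<xi>] by simp
  have fl: "flat \<eta> v (\<xi> v* \<eta> v) = \<xi>" for \<xi>
    by (simp add: flat_def vector_matrix_mul_assoc matrix_inv_det[OF nz(1)])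
  have "intersection_form (covariant_form \<eta>) mulv Et v \<xi> \<zeta> = contract (Et v) (formprod v \<xi> \<zeta>)"
    unfolding intersection_form_def gram_b[OF nz(1)] inv A B mulv_def fl sharp_def
    by (simp add: vector_matrix_mul_assoc matrix_inv_det[OF nz(1)])
  then show ?thesis using F.intersection[OF s(2) nz(2)] by simp
qed

lemma local_coordinates:
  assumes s: "local_section C p V s" and V: "V \<subseteq> M_D \<alpha> m z"
  shows "\<exists>\<Gamma>. contra_christoffel_on V (\<lambda>v. \<chi> a. t a (s v)) g \<Gamma> \<and>
      (\<forall>v\<in>V. \<forall>a b. formprod v (differential (t a \<circ> s) v) (differential (t b \<circ> s) v) =
         (\<Sum>c\<in>UNIV. (kc / d b * \<Gamma> a b c v) *s differential (t c \<circ> s) v))"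
    and "v \<in> V \<Longrightarrow> Et v = (\<Sum>a\<in>UNIV. (d a * t a (s v) / kc) *s coord_vec (\<lambda>v. \<chi> a. t a (s v)) a v)"
    and "v \<in> V \<Longrightarrow> bil (g v) (differential (t a \<circ> s) v) (differential (t e \<circ> s) v) =
       contract (Et v) (formprod v (differential (t a \<circ> s) v) (differential (t e \<circ> s) v))"
proof -
  interpret F: eigen_frame g \<eta> \<Gamma>0 \<Gamma>1 "\<lambda>r. thc r" "kc" m "zmap z 0 (x0 0)" v1 V "\<lambda>a v. t a (s v)" d K0
    by (rule eigen_frame[OF s])
  have J: "differential (t a \<circ> s) v = F.J v $ a" for a v by (simp add: F.J_row o_def)
  show "\<exists>\<Gamma>. contra_christoffel_on V (\<lambda>v. \<chi> a. t a (s v)) g \<Gamma> \<and>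
      (\<forall>v\<in>V. \<forall>a b. formprod v (differential (t a \<circ> s) v) (differential (t b \<circ> s) v) =
         (\<Sum>c\<in>UNIV. (kc / d b * \<Gamma> a b c v) *s differential (t c \<circ> s) v))"
    unfolding J by (rule F.christoffel_coords)
  show "v \<in> V \<Longrightarrow> Et v = (\<Sum>a\<in>UNIV. (d a * t a (s v) / kc) *s coord_vec (\<lambda>v. \<chi> a. t a (s v)) a v)"
    by (rule F.E_coords[OF _ K0(1)[OF d_nonzero]])
  assume v: "v \<in> V"
  then have "\<And>i. m i > 0 \<Longrightarrow> v $ i \<noteq> 0" using V by (auto simp: M_D_eq)
  then show "bil (g v) (differential (t a \<circ> s) v) (differential (t e \<circ> s) v) =
       contract (Et v) (formprod v (differential (t a \<circ> s) v) (differential (t e \<circ> s) v))"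
    using F.intersection[OF v] by simp
qed

end

theorem theorem3p13:
  fixes R :: "'v::euclidean_space set"
    and \<alpha> :: "'l::finite \<Rightarrow> 'v"
    and m :: "'l \<Rightarrow> nat"
    and z :: "'l \<Rightarrow> 'l exp_poly"
    and C :: "'w::topological_space set"
    and p :: "'w \<Rightarrow> complex^'l"
    and t :: "'l \<Rightarrow> 'w \<Rightarrow> complex"
    and d :: "'l \<Rightarrow> complex"
  assumes "root_system R" and "reduced_roots R" and "irreducible_roots R"
    and "\<forall>\<beta>\<in>R. \<beta> \<bullet> \<beta> \<in> \<rat>"
    and "simple_roots R \<alpha>"
    and "\<exists>j. m j \<noteq> 0"
    and "pencil_generators R \<alpha> m z"
    and "covering_space C p (UNIV - D_eta \<alpha> z)" and "simply_connected C"
    and "flat_eigenbasis C p (eta_metric \<alpha> z) (E_field \<alpha> m) t d"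
  shows "(\<forall>\<beta>. d \<beta> \<noteq> 0) \<and>
    (\<exists>(formprod :: complex^'l \<Rightarrow> complex^'l \<Rightarrow> complex^'l \<Rightarrow> complex^'l) e.
      let \<eta> = eta_metric \<alpha> z;
          g = g_metric \<alpha> z;
          M = M_D \<alpha> m z;
          \<kappa> = complex_of_real (kappa \<alpha> m);
          Et = (\<lambda>v. (1 / \<kappa>) *s E_field \<alpha> m v);
          mul = (\<lambda>v X Y. sharp \<eta> v (formprod v (flat \<eta> v X) (flat \<eta> v Y)))
      in
        generalized_frobenius_manifold M (covariant_form \<eta>) mul e Et 1 \<and>
        (\<forall>V L. open V \<and> V \<subseteq> M \<and>
            (\<forall>r. m r > 0 \<longrightarrow> mholomorphic_on V (L r) \<and> (\<forall>v\<in>V. exp (L r v) = v $ r)) \<longrightarrow>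
            (\<forall>v\<in>V. e v =
               - (1 / \<kappa>) *s grad \<eta> (\<lambda>u. \<Sum>r\<in>{r. m r > 0}. of_nat (m r) * L r u) v)) \<and>
        (\<forall>v\<in>M. \<forall>\<xi> \<zeta>. intersection_form (covariant_form \<eta>) mul Et v \<xi> \<zeta> = bil (g v) \<xi> \<zeta>) \<and>
        (\<forall>V s. local_section C p V s \<and> V \<subseteq> M \<longrightarrow>
          (let dt = (\<lambda>a v. differential (t a \<circ> s) v);
               \<tau> = (\<lambda>v. \<chi> a. t a (s v))
           in
            (\<exists>\<Gamma>. contra_christoffel_on V \<tau> g \<Gamma> \<and>
              (\<forall>v\<in>V. \<forall>a b. formprod v (dt a v) (dt b v) =
                 (\<Sum>c\<in>UNIV. (\<kappa> / d b * \<Gamma> a b c v) *s dt c v))) \<and>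
            (\<forall>v\<in>V. Et v = (\<Sum>a\<in>UNIV. (d a * t a (s v) / \<kappa>) *s coord_vec \<tau> a v)) \<and>
            (\<forall>v\<in>V. \<forall>a b. bil (g v) (dt a v) (dt b v) =
               contract (Et v) (formprod v (dt a v) (dt b v))))))"
proof -
  interpret X: covered_generators R \<alpha> m z C p t d
    using assms by unfold_locales
  have mul: "(\<lambda>v X Y. sharp (eta_metric \<alpha> z) v (X.formprod v (flat (eta_metric \<alpha> z) v X) (flat (eta_metric \<alpha> z) v Y))) = X.mulv"
    by (intro ext) (simp only: X.mulv_def)
  show ?thesis
    unfolding Let_def X.E_field_eq
  proof (intro conjI exI[of _ X.formprod] exI[of _ X.unit_field] allI ballI impI)
    show "d \<beta> \<noteq> 0" for \<beta> by (rule X.d_nonzero)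
  qed (unfold mul, (rule X.frobenius X.intersection_form_eq X.unit_field_log X.local_coordinates; blast?)+)
qed

end
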